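(* Let $d,p\in\mathbb{N}$, let $\mu_0(\mathrm{d}x)=\pi_0(x)\,\lambda_d(\mathrm{d}x)$ with $\pi_0\colon\mathbb{R}^d\to(0,\infty)$ infinitely often continuously differentiable, and let $\ell\colon\mathbb{R}^d\to[0,\infty)$ be measurable and satisfy the regularity conditions (M), (I), (T), (S), (P) listed in the context for this $p$, with associated manifolds $M_1,\dots,M_m$ of dimensions $k_1,\dots,k_m$. For $n\in\mathbb{N}$ let $$\mu_n(\mathrm{d}x)=\frac1{Z_n}\exp(-n\ell(x))\,\mu_0(\mathrm{d}x),\qquad Z_n=\int_{\mathbb{R}^d}\exp(-n\ell(x))\,\mu_0(\mathrm{d}x).$$ Set $k:=\max_{j=1,\dots,m}k_j$ and $R':=\bigcup_{i:\,\dim M_i=k}M_i$. Define $\phi\colon R'\to[0,\infty)$ by $$\phi(u):=\frac{\sum_{i:\,M_i\subseteq R'}\pi_0(S_i(0,u))\,\det\left(\frac{\partial^2(\ell\circ S_i)}{\partial^2t}(0,u)\right)^{-1/2}\mathbf{1}_{M_i}(u)}{\sum_{i:\,M_i\subseteq R'}\int_{M_i}\pi_0(S_i(0,v))\,\det\left(\frac{\partial^2(\ell\circ S_i)}{\partial^2t}(0,v)\right)^{-1/2}\mathcal{M}_i(\mathrm{d}v)},$$ the measure $\mathcal{M}(\cdot):=\sum_{i:\,M_i\subseteq R'}\mathcal{M}_i(\cdot\cap M_i)$ on $\mathcal{B}(R')$, and the probability measure $\mu(\mathrm{d}u):=\phi(u)\,\mathcal{M}(\mathrm{d}u)$ on $\mathcal{B}(R')$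 (regarded as a probability measure on $\mathbb{R}^d$). Then there exists a constant $K\in(0,\infty)$ such that $$W^p(\mu_n,\mu)\le K\,n^{-1/(2p)}\qquad\text{for all }n\in\mathbb{N}.$$
   Context: $\mathbb{N}=\{1,2,\dots\}$, $\lambda_s$ is Lebesgue measure on $\mathbb{R}^s$, $\|\cdot\|$ the Euclidean norm, $B^s_r(x)\subset\mathbb{R}^s$ the Euclidean ball of radius $r$ around $x$, $\mathbf{1}_A$ the indicator function of $A$. For probability measures $\mu,\nu$ on $\mathbb{R}^d$, $W^p(\mu,\nu)=\left(\inf_{\gamma}\int_{\mathbb{R}^{2d}}\|x-y\|^p\,\gamma(\mathrm{d}x,\mathrm{d}y)\right)^{1/p}$, the infimum being over all couplings $\gamma$ of $\mu$ and $\nu$. Admissible manifolds. A set $M\subset\mathbb{R}^d$ is called admissible (of dimension $k$) if it is a $k$-dimensional compact connected differentiable (smooth) orientable Riemannian manifold, endowed with the subspace topology, such that the inclusion $M\to\mathbb{R}^d$ is infinitely often continuously differentiable (so $M$ is a smooth embedded submanifold of $\mathbb{R}^d$ with the metric induced by the Euclidean one), and such that there are maps $v^{(1)},\dots,v^{(d-k)}$ on $M$, depending smoothly on $u\in M$, with $v^{(1)}(u),\dots,v^{(d-k)}(u)$ an orthonormal basis of the orthogonal complement $T_u(M)^\perp$ of the tangent space $T_u(M)$ in $\mathbb{R}^d$ for all $u\in M$. The Riemannian volume measure on $M$ is called the intrinsic measure. For all sufficiently small $\varepsilon>0$ the map $(u,v)\mapsto u+v$ is a diffeomorphism from $\{(u,v):u\in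 M,\ v\in T_u(M)^\perp,\ \|v\|<\varepsilon\}$ onto an open neighbourhood $N(\varepsilon)\subseteq\mathbb{R}^d$ of $M$, the tubular neighbourhood; only such $\varepsilon$ are considered. Then $$S\colon B^{d-k}_\varepsilon(0)\times M\to N(\varepsilon),\quad (t_1,\dots,t_{d-k},u)\mapsto u+t_1v^{(1)}(u)+\dots+t_{d-k}v^{(d-k)}(u)$$ is a diffeomorphism. For admissible manifolds $M_1,\dots,M_m$ these objects are indexed by $i$: dimension $k_i$, intrinsic measure $\mathcal{M}_i$, tubular neighbourhood $N_i(\varepsilon)$, diffeomorphism $S_i$. $\frac{\partial^2(\ell\circ S_i)}{\partial^2t}(0,u)$ denotes the Hessian at $t=0$ of $t\mapsto(\ell\circ S_i)(t,u)$. Regularity conditions on $\ell$ (for given $p\in\mathbb{N}$): (M) For $R_\ell:=\{x\in\mathbb{R}^d:\ell(x)=0\}$ there exist $m\in\mathbb{N}$, $k_1,\dots,k_m\in\mathbb{N}$ and pairwise disjoint admissible manifolds $M_i$ of dimension $k_i$, $i=1,\dots,m$, with $R_\ell=\bigcup_{i=1}^mM_i$. (I) There exists $y_0\in R_\ell$ with $\int_{\mathbb{R}^d}\|x-y_0\|^p\exp(-\ell(x))\,\mu_0(\mathrm{d}x)<\infty$. (T) There exists $\varepsilon>0$ such that the tubular neighbourhoods $N_i(\varepsilon)$, $i=1,\dots,m$, are pairwise disjoint and for all $\delta\in(0,\varepsilon]$, $\inf\{\ell(x): x\in\mathbb{R}^d\setminus\bigcup_{i=1}^mN_i(\delta)\}>0$.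 (S) With this $\varepsilon$: on a set $F\subseteq\mathbb{R}^d$ the function $\ell$ is $(2p+2)$-times continuously differentiable (all partial derivatives up to order $2p+2$ exist and are continuous), and $N_i(\varepsilon)$ is contained in the interior of $F$ for all $i=1,\dots,m$. (P) For all $i=1,\dots,m$ and all $u\in M_i$ the Hessian $\frac{\partial^2(\ell\circ S_i)}{\partial^2t}(0,u)$ is positive definite. *)

theory Defs
  imports "HOL-Analysis.Analysis" "Jordan_Normal_Form.Determinant"
begin

definition dir_deriv :: "'a::real_normed_vector \<Rightarrow> ('a \<Rightarrow> 'b::real_normed_vector) \<Rightarrow> 'a \<Rightarrow> 'b" where
  "dir_deriv b f x = vector_derivative (\<lambda>t::real. f (x + t *\<^sub>R b)) (at 0)"

text \<open>All iterated partial derivatives up to order \<open>n\<close> exist and are continuous on \<open>X\<close>.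
  The derivatives are two-sided, so this is the usual notion only for open \<open>X\<close>; it is
  applied to open sets only.\<close>

primrec Ck_on :: "nat \<Rightarrow> 'a::euclidean_space set \<Rightarrow> ('a \<Rightarrow> 'b::real_normed_vector) \<Rightarrow> bool" where
  "Ck_on 0 X f \<longleftrightarrow> continuous_on X f"
| "Ck_on (Suc n) X f \<longleftrightarrow> continuous_on X f \<and>
     (\<forall>b\<in>Basis. (\<forall>x\<in>X. (\<lambda>t::real. f (x + t *\<^sub>R b)) differentiable (at 0)) \<and>
                Ck_on n X (dir_deriv b f))"

definition smooth_on :: "'a::euclidean_space set \<Rightarrow> ('a \<Rightarrow> 'b::real_normed_vector) \<Rightarrow> bool" where
  "smooth_on X f \<longleftrightarrow> (\<forall>n. Ck_on n X f)"

text \<open>Smoothness of a map on an arbitrary subset of a Euclidean space: local extendability to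
  smooth maps on open sets. On an embedded submanifold this is smoothness in charts.\<close>

definition smooth_map_on :: "'a::euclidean_space set \<Rightarrow> ('a \<Rightarrow> 'b::real_normed_vector) \<Rightarrow> bool" where
  "smooth_map_on A f \<longleftrightarrow>
     (\<forall>x\<in>A. \<exists>W g. open W \<and> x \<in> W \<and> smooth_on W g \<and> (\<forall>y\<in>W \<inter> A. g y = f y))"

definition diffeomorphism ::
  "'a::euclidean_space set \<Rightarrow> 'b::euclidean_space set \<Rightarrow> ('a \<Rightarrow> 'b) \<Rightarrow> bool" where
  "diffeomorphism A B f \<longleftrightarrow>
     bij_betw f A B \<and> smooth_map_on A f \<and> smooth_map_on B (the_inv_into A f)"

text \<open>As the dimension \<open>k\<close> is a number and not a type, \<open>\<real>\<^sup>k\<close> is realised as the coordinate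
  subspace spanned by a list \<open>bs\<close> of \<open>k\<close> distinct standard basis vectors. A local
  parametrization is a triple \<open>(bs, U, \<psi>)\<close> of such a list, a relatively open subset \<open>U\<close> of the
  subspace, and a diffeomorphism \<open>\<psi>\<close> from \<open>U\<close> onto a relatively open subset of \<open>M\<close>.\<close>

type_synonym 'a param = "'a list \<times> 'a set \<times> ('a \<Rightarrow> 'a)"

definition param_image :: "'a param \<Rightarrow> 'a set" where
  "param_image c = (case c of (bs, U, \<psi>) \<Rightarrow> \<psi> ` U)"

definition local_param :: "nat \<Rightarrow> 'a::euclidean_space set \<Rightarrow> 'a param \<Rightarrow> bool" where
  "local_param k M c \<longleftrightarrow> (case c of (bs, U, \<psi>) \<Rightarrow>
     length bs = k \<and> distinct bs \<and> set bs \<subseteq> Basis \<and>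
     openin (top_of_set (span (set bs))) U \<and>
     openin (top_of_set M) (\<psi> ` U) \<and>
     diffeomorphism U (\<psi> ` U) \<psi>)"

definition submanifold :: "nat \<Rightarrow> 'a::euclidean_space set \<Rightarrow> bool" where
  "submanifold k M \<longleftrightarrow> (\<forall>x\<in>M. \<exists>c. local_param k M c \<and> x \<in> param_image c)"

definition transition_jacobian ::
  "nat \<Rightarrow> 'a::euclidean_space param \<Rightarrow> 'a param \<Rightarrow> 'a \<Rightarrow> real" where
  "transition_jacobian k c c' x = (case (c, c') of ((bs, U, \<psi>), (bs', U', \<psi>')) \<Rightarrow>
     Determinant.det (Matrix.mat k k (\<lambda>(i, j).
       inner (bs' ! i) (dir_deriv (bs ! j) (\<lambda>y. the_inv_into U' \<psi>' (\<psi> y)) x))))"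

definition orientable :: "nat \<Rightarrow> 'a::euclidean_space set \<Rightarrow> bool" where
  "orientable k M \<longleftrightarrow> (\<exists>\<A>. (\<forall>c\<in>\<A>. local_param k M c) \<and> M = (\<Union>c\<in>\<A>. param_image c) \<and>
     (\<forall>(bs, U, \<psi>)\<in>\<A>. \<forall>c'\<in>\<A>. \<forall>x\<in>U.
        \<psi> x \<in> param_image c' \<longrightarrow> 0 < transition_jacobian k (bs, U, \<psi>) c' x))"

definition tangent_space :: "'a::euclidean_space set \<Rightarrow> 'a \<Rightarrow> 'a set" where
  "tangent_space M u = {w. \<exists>(\<gamma>::real \<Rightarrow> 'a) e. 0 < e \<and> smooth_on {-e<..<e} \<gamma> \<and>
     \<gamma> ` {-e<..<e} \<subseteq> M \<and> \<gamma> 0 = u \<and> (\<gamma> has_vector_derivative w) (at 0)}"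

definition normal_frame :: "nat \<Rightarrow> 'a::euclidean_space set \<Rightarrow> (nat \<Rightarrow> 'a \<Rightarrow> 'a) \<Rightarrow> bool" where
  "normal_frame k M v \<longleftrightarrow>
     (\<forall>j < DIM('a) - k. smooth_map_on M (v j)) \<and>
     (\<forall>u\<in>M. (\<forall>i < DIM('a) - k. \<forall>j < DIM('a) - k. inner (v i u) (v j u) = (if i = j then 1 else 0)) \<and>
             span ((\<lambda>j. v j u) ` {..<DIM('a) - k}) = orthogonal_comp (tangent_space M u))"

definition admissible :: "nat \<Rightarrow> 'a::euclidean_space set \<Rightarrow> bool" where
  "admissible k M \<longleftrightarrow> M \<noteq> {} \<and> submanifold k M \<and> compact M \<and> connected M \<and> orientable k M \<and>
     (\<exists>v. normal_frame k M v)"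

text \<open>Lebesgue measure on the \<open>k\<close>-dimensional coordinate subspace spanned by \<open>bs\<close>.\<close>

definition lebesgue_coord :: "'a::euclidean_space list \<Rightarrow> 'a measure" where
  "lebesgue_coord bs = distr (\<Pi>\<^sub>M i\<in>{..<length bs}. (lborel :: real measure)) borel
     (\<lambda>t. \<Sum>i<length bs. t i *\<^sub>R bs ! i)"

definition gram_det :: "'a::euclidean_space list \<Rightarrow> ('a \<Rightarrow> 'a) \<Rightarrow> 'a \<Rightarrow> real" where
  "gram_det bs \<psi> x = Determinant.det (Matrix.mat (length bs) (length bs) (\<lambda>(i, j).
     inner (dir_deriv (bs ! i) \<psi> x) (dir_deriv (bs ! j) \<psi> x)))"

text \<open>Volume, for the metric induced by the ambient inner product, of the part of \<open>A\<close> that lies in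
  the image of a parametrization.\<close>

definition param_volume :: "'a::euclidean_space param \<Rightarrow> 'a set \<Rightarrow> ennreal" where
  "param_volume c A = (case c of (bs, U, \<psi>) \<Rightarrow>
     \<integral>\<^sup>+ x. indicator U x * indicator A (\<psi> x) * ennreal (sqrt (gram_det bs \<psi> x)) \<partial>lebesgue_coord bs)"

definition finite_atlas :: "nat \<Rightarrow> 'a::euclidean_space set \<Rightarrow> 'a param list \<Rightarrow> bool" where
  "finite_atlas k M cs \<longleftrightarrow> (\<forall>c\<in>set cs. local_param k M c) \<and> M = (\<Union>c\<in>set cs. param_image c)"

text \<open>The volume measure of a compact submanifold \<open>M\<close>, as a measure on the Borel sets of the ambient
  space that is concentrated on \<open>M\<close>. It is assembled from a finite atlas by cutting \<open>M\<close> into the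
  disjoint pieces that lie in the image of the \<open>j\<close>-th parametrization but of no earlier one; by the
  change of variables formula the result does not depend on the atlas.\<close>

definition intrinsic_measure :: "nat \<Rightarrow> 'a::euclidean_space set \<Rightarrow> 'a measure" where
  "intrinsic_measure k M = (let cs = (SOME cs. finite_atlas k M cs) in
     measure_of UNIV (sets borel)
       (\<lambda>A. \<Sum>j<length cs. param_volume (cs ! j) (A - (\<Union>i<j. param_image (cs ! i)))))"

definition normal_disc_bundle :: "'a::euclidean_space set \<Rightarrow> real \<Rightarrow> ('a \<times> 'a) set" where
  "normal_disc_bundle M \<epsilon> =
     {(u, w). u \<in> M \<and> w \<in> orthogonal_comp (tangent_space M u) \<and> norm w < \<epsilon>}"

definition tube :: "'a::euclidean_space set \<Rightarrow> real \<Rightarrow> 'a set" where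
  "tube M \<epsilon> = (\<lambda>(u, w). u + w) ` normal_disc_bundle M \<epsilon>"

definition tubular_radius :: "'a::euclidean_space set \<Rightarrow> real \<Rightarrow> bool" where
  "tubular_radius M \<epsilon> \<longleftrightarrow> 0 < \<epsilon> \<and> open (tube M \<epsilon>) \<and>
     diffeomorphism (normal_disc_bundle M \<epsilon>) (tube M \<epsilon>) (\<lambda>(u, w). u + w)"

text \<open>Points of \<open>\<real>\<^sup>c\<close>, where \<open>c\<close> is the codimension, are functions \<open>t :: nat \<Rightarrow> real\<close> of which only
  the values at \<open>j < c\<close> are used.\<close>

definition normal_map ::
  "nat \<Rightarrow> (nat \<Rightarrow> 'a \<Rightarrow> 'a) \<Rightarrow> (nat \<Rightarrow> real) \<Rightarrow> 'a \<Rightarrow> 'a::real_vector" where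
  "normal_map c v t u = u + (\<Sum>j<c. t j *\<^sub>R v j u)"

definition coord_deriv :: "nat \<Rightarrow> ((nat \<Rightarrow> real) \<Rightarrow> real) \<Rightarrow> (nat \<Rightarrow> real) \<Rightarrow> real" where
  "coord_deriv j g t = deriv (\<lambda>r. g (t(j := r))) (t j)"

definition hessian :: "nat \<Rightarrow> ((nat \<Rightarrow> real) \<Rightarrow> real) \<Rightarrow> (nat \<Rightarrow> real) \<Rightarrow> real mat" where
  "hessian c g t = Matrix.mat c c (\<lambda>(i, j). coord_deriv i (coord_deriv j g) t)"

definition normal_hessian ::
  "nat \<Rightarrow> (nat \<Rightarrow> 'a \<Rightarrow> 'a) \<Rightarrow> ('a::euclidean_space \<Rightarrow> real) \<Rightarrow> 'a \<Rightarrow> real mat" where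
  "normal_hessian k v l u =
     hessian (DIM('a) - k) (\<lambda>t. l (normal_map (DIM('a) - k) v t u)) (\<lambda>_. 0)"

definition positive_definite :: "real mat \<Rightarrow> bool" where
  "positive_definite A \<longleftrightarrow> (\<forall>w\<in>carrier_vec (dim_row A).
     w \<noteq> 0\<^sub>v (dim_row A) \<longrightarrow> 0 < scalar_prod w (A *\<^sub>v w))"

definition couplings ::
  "'a::euclidean_space measure \<Rightarrow> 'a measure \<Rightarrow> ('a \<times> 'a) measure set" where
  "couplings \<mu> \<nu> = {\<gamma>. sets \<gamma> = sets borel \<and> distr \<gamma> borel fst = \<mu> \<and> distr \<gamma> borel snd = \<nu>}"

definition ennreal_root :: "nat \<Rightarrow> ennreal \<Rightarrow> ennreal" where
  "ennreal_root p x = (if x = \<infinity> then \<infinity> else ennreal (root p (enn2real x)))"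

definition wasserstein ::
  "nat \<Rightarrow> 'a::euclidean_space measure \<Rightarrow> 'a measure \<Rightarrow> ennreal" where
  "wasserstein p \<mu> \<nu> = ennreal_root p
     (INF \<gamma>\<in>couplings \<mu> \<nu>. \<integral>\<^sup>+ (x, y). ennreal (norm (x - y) ^ p) \<partial>\<gamma>)"

definition prior :: "('a::euclidean_space \<Rightarrow> real) \<Rightarrow> 'a measure" where
  "prior \<pi>0 = density lborel (\<lambda>x. ennreal (\<pi>0 x))"

definition posterior_const ::
  "('a::euclidean_space \<Rightarrow> real) \<Rightarrow> ('a \<Rightarrow> real) \<Rightarrow> nat \<Rightarrow> ennreal" where
  "posterior_const \<pi>0 l n = (\<integral>\<^sup>+ x. ennreal (exp (- real n * l x)) \<partial>prior \<pi>0)"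

definition posterior ::
  "('a::euclidean_space \<Rightarrow> real) \<Rightarrow> ('a \<Rightarrow> real) \<Rightarrow> nat \<Rightarrow> 'a measure" where
  "posterior \<pi>0 l n =
     density (prior \<pi>0) (\<lambda>x. ennreal (exp (- real n * l x)) / posterior_const \<pi>0 l n)"

text \<open>The manifolds are \<open>M i\<close> for \<open>i < m\<close>, with dimensions \<open>k i\<close> and normal frames \<open>v i\<close>.\<close>

definition top_part :: "nat \<Rightarrow> (nat \<Rightarrow> nat) \<Rightarrow> (nat \<Rightarrow> 'a set) \<Rightarrow> 'a set" where
  "top_part m k M = (\<Union>i\<in>{i. i < m \<and> k i = Max (k ` {..<m})}. M i)"

definition top_indices :: "nat \<Rightarrow> (nat \<Rightarrow> nat) \<Rightarrow> (nat \<Rightarrow> 'a set) \<Rightarrow> nat set" where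
  "top_indices m k M = {i. i < m \<and> M i \<subseteq> top_part m k M}"

definition limit_weight ::
  "nat \<Rightarrow> (nat \<Rightarrow> 'a \<Rightarrow> 'a) \<Rightarrow> ('a::euclidean_space \<Rightarrow> real) \<Rightarrow> ('a \<Rightarrow> real) \<Rightarrow> 'a \<Rightarrow> real" where
  "limit_weight k v \<pi>0 l u = \<pi>0 (normal_map (DIM('a) - k) v (\<lambda>_. 0) u) *
     Determinant.det (normal_hessian k v l u) powr (- 1 / 2)"

definition limit_density ::
  "nat \<Rightarrow> (nat \<Rightarrow> nat) \<Rightarrow> (nat \<Rightarrow> 'a set) \<Rightarrow> (nat \<Rightarrow> nat \<Rightarrow> 'a \<Rightarrow> 'a) \<Rightarrow>
     ('a::euclidean_space \<Rightarrow> real) \<Rightarrow> ('a \<Rightarrow> real) \<Rightarrow> 'a \<Rightarrow> real" where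
  "limit_density m k M v \<pi>0 l u =
     (\<Sum>i\<in>top_indices m k M. limit_weight (k i) (v i) \<pi>0 l u * indicator (M i) u) /
     (\<Sum>i\<in>top_indices m k M.
        set_lebesgue_integral (intrinsic_measure (k i) (M i)) (M i) (limit_weight (k i) (v i) \<pi>0 l))"

definition total_intrinsic_measure ::
  "nat \<Rightarrow> (nat \<Rightarrow> nat) \<Rightarrow> (nat \<Rightarrow> 'a::euclidean_space set) \<Rightarrow> 'a measure" where
  "total_intrinsic_measure m k M = measure_of UNIV (sets borel)
     (\<lambda>A. \<Sum>i\<in>top_indices m k M. emeasure (intrinsic_measure (k i) (M i)) (A \<inter> M i))"

text \<open>The limit measure, already regarded as a measure on the ambient space: the total intrinsic
  measure gives no mass to the complement of \<open>top_part m k M\<close>.\<close>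

definition limit_measure ::
  "nat \<Rightarrow> (nat \<Rightarrow> nat) \<Rightarrow> (nat \<Rightarrow> 'a set) \<Rightarrow> (nat \<Rightarrow> nat \<Rightarrow> 'a \<Rightarrow> 'a) \<Rightarrow>
     ('a::euclidean_space \<Rightarrow> real) \<Rightarrow> ('a \<Rightarrow> real) \<Rightarrow> 'a measure" where
  "limit_measure m k M v \<pi>0 l =
     density (total_intrinsic_measure m k M) (\<lambda>u. ennreal (limit_density m k M v \<pi>0 l u))"

end

theory Submission
  imports Defs "HOL-Probability.Probability"
begin

text \<open>Near a component \<open>M\<^sub>i\<close> of codimension \<open>c\<close> the measure \<open>exp (- n \<ell>) \<mu>\<^sub>0\<close> is disintegrated along the
  normal fibres. On a fibre \<open>\<ell>\<close> agrees with half its Hessian form up to a cubic error, so Laplace's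
  method gives the fibre mass \<open>(2 \<pi> / n)\<^bsup>c/2\<^esup>\<close> times the unnormalised limit density, up to a factor
  \<open>1 + O(n\<^bsup>-1/2\<^esup>)\<close>. Hence the part of \<open>\<mu>\<^sub>n\<close> in the tubes around the components of top dimension,
  shrunk by a factor \<open>1 - O(n\<^bsup>-1/2\<^esup>)\<close> and pushed forward by the foot point projection, is a
  submeasure of the limit \<open>\<mu>\<close>. This part is transported along the projection, whose mean displacement
  is \<open>O(n\<^bsup>-1/2\<^esup>)\<close>. The remaining mass is \<open>O(n\<^bsup>-1/2\<^esup>)\<close>: lower dimensional components lose a factor
  \<open>n\<^bsup>-1/2\<^esup>\<close> for each missing dimension, and away from the tubes the density decays exponentially in
  \<open>n\<close>; it is coupled independently, at a \<open>p\<close>-th power cost of the same order.\<close>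

text \<open>The exponent 1/(2p) comes from the part that is coupled independently: a mass of order
  n^(-1/2) is moved over distances that do not shrink, so the p-th power cost is of order n^(-1/2)
  for every p. For the transported part a first moment is enough, because |x - T x|^p is at most
  \<epsilon>^(p-1) |x - T x| on a tube. A relative error of order n^(-1/2) is affordable at every
  stage. So the Jacobian of the normal coordinates is only trapped between 1 - C|t| and 1 + C|t|,
  the prior is treated as Lipschitz, and l is expanded with a third order remainder. The obstacle is
  domination: the image of the transported part has to lie below the limit measure on every Borel
  set. The upper estimate is therefore proved for each set B, the lower one for the total mass only,
  where it controls the normalising constant. With relative error a, the bounds 1 + a and 1 - a are
  reconciled by the shrinking factor (1 - a)/(1 + a). Remainders are bounded by multiples of the
  limit weight at the same foot point. That the limit has finite total weight follows by comparison
  with the finite mass of a bounded tube.\<close>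

no_notation Matrix.vec_index (infixl "$" 100)
no_notation Matrix.scalar_prod (infix "\<bullet>" 70)

section \<open>Linear maps of a Euclidean space and the change of variables formula\<close>

text \<open>Determinants of linear maps and the change of variables formula live on
  \<open>real ^ 'n\<close>. Indexing by the standard basis of \<open>'a\<close> itself gives an
  isometric copy of \<open>'a\<close> of that shape, through which both are carried over to any
  Euclidean space.\<close>

typedef (overloaded) 'a basis_index = "Basis :: 'a::euclidean_space set"
  using nonempty_Basis by blast

instance basis_index :: (euclidean_space) finite
proof
  have "inj (Rep_basis_index :: 'a basis_index \<Rightarrow> 'a)"
    by (simp add: inj_def Rep_basis_index_inject)
  moreover have "finite (range (Rep_basis_index :: 'a basis_index \<Rightarrow> 'a))"
    using Rep_basis_index finite_subset[OF _ finite_Basis] by blast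
  ultimately show "finite (UNIV :: 'a basis_index set)"
    using finite_imageD by blast
qed

text \<open>The order has no geometric meaning: it is pulled back from \<open>nat\<close> along an
  arbitrary injection. It is there because the change of variables formula on
  \<open>real ^ 'n\<close> asks for a well-ordered index type.\<close>

instantiation basis_index :: (euclidean_space) wellorder
begin

definition basis_index_rank :: "'a basis_index \<Rightarrow> nat" where
  "basis_index_rank = (SOME f. inj f)"

definition less_eq_basis_index :: "'a basis_index \<Rightarrow> 'a basis_index \<Rightarrow> bool" where
  "less_eq_basis_index x y \<longleftrightarrow> basis_index_rank x \<le> basis_index_rank y"

definition less_basis_index :: "'a basis_index \<Rightarrow> 'a basis_index \<Rightarrow> bool" where
  "less_basis_index x y \<longleftrightarrow> basis_index_rank x < basis_index_rank y"

instance
proof -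
  have "\<exists>f :: 'a basis_index \<Rightarrow> nat. inj f"
    using finite_imp_inj_to_nat_seg[OF finite_class.finite_UNIV] by auto
  then have inj: "inj (basis_index_rank :: 'a basis_index \<Rightarrow> nat)"
    unfolding basis_index_rank_def by (rule someI_ex)
  show "OFCLASS('a basis_index, wellorder_class)"
  proof
    fix P :: "'a basis_index \<Rightarrow> bool" and a :: "'a basis_index"
    assume "\<And>x. (\<And>y. y < x \<Longrightarrow> P y) \<Longrightarrow> P x"
    then show "P a"
      unfolding less_basis_index_def using measure_induct[of basis_index_rank P a] by blast
  qed (use inj in \<open>auto simp: less_eq_basis_index_def less_basis_index_def inj_def\<close>)
qed

end

lemma bij_betw_Rep_basis_index: "bij_betw Rep_basis_index UNIV (Basis :: 'a::euclidean_space set)"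
  unfolding bij_betw_def
  by (metis Rep_basis_index_inject inj_def type_definition.Rep_range type_definition_basis_index)

definition of_coords :: "real ^ ('a::euclidean_space basis_index) \<Rightarrow> 'a" where
  "of_coords x = (\<Sum>i\<in>UNIV. x $ i *\<^sub>R Rep_basis_index i)"

definition to_coords :: "'a::euclidean_space \<Rightarrow> real ^ ('a basis_index)" where
  "to_coords y = (\<chi> i. y \<bullet> Rep_basis_index i)"

lemma to_coords_nth [simp]: "to_coords y $ i = y \<bullet> Rep_basis_index i"
  by (simp add: to_coords_def)

lemma inner_Rep_basis_index: "Rep_basis_index i \<bullet> Rep_basis_index j = (if i = j then 1 else 0)"
  by (simp add: inner_Basis[OF Rep_basis_index Rep_basis_index] Rep_basis_index_inject)

lemma of_coords_inner [simp]: "of_coords x \<bullet> Rep_basis_index i = x $ i"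
  by (simp add: of_coords_def inner_sum_left inner_Rep_basis_index if_distrib cong: if_cong)

lemma to_coords_of_coords [simp]: "to_coords (of_coords x) = x"
  by (simp add: Finite_Cartesian_Product.vec_eq_iff)

lemma of_coords_to_coords [simp]: "of_coords (to_coords y) = y"
proof -
  have "of_coords (to_coords y) = (\<Sum>b\<in>Basis. (y \<bullet> b) *\<^sub>R b)"
    unfolding of_coords_def
    using sum.reindex_bij_betw[OF bij_betw_Rep_basis_index, of "\<lambda>b. (y \<bullet> b) *\<^sub>R b"] by simp
  then show ?thesis by (simp add: euclidean_representation)
qed

lemma linear_of_coords: "linear of_coords"
  by (rule linearI) (simp_all add: of_coords_def algebra_simps sum.distrib scaleR_sum_right)

lemma linear_to_coords: "linear to_coords"
  by (rule linearI) (simp_all add: Finite_Cartesian_Product.vec_eq_iff inner_add_left)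

lemma bounded_linear_of_coords: "bounded_linear of_coords"
  using linear_of_coords by (simp add: linear_conv_bounded_linear)

lemma bounded_linear_to_coords: "bounded_linear to_coords"
  using linear_to_coords by (simp add: linear_conv_bounded_linear)

lemma measurable_of_coords [measurable]: "of_coords \<in> borel_measurable borel"
  by (intro borel_measurable_continuous_onI linear_continuous_on bounded_linear_of_coords)

lemma measurable_to_coords [measurable]: "to_coords \<in> borel_measurable borel"
  by (intro borel_measurable_continuous_onI linear_continuous_on bounded_linear_to_coords)

lemma of_coords_vimage_box: "of_coords -` box l u = box (to_coords l) (to_coords u)"
proof -
  have "of_coords x \<in> box l u \<longleftrightarrow> x \<in> box (to_coords l) (to_coords u)" for x
  proof -
    have "of_coords x \<in> box l u \<longleftrightarrow> (\<forall>b\<in>range Rep_basis_index. l \<bullet> b < of_coords x \<bullet> b \<and> of_coords x \<bullet> b < u \<bullet> b)"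
      using bij_betw_Rep_basis_index[where 'a='a] by (simp add: mem_box bij_betw_def)
    also have "\<dots> \<longleftrightarrow> x \<in> box (to_coords l) (to_coords u)"
      by (auto simp: mem_box_cart)
    finally show ?thesis .
  qed
  then show ?thesis by auto
qed

text \<open>Lebesgue measure is determined by its values on boxes, and \<open>of_coords\<close>
  pulls a box back to a box with the same side lengths.\<close>

lemma lborel_distr_of_coords: "distr lborel borel of_coords = (lborel :: 'a::euclidean_space measure)"
proof (rule lborel_eqI[symmetric])
  fix l u :: 'a
  assume lu: "\<And>b. b \<in> Basis \<Longrightarrow> l \<bullet> b \<le> u \<bullet> b"
  have le: "\<And>b. b \<in> Basis \<Longrightarrow> to_coords l \<bullet> b \<le> to_coords u \<bullet> b"
    using lu[OF Rep_basis_index] by (auto simp: Basis_vec_def inner_axis)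
  have "emeasure (distr lborel borel of_coords) (box l u) = emeasure lborel (box (to_coords l) (to_coords u))"
    by (subst emeasure_distr) (auto simp: of_coords_vimage_box)
  also have "\<dots> = (\<Prod>b\<in>Basis. (to_coords u - to_coords l) \<bullet> b)"
    by (simp add: emeasure_lborel_box[OF le])
  also have "(\<Prod>b\<in>Basis. (to_coords u - to_coords l) \<bullet> b) = (\<Prod>i\<in>UNIV. (u - l) \<bullet> Rep_basis_index i)"
  proof -
    have "(Basis :: (real ^ 'a basis_index) set) = range (\<lambda>i. axis i 1)"
      by (auto simp: Basis_vec_def)
    moreover have "inj (\<lambda>i. axis i (1::real) :: real ^ 'a basis_index)"
      by (auto simp: inj_def axis_eq_axis)
    ultimately have "(\<Prod>b\<in>Basis. (to_coords u - to_coords l) \<bullet> b) =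
        (\<Prod>i\<in>UNIV. (to_coords u - to_coords l) \<bullet> axis i 1)"
      by (metis (no_types, lifting) prod.reindex_cong)
    then show ?thesis
      by (simp add: inner_axis inner_diff_left)
  qed
  also have "\<dots> = (\<Prod>b\<in>Basis. (u - l) \<bullet> b)"
    by (rule prod.reindex_bij_betw[OF bij_betw_Rep_basis_index])
  finally show "emeasure (distr lborel borel of_coords) (box l u) = (\<Prod>b\<in>Basis. (u - l) \<bullet> b)" .
qed simp

text \<open>The determinant of an endomorphism, read in standard coordinates. Only its absolute
  value is kept, as this is what a change of variables sees.\<close>

definition abs_det :: "('a::euclidean_space \<Rightarrow> 'a) \<Rightarrow> real" where
  "abs_det L = \<bar>Determinants.det (matrix (\<lambda>x. to_coords (L (of_coords x))))\<bar>"

lemma abs_det_nonneg [simp]: "0 \<le> abs_det L"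
  by (simp add: abs_det_def)

lemma abs_det_compose:
  assumes "linear A" "linear B"
  shows "abs_det (\<lambda>x. A (B x)) = abs_det A * abs_det B"
proof -
  let ?c = "\<lambda>L x. to_coords (L (of_coords x))"
  have "linear (?c A)" "linear (?c B)"
    using linear_compose[OF linear_compose[OF linear_of_coords assms(1)] linear_to_coords]
      linear_compose[OF linear_compose[OF linear_of_coords assms(2)] linear_to_coords]
    by (simp_all add: o_def)
  then have "matrix (?c A \<circ> ?c B) = matrix (?c A) ** matrix (?c B)"
    by (rule matrix_compose[rotated])
  moreover have "?c A \<circ> ?c B = ?c (\<lambda>x. A (B x))"
    by (simp add: o_def)
  ultimately show ?thesis
    by (simp add: abs_det_def det_mul abs_mult)
qed

text \<open>The integral is a supremum over simple functions, and a simple function below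
  \<open>f\<close> pulls back to one below \<open>f\<close> composed with \<open>T\<close>. This
  direction therefore holds for an \<open>f\<close> that is not known to be measurable, such as an
  integrand containing a Jacobian.\<close>

lemma nn_integral_distr_le:
  assumes "T \<in> measurable M N"
  shows "(\<integral>\<^sup>+ y. f y \<partial>distr M N T) \<le> (\<integral>\<^sup>+ x. f (T x) \<partial>M)"
  unfolding nn_integral_def[of "distr M N T"]
proof (rule SUP_least, clarify)
  fix g assume g: "simple_function (distr M N T) g" "g \<le> f"
  then have "g \<in> borel_measurable N"
    using borel_measurable_simple_function by fastforce
  then have "integral\<^sup>S (distr M N T) g = (\<integral>\<^sup>+ x. g (T x) \<partial>M)"
    using g(1) assms by (simp add: nn_integral_eq_simple_integral[symmetric] nn_integral_distr)
  also have "\<dots> \<le> (\<integral>\<^sup>+ x. f (T x) \<partial>M)"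
    using g(2) by (intro nn_integral_mono) (simp add: le_fun_def)
  finally show "integral\<^sup>S (distr M N T) g \<le> (\<integral>\<^sup>+ x. f (T x) \<partial>M)" .
qed

text \<open>In coordinates this is the formula for absolutely integrable functions. For a
  nonnegative integrand it extends to the value infinity: the two integrands are integrable together
  and then have the same integral, and otherwise both integrals are infinite.\<close>

lemma nn_integral_change_of_variables:
  fixes \<Phi> :: "'a::euclidean_space \<Rightarrow> 'a" and f :: "'a \<Rightarrow> real"
  assumes S: "S \<in> sets borel" and [measurable]: "\<Phi> ` S \<in> sets borel" "f \<in> borel_measurable borel"
    and f: "\<And>x. 0 \<le> f x"
    and der: "\<And>x. x \<in> S \<Longrightarrow> (\<Phi> has_derivative \<Phi>' x) (at x)"
    and inj: "inj_on \<Phi> S"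
  shows "(\<integral>\<^sup>+ x. indicator (\<Phi> ` S) x * ennreal (f x) \<partial>lborel) =
    (\<integral>\<^sup>+ x. indicator S x * ennreal (f (\<Phi> x) * abs_det (\<Phi>' x)) \<partial>lborel)"
proof -
  let ?S = "to_coords ` S"
  let ?g = "\<lambda>x. to_coords (\<Phi> (of_coords x))"
  let ?g' = "\<lambda>x v. to_coords (\<Phi>' (of_coords x) (of_coords v))"
  let ?F = "\<lambda>x. f (of_coords x)"
  have Seq: "?S = of_coords -` S"
    by (auto intro: image_eqI[of _ _ "of_coords _"])
  have S'[measurable]: "?S \<in> sets borel"
    using S measurable_sets[OF measurable_of_coords] unfolding Seq by simp
  have gS: "?g ` ?S = of_coords -` (\<Phi> ` S)"
    by (auto simp: Seq intro!: image_eqI[of _ _ "to_coords _"]) (metis to_coords_of_coords)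
  have gS_meas[measurable]: "?g ` ?S \<in> sets borel"
    unfolding gS using measurable_sets[OF measurable_of_coords assms(2)] by simp
  have der': "(?g has_derivative ?g' x) (at x within ?S)" if "x \<in> ?S" for x
  proof -
    have "of_coords x \<in> S" using that Seq by auto
    have "((\<lambda>x. \<Phi> (of_coords x)) has_derivative (\<lambda>v. \<Phi>' (of_coords x) (of_coords v))) (at x)"
      using has_derivative_compose[OF bounded_linear_imp_has_derivative[OF bounded_linear_of_coords]
          der[OF \<open>of_coords x \<in> S\<close>]] .
    from bounded_linear.has_derivative[OF bounded_linear_to_coords this]
    show ?thesis by (rule has_derivative_at_withinI)
  qed
  have inj': "inj_on ?g ?S"
  proof (rule inj_onI)
    fix x y assume "x \<in> ?S" "y \<in> ?S" "?g x = ?g y"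
    then have "\<Phi> (of_coords x) = \<Phi> (of_coords y)" "of_coords x \<in> S" "of_coords y \<in> S"
      unfolding Seq by (metis of_coords_to_coords, auto)
    then have "of_coords x = of_coords y" using inj by (auto dest: inj_onD)
    then show "x = y" by (metis to_coords_of_coords)
  qed
  have "?S \<in> sets lebesgue" using S' by simp
  let ?D = "\<lambda>x. \<bar>Determinants.det (matrix (?g' x))\<bar> * ?F (?g x)"
  \<comment> \<open>The formula is stated for vector valued integrands, so a scalar one is wrapped
    into \<open>real ^ 1\<close>.\<close>
  let ?v = "\<lambda>h x. Finite_Cartesian_Product.vec (h x) :: real^1"
  have cov: "(?D absolutely_integrable_on ?S \<and> integral ?S ?D = b) \<longleftrightarrow>
     (?F absolutely_integrable_on (?g ` ?S) \<and> integral (?g ` ?S) ?F = b)" for b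
  proof -
    have *: "h absolutely_integrable_on T \<and> integral T h = b \<longleftrightarrow>
        ?v h absolutely_integrable_on T \<and> integral T (?v h) = Finite_Cartesian_Product.vec b"
      for h and T :: "(real ^ 'a basis_index) set"
      using absolutely_integrable_on_1_iff[where f = "?v h" and S = T] integral_on_1_eq[where f = "?v h" and S = T]
      by (auto simp: Finite_Cartesian_Product.vec_eq_iff)
    have "(\<lambda>x. \<bar>Determinants.det (matrix (?g' x))\<bar> *\<^sub>R ?v ?F (?g x)) = ?v ?D"
      by (simp add: fun_eq_iff Finite_Cartesian_Product.vec_eq_iff)
    with has_absolute_integral_change_of_variables[OF \<open>?S \<in> sets lebesgue\<close> der' inj', of "?v ?F" "Finite_Cartesian_Product.vec b"]
    show ?thesis
      unfolding * by simp
  qed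
  have D_meas: "(\<lambda>x. indicator ?S x *\<^sub>R ?D x) \<in> borel_measurable lebesgue"
  proof -
    have "?g differentiable_on ?S"
      using der' by (auto simp: differentiable_on_def differentiable_def)
    then have "?g \<in> borel_measurable (lebesgue_on ?S)"
      by (intro continuous_imp_measurable_on_sets_lebesgue differentiable_imp_continuous_on) (use S' in auto)
    moreover have "?F \<in> borel_measurable borel" by measurable
    ultimately have "(\<lambda>x. ?F (?g x)) \<in> borel_measurable (lebesgue_on ?S)"
      by (rule measurable_compose)
    moreover have "(\<lambda>x. Determinants.det (matrix (?g' x))) \<in> borel_measurable (lebesgue_on ?S)"
      using borel_measurable_det_Jacobian[OF \<open>?S \<in> sets lebesgue\<close> der'] by simp
    ultimately have "?D \<in> borel_measurable (lebesgue_on ?S)"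
      by simp
    then show ?thesis
      using \<open>?S \<in> sets lebesgue\<close> by (subst (asm) borel_measurable_restrict_space_iff) simp_all
  qed
  have F_meas: "(\<lambda>x. indicator (?g ` ?S) x *\<^sub>R ?F x) \<in> borel_measurable lebesgue"
    by (rule measurable_completion) measurable
  have fin: "h absolutely_integrable_on T \<longleftrightarrow> (\<integral>\<^sup>+ x. indicator T x * ennreal (h x) \<partial>lborel) < \<infinity>"
    if "(\<lambda>x. indicator T x *\<^sub>R h x) \<in> borel_measurable lebesgue" "\<And>x. 0 \<le> h x"
    for h and T :: "(real ^ 'a basis_index) set"
    using that
    by (simp add: set_integrable_def integrable_iff_bounded nn_integral_completion abs_mult ennreal_mult' ennreal_indicator)
  have val: "(\<integral>\<^sup>+ x. indicator T x * ennreal (h x) \<partial>lborel) = ennreal (integral T h)"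
    if "h absolutely_integrable_on T" "\<And>x. 0 \<le> h x" for h and T :: "(real ^ 'a basis_index) set"
  proof -
    have "(h has_integral integral T h) T"
      using that(1) by (simp add: set_lebesgue_integral_eq_integral(1) integrable_integral)
    from nn_integral_has_integral_lebesgue[OF _ this] that(2) show ?thesis
      by (simp add: ennreal_mult' ennreal_indicator)
  qed
  have "(\<integral>\<^sup>+ x. indicator (\<Phi> ` S) x * ennreal (f x) \<partial>lborel) =
     (\<integral>\<^sup>+ x. indicator (?g ` ?S) x * ennreal (?F x) \<partial>lborel)"
    by (subst lborel_distr_of_coords[symmetric], subst nn_integral_distr)
       (auto simp: gS indicator_def intro!: nn_integral_cong)
  also have "\<dots> = (\<integral>\<^sup>+ x. indicator ?S x * ennreal (?D x) \<partial>lborel)"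
  proof (cases "?F absolutely_integrable_on (?g ` ?S)")
    case True
    with cov[of "integral (?g ` ?S) ?F"] have "?D absolutely_integrable_on ?S" "integral ?S ?D = integral (?g ` ?S) ?F"
      by simp_all
    with val[OF True] val[OF this(1)] f show ?thesis by simp
  next
    case False
    with cov have "\<not> ?D absolutely_integrable_on ?S" by blast
    with False fin[OF F_meas f] fin[OF D_meas]
    have "\<not> (\<integral>\<^sup>+ x. indicator (?g ` ?S) x * ennreal (?F x) \<partial>lborel) < \<infinity>"
      "\<not> (\<integral>\<^sup>+ x. indicator ?S x * ennreal (?D x) \<partial>lborel) < \<infinity>"
      using f by simp_all
    moreover have "a = b" if "\<not> a < \<infinity>" "\<not> b < \<infinity>" for a b :: ennreal
      using that by (metis infinity_ennreal_def top.not_eq_extremum)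
    ultimately show ?thesis by blast
  qed
  also have "\<dots> = (\<integral>\<^sup>+ x. indicator S (of_coords x) * ennreal (f (\<Phi> (of_coords x)) * abs_det (\<Phi>' (of_coords x))) \<partial>lborel)"
    by (intro nn_integral_cong) (auto simp: Seq indicator_def abs_det_def mult.commute)
  also have "\<dots> = (\<integral>\<^sup>+ x. indicator S x * ennreal (f (\<Phi> x) * abs_det (\<Phi>' x)) \<partial>lborel)"
    (is "(\<integral>\<^sup>+ x. ?G (of_coords x) \<partial>_) = _")
  \<comment> \<open>The Jacobian factor has been shown measurable for the completed measure only.
    The two inequalities are therefore taken from \<open>nn_integral_distr_le\<close>, once along
    \<open>to_coords\<close> and once along \<open>of_coords\<close>.\<close>
  proof (rule antisym)
    have "distr lborel borel to_coords = (lborel :: (real ^ 'a basis_index) measure)"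
      by (subst lborel_distr_of_coords[symmetric], subst distr_distr) (auto simp: o_def distr_id2)
    then show "(\<integral>\<^sup>+ x. ?G (of_coords x) \<partial>lborel) \<le> (\<integral>\<^sup>+ x. ?G x \<partial>lborel)"
      using nn_integral_distr_le[of to_coords lborel borel "\<lambda>x. ?G (of_coords x)"] by simp
    show "(\<integral>\<^sup>+ x. ?G x \<partial>lborel) \<le> (\<integral>\<^sup>+ x. ?G (of_coords x) \<partial>lborel)"
      using nn_integral_distr_le[of of_coords lborel borel ?G]
      by (simp add: lborel_distr_of_coords)
  qed
  finally show ?thesis .
qed

text \<open>The squared determinant of a matrix A is the determinant of its transpose times A, whose
  entries are the inner products of the images of the basis vectors. What remains is to match two
  Leibniz formulas, one over permutations of \<open>'a basis_index\<close> and one over permutations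
  of list positions, by relabelling each permutation along \<open>h\<close>.\<close>

lemma abs_det_gram:
  fixes bs :: "'a::euclidean_space list"
  assumes L: "linear L" and bs: "distinct bs" "set bs = Basis"
  shows "(abs_det L)\<^sup>2 = Determinant.det (Matrix.mat DIM('a) DIM('a) (\<lambda>(i, j). L (bs ! i) \<bullet> L (bs ! j)))"
proof -
  let ?A = "matrix (\<lambda>x. to_coords (L (of_coords x)))"
  let ?d = "DIM('a)"
  let ?G = "\<lambda>x y. L x \<bullet> L y"
  have len: "length bs = ?d" using bs distinct_card by fastforce
  have of_axis: "of_coords (axis i 1) = Rep_basis_index i" for i :: "'a basis_index"
    by (simp add: of_coords_def axis_def if_distrib[of "\<lambda>c. c *\<^sub>R _"] cong: if_cong)
  have entry: "(transpose ?A ** ?A) $ i $ j = ?G (Rep_basis_index i) (Rep_basis_index j)" for i j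
  proof -
    have "(transpose ?A ** ?A) $ i $ j =
        (\<Sum>k\<in>UNIV. (L (Rep_basis_index i) \<bullet> Rep_basis_index k) * (L (Rep_basis_index j) \<bullet> Rep_basis_index k))"
      by (simp add: matrix_matrix_mult_def Finite_Cartesian_Product.transpose_def matrix_def of_axis)
    also have "\<dots> = (\<Sum>b\<in>Basis. (L (Rep_basis_index i) \<bullet> b) * (L (Rep_basis_index j) \<bullet> b))"
      by (rule sum.reindex_bij_betw[OF bij_betw_Rep_basis_index])
    finally show ?thesis by (subst euclidean_inner)
  qed
  define h where "h n = Abs_basis_index (bs ! n)" for n
  have Rep_h: "Rep_basis_index (h n) = bs ! n" if "n < ?d" for n
    unfolding h_def using that bs len by (intro Abs_basis_index_inverse) (metis nth_mem)
  have h: "bij_betw h {0..<?d} UNIV"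
  proof (rule bij_betwI')
    show "(h x = h y) = (x = y)" if "x \<in> {0..<?d}" "y \<in> {0..<?d}" for x y
      using that Rep_h nth_eq_iff_index_eq[OF bs(1), of x y] len by (metis atLeastLessThan_iff)
    show "\<exists>x\<in>{0..<?d}. y = h x" for y
    proof -
      obtain n where "n < ?d" "bs ! n = Rep_basis_index y"
        using Rep_basis_index[of y] bs len by (metis in_set_conv_nth)
      then show ?thesis
        by (intro bexI[of _ n]) (auto simp: h_def Rep_basis_index_inverse)
    qed
  qed simp
  let ?P = "\<lambda>p. map_permutation {0..<?d} h p"
  have perm: "?P p permutes UNIV" if "p permutes {0..<?d}" for p
    using map_permutation_permutes[OF h that] .
  have "(abs_det L)\<^sup>2 = Determinants.det (transpose ?A ** ?A)"
    by (simp add: abs_det_def det_mul det_transpose power2_eq_square)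
  also have "\<dots> = (\<Sum>q | q permutes (UNIV :: 'a basis_index set). of_int (sign q) *
      (\<Prod>i\<in>UNIV. ?G (Rep_basis_index i) (Rep_basis_index (q i))))"
    by (simp add: Determinants.det_def entry)
  also have "\<dots> = (\<Sum>p | p permutes {0..<?d}. of_int (sign (?P p)) *
      (\<Prod>i\<in>UNIV. ?G (Rep_basis_index i) (Rep_basis_index (?P p i))))"
  proof (rule sum.reindex_bij_betw[symmetric])
    have "bij_betw (\<lambda>p x. if x \<in> UNIV then h (p (inv_into {0..<?d} h x)) else x)
       {p. p permutes {0..<?d}} {p. p permutes UNIV}"
      by (rule bij_betw_permutations[OF h])
    moreover have "?P p = (\<lambda>x. if x \<in> UNIV then h (p (inv_into {0..<?d} h x)) else x)" for p
      using h by (auto simp: map_permutation_def restrict_id_def fun_eq_iff bij_betw_def)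
    ultimately show "bij_betw ?P {p. p permutes {0..<?d}} {p. p permutes UNIV}"
      by simp
  qed
  also have "\<dots> = (\<Sum>p | p permutes {0..<?d}. signof p * (\<Prod>i=0..<?d. ?G (bs ! i) (bs ! (p i))))"
  proof (rule sum.cong[OF refl])
    fix p assume "p \<in> {p. p permutes {0..<?d}}"
    then have p: "p permutes {0..<?d}" by simp
    have "sign (?P p) = sign p"
      using p h by (intro sign_map_permutation) (auto simp: bij_betw_def)
    moreover have "(\<Prod>i\<in>UNIV. ?G (Rep_basis_index i) (Rep_basis_index (?P p i))) =
        (\<Prod>n=0..<?d. ?G (Rep_basis_index (h n)) (Rep_basis_index (?P p (h n))))"
      by (rule prod.reindex_bij_betw[OF h, symmetric])
    moreover have "\<dots> = (\<Prod>n=0..<?d. ?G (bs ! n) (bs ! (p n)))"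
    proof (rule prod.cong[OF refl])
      fix n assume n: "n \<in> {0..<?d}"
      then have "p n < ?d" using permutes_in_image[OF p] by (metis atLeastLessThan_iff)
      moreover have "?P p (h n) = h (p n)"
        using h n by (intro map_permutation_apply) (auto simp: bij_betw_def)
      ultimately show "?G (Rep_basis_index (h n)) (Rep_basis_index (?P p (h n))) = ?G (bs ! n) (bs ! (p n))"
        using n Rep_h by simp
    qed
    ultimately show "of_int (sign (?P p)) * (\<Prod>i\<in>UNIV. ?G (Rep_basis_index i) (Rep_basis_index (?P p i))) =
        signof p * (\<Prod>i=0..<?d. ?G (bs ! i) (bs ! (p i)))"
      by simp
  qed
  also have "\<dots> = Determinant.det (Matrix.mat ?d ?d (\<lambda>(i, j). ?G (bs ! i) (bs ! j)))"
  proof -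
    have "(\<Prod>i=0..<?d. ?G (bs ! i) (bs ! (p i))) =
       (\<Prod>i=0..<?d. Matrix.mat ?d ?d (\<lambda>(i, j). ?G (bs ! i) (bs ! j)) $$ (i, p i))"
      if "p permutes {0..<?d}" for p
      using permutes_in_image[OF that] by (intro prod.cong) auto
    then show ?thesis
      by (simp add: Determinant.det_def)
  qed
  finally show ?thesis .
qed

text \<open>The determinant is read off as a volume ratio: a linear map that differs from the
  identity by at most \<eta> in operator norm sends the unit ball to a set between the balls of
  radius 1 - \<eta> and 1 + \<eta>.\<close>

lemma abs_det_near_identity:
  fixes E :: "'a::euclidean_space \<Rightarrow> 'a"
  assumes E: "bounded_linear E" and \<eta>: "\<And>x. norm (E x) \<le> \<eta> * norm x" "0 \<le> \<eta>" "\<eta> < 1"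
  shows "(1 - \<eta>) ^ DIM('a) \<le> abs_det (\<lambda>x. x + E x)" "abs_det (\<lambda>x. x + E x) \<le> (1 + \<eta>) ^ DIM('a)"
proof -
  let ?L = "\<lambda>x. x + E x"
  let ?B = "ball 0 1 :: 'a set"
  let ?v = "unit_ball_vol (real DIM('a))"
  have L: "bounded_linear ?L"
    using E by (intro bounded_linear_add bounded_linear_ident)
  have lin: "linear ?L" using L by (rule bounded_linear.linear)
  have low: "(1 - \<eta>) * norm x \<le> norm (?L x)" for x
    using \<eta>(1)[of x] norm_triangle_ineq4[of "?L x" "E x"] by (simp add: algebra_simps)
  have inj: "inj ?L"
  proof (rule linear_injective_0[OF lin, THEN iffD2], safe)
    fix x assume "?L x = 0"
    then have "(1 - \<eta>) * norm x \<le> 0" using low[of x] by simp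
    then show "x = 0" using \<eta> by (simp add: mult_le_0_iff)
  qed
  have surj: "surj ?L"
    using linear_injective_imp_surjective[OF lin inj] by simp
  have "open (?L ` ?B)"
    using open_surjective_linear_image[OF _ lin surj] by simp
  then have meas: "?L ` ?B \<in> sets borel" by simp
  have "(\<integral>\<^sup>+ x. indicator (?L ` ?B) x * ennreal 1 \<partial>lborel) =
      (\<integral>\<^sup>+ x. indicator ?B x * ennreal (1 * abs_det ?L) \<partial>lborel)"
    by (rule nn_integral_change_of_variables[where \<Phi>' = "\<lambda>_. ?L"])
       (use meas inj bounded_linear_imp_has_derivative[OF L] in \<open>auto intro: inj_on_subset\<close>)
  also have "\<dots> = ennreal (abs_det ?L) * emeasure lborel ?B"
    by (subst mult.commute, subst nn_integral_cmult_indicator) simp_all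
  finally have "emeasure lborel (?L ` ?B) = ennreal (abs_det ?L) * emeasure lborel ?B"
    using meas by simp
  also have "emeasure lborel ?B = ennreal ?v"
    by (simp add: emeasure_ball)
  finally have vol: "emeasure lborel (?L ` ?B) = ennreal (abs_det ?L * ?v)"
    by (simp add: ennreal_mult')
  have v: "0 < ?v" by simp
  have "?L ` ?B \<subseteq> cball 0 (1 + \<eta>)"
  proof clarify
    fix x :: 'a assume "x \<in> ?B"
    then have "norm (E x) \<le> \<eta>"
      using \<eta>(1)[of x] \<eta>(2) mult_left_mono[of "norm x" 1 \<eta>] by simp
    then show "?L x \<in> cball 0 (1 + \<eta>)"
      using norm_triangle_ineq[of x "E x"] \<open>x \<in> ?B\<close> by simp
  qed
  then have "emeasure lborel (?L ` ?B) \<le> emeasure lborel (cball (0::'a) (1 + \<eta>))"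
    by (rule emeasure_mono) simp
  then have "ennreal (abs_det ?L * ?v) \<le> ennreal (?v * (1 + \<eta>) ^ DIM('a))"
    unfolding vol using \<eta>(2) by (simp add: emeasure_cball)
  then show "abs_det ?L \<le> (1 + \<eta>) ^ DIM('a)"
    using v \<eta>(2) by (subst (asm) ennreal_le_iff) (auto simp: mult.commute)
  have "ball 0 (1 - \<eta>) \<subseteq> ?L ` ?B"
  proof
    fix y :: 'a assume y: "y \<in> ball 0 (1 - \<eta>)"
    obtain x where x: "y = ?L x" using surj by blast
    have "(1 - \<eta>) * norm x < (1 - \<eta>) * 1"
      using low[of x] y x by simp
    then have "norm x < 1" using \<eta>(3) by (subst (asm) mult_less_cancel_left_pos) auto
    then show "y \<in> ?L ` ?B" using x by auto
  qed
  then have "emeasure lborel (ball (0::'a) (1 - \<eta>)) \<le> emeasure lborel (?L ` ?B)"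
    using meas by (intro emeasure_mono) auto
  then have "ennreal (?v * (1 - \<eta>) ^ DIM('a)) \<le> ennreal (abs_det ?L * ?v)"
    unfolding vol using \<eta>(3) by (simp add: emeasure_ball)
  then show "(1 - \<eta>) ^ DIM('a) \<le> abs_det ?L"
    using v by (subst (asm) ennreal_le_iff) (auto simp: mult.commute)
qed

section \<open>Functions with continuous partial derivatives\<close>

lemma Ck_on_imp_continuous_on: "Ck_on n X f \<Longrightarrow> continuous_on X f"
  by (cases n) simp_all

lemma Ck_on_SucD: "Ck_on (Suc n) X f \<Longrightarrow> Ck_on n X f"
proof (induction n arbitrary: f)
  case (Suc n)
  then show ?case by (simp only: Ck_on.simps(2)[of "Suc n"] Ck_on.simps(2)[of n]) blast
qed simp

lemma Ck_on_le: "Ck_on n X f \<Longrightarrow> m \<le> n \<Longrightarrow> Ck_on m X f"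
  by (induction n) (auto simp: le_Suc_eq dest: Ck_on_SucD simp del: Ck_on.simps)

lemma Ck_on_dir_deriv: "Ck_on (Suc n) X f \<Longrightarrow> b \<in> Basis \<Longrightarrow> Ck_on n X (dir_deriv b f)"
  by simp

lemma dir_deriv_has_vector_derivative:
  assumes "Ck_on (Suc n) X f" "b \<in> Basis" "x + s *\<^sub>R b \<in> X"
  shows "((\<lambda>t. f (x + t *\<^sub>R b)) has_vector_derivative dir_deriv b f (x + s *\<^sub>R b)) (at s)"
proof -
  have "(\<lambda>t. f ((x + s *\<^sub>R b) + t *\<^sub>R b)) differentiable (at 0)"
    using assms by simp
  then have "((\<lambda>t. f ((x + s *\<^sub>R b) + t *\<^sub>R b)) has_vector_derivative dir_deriv b f (x + s *\<^sub>R b)) (at 0)"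
    by (simp add: dir_deriv_def vector_derivative_works)
  then have "((\<lambda>t. f ((x + s *\<^sub>R b) + t *\<^sub>R b)) has_derivative (\<lambda>h. h *\<^sub>R dir_deriv b f (x + s *\<^sub>R b))) (at (s - s))"
    by (simp add: has_vector_derivative_def)
  moreover have "((\<lambda>t. t - s) has_derivative (\<lambda>h. h)) (at s)"
    by (auto intro!: derivative_eq_intros)
  ultimately have "((\<lambda>t. f ((x + s *\<^sub>R b) + (t - s) *\<^sub>R b)) has_vector_derivative
      dir_deriv b f (x + s *\<^sub>R b)) (at s)"
    unfolding has_vector_derivative_def
    using has_derivative_compose[where f = "\<lambda>t. t - s" and g = "\<lambda>t. f ((x + s *\<^sub>R b) + t *\<^sub>R b)"] by blast
  then show ?thesis
    by (simp add: algebra_simps)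
qed

definition lin_deriv :: "('a::euclidean_space \<Rightarrow> 'b::real_normed_vector) \<Rightarrow> 'a \<Rightarrow> 'a \<Rightarrow> 'b" where
  "lin_deriv f x w = (\<Sum>b\<in>Basis. (w \<bullet> b) *\<^sub>R dir_deriv b f x)"

lemma bounded_linear_lin_deriv: "bounded_linear (lin_deriv f x)"
  unfolding lin_deriv_def
  by (intro bounded_linear_sum bounded_linear_compose[OF bounded_linear_scaleR_left] bounded_linear_inner_left)

lemma lin_deriv_Basis: "b \<in> Basis \<Longrightarrow> lin_deriv f x b = dir_deriv b f x"
  by (simp add: lin_deriv_def inner_Basis if_distrib[of "\<lambda>c. c *\<^sub>R _"] cong: if_cong)

text \<open>One passes from \<open>x\<close> to \<open>x + w\<close> along the coordinate axes, one axis at a time.\<close>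

lemma Ck_on_has_derivative:
  fixes f :: "'a::euclidean_space \<Rightarrow> 'b::real_normed_vector"
  assumes "open X" "Ck_on (Suc n) X f" "x \<in> X"
  shows "(f has_derivative lin_deriv f x) (at x)"
  unfolding has_derivative_at_alt
proof (intro conjI allI impI bounded_linear_lin_deriv)
  fix e :: real assume "0 < e"
  \<comment> \<open>Each of the \<open>DIM('a)\<close> steps along an axis is allowed an equal share
    of the error.\<close>
  define e' where "e' = e / DIM('a)"
  have "0 < e'" using \<open>0 < e\<close> by (simp add: e'_def)
  have "\<exists>d>0. \<forall>y. dist y x < d \<longrightarrow> y \<in> X \<and> norm (dir_deriv b f y - dir_deriv b f x) < e'"
    if b: "b \<in> Basis" for b
  proof -
    have "continuous_on X (dir_deriv b f)"
      using Ck_on_dir_deriv[OF assms(2) b] by (rule Ck_on_imp_continuous_on)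
    then have "isCont (dir_deriv b f) x"
      using assms by (simp add: continuous_on_eq_continuous_at)
    then obtain d1 where "d1 > 0" "\<And>y. dist y x < d1 \<Longrightarrow> dist (dir_deriv b f y) (dir_deriv b f x) < e'"
      using \<open>0 < e'\<close> unfolding continuous_at_eps_delta by blast
    moreover obtain d2 where "d2 > 0" "\<And>y. dist y x < d2 \<Longrightarrow> y \<in> X"
      using assms unfolding open_dist by blast
    ultimately show ?thesis
      by (intro exI[of _ "min d1 d2"]) (auto simp: dist_norm)
  qed
  then obtain d where d: "\<And>b. b \<in> Basis \<Longrightarrow> d b > 0"
    "\<And>b y. b \<in> Basis \<Longrightarrow> dist y x < d b \<Longrightarrow> y \<in> X \<and> norm (dir_deriv b f y - dir_deriv b f x) < e'"
    by metis
  define D where "D = Min (d ` Basis)"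
  have "D > 0" using d(1) by (auto simp: D_def)
  have D: "y \<in> X \<and> norm (dir_deriv b f y - dir_deriv b f x) < e'" if "b \<in> Basis" "dist y x < D" for b y
    using that by (intro d(2)) (auto simp: D_def)
  show "\<exists>d>0. \<forall>y. norm (y - x) < d \<longrightarrow> norm (f y - f x - lin_deriv f x (y - x)) \<le> e * norm (y - x)"
  proof (intro exI[of _ D] conjI allI impI \<open>D > 0\<close>)
    fix y assume y: "norm (y - x) < D"
    define w where "w = y - x"
    define P where "P A = (\<Sum>b\<in>A. (w \<bullet> b) *\<^sub>R b)" for A
    have part: "norm (f (x + P A) - f x - (\<Sum>b\<in>A. (w \<bullet> b) *\<^sub>R dir_deriv b f x)) \<le> card A * (e' * norm w)"
      if "A \<subseteq> Basis" for A
      using finite_subset[OF that finite_Basis] that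
    proof (induction A)
      case empty
      then show ?case by (simp add: P_def)
    next
      case (insert b A)
      then have b: "b \<in> Basis" and A: "A \<subseteq> Basis" by auto
      let ?z = "x + P A"
      have near: "?z + s *\<^sub>R b \<in> X" "norm (dir_deriv b f (?z + s *\<^sub>R b) - dir_deriv b f x) < e'"
        if "s \<in> closed_segment 0 (w \<bullet> b)" for s
      proof -
        have "norm (P A + s *\<^sub>R b) \<le> norm w"
        proof (rule norm_le_componentwise)
          fix c :: 'a assume c: "c \<in> Basis"
          have "P A \<bullet> c = (if c \<in> A then w \<bullet> c else 0)"
            using insert.hyps(1) c A unfolding P_def
            by (subst inner_sum_left) (auto simp: inner_Basis subset_iff if_distrib sum.If_cases cong: if_cong sum.cong intro!: sum.neutral)
          moreover have "\<bar>s\<bar> \<le> \<bar>w \<bullet> b\<bar>"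
            using that by (auto simp: closed_segment_eq_real_ivl split: if_splits)
          ultimately show "\<bar>(P A + s *\<^sub>R b) \<bullet> c\<bar> \<le> \<bar>w \<bullet> c\<bar>"
            using b c insert.hyps(2) by (auto simp: inner_add_left inner_Basis)
        qed
        then have "dist (?z + s *\<^sub>R b) x < D"
          using y by (simp add: dist_norm w_def add.assoc)
        from D[OF b this] show "?z + s *\<^sub>R b \<in> X" "norm (dir_deriv b f (?z + s *\<^sub>R b) - dir_deriv b f x) < e'"
          by auto
      qed
      \<comment> \<open>Without its linear part, the restriction of \<open>f\<close> to the segment
        has a derivative smaller than \<open>e'\<close>, so the mean value inequality bounds its
        increment.\<close>
      let ?F = "\<lambda>s. f (?z + s *\<^sub>R b) - s *\<^sub>R dir_deriv b f x"
      have "norm (?F (w \<bullet> b) - ?F 0) \<le> e' * norm (w \<bullet> b - 0)"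
      proof (rule differentiable_bound[where f' = "\<lambda>s h. h *\<^sub>R (dir_deriv b f (?z + s *\<^sub>R b) - dir_deriv b f x)"])
        fix s assume s: "s \<in> closed_segment 0 (w \<bullet> b)"
        have "(?F has_vector_derivative dir_deriv b f (?z + s *\<^sub>R b) - dir_deriv b f x) (at s within closed_segment 0 (w \<bullet> b))"
          by (rule has_vector_derivative_at_within)
            (auto intro!: derivative_eq_intros dir_deriv_has_vector_derivative[OF assms(2) b near(1)[OF s]])
        then show "(?F has_derivative (\<lambda>h. h *\<^sub>R (dir_deriv b f (?z + s *\<^sub>R b) - dir_deriv b f x))) (at s within closed_segment 0 (w \<bullet> b))"
          by (simp add: has_vector_derivative_def)
        show "onorm (\<lambda>h. h *\<^sub>R (dir_deriv b f (?z + s *\<^sub>R b) - dir_deriv b f x)) \<le> e'"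
          using near(2)[OF s] by (intro onorm_le) (simp add: mult.commute[of e'] mult_left_mono)
      qed auto
      moreover have "e' * norm (w \<bullet> b - 0) \<le> e' * norm w"
        using \<open>0 < e'\<close> Basis_le_norm[OF b, of w] by simp
      ultimately have "norm (f (?z + (w \<bullet> b) *\<^sub>R b) - f ?z - (w \<bullet> b) *\<^sub>R dir_deriv b f x) \<le> e' * norm w"
        by (simp add: algebra_simps)
      moreover have "norm (f ?z - f x - (\<Sum>b\<in>A. (w \<bullet> b) *\<^sub>R dir_deriv b f x)) \<le> card A * (e' * norm w)"
        using insert.IH A .
      ultimately have "norm ((f (?z + (w \<bullet> b) *\<^sub>R b) - f ?z - (w \<bullet> b) *\<^sub>R dir_deriv b f x)
          + (f ?z - f x - (\<Sum>b\<in>A. (w \<bullet> b) *\<^sub>R dir_deriv b f x))) \<le> e' * norm w + card A * (e' * norm w)"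
        by (rule norm_triangle_mono)
      moreover have "x + P (insert b A) = ?z + (w \<bullet> b) *\<^sub>R b"
        using insert.hyps by (simp add: P_def algebra_simps)
      ultimately show ?case
        using insert.hyps by (simp add: algebra_simps)
    qed
    have "norm (f (x + w) - f x - lin_deriv f x w) \<le> DIM('a) * (e' * norm w)"
      using part[OF order.refl] by (simp add: P_def lin_deriv_def euclidean_representation)
    also have "\<dots> = e * norm w"
      by (simp add: e'_def)
    finally show "norm (f y - f x - lin_deriv f x (y - x)) \<le> e * norm (y - x)"
      by (simp add: w_def)
  qed
qed

lemma Ck_on_has_vector_derivative_line:
  assumes "open X" "Ck_on (Suc n) X f" "x + s *\<^sub>R w \<in> X"
  shows "((\<lambda>r. f (x + r *\<^sub>R w)) has_vector_derivative lin_deriv f (x + s *\<^sub>R w) w) (at s)"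
proof -
  have "((\<lambda>r. x + r *\<^sub>R w) has_derivative (\<lambda>r. r *\<^sub>R w)) (at s)"
    by (auto intro!: derivative_eq_intros)
  from has_derivative_compose[OF this Ck_on_has_derivative[OF assms(1,2,3)]]
  show ?thesis
    unfolding has_vector_derivative_def
    by (simp add: linear_scale[OF bounded_linear.linear[OF bounded_linear_lin_deriv]])
qed

text \<open>The mean value theorem, applied in direction \<open>a\<close> and then in direction
  \<open>b\<close>, writes the quotient as the mixed derivative at a point that tends to
  \<open>x\<close>; the rest is continuity of that derivative.\<close>

lemma second_difference_quotient:
  fixes f :: "'a::euclidean_space \<Rightarrow> real"
  assumes X: "open X" "x \<in> X" and f: "Ck_on 2 X f" and ab: "a \<in> Basis" "b \<in> Basis"
  shows "((\<lambda>h. (f (x + h *\<^sub>R a + h *\<^sub>R b) - f (x + h *\<^sub>R a) - f (x + h *\<^sub>R b) + f x) / h\<^sup>2)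
     \<longlongrightarrow> dir_deriv b (dir_deriv a f) x) (at_right 0)"
proof (rule tendstoI)
  fix e :: real assume "0 < e"
  let ?g = "dir_deriv b (dir_deriv a f)"
  have f2: "Ck_on (Suc (Suc 0)) X f" using f by (simp add: numeral_2_eq_2)
  note fa = Ck_on_dir_deriv[OF f2 ab(1)]
  have "continuous_on X ?g"
    using Ck_on_dir_deriv[OF fa ab(2)] by (rule Ck_on_imp_continuous_on)
  then have "isCont ?g x"
    using X by (simp add: continuous_on_eq_continuous_at)
  then obtain d1 where d1: "d1 > 0" "\<And>y. dist y x < d1 \<Longrightarrow> dist (?g y) (?g x) < e"
    using \<open>0 < e\<close> unfolding continuous_at_eps_delta by blast
  obtain d2 where d2: "d2 > 0" "\<And>y. dist y x < d2 \<Longrightarrow> y \<in> X"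
    using X unfolding open_dist by blast
  define d where "d = min d1 d2 / 2"
  have "d > 0" using d1 d2 by (simp add: d_def)
  have near: "dist (x + s *\<^sub>R a + r *\<^sub>R b) x < min d1 d2" if "0 \<le> s" "s < d" "0 \<le> r" "r < d" for s r
  proof -
    have "norm (s *\<^sub>R a + r *\<^sub>R b) \<le> s + r"
      using norm_triangle_ineq[of "s *\<^sub>R a" "r *\<^sub>R b"] that ab by simp
    then show ?thesis using that by (simp add: dist_norm d_def add.assoc)
  qed
  have "dist ((f (x + h *\<^sub>R a + h *\<^sub>R b) - f (x + h *\<^sub>R a) - f (x + h *\<^sub>R b) + f x) / h\<^sup>2) (?g x) < e"
    if h: "0 < h" "h < d" for h
  proof -
    have inX: "x + s *\<^sub>R a + r *\<^sub>R b \<in> X" if "0 \<le> s" "s \<le> h" "0 \<le> r" "r \<le> h" for s r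
      using near[of s r] d2(2) that h by auto
    let ?\<phi> = "\<lambda>s. f (x + s *\<^sub>R a + h *\<^sub>R b) - f (x + s *\<^sub>R a)"
    have "(?\<phi> has_real_derivative dir_deriv a f (x + s *\<^sub>R a + h *\<^sub>R b) - dir_deriv a f (x + s *\<^sub>R a)) (at s)"
      if s: "0 \<le> s" "s \<le> h" for s
      using dir_deriv_has_vector_derivative[OF f2 ab(1), of "x + h *\<^sub>R b" s]
        dir_deriv_has_vector_derivative[OF f2 ab(1), of x s] inX[of s h] inX[of s 0] s h
      by (auto simp: has_real_derivative_iff_has_vector_derivative algebra_simps intro!: derivative_intros)
    from MVT2[OF \<open>0 < h\<close> this] obtain s where s: "0 < s" "s < h"
      "?\<phi> h - ?\<phi> 0 = h * (dir_deriv a f (x + s *\<^sub>R a + h *\<^sub>R b) - dir_deriv a f (x + s *\<^sub>R a))"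
      by auto
    have "((\<lambda>r. dir_deriv a f (x + s *\<^sub>R a + r *\<^sub>R b)) has_real_derivative ?g (x + s *\<^sub>R a + r *\<^sub>R b)) (at r)"
      if r: "0 \<le> r" "r \<le> h" for r
      using dir_deriv_has_vector_derivative[OF fa ab(2) inX[of s r]] s h r
      by (simp add: has_real_derivative_iff_has_vector_derivative)
    from MVT2[OF \<open>0 < h\<close> this] obtain r where r: "0 < r" "r < h"
      "dir_deriv a f (x + s *\<^sub>R a + h *\<^sub>R b) - dir_deriv a f (x + s *\<^sub>R a) = h * ?g (x + s *\<^sub>R a + r *\<^sub>R b)"
      by auto
    have "f (x + h *\<^sub>R a + h *\<^sub>R b) - f (x + h *\<^sub>R a) - f (x + h *\<^sub>R b) + f x = ?\<phi> h - ?\<phi> 0"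
      by simp
    also have "\<dots> = h\<^sup>2 * ?g (x + s *\<^sub>R a + r *\<^sub>R b)"
      using s(3) r(3) by (simp add: power2_eq_square)
    finally have "(f (x + h *\<^sub>R a + h *\<^sub>R b) - f (x + h *\<^sub>R a) - f (x + h *\<^sub>R b) + f x) / h\<^sup>2 = ?g (x + s *\<^sub>R a + r *\<^sub>R b)"
      using h by simp
    then show ?thesis
      using d1(2)[of "x + s *\<^sub>R a + r *\<^sub>R b"] near[of s r] s r h by simp
  qed
  then show "\<forall>\<^sub>F h in at_right 0. dist ((f (x + h *\<^sub>R a + h *\<^sub>R b) - f (x + h *\<^sub>R a) - f (x + h *\<^sub>R b) + f x) / h\<^sup>2) (?g x) < e"
    using \<open>d > 0\<close> by (auto simp: eventually_at_right_field)
qed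

text \<open>The second difference quotient is symmetric in \<open>a\<close> and \<open>b\<close>, so
  both mixed derivatives are limits of the same expression.\<close>

lemma dir_deriv_commute:
  fixes f :: "'a::euclidean_space \<Rightarrow> real"
  assumes "open X" "x \<in> X" "Ck_on 2 X f" "a \<in> Basis" "b \<in> Basis"
  shows "dir_deriv b (dir_deriv a f) x = dir_deriv a (dir_deriv b f) x"
proof (rule tendsto_unique)
  show "((\<lambda>h. (f (x + h *\<^sub>R a + h *\<^sub>R b) - f (x + h *\<^sub>R a) - f (x + h *\<^sub>R b) + f x) / h\<^sup>2)
     \<longlongrightarrow> dir_deriv b (dir_deriv a f) x) (at_right 0)"
    by (rule second_difference_quotient) fact+
  have "((\<lambda>h. (f (x + h *\<^sub>R b + h *\<^sub>R a) - f (x + h *\<^sub>R b) - f (x + h *\<^sub>R a) + f x) / h\<^sup>2)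
     \<longlongrightarrow> dir_deriv a (dir_deriv b f) x) (at_right 0)"
    by (rule second_difference_quotient) fact+
  then show "((\<lambda>h. (f (x + h *\<^sub>R a + h *\<^sub>R b) - f (x + h *\<^sub>R a) - f (x + h *\<^sub>R b) + f x) / h\<^sup>2)
     \<longlongrightarrow> dir_deriv a (dir_deriv b f) x) (at_right 0)"
    by (simp add: algebra_simps)
qed simp

text \<open>The Hessian of \<open>f\<close> at \<open>x\<close> as a bilinear form, assembled from
  iterated partial derivatives; its symmetry is proved afterwards.\<close>

definition lin_deriv2 :: "('a::euclidean_space \<Rightarrow> real) \<Rightarrow> 'a \<Rightarrow> 'a \<Rightarrow> 'a \<Rightarrow> real" where
  "lin_deriv2 f x v w = (\<Sum>b\<in>Basis. (v \<bullet> b) * lin_deriv (dir_deriv b f) x w)"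

lemma lin_deriv2_commute:
  assumes "open X" "x \<in> X" "Ck_on 2 X f"
  shows "lin_deriv2 f x v w = lin_deriv2 f x w v"
proof -
  have "lin_deriv2 f x v w = (\<Sum>b\<in>Basis. \<Sum>a\<in>Basis. (v \<bullet> b) * (w \<bullet> a) * dir_deriv a (dir_deriv b f) x)"
    by (simp add: lin_deriv2_def lin_deriv_def sum_distrib_left mult.assoc)
  also have "\<dots> = (\<Sum>b\<in>Basis. \<Sum>a\<in>Basis. (v \<bullet> b) * (w \<bullet> a) * dir_deriv b (dir_deriv a f) x)"
    by (intro sum.cong refl) (simp add: dir_deriv_commute[OF assms])
  also have "\<dots> = (\<Sum>a\<in>Basis. \<Sum>b\<in>Basis. (v \<bullet> b) * (w \<bullet> a) * dir_deriv b (dir_deriv a f) x)"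
    by (rule sum.swap)
  also have "\<dots> = lin_deriv2 f x w v"
    by (simp add: lin_deriv2_def lin_deriv_def sum_distrib_left mult_ac)
  finally show ?thesis .
qed

lemma linear_lin_deriv2_right: "linear (lin_deriv2 f x v)"
proof -
  have "linear (\<lambda>w. \<Sum>b\<in>Basis. (v \<bullet> b) *\<^sub>R lin_deriv (dir_deriv b f) x w)"
    by (intro bounded_linear.linear bounded_linear_sum bounded_linear_compose[OF bounded_linear_scaleR_right] bounded_linear_lin_deriv)
  then show ?thesis by (simp add: lin_deriv2_def[abs_def])
qed

lemma linear_lin_deriv2_left: "linear (\<lambda>v. lin_deriv2 f x v w)"
  by (rule linearI) (simp_all add: lin_deriv2_def inner_add_left algebra_simps sum.distrib sum_distrib_left)

lemma continuous_on_lin_deriv2: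
  assumes "Ck_on 2 X f"
  shows "continuous_on (X \<times> UNIV) (\<lambda>(x, w). lin_deriv2 f x w w)"
proof -
  have "continuous_on X (dir_deriv a (dir_deriv b f))" if "a \<in> Basis" "b \<in> Basis" for a b
    using assms that by (simp add: numeral_2_eq_2)
  then have "continuous_on (X \<times> (UNIV :: 'a set)) (\<lambda>z. dir_deriv a (dir_deriv b f) (fst z))" if "a \<in> Basis" "b \<in> Basis" for a b
    using that by (intro continuous_on_compose2[OF _ continuous_on_fst[OF continuous_on_id]]) auto
  then show ?thesis
    unfolding lin_deriv2_def lin_deriv_def split_def by (intro continuous_intros) auto
qed

text \<open>This is the one-variable expansion along the segment from \<open>u\<close> to
  \<open>u + w\<close>. The list \<open>diff\<close> holds the function of the segment parameter and
  its first three derivatives.\<close>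

lemma Ck_on_taylor3:
  fixes f :: "'a::euclidean_space \<Rightarrow> real"
  assumes X: "open X" and f: "Ck_on 3 X f" and seg: "\<And>r. 0 \<le> r \<Longrightarrow> r \<le> 1 \<Longrightarrow> u + r *\<^sub>R w \<in> X"
  shows "\<exists>r. 0 < r \<and> r < 1 \<and> f (u + w) = f u + lin_deriv f u w + lin_deriv2 f u w w / 2 +
     (\<Sum>b\<in>Basis. \<Sum>a\<in>Basis. (w \<bullet> b) * (w \<bullet> a) * lin_deriv (dir_deriv a (dir_deriv b f)) (u + r *\<^sub>R w) w) / 6"
proof -
  let ?D3 = "\<lambda>x. \<Sum>b\<in>Basis. \<Sum>a\<in>Basis. (w \<bullet> b) * (w \<bullet> a) * lin_deriv (dir_deriv a (dir_deriv b f)) x w"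
  define diff where "diff m = [\<lambda>r. f (u + r *\<^sub>R w), \<lambda>r. lin_deriv f (u + r *\<^sub>R w) w,
     \<lambda>r. lin_deriv2 f (u + r *\<^sub>R w) w w, \<lambda>r. ?D3 (u + r *\<^sub>R w)] ! m" for m
  have f3: "Ck_on (Suc (Suc (Suc 0))) X f" using f by (simp add: numeral_3_eq_3)
  note fb = Ck_on_dir_deriv[OF f3]
  note fba = Ck_on_dir_deriv[OF fb]
  have line: "((\<lambda>r. g (u + r *\<^sub>R w)) has_real_derivative lin_deriv g (u + r *\<^sub>R w) w) (at r)"
    if "Ck_on (Suc n) X g" "0 \<le> r" "r \<le> 1" for g :: "'a \<Rightarrow> real" and n r
    using Ck_on_has_vector_derivative_line[OF X that(1) seg[OF that(2,3)]]
    by (simp add: has_real_derivative_iff_has_vector_derivative)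
  have "\<exists>r>0. r < 1 \<and> f (u + 1 *\<^sub>R w) = (\<Sum>m<3. (diff m 0 / fact m) * 1 ^ m) + (diff 3 r / fact 3) * 1 ^ 3"
  proof (rule Maclaurin)
    show "diff 0 = (\<lambda>r. f (u + r *\<^sub>R w))" by (simp add: diff_def)
    have "DERIV (diff m) t :> diff (Suc m) t" if "m \<in> {0, 1, 2}" "0 \<le> t" "t \<le> 1" for m t
      using that
    proof (elim insertE)
      assume "m = 0"
      then show ?thesis using line[OF f3] that by (simp add: diff_def)
    next
      assume "m = 1"
      then show ?thesis using line[OF fb] that
        by (auto simp: diff_def lin_deriv2_def lin_deriv_def[of f] intro!: DERIV_sum DERIV_cmult)
    next
      assume m: "m = 2"
      have "((\<lambda>r. \<Sum>b\<in>Basis. (w \<bullet> b) * (\<Sum>a\<in>Basis. (w \<bullet> a) * dir_deriv a (dir_deriv b f) (u + r *\<^sub>R w))) has_real_derivative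
         (\<Sum>b\<in>Basis. (w \<bullet> b) * (\<Sum>a\<in>Basis. (w \<bullet> a) * lin_deriv (dir_deriv a (dir_deriv b f)) (u + t *\<^sub>R w) w))) (at t)"
        using line[OF fba] that by (intro DERIV_sum DERIV_cmult) auto
      then show ?thesis
        by (simp add: m diff_def lin_deriv2_def lin_deriv_def[of "dir_deriv _ f"] sum_distrib_left mult.assoc)
    qed simp
    then show "\<forall>m t. m < 3 \<and> 0 \<le> t \<and> t \<le> 1 \<longrightarrow> DERIV (diff m) t :> diff (Suc m) t"
      by (auto simp: numeral_3_eq_3 less_Suc_eq)
  qed simp_all
  then show ?thesis
    by (auto simp: diff_def numeral_3_eq_3 fact_numeral eval_nat_numeral intro!: exI)
qed

text \<open>The closed \<open>d\<close>-neighbourhood of a compact set inside an open set is again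
  compact and inside it for small \<open>d\<close>. The third derivatives are bounded there, which
  makes the constant in the cubic remainder independent of the base point.\<close>

lemma Ck_on_taylor3_uniform:
  fixes f :: "'a::euclidean_space \<Rightarrow> real"
  assumes X: "open X" and K: "compact K" "K \<subseteq> X" and f: "Ck_on 3 X f"
  obtains C d where "0 < d" "0 \<le> C" "\<And>u w. u \<in> K \<Longrightarrow> norm w \<le> d \<Longrightarrow> u + w \<in> X"
    "\<And>u w. u \<in> K \<Longrightarrow> norm w \<le> d \<Longrightarrow>
       \<bar>f (u + w) - (f u + lin_deriv f u w + lin_deriv2 f u w w / 2)\<bar> \<le> C * norm w ^ 3"
proof -
  obtain d where d: "0 < d" "(\<Union>x\<in>K. cball x d) \<subseteq> X"
    using compact_subset_open_imp_cball_epsilon_subset[OF K(1) X K(2)] .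
  have inX: "u + w \<in> X" if "u \<in> K" "norm w \<le> d" for u w
  proof -
    have "u + w \<in> cball u d" using that(2) by (simp add: dist_norm)
    then show ?thesis using d(2) that(1) by blast
  qed
  define H where "H = (\<lambda>(u, w). u + w) ` (K \<times> cball (0::'a) d)"
  have H: "compact H" "H \<subseteq> X"
    using K(1) inX unfolding H_def split_def
    by (auto intro!: compact_continuous_image continuous_intros compact_Times)
  have f3: "Ck_on (Suc (Suc (Suc 0))) X f" using f by (simp add: numeral_3_eq_3)
  have "\<exists>B. \<forall>x\<in>H. \<bar>dir_deriv c (dir_deriv a (dir_deriv b f)) x\<bar> \<le> B"
    if "a \<in> Basis" "b \<in> Basis" "c \<in> Basis" for a b c
  proof -
    have "continuous_on X (dir_deriv c (dir_deriv a (dir_deriv b f)))"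
      using f3 that by simp
    then have "compact (dir_deriv c (dir_deriv a (dir_deriv b f)) ` H)"
      using H continuous_on_subset by (intro compact_continuous_image) auto
    then show ?thesis
      by (metis bounded_iff compact_imp_bounded imageI real_norm_def)
  qed
  then obtain B where B: "\<And>a b c x. a \<in> Basis \<Longrightarrow> b \<in> Basis \<Longrightarrow> c \<in> Basis \<Longrightarrow> x \<in> H \<Longrightarrow>
      \<bar>dir_deriv c (dir_deriv a (dir_deriv b f)) x\<bar> \<le> B a b c"
    by metis
  define C where "C = (\<Sum>b\<in>Basis. \<Sum>a\<in>Basis. \<Sum>c\<in>Basis. \<bar>B a b c\<bar>)"
  show ?thesis
  proof (rule that[OF \<open>0 < d\<close>, of C])
    show "0 \<le> C" by (simp add: C_def sum_nonneg)
    show "u + w \<in> X" if "u \<in> K" "norm w \<le> d" for u w using inX that .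
    fix u w :: 'a assume u: "u \<in> K" and w: "norm w \<le> d"
    have seg: "u + r *\<^sub>R w \<in> H" if "0 \<le> r" "r \<le> 1" for r
    proof -
      have "norm (r *\<^sub>R w) \<le> d"
        using that w mult_left_le_one_le[of "norm w" r] by simp
      then show ?thesis using u by (auto simp: H_def intro!: image_eqI[of _ _ "(u, r *\<^sub>R w)"])
    qed
    obtain r where r: "0 < r" "r < 1" "f (u + w) = f u + lin_deriv f u w + lin_deriv2 f u w w / 2 +
     (\<Sum>b\<in>Basis. \<Sum>a\<in>Basis. (w \<bullet> b) * (w \<bullet> a) * lin_deriv (dir_deriv a (dir_deriv b f)) (u + r *\<^sub>R w) w) / 6"
      using Ck_on_taylor3[OF X f, of u w] seg H by (meson subsetD)
    let ?R = "\<Sum>b\<in>Basis. \<Sum>a\<in>Basis. (w \<bullet> b) * (w \<bullet> a) * lin_deriv (dir_deriv a (dir_deriv b f)) (u + r *\<^sub>R w) w"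
    have "?R = (\<Sum>b\<in>Basis. \<Sum>a\<in>Basis. \<Sum>c\<in>Basis. (w \<bullet> b) * (w \<bullet> a) * (w \<bullet> c) *
        dir_deriv c (dir_deriv a (dir_deriv b f)) (u + r *\<^sub>R w))"
      by (simp add: lin_deriv_def sum_distrib_left mult_ac)
    also have "\<bar>\<dots>\<bar> \<le> (\<Sum>b\<in>Basis. \<Sum>a\<in>Basis. \<Sum>c\<in>Basis. \<bar>B a b c\<bar> * norm w ^ 3)"
    proof (intro order.trans[OF sum_abs] sum_mono)
      fix a b c :: 'a assume abc: "a \<in> Basis" "b \<in> Basis" "c \<in> Basis"
      have "\<bar>(w \<bullet> b) * (w \<bullet> a) * (w \<bullet> c)\<bar> \<le> norm w * norm w * norm w"
        unfolding abs_mult using abc by (intro mult_mono Basis_le_norm) auto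
      moreover have "\<bar>dir_deriv c (dir_deriv a (dir_deriv b f)) (u + r *\<^sub>R w)\<bar> \<le> \<bar>B a b c\<bar>"
        using B[OF abc seg[of r]] r by linarith
      ultimately have "\<bar>(w \<bullet> b) * (w \<bullet> a) * (w \<bullet> c)\<bar> * \<bar>dir_deriv c (dir_deriv a (dir_deriv b f)) (u + r *\<^sub>R w)\<bar>
          \<le> (norm w * norm w * norm w) * \<bar>B a b c\<bar>"
        by (intro mult_mono) auto
      then show "\<bar>(w \<bullet> b) * (w \<bullet> a) * (w \<bullet> c) * dir_deriv c (dir_deriv a (dir_deriv b f)) (u + r *\<^sub>R w)\<bar>
          \<le> \<bar>B a b c\<bar> * norm w ^ 3"
        by (simp add: abs_mult power3_eq_cube mult_ac)
    qed
    also have "\<dots> = C * norm w ^ 3"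
      by (simp add: C_def sum_distrib_right)
    finally have "\<bar>?R\<bar> \<le> C * norm w ^ 3" .
    moreover have "f (u + w) - (f u + lin_deriv f u w + lin_deriv2 f u w w / 2) = ?R / 6"
      using r(3) by simp
    ultimately show "\<bar>f (u + w) - (f u + lin_deriv f u w + lin_deriv2 f u w w / 2)\<bar> \<le> C * norm w ^ 3"
      by simp
  qed
qed

text \<open>The same compactness argument at first order. The function is differentiable everywhere,
  so the radius \<open>d\<close> is arbitrary here and only \<open>C\<close> depends on it.\<close>

lemma Ck_on_lipschitz_near_compact:
  fixes f :: "'a::euclidean_space \<Rightarrow> real"
  assumes f: "Ck_on (Suc n) UNIV f" and K: "compact K"
  obtains C where "0 \<le> C" "\<And>u w. u \<in> K \<Longrightarrow> norm w \<le> d \<Longrightarrow> \<bar>f (u + w) - f u\<bar> \<le> C * norm w"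
proof -
  define H where "H = (\<lambda>(u, w). u + w) ` (K \<times> cball (0::'a) d)"
  have H: "compact H"
    using K unfolding H_def split_def
    by (auto intro!: compact_continuous_image continuous_intros compact_Times)
  have "\<exists>B. \<forall>x\<in>H. \<bar>dir_deriv b f x\<bar> \<le> B" if "b \<in> Basis" for b
  proof -
    have "continuous_on UNIV (dir_deriv b f)"
      using Ck_on_imp_continuous_on[OF Ck_on_dir_deriv[OF f that]] .
    then have "compact (dir_deriv b f ` H)"
      using H continuous_on_subset by (intro compact_continuous_image) auto
    then show ?thesis
      by (metis bounded_iff compact_imp_bounded imageI real_norm_def)
  qed
  then obtain B where B: "\<And>b x. b \<in> Basis \<Longrightarrow> x \<in> H \<Longrightarrow> \<bar>dir_deriv b f x\<bar> \<le> B b"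
    by metis
  define C where "C = (\<Sum>b\<in>Basis. \<bar>B b\<bar>)"
  show ?thesis
  proof (rule that[of C])
    show "0 \<le> C" by (simp add: C_def sum_nonneg)
    fix u w :: 'a assume u: "u \<in> K" and w: "norm w \<le> d"
    have seg: "u + r *\<^sub>R w \<in> H" if "0 \<le> r" "r \<le> 1" for r
    proof -
      have "norm (r *\<^sub>R w) \<le> d"
        using that w mult_left_le_one_le[of "norm w" r] by simp
      then show ?thesis using u by (auto simp: H_def intro!: image_eqI[of _ _ "(u, r *\<^sub>R w)"])
    qed
    have "((\<lambda>r. f (u + r *\<^sub>R w)) has_real_derivative lin_deriv f (u + r *\<^sub>R w) w) (at r)" for r
      using Ck_on_has_vector_derivative_line[OF open_UNIV f]
      by (simp add: has_real_derivative_iff_has_vector_derivative)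
    then obtain r where r: "0 < r" "r < 1" "f (u + 1 *\<^sub>R w) - f (u + 0 *\<^sub>R w) = (1 - 0) * lin_deriv f (u + r *\<^sub>R w) w"
      using MVT2[of 0 1 "\<lambda>r. f (u + r *\<^sub>R w)" "\<lambda>r. lin_deriv f (u + r *\<^sub>R w) w"] by auto
    have "\<bar>lin_deriv f (u + r *\<^sub>R w) w\<bar> \<le> (\<Sum>b\<in>Basis. \<bar>B b\<bar> * norm w)"
      unfolding lin_deriv_def
    proof (intro order.trans[OF sum_abs] sum_mono)
      fix b :: 'a assume b: "b \<in> Basis"
      have "\<bar>w \<bullet> b\<bar> * \<bar>dir_deriv b f (u + r *\<^sub>R w)\<bar> \<le> norm w * \<bar>B b\<bar>"
        using B[OF b seg[of r]] r Basis_le_norm[OF b, of w] by (intro mult_mono) auto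
      then show "\<bar>(w \<bullet> b) *\<^sub>R dir_deriv b f (u + r *\<^sub>R w)\<bar> \<le> \<bar>B b\<bar> * norm w"
        by (simp add: abs_mult mult_ac)
    qed
    then show "\<bar>f (u + w) - f u\<bar> \<le> C * norm w"
      using r(3) by (simp add: C_def sum_distrib_right)
  qed
qed

section \<open>Gaussian integrals\<close>

abbreviation lborel_PiM :: "nat \<Rightarrow> (nat \<Rightarrow> real) measure" where
  "lborel_PiM c \<equiv> \<Pi>\<^sub>M i\<in>{..<c}. lborel"

definition quad_form :: "nat \<Rightarrow> (nat \<Rightarrow> nat \<Rightarrow> real) \<Rightarrow> (nat \<Rightarrow> real) \<Rightarrow> real" where
  "quad_form c H t = (\<Sum>i<c. \<Sum>j<c. H i j * t i * t j)"

lemma measurable_lborel_PiM_component [measurable]: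
  "i < c \<Longrightarrow> (\<lambda>t. t i) \<in> borel_measurable (lborel_PiM c)"
  using measurable_component_singleton[of i "{..<c}" "\<lambda>_. lborel"] by simp

lemma measurable_quad_form [measurable]: "quad_form c H \<in> borel_measurable (lborel_PiM c)"
  unfolding quad_form_def by (intro borel_measurable_sum borel_measurable_times) auto

lemma nn_integral_gaussian:
  assumes "0 < a"
  shows "(\<integral>\<^sup>+ y. ennreal (exp (- a * (y - m)\<^sup>2 / 2)) \<partial>lborel) = ennreal (sqrt (2 * pi / a))"
proof -
  let ?s = "1 / sqrt a"
  have "?s\<^sup>2 = 1 / a" using assms by (simp add: power_divide)
  then have eq: "exp (- a * (y - m)\<^sup>2 / 2) = sqrt (2 * pi / a) * normal_density m ?s y" for y
    using assms unfolding normal_density_def by (simp add: real_sqrt_divide real_sqrt_mult)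
  interpret prob_space "density lborel (normal_density m ?s)"
    using assms by (intro prob_space_normal_density) simp
  have "(\<integral>\<^sup>+ y. ennreal (normal_density m ?s y) \<partial>lborel) = 1"
    using emeasure_space_1 by (simp add: emeasure_density)
  then have "(\<integral>\<^sup>+ y. ennreal (sqrt (2 * pi / a)) * ennreal (normal_density m ?s y) \<partial>lborel) = ennreal (sqrt (2 * pi / a))"
    by (subst nn_integral_cmult) simp_all
  then show ?thesis
    using assms unfolding eq by (simp add: ennreal_mult')
qed

text \<open>One step of elimination: the matrix is \<open>P * Q\<close>, where \<open>P\<close> is
  upper triangular with unit diagonal and removes the last column, and \<open>Q\<close> is block
  lower triangular with the Schur complement and \<open>H c c\<close> as its diagonal
  blocks.\<close>

lemma det_schur_complement:
  fixes H :: "nat \<Rightarrow> nat \<Rightarrow> real"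
  assumes "H c c \<noteq> 0"
  shows "Determinant.det (Matrix.mat (Suc c) (Suc c) (\<lambda>(i, j). H i j)) =
    H c c * Determinant.det (Matrix.mat c c (\<lambda>(i, j). H i j - H i c * H c j / H c c))"
proof -
  define P where "P = Matrix.mat (Suc c) (Suc c) (\<lambda>(i, j). if i = j then 1 else if j = c then H i c / H c c else 0)"
  define Q where "Q = Matrix.mat (Suc c) (Suc c)
    (\<lambda>(i, j). if i < c then (if j < c then H i j - H i c * H c j / H c c else 0) else H c j)"
  have carr: "P \<in> carrier_mat (Suc c) (Suc c)" "Q \<in> carrier_mat (Suc c) (Suc c)"
    by (simp_all add: P_def Q_def)
  have "Matrix.mat (Suc c) (Suc c) (\<lambda>(i, j). H i j) = P * Q"
  proof (rule eq_matI)
    fix i j assume "i < dim_row (P * Q)" "j < dim_col (P * Q)"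
    then have ij: "i < Suc c" "j < Suc c" by (simp_all add: P_def Q_def)
    have "(P * Q) $$ (i, j) = (\<Sum>k<Suc c. P $$ (i, k) * Q $$ (k, j))"
      using ij carr by (simp add: times_mat_def scalar_prod_def atLeast0LessThan del: sum.lessThan_Suc)
    also have "\<dots> = (\<Sum>k<c. (if i = k then 1 else 0) * Q $$ (k, j)) + P $$ (i, c) * Q $$ (c, j)"
      using ij by (auto simp: P_def intro!: sum.cong)
    also have "(\<Sum>k<c. (if i = k then 1 else 0) * Q $$ (k, j)) = (if i < c then Q $$ (i, j) else 0)"
      by (simp add: if_distrib[of "\<lambda>x. x * _"] cong: if_cong)
    finally show "Matrix.mat (Suc c) (Suc c) (\<lambda>(i, j). H i j) $$ (i, j) = (P * Q) $$ (i, j)"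
      using ij assms by (auto simp: P_def Q_def less_Suc_eq)
  qed (simp_all add: P_def Q_def)
  moreover have "Determinant.det P = 1"
  proof -
    have "Determinant.det P = prod_list (diag_mat P)"
      by (rule Determinant.det_upper_triangular[OF _ carr(1)]) (auto simp: P_def upper_triangular_def)
    also have "diag_mat P = map (\<lambda>_. 1) [0..<Suc c]"
      by (auto simp: diag_mat_def P_def intro!: map_cong)
    also have "prod_list (map (\<lambda>_. 1) xs) = (1 :: real)" for xs :: "nat list"
      by (induction xs) auto
    finally show ?thesis .
  qed
  moreover have "Determinant.det Q = Determinant.det (Matrix.mat c c (\<lambda>(i, j). H i j - H i c * H c j / H c c)) * H c c"
  proof -
    let ?A = "Matrix.mat c c (\<lambda>(i, j). H i j - H i c * H c j / H c c)"
    let ?C = "Matrix.mat 1 c (\<lambda>(i, j). H c j)" and ?D = "Matrix.mat 1 1 (\<lambda>_. H c c)"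
    have "Q = four_block_mat ?A (0\<^sub>m c 1) ?C ?D"
      by (rule eq_matI) (auto simp: Q_def less_Suc_eq)
    then show ?thesis
      by (simp add: det_four_block_mat_upper_right_zero[of _ c _ 1] det_single)
  qed
  ultimately show ?thesis
    by (simp add: Determinant.det_mult[OF carr])
qed

text \<open>By induction on the dimension: integrating out the last coordinate by completing the
  square leaves the Gaussian of the Schur complement. The sign of the determinant is carried in the
  same induction because the square roots are multiplied along the way.\<close>

lemma gaussian_integral:
  fixes H :: "nat \<Rightarrow> nat \<Rightarrow> real"
  assumes "\<And>i j. i < c \<Longrightarrow> j < c \<Longrightarrow> H i j = H j i"
    and "\<And>t. \<exists>i<c. t i \<noteq> 0 \<Longrightarrow> 0 < quad_form c H t"
  shows "0 < Determinant.det (Matrix.mat c c (\<lambda>(i, j). H i j)) \<and>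
    (\<integral>\<^sup>+ t. ennreal (exp (- quad_form c H t / 2)) \<partial>lborel_PiM c) =
      ennreal (sqrt ((2 * pi) ^ c / Determinant.det (Matrix.mat c c (\<lambda>(i, j). H i j))))"
  using assms
proof (induction c arbitrary: H)
  case 0
  then show ?case
    by (simp add: quad_form_def PiM_empty nn_integral_count_space_finite)
next
  case (Suc c)
  let ?a = "H c c"
  define H' where "H' i j = H i j - H i c * H c j / ?a" for i j
  have sym: "H i j = H j i" if "i < Suc c" "j < Suc c" for i j
    using Suc.prems(1) that .
  have split: "quad_form (Suc c) H (t(c := y)) = ?a * y\<^sup>2 + 2 * y * (\<Sum>i<c. H i c * t i) + quad_form c H t" for t y
  proof -
    have "quad_form (Suc c) H (t(c := y)) = (\<Sum>i<c. (\<Sum>j<c. H i j * t i * t j) + H i c * t i * y) +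
       (\<Sum>j<c. H c j * y * t j) + H c c * y * y"
      by (simp add: quad_form_def)
    also have "(\<Sum>j<c. H c j * y * t j) = y * (\<Sum>i<c. H i c * t i)"
      using sym by (auto simp: sum_distrib_left mult_ac intro!: sum.cong)
    also have "(\<Sum>i<c. (\<Sum>j<c. H i j * t i * t j) + H i c * t i * y) = quad_form c H t + y * (\<Sum>i<c. H i c * t i)"
      by (simp add: sum.distrib quad_form_def sum_distrib_left mult_ac)
    finally show ?thesis by (simp add: power2_eq_square algebra_simps del: fun_upd_apply)
  qed
  have a: "0 < ?a"
  proof -
    have "0 < quad_form (Suc c) H ((\<lambda>_. 0)(c := 1))"
      by (rule Suc.prems(2)) auto
    then show ?thesis unfolding split by (simp add: quad_form_def)
  qed
  have H'_form: "quad_form c H' t = quad_form c H t - (\<Sum>i<c. H i c * t i)\<^sup>2 / ?a" for t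
  proof -
    have "(\<Sum>i<c. H i c * t i)\<^sup>2 = (\<Sum>i<c. \<Sum>j<c. (H i c * t i) * (H c j * t j))"
      unfolding power2_eq_square sum_product using sym by (intro sum.cong refl) auto
    then show ?thesis
      by (simp add: quad_form_def H'_def algebra_simps sum_subtractf sum_divide_distrib diff_divide_distrib)
  qed
  have complete: "quad_form (Suc c) H (t(c := y)) = ?a * (y - - (\<Sum>i<c. H i c * t i) / ?a)\<^sup>2 + quad_form c H' t" for t y
    unfolding split H'_form using a by (simp add: field_simps power2_eq_square)
  have IH: "0 < Determinant.det (Matrix.mat c c (\<lambda>(i, j). H' i j)) \<and>
    (\<integral>\<^sup>+ t. ennreal (exp (- quad_form c H' t / 2)) \<partial>lborel_PiM c) =
      ennreal (sqrt ((2 * pi) ^ c / Determinant.det (Matrix.mat c c (\<lambda>(i, j). H' i j))))"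
  proof (rule Suc.IH)
    show "H' i j = H' j i" if "i < c" "j < c" for i j
      using sym[of i j] sym[of i c] sym[of j c] that by (simp add: H'_def)
    fix t :: "nat \<Rightarrow> real" assume "\<exists>i<c. t i \<noteq> 0"
    then have "\<exists>i<Suc c. (t(c := y)) i \<noteq> 0" for y
      by (metis fun_upd_apply less_Suc_eq less_irrefl)
    \<comment> \<open>Positivity passes to the Schur complement: at this value of the last
      coordinate the completed square vanishes and only \<open>quad_form c H' t\<close> is
      left.\<close>
    from Suc.prems(2)[OF this, of "- (\<Sum>i<c. H i c * t i) / ?a"] show "0 < quad_form c H' t"
      unfolding complete by simp
  qed
  let ?D = "Determinant.det (Matrix.mat c c (\<lambda>(i, j). H' i j))"
  have det: "Determinant.det (Matrix.mat (Suc c) (Suc c) (\<lambda>(i, j). H i j)) = ?a * ?D"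
    unfolding H'_def using a by (intro det_schur_complement) simp
  interpret product_sigma_finite "\<lambda>_::nat. lborel :: real measure" ..
  have "(\<integral>\<^sup>+ t. ennreal (exp (- quad_form (Suc c) H t / 2)) \<partial>lborel_PiM (Suc c)) =
     (\<integral>\<^sup>+ t. (\<integral>\<^sup>+ y. ennreal (exp (- quad_form (Suc c) H (t(c := y)) / 2)) \<partial>lborel) \<partial>lborel_PiM c)"
    unfolding lessThan_Suc
    by (rule product_nn_integral_insert) (auto simp: lessThan_Suc[symmetric])
  also have "\<dots> = (\<integral>\<^sup>+ t. ennreal (sqrt (2 * pi / ?a)) * ennreal (exp (- quad_form c H' t / 2)) \<partial>lborel_PiM c)"
  proof (rule nn_integral_cong)
    fix t
    let ?m = "- (\<Sum>i<c. H i c * t i) / ?a"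
    have "(\<integral>\<^sup>+ y. ennreal (exp (- quad_form (Suc c) H (t(c := y)) / 2)) \<partial>lborel) =
        (\<integral>\<^sup>+ y. ennreal (exp (- ?a * (y - ?m)\<^sup>2 / 2)) * ennreal (exp (- quad_form c H' t / 2)) \<partial>lborel)"
      unfolding complete by (simp add: ennreal_mult'[symmetric] exp_add[symmetric] add_divide_distrib diff_divide_distrib)
    also have "\<dots> = ennreal (sqrt (2 * pi / ?a)) * ennreal (exp (- quad_form c H' t / 2))"
      by (subst nn_integral_multc) (simp_all only: nn_integral_gaussian[OF a], simp)
    finally show "(\<integral>\<^sup>+ y. ennreal (exp (- quad_form (Suc c) H (t(c := y)) / 2)) \<partial>lborel) =
      ennreal (sqrt (2 * pi / ?a)) * ennreal (exp (- quad_form c H' t / 2))" .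
  qed
  also have "\<dots> = ennreal (sqrt (2 * pi / ?a)) * ennreal (sqrt ((2 * pi) ^ c / ?D))"
    using IH by (subst nn_integral_cmult) auto
  also have "\<dots> = ennreal (sqrt ((2 * pi) ^ Suc c / (?a * ?D)))"
    using a IH by (simp add: ennreal_mult'[symmetric] real_sqrt_mult[symmetric])
  finally show ?case
    using a IH unfolding det by simp
qed

lemma gaussian_integral_scaled:
  fixes H :: "nat \<Rightarrow> nat \<Rightarrow> real"
  assumes "\<And>i j. i < c \<Longrightarrow> j < c \<Longrightarrow> H i j = H j i"
    and "\<And>t. \<exists>i<c. t i \<noteq> 0 \<Longrightarrow> 0 < quad_form c H t" and "0 < n"
  shows "(\<integral>\<^sup>+ t. ennreal (exp (- n * quad_form c H t / 2)) \<partial>lborel_PiM c) =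
      ennreal (sqrt ((2 * pi / n) ^ c) * Determinant.det (Matrix.mat c c (\<lambda>(i, j). H i j)) powr (- 1 / 2))"
proof -
  let ?D = "Determinant.det (Matrix.mat c c (\<lambda>(i, j). H i j))"
  have quad: "quad_form c (\<lambda>i j. n * H i j) t = n * quad_form c H t" for t
    by (simp add: quad_form_def sum_distrib_left mult_ac)
  have "Matrix.mat c c (\<lambda>(i, j). n * H i j) = n \<cdot>\<^sub>m Matrix.mat c c (\<lambda>(i, j). H i j)"
    by (rule eq_matI) auto
  then have det: "Determinant.det (Matrix.mat c c (\<lambda>(i, j). n * H i j)) = n ^ c * ?D"
    by simp
  have D: "0 < ?D"
    using gaussian_integral[of c H] assms by simp
  have "(\<integral>\<^sup>+ t. ennreal (exp (- quad_form c (\<lambda>i j. n * H i j) t / 2)) \<partial>lborel_PiM c) =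
      ennreal (sqrt ((2 * pi) ^ c / (n ^ c * ?D)))"
    using gaussian_integral[of c "\<lambda>i j. n * H i j"] assms unfolding quad det by simp
  also have "sqrt ((2 * pi) ^ c / (n ^ c * ?D)) = sqrt ((2 * pi / n) ^ c) * ?D powr (- 1 / 2)"
    using D by (simp add: power_divide real_sqrt_divide real_sqrt_mult powr_minus powr_half_sqrt divide_simps)
  finally show ?thesis
    by (simp add: quad)
qed

lemma gaussian_integral_isotropic:
  assumes "0 < a"
  shows "(\<integral>\<^sup>+ t. ennreal (exp (- a * (\<Sum>j<c. (t j)\<^sup>2) / 2)) \<partial>lborel_PiM c) = ennreal (sqrt ((2 * pi / a) ^ c))"
proof -
  interpret product_sigma_finite "\<lambda>_::nat. lborel :: real measure" ..
  have "(\<integral>\<^sup>+ t. ennreal (exp (- a * (\<Sum>j<c. (t j)\<^sup>2) / 2)) \<partial>lborel_PiM c) =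
     (\<integral>\<^sup>+ t. (\<Prod>j<c. ennreal (exp (- a * (t j - 0)\<^sup>2 / 2))) \<partial>lborel_PiM c)"
    by (simp add: prod_ennreal exp_sum[symmetric] sum_distrib_left sum_divide_distrib sum_negf)
  also have "\<dots> = (\<Prod>j<c. \<integral>\<^sup>+ y. ennreal (exp (- a * (y - 0)\<^sup>2 / 2)) \<partial>lborel)"
    by (rule product_nn_integral_prod) simp_all
  also have "\<dots> = ennreal (sqrt (2 * pi / a)) ^ c"
    by (simp only: nn_integral_gaussian[OF assms]) simp
  also have "\<dots> = ennreal (sqrt ((2 * pi / a) ^ c))"
    using assms by (simp add: ennreal_power real_sqrt_power)
  finally show ?thesis .
qed

lemma positive_definite_imp_quad_form_pos:
  assumes "positive_definite (Matrix.mat c c (\<lambda>(i, j). H i j))" and "\<exists>i<c. t i \<noteq> 0"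
  shows "0 < quad_form c H t"
proof -
  let ?w = "Matrix.vec c t"
  have "?w \<noteq> 0\<^sub>v c"
    using assms(2) by (auto simp: Matrix.vec_eq_iff)
  then have "0 < scalar_prod ?w (Matrix.mat c c (\<lambda>(i, j). H i j) *\<^sub>v ?w)"
    using assms(1) by (auto simp: positive_definite_def)
  also have "scalar_prod ?w (Matrix.mat c c (\<lambda>(i, j). H i j) *\<^sub>v ?w) = quad_form c H t"
    by (simp add: scalar_prod_def quad_form_def sum_distrib_left atLeast0LessThan mult_ac)
  finally show ?thesis .
qed

section \<open>Volume measures of submanifolds\<close>

text \<open>A finite sum of measures on the Borel sets, in the shape in which
  \<open>intrinsic_measure\<close> and \<open>total_intrinsic_measure\<close> are defined. Both are
  rewritten to it, which shows that their set functions really are measures.\<close>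

definition sum_measure :: "'i set \<Rightarrow> ('i \<Rightarrow> 'a::topological_space measure) \<Rightarrow> 'a measure" where
  "sum_measure I N = measure_of UNIV (sets borel) (\<lambda>A. \<Sum>i\<in>I. emeasure (N i) A)"

lemma sets_sum_measure [simp, measurable_cong]: "sets (sum_measure I N) = sets borel"
  and space_sum_measure [simp]: "space (sum_measure I N) = UNIV"
  by (simp_all add: sum_measure_def sets.sigma_sets_eq[of borel, simplified])

lemma emeasure_sum_measure:
  assumes N: "\<And>i. i \<in> I \<Longrightarrow> sets (N i) = sets borel" and A: "A \<in> sets borel"
  shows "emeasure (sum_measure I N) A = (\<Sum>i\<in>I. emeasure (N i) A)"
proof (rule emeasure_measure_of[OF sum_measure_def])
  show "countably_additive (sets (sum_measure I N)) (\<lambda>A. \<Sum>i\<in>I. emeasure (N i) A)"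
    unfolding countably_additive_def
  proof (intro allI impI)
    fix F :: "nat \<Rightarrow> 'b set"
    assume F: "range F \<subseteq> sets (sum_measure I N)" "disjoint_family F"
    have "(\<Sum>n. \<Sum>i\<in>I. emeasure (N i) (F n)) = (\<Sum>i\<in>I. \<Sum>n. emeasure (N i) (F n))"
      by (rule suminf_sum) simp
    also have "\<dots> = (\<Sum>i\<in>I. emeasure (N i) (\<Union>n. F n))"
      using F N by (intro sum.cong refl suminf_emeasure) auto
    finally show "(\<Sum>n. \<Sum>i\<in>I. emeasure (N i) (F n)) = (\<Sum>i\<in>I. emeasure (N i) (\<Union>n. F n))" .
  qed
qed (use A in \<open>auto simp: positive_def\<close>)

lemma nn_integral_sum_measure:
  assumes N: "\<And>i. i \<in> I \<Longrightarrow> sets (N i) = sets borel" and f: "f \<in> borel_measurable borel"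
  shows "(\<integral>\<^sup>+ x. f x \<partial>sum_measure I N) = (\<Sum>i\<in>I. \<integral>\<^sup>+ x. f x \<partial>N i)"
  using f
proof (induction rule: borel_measurable_induct)
  case (cong f g)
  then show ?case by simp
next
  case (set A)
  then show ?case
    using N by (simp add: emeasure_sum_measure)
next
  case (mult u c)
  have "u \<in> borel_measurable (N i)" if "i \<in> I" for i
    using mult N[OF that] by (simp cong: measurable_cong_sets)
  then show ?case
    using mult by (simp add: nn_integral_cmult sum_distrib_left cong: measurable_cong_sets)
next
  case (add u v)
  have "u \<in> borel_measurable (N i)" "v \<in> borel_measurable (N i)" if "i \<in> I" for i
    using add N[OF that] by (simp_all cong: measurable_cong_sets)
  then show ?case
    using add by (simp add: nn_integral_add sum.distrib cong: measurable_cong_sets)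
next
  case (seq U)
  have meas: "U n \<in> borel_measurable (N i)" if "i \<in> I" for i n
    using seq N[OF that] by (simp cong: measurable_cong_sets)
  have "(\<integral>\<^sup>+ x. (SUP n. U n) x \<partial>sum_measure I N) = (SUP n. \<integral>\<^sup>+ x. U n x \<partial>sum_measure I N)"
    using seq by (simp add: image_comp nn_integral_monotone_convergence_SUP cong: measurable_cong_sets)
  also have "\<dots> = (SUP n. \<Sum>i\<in>I. \<integral>\<^sup>+ x. U n x \<partial>N i)"
    using seq by simp
  also have "\<dots> = (\<Sum>i\<in>I. SUP n. \<integral>\<^sup>+ x. U n x \<partial>N i)"
    using \<open>incseq U\<close> by (intro ennreal_SUP_sum) (auto simp: incseq_def le_fun_def intro!: nn_integral_mono)
  also have "\<dots> = (\<Sum>i\<in>I. \<integral>\<^sup>+ x. (SUP n. U n) x \<partial>N i)"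
    using seq meas by (intro sum.cong refl) (simp add: image_comp nn_integral_monotone_convergence_SUP)
  finally show ?case .
qed

section \<open>Coordinate subspaces and the splitting of Lebesgue measure\<close>

definition coord_sum :: "'a::euclidean_space list \<Rightarrow> (nat \<Rightarrow> real) \<Rightarrow> 'a" where
  "coord_sum bs t = (\<Sum>i<length bs. t i *\<^sub>R bs ! i)"

lemma measurable_coord_sum [measurable]: "coord_sum bs \<in> borel_measurable (lborel_PiM (length bs))"
  unfolding coord_sum_def by (intro borel_measurable_sum borel_measurable_scaleR) auto

lemma lebesgue_coord_alt: "lebesgue_coord bs = distr (lborel_PiM (length bs)) borel (coord_sum bs)"
  by (simp add: lebesgue_coord_def coord_sum_def[abs_def])

lemma sets_lebesgue_coord [simp, measurable_cong]: "sets (lebesgue_coord bs) = sets borel"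
  and space_lebesgue_coord [simp]: "space (lebesgue_coord bs) = UNIV"
  by (simp_all add: lebesgue_coord_alt)

lemma coord_sum_inner_nth:
  assumes "distinct bs" "set bs \<subseteq> Basis" "i < length bs"
  shows "coord_sum bs t \<bullet> bs ! i = t i"
proof -
  have "coord_sum bs t \<bullet> bs ! i = (\<Sum>j<length bs. if j = i then t i else 0)"
    unfolding coord_sum_def inner_sum_left
  proof (rule sum.cong[OF refl])
    fix j assume "j \<in> {..<length bs}"
    then have "bs ! j \<in> Basis" "bs ! i \<in> Basis" "bs ! j = bs ! i \<longleftrightarrow> j = i"
      using assms by (auto simp: nth_eq_iff_index_eq subset_iff)
    then show "t j *\<^sub>R bs ! j \<bullet> bs ! i = (if j = i then t i else 0)"
      by (simp add: inner_Basis)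
  qed
  then show ?thesis using assms(3) by simp
qed

lemma coord_sum_inner_other:
  assumes "set bs \<subseteq> Basis" "b \<in> Basis" "b \<notin> set bs"
  shows "coord_sum bs t \<bullet> b = 0"
  unfolding coord_sum_def inner_sum_left
proof (rule sum.neutral, rule ballI)
  fix j assume "j \<in> {..<length bs}"
  then have "bs ! j \<in> Basis" "bs ! j \<noteq> b"
    using assms by (auto simp: subset_iff)
  then show "t j *\<^sub>R bs ! j \<bullet> b = 0" using assms by (simp add: inner_Basis)
qed

lemma coord_sum_mem_span: "coord_sum bs t \<in> span (set bs)"
  unfolding coord_sum_def by (intro span_sum span_scale span_base) auto

definition coord_proj :: "'a::euclidean_space list \<Rightarrow> 'a \<Rightarrow> 'a" where
  "coord_proj bs z = (\<Sum>i<length bs. (z \<bullet> bs ! i) *\<^sub>R bs ! i)"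

lemma bounded_linear_coord_proj: "bounded_linear (coord_proj bs)"
  unfolding coord_proj_def[abs_def]
  by (intro bounded_linear_sum bounded_linear_compose[OF bounded_linear_scaleR_left] bounded_linear_inner_left)

lemma coord_proj_eq_coord_sum: "coord_proj bs z = coord_sum bs (\<lambda>i. z \<bullet> bs ! i)"
  by (simp add: coord_proj_def coord_sum_def)

lemma coord_proj_eq_sum_Basis:
  assumes "distinct bs" "set bs \<subseteq> Basis"
  shows "coord_proj bs z = (\<Sum>b\<in>set bs. (z \<bullet> b) *\<^sub>R b)"
  unfolding coord_proj_def
  using sum.reindex_bij_betw[OF bij_betw_nth[OF assms(1) refl refl], of "\<lambda>b. (z \<bullet> b) *\<^sub>R b"] .

lemma coord_proj_span:
  assumes "distinct bs" "set bs \<subseteq> Basis" "y \<in> span (set bs)"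
  shows "coord_proj bs y = y"
proof -
  interpret linear "coord_proj bs"
    using bounded_linear_coord_proj by (rule bounded_linear.linear)
  have base: "coord_proj bs b = b" if "b \<in> set bs" for b
    using assms(1,2) that by (auto simp: coord_proj_eq_sum_Basis inner_Basis subset_iff if_distrib[of "\<lambda>c. c *\<^sub>R _"] cong: if_cong)
  show ?thesis
    using assms(3) base by (induction rule: span_induct_alt) (simp_all add: zero add scale)
qed

text \<open>A chart uses \<open>k\<close> of the basis vectors as base coordinates; the remaining
  ones will serve as coordinates on the normal fibres.\<close>

lemma complementary_basis_list:
  fixes bs :: "'a::euclidean_space list"
  assumes "distinct bs" "set bs \<subseteq> Basis"
  obtains cs where "distinct (bs @ cs)" "set (bs @ cs) = Basis" "length cs = DIM('a) - length bs" "length bs \<le> DIM('a)"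
proof -
  obtain cs where cs: "set cs = Basis - set bs" "distinct cs"
    using finite_distinct_list[of "Basis - set bs"] by auto
  have "length cs = DIM('a) - length bs"
    using cs assms by (simp add: distinct_card[symmetric] card_Diff_subset)
  moreover have "length bs \<le> DIM('a)"
    using assms card_mono[OF finite_Basis assms(2)] by (simp add: distinct_card)
  ultimately show ?thesis
    using cs assms by (intro that[of cs]) auto
qed

lemma coord_decomposition:
  assumes "distinct (bs @ cs)" "set (bs @ cs) = Basis"
  shows "z = coord_proj bs z + coord_proj cs z"
proof -
  have "z = (\<Sum>b\<in>set bs \<union> set cs. (z \<bullet> b) *\<^sub>R b)"
    using assms(2) by (simp add: euclidean_representation)
  also have "\<dots> = (\<Sum>b\<in>set bs. (z \<bullet> b) *\<^sub>R b) + (\<Sum>b\<in>set cs. (z \<bullet> b) *\<^sub>R b)"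
    using assms(1) by (intro sum.union_disjoint) auto
  finally show ?thesis
    using assms by (subst (1 2) coord_proj_eq_sum_Basis) auto
qed

text \<open>Again by testing on boxes: the preimage of a box is a product of two boxes, one for each
  group of coordinates.\<close>

lemma lborel_split:
  fixes bs cs :: "'a::euclidean_space list"
  assumes "distinct (bs @ cs)" "set (bs @ cs) = Basis"
  shows "distr (lborel_PiM (length bs) \<Otimes>\<^sub>M lborel_PiM (length cs)) borel (\<lambda>(s, t). coord_sum bs s + coord_sum cs t) = lborel"
    (is "distr ?P borel ?T = _")
proof (rule lborel_eqI[symmetric])
  interpret product_sigma_finite "\<lambda>_::nat. lborel :: real measure" ..
  interpret I: finite_product_sigma_finite "\<lambda>_. lborel" "{..<length bs}" by standard simp
  interpret J: finite_product_sigma_finite "\<lambda>_. lborel" "{..<length cs}" by standard simp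
  have sub: "set bs \<subseteq> Basis" "set cs \<subseteq> Basis" "distinct bs" "distinct cs"
    using assms by auto
  have T: "?T \<in> borel_measurable ?P" by measurable
  fix l u :: 'a
  assume lu: "\<And>b. b \<in> Basis \<Longrightarrow> l \<bullet> b \<le> u \<bullet> b"
  let ?A = "\<lambda>i. {l \<bullet> bs ! i <..< u \<bullet> bs ! i}" and ?B = "\<lambda>j. {l \<bullet> cs ! j <..< u \<bullet> cs ! j}"
  have Tbs: "?T (s, t) \<bullet> bs ! i = s i" if "i < length bs" for s t i
  proof -
    have "bs ! i \<in> Basis" "bs ! i \<notin> set cs" using assms that by (auto simp: disjoint_iff)
    then show ?thesis
      using coord_sum_inner_nth[OF sub(3,1) that] coord_sum_inner_other[OF sub(2)] by (simp add: inner_add_left)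
  qed
  have Tcs: "?T (s, t) \<bullet> cs ! i = t i" if "i < length cs" for s t i
  proof -
    have "cs ! i \<in> Basis" "cs ! i \<notin> set bs" using assms that by (auto simp: disjoint_iff)
    then show ?thesis
      using coord_sum_inner_nth[OF sub(4,2) that] coord_sum_inner_other[OF sub(1)] by (simp add: inner_add_left)
  qed
  have mem: "?T (s, t) \<in> box l u \<longleftrightarrow> (\<forall>i<length bs. s i \<in> ?A i) \<and> (\<forall>j<length cs. t j \<in> ?B j)" for s t
  proof -
    have "?T (s, t) \<in> box l u \<longleftrightarrow> (\<forall>b\<in>set bs \<union> set cs. l \<bullet> b < ?T (s, t) \<bullet> b \<and> ?T (s, t) \<bullet> b < u \<bullet> b)"
      using assms(2) by (simp add: mem_box)
    also have "\<dots> \<longleftrightarrow> (\<forall>i<length bs. s i \<in> ?A i) \<and> (\<forall>j<length cs. t j \<in> ?B j)"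
      unfolding ball_Un using Tbs Tcs by (auto simp: all_set_conv_all_nth)
    finally show ?thesis .
  qed
  have "?T -` box l u \<inter> space ?P = (\<Pi>\<^sub>E i\<in>{..<length bs}. ?A i) \<times> (\<Pi>\<^sub>E j\<in>{..<length cs}. ?B j)"
    using mem by (auto simp: space_pair_measure space_PiM PiE_def Pi_def)
  then have "emeasure (distr ?P borel ?T) (box l u) =
      emeasure ?P ((\<Pi>\<^sub>E i\<in>{..<length bs}. ?A i) \<times> (\<Pi>\<^sub>E j\<in>{..<length cs}. ?B j))"
    by (subst emeasure_distr[OF T]) simp_all
  also have "\<dots> = emeasure (lborel_PiM (length bs)) (\<Pi>\<^sub>E i\<in>{..<length bs}. ?A i) * emeasure (lborel_PiM (length cs)) (\<Pi>\<^sub>E j\<in>{..<length cs}. ?B j)"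
    by (rule J.emeasure_pair_measure_Times) (auto intro!: sets_PiM_I_finite)
  also have "\<dots> = (\<Prod>i<length bs. ennreal ((u - l) \<bullet> bs ! i)) * (\<Prod>j<length cs. ennreal ((u - l) \<bullet> cs ! j))"
  proof -
    have "emeasure (lborel_PiM (length xs)) (\<Pi>\<^sub>E i\<in>{..<length xs}. {l \<bullet> xs ! i <..< u \<bullet> xs ! i}) =
        (\<Prod>i<length xs. ennreal ((u - l) \<bullet> xs ! i))" if "set xs \<subseteq> Basis" for xs
    proof -
      have "emeasure lborel {l \<bullet> xs ! i <..< u \<bullet> xs ! i} = ennreal ((u - l) \<bullet> xs ! i)" if "i \<in> {..<length xs}" for i
      proof -
        have "xs ! i \<in> Basis" using that \<open>set xs \<subseteq> Basis\<close> nth_mem[of i xs] by blast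
        from lu[OF this] show ?thesis
          by (subst emeasure_lborel_Ioo) (simp_all add: inner_diff_left)
      qed
      then show ?thesis
        by (subst emeasure_PiM) (auto intro!: prod.cong)
    qed
    then show ?thesis using sub by simp
  qed
  also have "\<dots> = (\<Prod>b\<in>set bs. ennreal ((u - l) \<bullet> b)) * (\<Prod>b\<in>set cs. ennreal ((u - l) \<bullet> b))"
    using prod.reindex_bij_betw[OF bij_betw_nth[OF sub(3) refl refl], of "\<lambda>b. ennreal ((u - l) \<bullet> b)"]
      prod.reindex_bij_betw[OF bij_betw_nth[OF sub(4) refl refl], of "\<lambda>b. ennreal ((u - l) \<bullet> b)"]
    by simp
  also have "\<dots> = (\<Prod>b\<in>set bs \<union> set cs. ennreal ((u - l) \<bullet> b))"
    using assms(1) by (intro prod.union_disjoint[symmetric]) auto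
  also have "set bs \<union> set cs = Basis"
    using assms(2) by simp
  also have "(\<Prod>b\<in>Basis. ennreal ((u - l) \<bullet> b)) = ennreal (\<Prod>b\<in>Basis. (u - l) \<bullet> b)"
    using lu by (simp add: prod_ennreal inner_diff_left)
  finally show "emeasure (distr ?P borel ?T) (box l u) = ennreal (\<Prod>b\<in>Basis. (u - l) \<bullet> b)" .
qed simp

text \<open>Fubini in the form used for tubes: the inner integral runs over the fibre coordinates,
  the outer one over the coordinate subspace on which a chart is defined.\<close>

lemma nn_integral_lborel_split:
  fixes bs cs :: "'a::euclidean_space list"
  assumes "distinct (bs @ cs)" "set (bs @ cs) = Basis" and [measurable]: "h \<in> borel_measurable borel"
  shows "(\<integral>\<^sup>+ z. h z \<partial>lborel) =
    (\<integral>\<^sup>+ y. (\<integral>\<^sup>+ t. h (y + coord_sum cs t) \<partial>lborel_PiM (length cs)) \<partial>lebesgue_coord bs)"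
proof -
  interpret product_sigma_finite "\<lambda>_::nat. lborel :: real measure" ..
  interpret J: finite_product_sigma_finite "\<lambda>_. lborel" "{..<length cs}" by standard simp
  have [measurable]: "(\<lambda>(s, t). coord_sum bs s + coord_sum cs t) \<in>
      borel_measurable (lborel_PiM (length bs) \<Otimes>\<^sub>M lborel_PiM (length cs))" by measurable
  have m2: "(\<lambda>y. \<integral>\<^sup>+ t. h (y + coord_sum cs t) \<partial>lborel_PiM (length cs)) \<in> borel_measurable borel"
    by measurable
  have "(\<integral>\<^sup>+ z. h z \<partial>lborel) =
      (\<integral>\<^sup>+ x. h (case x of (s, t) \<Rightarrow> coord_sum bs s + coord_sum cs t) \<partial>(lborel_PiM (length bs) \<Otimes>\<^sub>M lborel_PiM (length cs)))"
    by (subst lborel_split[OF assms(1,2), symmetric], subst nn_integral_distr) simp_all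
  also have "\<dots> = (\<integral>\<^sup>+ s. \<integral>\<^sup>+ t. h (coord_sum bs s + coord_sum cs t) \<partial>lborel_PiM (length cs) \<partial>lborel_PiM (length bs))"
    by (subst J.nn_integral_fst[symmetric]) simp_all
  also have "\<dots> = (\<integral>\<^sup>+ y. (\<integral>\<^sup>+ t. h (y + coord_sum cs t) \<partial>lborel_PiM (length cs)) \<partial>lebesgue_coord bs)"
    unfolding lebesgue_coord_alt by (subst nn_integral_distr) (use m2 in simp_all)
  finally show ?thesis .
qed

lemma AE_lebesgue_coord_span: "AE y in lebesgue_coord bs. y \<in> span (set bs)"
  unfolding lebesgue_coord_alt
  by (subst AE_distr_iff) (auto simp: coord_sum_mem_span intro!: borel_closed closed_span)

lemma continuous_on_det:
  fixes F :: "'a::topological_space \<Rightarrow> nat \<Rightarrow> nat \<Rightarrow> real"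
  assumes "\<And>i j. i < n \<Longrightarrow> j < n \<Longrightarrow> continuous_on S (\<lambda>x. F x i j)"
  shows "continuous_on S (\<lambda>x. Determinant.det (Matrix.mat n n (\<lambda>(i, j). F x i j)))"
proof -
  have "Determinant.det (Matrix.mat n n (\<lambda>(i, j). F x i j)) =
     (\<Sum>p | p permutes {0..<n}. signof p * (\<Prod>i=0..<n. F x i (p i)))" for x
  proof -
    have "(\<Prod>i=0..<n. Matrix.mat n n (\<lambda>(i, j). F x i j) $$ (i, p i)) = (\<Prod>i=0..<n. F x i (p i))"
      if "p permutes {0..<n}" for p
      using permutes_in_image[OF that] by (intro prod.cong) auto
    then show ?thesis by (simp add: Determinant.det_def)
  qed
  moreover have "continuous_on S (\<lambda>x. F x i (p i))" if "p permutes {0..<n}" "i \<in> {0..<n}" for p i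
    using assms that permutes_in_image[OF that(1), of i] by auto
  ultimately show ?thesis
    by (auto intro!: continuous_intros)
qed

section \<open>Smooth maps on subsets and their local extensions\<close>

lemma smooth_map_onE:
  assumes "smooth_map_on A f" "x \<in> A"
  obtains W g where "open W" "x \<in> W" "smooth_on W g" "\<And>y. y \<in> W \<Longrightarrow> y \<in> A \<Longrightarrow> g y = f y"
proof -
  have "\<exists>W g. open W \<and> x \<in> W \<and> smooth_on W g \<and> (\<forall>y\<in>W \<inter> A. g y = f y)"
    using assms(1) unfolding smooth_map_on_def by (rule bspec) (rule assms(2))
  then show ?thesis
    using that by (elim exE conjE) simp
qed

lemma smooth_on_imp_Ck_on: "smooth_on X f \<Longrightarrow> Ck_on n X f"
  by (simp add: smooth_on_def del: Ck_on.simps)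

lemma smooth_map_on_imp_continuous_on:
  assumes "smooth_map_on A f"
  shows "continuous_on A f"
  unfolding continuous_on_eq_continuous_within
proof
  fix x assume "x \<in> A"
  with assms obtain W g where W: "open W" "x \<in> W" "smooth_on W g" "\<And>y. y \<in> W \<Longrightarrow> y \<in> A \<Longrightarrow> g y = f y"
    by (rule smooth_map_onE) blast
  have "continuous_on W g"
    using W(3) by (rule Ck_on_imp_continuous_on[OF smooth_on_imp_Ck_on])
  then have "isCont g x"
    using W(1,2) by (simp add: continuous_on_eq_continuous_at)
  then have "continuous (at x within A) g"
    by (rule continuous_at_imp_continuous_within)
  then show "continuous (at x within A) f"
  proof (rule continuous_transform_within_openin)
    show "openin (top_of_set A) (A \<inter> W)" using W(1) by (rule openin_open_Int)
    show "x \<in> A \<inter> W" using W(2) \<open>x \<in> A\<close> by blast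
    show "g y = f y" if "y \<in> A \<inter> W" for y using W(4) that by blast
  qed
qed

text \<open>Restricting a smooth extension to a coordinate line gives a smooth curve. This is how
  the partial derivatives of a chart are recognised as tangent vectors.\<close>

lemma Ck_on_line:
  fixes f :: "'a::euclidean_space \<Rightarrow> 'b::real_normed_vector"
  assumes "Ck_on n W f" "b \<in> Basis" "\<And>s. s \<in> I \<Longrightarrow> y + s *\<^sub>R b \<in> W"
  shows "Ck_on n I (\<lambda>s::real. f (y + s *\<^sub>R b))"
  using assms(1)
proof (induction n arbitrary: f)
  case 0
  then have "continuous_on W f" by simp
  then show ?case
    using assms(3) by (auto intro!: continuous_on_compose2[of W f] continuous_intros)
next
  case (Suc n)
  have cont: "continuous_on I (\<lambda>s. f (y + s *\<^sub>R b))"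
    using assms(3) Ck_on_imp_continuous_on[OF Suc.prems]
    by (auto intro!: continuous_on_compose2[of W f] continuous_intros)
  have shift: "(\<lambda>t. f (y + (s + t *\<^sub>R 1) *\<^sub>R b)) = (\<lambda>t. f ((y + s *\<^sub>R b) + t *\<^sub>R b))" for s
    by (simp add: algebra_simps)
  have "dir_deriv 1 (\<lambda>s. f (y + s *\<^sub>R b)) = (\<lambda>s. dir_deriv b f (y + s *\<^sub>R b))"
    by (simp only: dir_deriv_def fun_eq_iff shift) simp
  moreover have "Ck_on n I (\<lambda>s. dir_deriv b f (y + s *\<^sub>R b))"
    using Suc.IH[OF Ck_on_dir_deriv[OF Suc.prems assms(2)]] .
  moreover have "(\<lambda>t. f (y + (s + t *\<^sub>R 1) *\<^sub>R b)) differentiable (at 0)" if "s \<in> I" for s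
    unfolding shift using Suc.prems assms(2) assms(3)[OF that] by simp
  ultimately show ?case
    using cont by simp
qed

text \<open>A smooth map on a set has extensions near each point, which need not fit together. They
  may change with the base point here, and only the bound on their derivatives is uniform: each one
  works on a neighbourhood, and a finite subcover gives a single constant.\<close>

lemma smooth_map_on_compact_extension:
  fixes f :: "'a::euclidean_space \<Rightarrow> 'b::real_normed_vector"
  assumes "compact A" "smooth_map_on A f"
  obtains L where "0 \<le> L" "\<And>u. u \<in> A \<Longrightarrow> \<exists>W g. open W \<and> u \<in> W \<and> smooth_on W g \<and>
    (\<forall>y. y \<in> W \<longrightarrow> y \<in> A \<longrightarrow> g y = f y) \<and> (\<forall>x. norm (lin_deriv g u x) \<le> L * norm x)"
proof -
  define good where "good L u \<longleftrightarrow> (\<exists>W g. open W \<and> u \<in> W \<and> smooth_on W g \<and>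
    (\<forall>y. y \<in> W \<longrightarrow> y \<in> A \<longrightarrow> g y = f y) \<and> (\<forall>x. norm (lin_deriv g u x) \<le> L * norm x))" for L u
  have mono: "good L' u" if good: "good L u" and le: "L \<le> L'" for L L' u
  proof -
    have "norm z \<le> L' * norm x" if "norm z \<le> L * norm x" for z :: 'b and x :: 'a
      using that mult_right_mono[OF le norm_ge_zero[of x]] by linarith
    then show ?thesis
      using good unfolding good_def by meson
  qed
  have "\<exists>N L. open N \<and> a \<in> N \<and> 0 \<le> L \<and> (\<forall>u\<in>N. good L u)" if "a \<in> A" for a
  proof -
    obtain W g where W: "open W" "a \<in> W" "smooth_on W g" "\<And>y. y \<in> W \<Longrightarrow> y \<in> A \<Longrightarrow> g y = f y"
      using assms(2) \<open>a \<in> A\<close> by (rule smooth_map_onE) blast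
    \<comment> \<open>The sum of the norms of the partial derivatives bounds the operator norm and
      is continuous, so it stays below \<open>s a + 1\<close> near \<open>a\<close>.\<close>
    define s where "s y = (\<Sum>b\<in>Basis. norm (dir_deriv b g y))" for y
    have "continuous_on W s"
      unfolding s_def
      by (intro continuous_intros Ck_on_imp_continuous_on[OF Ck_on_dir_deriv[OF smooth_on_imp_Ck_on[OF W(3)]]])
    then have "open (W \<inter> s -` {..<s a + 1})"
      using W(1) by (intro continuous_open_preimage) auto
    moreover have "good (s a + 1) u" if "u \<in> W \<inter> s -` {..<s a + 1}" for u
    proof -
      have "norm (lin_deriv g u x) \<le> (s a + 1) * norm x" for x
      proof -
        have "norm (lin_deriv g u x) \<le> (\<Sum>b\<in>Basis. norm (dir_deriv b g u) * norm x)"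
          unfolding lin_deriv_def
          by (intro order.trans[OF norm_sum] sum_mono) (simp add: mult.commute[of _ "norm x"] Basis_le_norm mult_right_mono)
        also have "\<dots> = s u * norm x"
          by (simp add: s_def sum_distrib_right)
        also have "\<dots> \<le> (s a + 1) * norm x"
          using that by (intro mult_right_mono) auto
        finally show ?thesis .
      qed
      then show ?thesis
        unfolding good_def using W that by (intro exI[of _ W] exI[of _ g]) simp
    qed
    moreover have "0 \<le> s a"
      by (simp add: s_def sum_nonneg)
    ultimately show ?thesis
      using W(2) by (intro exI[of _ "W \<inter> s -` {..<s a + 1}"] exI[of _ "s a + 1"]) auto
  qed
  then obtain N L where NL: "\<And>a. a \<in> A \<Longrightarrow> open (N a)" "\<And>a. a \<in> A \<Longrightarrow> a \<in> N a"
     "\<And>a. a \<in> A \<Longrightarrow> 0 \<le> L a" "\<And>a u. a \<in> A \<Longrightarrow> u \<in> N a \<Longrightarrow> good (L a) u"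
    by metis
  obtain C where C: "C \<subseteq> A" "finite C" "A \<subseteq> (\<Union>a\<in>C. N a)"
    using compactE_image[OF assms(1), of A N] NL by blast
  show ?thesis
  proof (rule that[of "\<Sum>a\<in>C. L a"])
    show "0 \<le> (\<Sum>a\<in>C. L a)"
      using C NL(3) by (intro sum_nonneg) auto
    fix u assume "u \<in> A"
    then obtain a where a: "a \<in> C" "u \<in> N a" using C(3) by blast
    have "L a \<le> (\<Sum>a\<in>C. L a)"
      using C NL(3) a by (intro member_le_sum) auto
    with NL(4)[of a u] a C(1) have "good (\<Sum>a\<in>C. L a) u"
      using mono by blast
    then show "\<exists>W g. open W \<and> u \<in> W \<and> smooth_on W g \<and>
        (\<forall>y. y \<in> W \<longrightarrow> y \<in> A \<longrightarrow> g y = f y) \<and> (\<forall>x. norm (lin_deriv g u x) \<le> (\<Sum>a\<in>C. L a) * norm x)"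
      unfolding good_def .
  qed
qed

section \<open>Charts and the area measures that they carry\<close>

locale chart =
  fixes k :: nat and M :: "'a::euclidean_space set" and bs :: "'a list" and U :: "'a set" and \<psi> :: "'a \<Rightarrow> 'a"
  assumes param: "local_param k M (bs, U, \<psi>)"
begin

lemma length_bs: "length bs = k" and distinct_bs: "distinct bs" and bs_subset: "set bs \<subseteq> Basis"
  and openin_U: "openin (top_of_set (span (set bs))) U"
  and openin_image: "openin (top_of_set M) (\<psi> ` U)"
  and smooth_\<psi>: "smooth_map_on U \<psi>"
  and inj_\<psi>: "inj_on \<psi> U"
  using param unfolding local_param_def diffeomorphism_def bij_betw_def by simp_all

lemma nth_bs_Basis: "i < k \<Longrightarrow> bs ! i \<in> Basis"
  using bs_subset length_bs nth_mem by blast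

lemma image_subset: "\<psi> ` U \<subseteq> M"
  using openin_image by (rule openin_imp_subset)

lemma U_subset: "U \<subseteq> span (set bs)"
  using openin_U by (rule openin_imp_subset)

lemma U_borel [measurable]: "U \<in> sets borel"
proof -
  obtain O' where "open O'" "U = span (set bs) \<inter> O'"
    using openin_U unfolding openin_open by blast
  then show ?thesis
    by (simp add: borel_closed borel_open closed_span sets.Int)
qed

lemma continuous_on_\<psi>: "continuous_on U \<psi>"
  using smooth_\<psi> by (rule smooth_map_on_imp_continuous_on)

lemma U_line:
  assumes "y \<in> U" "b \<in> set bs" "open W" "y \<in> W"
  obtains e where "0 < e" "\<And>s. \<bar>s\<bar> < e \<Longrightarrow> y + s *\<^sub>R b \<in> U" "\<And>s. \<bar>s\<bar> < e \<Longrightarrow> y + s *\<^sub>R b \<in> W"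
proof -
  obtain O' where O': "open O'" "U = span (set bs) \<inter> O'"
    using openin_U unfolding openin_open by blast
  have "open ((\<lambda>s. y + s *\<^sub>R b) -` (O' \<inter> W))"
    using O'(1) assms(3) by (intro open_vimage continuous_intros) auto
  moreover have "0 \<in> (\<lambda>s::real. y + s *\<^sub>R b) -` (O' \<inter> W)"
    using assms O' by simp
  ultimately obtain e where e: "0 < e" "ball 0 e \<subseteq> (\<lambda>s::real. y + s *\<^sub>R b) -` (O' \<inter> W)"
    by (rule openE)
  show ?thesis
  proof (rule that[OF e(1)])
    fix s assume "\<bar>s\<bar> < e"
    then have "s \<in> ball 0 e" by simp
    then have s: "y + s *\<^sub>R b \<in> O' \<inter> W" using e(2) by blast
    then show "y + s *\<^sub>R b \<in> W" by simp
    have "y \<in> span (set bs)" using assms(1) U_subset by blast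
    then have "y + s *\<^sub>R b \<in> span (set bs)"
      using span_base[OF assms(2)] by (intro span_add span_scale)
    then show "y + s *\<^sub>R b \<in> U" using s O'(2) by simp
  qed
qed

text \<open>The map \<psi> is arbitrary off \<open>U\<close>, so it has derivatives only along the
  coordinate subspace. In such a direction the line stays in \<open>U\<close> for a short time,
  where \<psi> agrees with any of its extensions.\<close>

lemma dir_deriv_extension:
  assumes "y \<in> U" "b \<in> set bs" "open W" "y \<in> W" "\<And>y'. y' \<in> W \<Longrightarrow> y' \<in> U \<Longrightarrow> h y' = \<psi> y'"
  shows "dir_deriv b \<psi> y = dir_deriv b h y"
proof -
  obtain e where e: "0 < e" "\<And>s. \<bar>s\<bar> < e \<Longrightarrow> y + s *\<^sub>R b \<in> U" "\<And>s. \<bar>s\<bar> < e \<Longrightarrow> y + s *\<^sub>R b \<in> W"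
    by (rule U_line[OF assms(1-4)]) blast
  have "eventually (\<lambda>s. s \<in> ball (0::real) e) (nhds 0)"
    using e(1) by (intro eventually_nhds_in_open) auto
  then have "eventually (\<lambda>s. s \<in> UNIV \<longrightarrow> \<psi> (y + s *\<^sub>R b) = h (y + s *\<^sub>R b)) (nhds 0)"
    by (rule eventually_mono) (use e assms(5) in simp)
  then show ?thesis
    unfolding dir_deriv_def by (rule vector_derivative_cong_eq) auto
qed

lemma continuous_on_dir_deriv:
  assumes b: "b \<in> set bs"
  shows "continuous_on U (dir_deriv b \<psi>)"
  unfolding continuous_on_eq_continuous_within
proof
  fix y assume y: "y \<in> U"
  obtain W h where W: "open W" "y \<in> W" "smooth_on W h" "\<And>y'. y' \<in> W \<Longrightarrow> y' \<in> U \<Longrightarrow> h y' = \<psi> y'"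
    using smooth_\<psi> y by (rule smooth_map_onE) blast
  have "b \<in> Basis" using b bs_subset by blast
  then have "continuous_on W (dir_deriv b h)"
    by (intro Ck_on_imp_continuous_on Ck_on_dir_deriv[OF smooth_on_imp_Ck_on[OF W(3)]])
  then have "isCont (dir_deriv b h) y"
    using W(1,2) by (simp add: continuous_on_eq_continuous_at)
  then have "continuous (at y within U) (dir_deriv b h)"
    by (rule continuous_at_imp_continuous_within)
  then show "continuous (at y within U) (dir_deriv b \<psi>)"
  proof (rule continuous_transform_within_openin)
    show "openin (top_of_set U) (U \<inter> W)" using W(1) by (rule openin_open_Int)
    show "y \<in> U \<inter> W" using W(2) y by blast
    show "dir_deriv b h y' = dir_deriv b \<psi> y'" if "y' \<in> U \<inter> W" for y'
      using dir_deriv_extension[of y' b W h] that b W by simp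
  qed
qed

text \<open>The witnessing curve runs along a coordinate line in \<open>U\<close> and is followed by
  a smooth extension of \<psi>; for small parameters it stays in \<open>M\<close>.\<close>

lemma dir_deriv_tangent:
  assumes "y \<in> U" "b \<in> set bs"
  shows "dir_deriv b \<psi> y \<in> tangent_space M (\<psi> y)"
proof -
  obtain W h where W: "open W" "y \<in> W" "smooth_on W h" "\<And>y'. y' \<in> W \<Longrightarrow> y' \<in> U \<Longrightarrow> h y' = \<psi> y'"
    using smooth_\<psi> assms(1) by (rule smooth_map_onE) blast
  obtain e where e: "0 < e" "\<And>s. \<bar>s\<bar> < e \<Longrightarrow> y + s *\<^sub>R b \<in> U" "\<And>s. \<bar>s\<bar> < e \<Longrightarrow> y + s *\<^sub>R b \<in> W"
    by (rule U_line[OF assms W(1,2)]) blast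
  have b: "b \<in> Basis" using assms(2) bs_subset by blast
  let ?\<gamma> = "\<lambda>s. h (y + s *\<^sub>R b)"
  have "smooth_on {-e<..<e} ?\<gamma>"
    unfolding smooth_on_def
    by (intro allI Ck_on_line[OF smooth_on_imp_Ck_on[OF W(3)] b] e(3)) auto
  moreover have "?\<gamma> ` {-e<..<e} \<subseteq> M"
    using e(2,3) W(4) image_subset by force
  moreover have "(?\<gamma> has_vector_derivative dir_deriv b \<psi> y) (at 0)"
    using dir_deriv_has_vector_derivative[OF smooth_on_imp_Ck_on[OF W(3)] b, of y 0] W(2)
      dir_deriv_extension[OF assms W(1,2,4)] by simp
  moreover have "?\<gamma> 0 = \<psi> y"
    using W assms by simp
  ultimately show ?thesis
    unfolding tangent_space_def using e(1) by blast
qed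

text \<open>The density of the Riemannian volume in the chart. The cut-off outside \<open>U\<close>,
  here and in \<open>chart_map\<close>, makes the function Borel on the whole space.\<close>

definition area_factor :: "'a \<Rightarrow> real" where
  "area_factor y = indicator U y * sqrt (gram_det bs \<psi> y)"

lemma measurable_area_factor [measurable]: "area_factor \<in> borel_measurable borel"
proof -
  have "continuous_on U (\<lambda>y. gram_det bs \<psi> y)"
    unfolding gram_det_def
    by (intro continuous_on_det continuous_intros continuous_on_dir_deriv) auto
  then have "(\<lambda>y. indicator U y *\<^sub>R sqrt (gram_det bs \<psi> y)) \<in> borel_measurable borel"
    by (intro borel_measurable_continuous_on_indicator continuous_intros) auto
  then show ?thesis
    by (simp add: area_factor_def[abs_def])
qed

definition chart_map :: "'a \<Rightarrow> 'a" where
  "chart_map y = indicator U y *\<^sub>R \<psi> y"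

lemma chart_map_eq [simp]: "y \<in> U \<Longrightarrow> chart_map y = \<psi> y"
  by (simp add: chart_map_def)

lemma measurable_chart_map [measurable]: "chart_map \<in> borel_measurable borel"
  unfolding chart_map_def[abs_def]
  by (intro borel_measurable_continuous_on_indicator continuous_on_\<psi>) simp

text \<open>The volume of the chart image, restricted to \<open>B\<close> and carried over to the
  ambient space. It is built by \<open>density\<close> and \<open>distr\<close>, so countable
  additivity comes for free.\<close>

definition piece_measure :: "'a set \<Rightarrow> 'a measure" where
  "piece_measure B = distr (density (lebesgue_coord bs)
     (\<lambda>y. indicator B (chart_map y) * ennreal (area_factor y))) borel chart_map"

lemma sets_piece_measure [simp]: "sets (piece_measure B) = sets borel"
  by (simp add: piece_measure_def)

lemma nn_integral_piece_measure:
  assumes [measurable]: "B \<in> sets borel" "f \<in> borel_measurable borel"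
  shows "(\<integral>\<^sup>+ u. f u \<partial>piece_measure B) =
    (\<integral>\<^sup>+ y. indicator B (chart_map y) * ennreal (area_factor y) * f (chart_map y) \<partial>lebesgue_coord bs)"
proof -
  have "(\<lambda>y. indicator B (chart_map y) * ennreal (area_factor y)) \<in> borel_measurable borel" by measurable
  then show ?thesis
    unfolding piece_measure_def
    by (subst nn_integral_distr) (simp_all add: nn_integral_density)
qed

lemma param_volume_eq_piece_measure:
  assumes [measurable]: "A \<in> sets borel" "B \<in> sets borel"
  shows "param_volume (bs, U, \<psi>) (A \<inter> B) = emeasure (piece_measure B) A"
proof -
  have "emeasure (piece_measure B) A = (\<integral>\<^sup>+ u. indicator A u \<partial>piece_measure B)"
    using assms by simp
  also have "\<dots> = (\<integral>\<^sup>+ y. indicator B (chart_map y) * ennreal (area_factor y) * indicator A (chart_map y) \<partial>lebesgue_coord bs)"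
    by (rule nn_integral_piece_measure) measurable
  also have "\<dots> = (\<integral>\<^sup>+ y. indicator U y * indicator (A \<inter> B) (\<psi> y) * ennreal (sqrt (gram_det bs \<psi> y)) \<partial>lebesgue_coord bs)"
    by (intro nn_integral_cong) (auto simp: area_factor_def indicator_def)
  finally show ?thesis by (simp add: param_volume_def)
qed

end

section \<open>The volume measure of a compact manifold, assembled from an atlas\<close>

locale tubular_manifold =
  fixes k :: nat and M :: "'a::euclidean_space set" and v :: "nat \<Rightarrow> 'a \<Rightarrow> 'a" and \<epsilon> :: real and codim :: nat
  assumes codim_eq: "codim = DIM('a) - k"
    and admissible: "admissible k M" and frame: "normal_frame k M v" and radius: "tubular_radius M \<epsilon>"
begin

lemma compact_M: "compact M" and M_nonempty: "M \<noteq> {}"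
  using admissible by (simp_all add: admissible_def)

lemma M_borel [measurable]: "M \<in> sets borel"
  using compact_M by (simp add: borel_compact)

text \<open>This is the choice hidden in \<open>intrinsic_measure\<close>, so everything below
  speaks about the very atlas from which that measure is built.\<close>

definition atlas :: "'a param list" where
  "atlas = (SOME cs. finite_atlas k M cs)"

text \<open>Chart images are relatively open and cover the compact set \<open>M\<close>; the finite
  subcover shows that the choice behind \<open>atlas\<close> is not void.\<close>

lemma finite_atlas: "finite_atlas k M atlas"
proof -
  let ?C = "{c. local_param k M c}"
  have op: "openin (top_of_set M) (param_image c)" if "c \<in> ?C" for c
    using that by (auto simp: local_param_def param_image_def split: prod.splits)
  have "M \<subseteq> (\<Union>c\<in>?C. param_image c)"
    using admissible unfolding admissible_def submanifold_def by blast
  moreover have "\<forall>T\<in>param_image ` ?C. openin (top_of_set M) T"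
    using op by blast
  ultimately obtain D where D: "D \<subseteq> param_image ` ?C" "finite D" "M \<subseteq> \<Union>D"
    using compact_M unfolding compact_eq_openin_cover by (metis (no_types, lifting))
  then obtain C where C: "C \<subseteq> ?C" "finite C" "D = param_image ` C"
    using finite_subset_image by metis
  obtain cs where cs: "set cs = C"
    using finite_list[OF C(2)] by blast
  have "M = (\<Union>c\<in>C. param_image c)"
  proof
    show "M \<subseteq> (\<Union>c\<in>C. param_image c)" using D(3) C(3) by simp
    show "(\<Union>c\<in>C. param_image c) \<subseteq> M"
      using C(1) by (intro UN_least openin_imp_subset[OF op]) auto
  qed
  then have "finite_atlas k M cs"
    using C cs by (auto simp: finite_atlas_def)
  then show ?thesis
    unfolding atlas_def by (rule someI)
qed

lemma chart_atlas:
  assumes "i < length atlas" "atlas ! i = (bs, U, \<psi>)"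
  shows "chart k M bs U \<psi>"
  using finite_atlas assms nth_mem[of i atlas] by unfold_locales (simp add: finite_atlas_def)

lemma k_le: "k \<le> DIM('a)"
proof -
  obtain u where "u \<in> M" using M_nonempty by blast
  then obtain c where "local_param k M c"
    using admissible unfolding admissible_def submanifold_def by blast
  then obtain bs U \<psi> where "local_param k M (bs, U, \<psi>)"
    by (metis prod_cases3)
  then interpret chart k M bs U \<psi> by unfold_locales
  show ?thesis
    using length_bs distinct_bs card_mono[OF finite_Basis bs_subset] by (simp add: distinct_card)
qed

definition earlier :: "nat \<Rightarrow> 'a set" where
  "earlier j = (\<Union>i<j. param_image (atlas ! i))"

definition piece :: "nat \<Rightarrow> 'a measure" where
  "piece j = (case atlas ! j of (bs, U, \<psi>) \<Rightarrow> chart.piece_measure bs U \<psi> (- earlier j))"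

lemma param_image_borel:
  assumes "i < length atlas"
  shows "param_image (atlas ! i) \<in> sets borel"
proof -
  obtain bs U \<psi> where eq: "atlas ! i = (bs, U, \<psi>)" by (rule prod_cases3)
  interpret chart k M bs U \<psi> using chart_atlas[OF assms eq] .
  obtain T where "open T" "\<psi> ` U = M \<inter> T"
    using openin_image unfolding openin_open by blast
  then show ?thesis
    unfolding eq param_image_def by simp
qed

lemma earlier_borel:
  assumes "j < length atlas" shows "earlier j \<in> sets borel"
  unfolding earlier_def using assms by (intro sets.finite_UN param_image_borel) auto

lemma sets_piece: "j < length atlas \<Longrightarrow> sets (piece j) = sets borel"
  using chart.sets_piece_measure[OF chart_atlas] by (cases "atlas ! j") (simp add: piece_def)

text \<open>On Borel sets each summand of the defining set function is the value of a genuine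
  measure \<open>piece j\<close>, so the volume inherits additivity and an integral formula from
  \<open>sum_measure\<close>.\<close>

lemma intrinsic_measure_eq: "intrinsic_measure k M = sum_measure {..<length atlas} piece"
  unfolding intrinsic_measure_def atlas_def[symmetric] Let_def sum_measure_def
proof (rule measure_of_eq)
  fix A :: "'a set" assume "A \<in> sigma_sets UNIV (sets borel)"
  then have A: "A \<in> sets borel"
    using sets.sigma_sets_eq[of "borel :: 'a measure"] by simp
  show "(\<Sum>j<length atlas. param_volume (atlas ! j) (A - (\<Union>i<j. param_image (atlas ! i)))) =
      (\<Sum>j<length atlas. emeasure (piece j) A)"
  proof (rule sum.cong[OF refl])
    fix j assume j: "j \<in> {..<length atlas}"
    obtain bs U \<psi> where eq: "atlas ! j = (bs, U, \<psi>)" by (rule prod_cases3)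
    interpret chart k M bs U \<psi> using chart_atlas[OF _ eq] j by simp
    have "- earlier j \<in> sets borel" using earlier_borel j by simp
    from param_volume_eq_piece_measure[OF A this]
    show "param_volume (atlas ! j) (A - (\<Union>i<j. param_image (atlas ! i))) = emeasure (piece j) A"
      by (simp add: piece_def eq earlier_def Diff_eq)
  qed
qed simp

abbreviation vol :: "'a measure" where "vol \<equiv> intrinsic_measure k M"

lemma sets_vol [simp, measurable_cong]: "sets vol = sets borel" and space_vol [simp]: "space vol = UNIV"
  by (simp_all add: intrinsic_measure_eq)

lemma nn_integral_vol:
  assumes "f \<in> borel_measurable borel"
  shows "(\<integral>\<^sup>+ u. f u \<partial>vol) = (\<Sum>j<length atlas. \<integral>\<^sup>+ u. f u \<partial>piece j)"
  unfolding intrinsic_measure_eq using assms by (intro nn_integral_sum_measure sets_piece) auto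

lemma AE_vol: "AE u in vol. u \<in> M"
proof -
  have "emeasure vol (- M) = (\<integral>\<^sup>+ u. indicator (- M) u \<partial>vol)"
    by (rule nn_integral_indicator[symmetric]) simp
  also have "\<dots> = (\<Sum>j<length atlas. \<integral>\<^sup>+ u. indicator (- M) u \<partial>piece j)"
    by (rule nn_integral_vol) simp
  also have "\<dots> = 0"
  proof (rule sum.neutral, rule ballI)
    fix j assume j: "j \<in> {..<length atlas}"
    obtain bs U \<psi> where eq: "atlas ! j = (bs, U, \<psi>)" by (rule prod_cases3)
    interpret chart k M bs U \<psi> using chart_atlas[OF _ eq] j by simp
    have "(\<integral>\<^sup>+ u. indicator (- M) u \<partial>piece j) = (\<integral>\<^sup>+ y. indicator (- earlier j) (chart_map y) *
        ennreal (area_factor y) * indicator (- M) (chart_map y) \<partial>lebesgue_coord bs)"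
      using j earlier_borel[of j] by (simp only: piece_def eq prod.case, subst nn_integral_piece_measure) auto
    also have "\<dots> = (\<integral>\<^sup>+ y. 0 \<partial>lebesgue_coord bs)"
      using image_subset by (intro nn_integral_cong) (auto simp: indicator_def area_factor_def)
    finally show "(\<integral>\<^sup>+ u. indicator (- M) u \<partial>piece j) = 0" by simp
  qed
  finally have "- M \<in> null_sets vol" by (simp add: null_sets_def)
  from AE_not_in[OF this] show ?thesis
    by simp
qed

end

section \<open>Integration over tubular neighbourhoods\<close>

context tubular_manifold
begin

lemma frame_orthonormal: "u \<in> M \<Longrightarrow> i < codim \<Longrightarrow> j < codim \<Longrightarrow> v i u \<bullet> v j u = (if i = j then 1 else 0)"
  using frame unfolding normal_frame_def codim_eq[symmetric] by blast

lemma frame_span: "u \<in> M \<Longrightarrow> span ((\<lambda>j. v j u) ` {..<codim}) = orthogonal_comp (tangent_space M u)"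
  using frame unfolding normal_frame_def codim_eq[symmetric] by blast

lemma frame_smooth: "j < codim \<Longrightarrow> smooth_map_on M (v j)"
  using frame unfolding normal_frame_def codim_eq[symmetric] by blast

lemma frame_orthogonal_tangent:
  assumes "u \<in> M" "j < codim" "w \<in> tangent_space M u"
  shows "w \<bullet> v j u = 0"
proof -
  have "v j u \<in> orthogonal_comp (tangent_space M u)"
    using assms(2) unfolding frame_span[OF assms(1), symmetric] by (intro span_base) auto
  then show ?thesis
    using assms(3) by (simp add: orthogonal_comp_def real_inner_class.orthogonal_def)
qed

lemma frame_sum_inner:
  assumes "u \<in> M" "i < codim"
  shows "(\<Sum>j<codim. t j *\<^sub>R v j u) \<bullet> v i u = t i"
proof -
  have "(\<Sum>j<codim. t j *\<^sub>R v j u) \<bullet> v i u = (\<Sum>j<codim. if j = i then t i else 0)"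
    unfolding inner_sum_left using assms by (intro sum.cong refl) (simp add: frame_orthonormal)
  then show ?thesis using assms(2) by simp
qed

lemma frame_sum_norm:
  assumes "u \<in> M"
  shows "norm (\<Sum>j<codim. t j *\<^sub>R v j u) = L2_set t {..<codim}"
proof -
  have "(\<Sum>j<codim. t j *\<^sub>R v j u) \<bullet> (\<Sum>j<codim. t j *\<^sub>R v j u) = (\<Sum>i<codim. t i * ((\<Sum>j<codim. t j *\<^sub>R v j u) \<bullet> v i u))"
    by (simp only: inner_sum_right inner_scaleR_right)
  also have "\<dots> = (\<Sum>i<codim. (t i)\<^sup>2)"
    using assms by (intro sum.cong refl) (simp add: frame_sum_inner power2_eq_square)
  finally show ?thesis
    by (simp add: norm_eq_sqrt_inner L2_set_def)
qed

lemma normal_space_iff: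
  assumes "u \<in> M"
  shows "w \<in> orthogonal_comp (tangent_space M u) \<longleftrightarrow> (\<exists>t. w = (\<Sum>j<codim. t j *\<^sub>R v j u))"
proof
  assume "w \<in> orthogonal_comp (tangent_space M u)"
  then have "w \<in> span ((\<lambda>j. v j u) ` {..<codim})"
    using frame_span[OF assms] by simp
  then show "\<exists>t. w = (\<Sum>j<codim. t j *\<^sub>R v j u)"
  proof (induction rule: span_induct_alt)
    case base
    then show ?case by (intro exI[of _ "\<lambda>_. 0"]) simp
  next
    case (step c x y)
    then obtain t i where t: "y = (\<Sum>j<codim. t j *\<^sub>R v j u)" and i: "i < codim" "x = v i u" by blast
    have "c *\<^sub>R x + y = (\<Sum>j<codim. ((if j = i then c else 0) + t j) *\<^sub>R v j u)"
      using i by (simp add: t scaleR_add_left sum.distrib if_distrib[of "\<lambda>c. c *\<^sub>R _"] cong: if_cong)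
    then show ?case by (rule exI[of _ "\<lambda>j. (if j = i then c else 0) + t j"])
  qed
next
  assume "\<exists>t. w = (\<Sum>j<codim. t j *\<^sub>R v j u)"
  then show "w \<in> orthogonal_comp (tangent_space M u)"
    unfolding frame_span[OF assms, symmetric] by (elim exE ssubst) (intro span_sum span_scale span_base imageI)
qed

text \<open>The orthonormal frame replaces normal vectors by their coordinates \<open>t\<close>,
  with the Euclidean norm of \<open>t\<close> equal to the distance from the foot point. From here
  on tangent spaces enter only through orthogonality to the frame.\<close>

lemma mem_tube_iff:
  "x \<in> tube M \<delta> \<longleftrightarrow> (\<exists>u\<in>M. \<exists>t. L2_set t {..<codim} < \<delta> \<and> x = normal_map codim v t u)"
proof
  assume "x \<in> tube M \<delta>"
  then obtain u w where u: "u \<in> M" and w: "w \<in> orthogonal_comp (tangent_space M u)" "norm w < \<delta>" "x = u + w"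
    by (auto simp: tube_def normal_disc_bundle_def)
  from w(1) obtain t where "w = (\<Sum>j<codim. t j *\<^sub>R v j u)"
    unfolding normal_space_iff[OF u] by blast
  then show "\<exists>u\<in>M. \<exists>t. L2_set t {..<codim} < \<delta> \<and> x = normal_map codim v t u"
    using u w frame_sum_norm[OF u, of t] by (auto simp: normal_map_def)
next
  assume "\<exists>u\<in>M. \<exists>t. L2_set t {..<codim} < \<delta> \<and> x = normal_map codim v t u"
  then obtain u t where u: "u \<in> M" and t: "L2_set t {..<codim} < \<delta>" "x = normal_map codim v t u" by blast
  have "(u, \<Sum>j<codim. t j *\<^sub>R v j u) \<in> normal_disc_bundle M \<delta>"
    using u t frame_sum_norm[OF u, of t] normal_space_iff[OF u] by (auto simp: normal_disc_bundle_def)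
  then show "x \<in> tube M \<delta>"
    unfolding tube_def using t(2) by (auto simp: normal_map_def intro!: image_eqI)
qed

lemma radius_pos: "0 < \<epsilon>" and open_tube: "open (tube M \<epsilon>)"
  and bundle_diffeo: "diffeomorphism (normal_disc_bundle M \<epsilon>) (tube M \<epsilon>) (\<lambda>(u, w). u + w)"
  using radius by (simp_all add: tubular_radius_def)

text \<open>The foot point projection: the base component of the inverse of the normal bundle
  diffeomorphism, with default value 0 off the tube so that it is Borel on the whole space.\<close>

definition foot :: "'a \<Rightarrow> 'a" where
  "foot x = indicator (tube M \<epsilon>) x *\<^sub>R fst (the_inv_into (normal_disc_bundle M \<epsilon>) (\<lambda>(u, w). u + w) x)"

lemma continuous_on_foot: "continuous_on (tube M \<epsilon>) foot"
proof -
  have "continuous_on (tube M \<epsilon>) (the_inv_into (normal_disc_bundle M \<epsilon>) (\<lambda>(u, w). u + w))"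
    using bundle_diffeo by (intro smooth_map_on_imp_continuous_on) (simp add: diffeomorphism_def)
  then have "continuous_on (tube M \<epsilon>) (\<lambda>x. fst (the_inv_into (normal_disc_bundle M \<epsilon>) (\<lambda>(u, w). u + w) x))"
    by (rule continuous_on_fst)
  then show ?thesis
    by (rule continuous_on_eq) (simp add: foot_def)
qed

lemma measurable_foot [measurable]: "foot \<in> borel_measurable borel"
proof -
  have "(\<lambda>x. indicator (tube M \<epsilon>) x *\<^sub>R foot x) \<in> borel_measurable borel"
    using open_tube continuous_on_foot by (intro borel_measurable_continuous_on_indicator) auto
  moreover have "(\<lambda>x. indicator (tube M \<epsilon>) x *\<^sub>R foot x) = foot"
    by (auto simp: foot_def indicator_def)
  ultimately show ?thesis by simp
qed

lemma foot_normal_map: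
  assumes "u \<in> M" "L2_set t {..<codim} < \<epsilon>"
  shows "foot (normal_map codim v t u) = u"
proof -
  let ?w = "\<Sum>j<codim. t j *\<^sub>R v j u"
  have mem: "(u, ?w) \<in> normal_disc_bundle M \<epsilon>"
    using assms frame_sum_norm[OF assms(1), of t] normal_space_iff[OF assms(1)]
    by (auto simp: normal_disc_bundle_def)
  have inj: "inj_on (\<lambda>(u, w). u + w) (normal_disc_bundle M \<epsilon>)"
    using bundle_diffeo by (simp add: diffeomorphism_def bij_betw_def)
  have "the_inv_into (normal_disc_bundle M \<epsilon>) (\<lambda>(u, w). u + w) (normal_map codim v t u) = (u, ?w)"
    using the_inv_into_f_f[OF inj mem] by (simp add: normal_map_def)
  moreover have "normal_map codim v t u \<in> tube M \<epsilon>"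
    using assms mem_tube_iff by blast
  ultimately show ?thesis by (simp add: foot_def)
qed

lemma norm_normal_map_diff:
  "u \<in> M \<Longrightarrow> norm (normal_map codim v t u - u) = L2_set t {..<codim}"
  by (simp add: normal_map_def frame_sum_norm)

text \<open>A thinner tube is cut out of the given one by a condition on \<open>foot\<close>, which
  is how it inherits measurability and openness.\<close>

lemma tube_eq_foot:
  assumes "\<delta> \<le> \<epsilon>"
  shows "tube M \<delta> = {x \<in> tube M \<epsilon>. norm (x - foot x) < \<delta>}"
proof (intro equalityI subsetI)
  fix x assume "x \<in> tube M \<delta>"
  then obtain u t where u: "u \<in> M" and t: "L2_set t {..<codim} < \<delta>" "x = normal_map codim v t u"
    unfolding mem_tube_iff by blast
  then show "x \<in> {x \<in> tube M \<epsilon>. norm (x - foot x) < \<delta>}"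
    using assms foot_normal_map[of u t] norm_normal_map_diff[of u t]
    by (auto simp: mem_tube_iff intro!: bexI[of _ u] exI[of _ t])
next
  fix x assume x: "x \<in> {x \<in> tube M \<epsilon>. norm (x - foot x) < \<delta>}"
  then obtain u t where u: "u \<in> M" and t: "L2_set t {..<codim} < \<epsilon>" "x = normal_map codim v t u"
    using mem_tube_iff by blast
  then show "x \<in> tube M \<delta>"
    using x foot_normal_map[of u t] norm_normal_map_diff[of u t] by (auto simp: mem_tube_iff)
qed

lemma tube_borel: "\<delta> \<le> \<epsilon> \<Longrightarrow> tube M \<delta> \<in> sets borel"
proof -
  assume "\<delta> \<le> \<epsilon>"
  have [measurable]: "tube M \<epsilon> \<in> sets borel" using open_tube by simp
  have "{x \<in> space borel. x \<in> tube M \<epsilon> \<and> norm (x - foot x) < \<delta>} \<in> sets borel" by measurable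
  then show ?thesis unfolding tube_eq_foot[OF \<open>\<delta> \<le> \<epsilon>\<close>] by simp
qed

lemma foot_mem: "x \<in> tube M \<epsilon> \<Longrightarrow> foot x \<in> M"
  using mem_tube_iff foot_normal_map by metis

text \<open>The extension of a frame field may depend on the point \<open>u\<close>, but
  \<open>L\<close> may not: it bounds the derivative of the frame and thereby the shape operator
  uniformly over \<open>M\<close>.\<close>

definition frame_bound :: "real \<Rightarrow> bool" where
  "frame_bound L \<longleftrightarrow> 0 \<le> L \<and> (\<forall>u\<in>M. \<forall>j<codim. \<exists>W g. open W \<and> u \<in> W \<and> smooth_on W g \<and>
    (\<forall>y. y \<in> W \<longrightarrow> y \<in> M \<longrightarrow> g y = v j y) \<and> (\<forall>x. norm (lin_deriv g u x) \<le> L * norm x))"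

lemma frame_boundD:
  assumes "frame_bound L"
  shows "0 \<le> L" and "\<And>u j. u \<in> M \<Longrightarrow> j < codim \<Longrightarrow> \<exists>W g. open W \<and> u \<in> W \<and> smooth_on W g \<and>
    (\<forall>y. y \<in> W \<longrightarrow> y \<in> M \<longrightarrow> g y = v j y) \<and> (\<forall>x. norm (lin_deriv g u x) \<le> L * norm x)"
  using assms unfolding frame_bound_def by simp_all

lemma frame_extension: "\<exists>L. frame_bound L"
proof -
  let ?good = "\<lambda>L u j. \<exists>W g. open W \<and> u \<in> W \<and> smooth_on W g \<and>
    (\<forall>y. y \<in> W \<longrightarrow> y \<in> M \<longrightarrow> g y = v j y) \<and> (\<forall>x. norm (lin_deriv g u x) \<le> L * norm x)"
  have "\<forall>j\<in>{..<codim}. \<exists>L. 0 \<le> L \<and> (\<forall>u\<in>M. ?good L u j)"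
  proof
    fix j assume j: "j \<in> {..<codim}"
    show "\<exists>L. 0 \<le> L \<and> (\<forall>u\<in>M. ?good L u j)"
      by (rule smooth_map_on_compact_extension[OF compact_M frame_smooth]) (use j in auto)
  qed
  then obtain L where L: "\<And>j. j < codim \<Longrightarrow> 0 \<le> L j" "\<And>u j. j < codim \<Longrightarrow> u \<in> M \<Longrightarrow> ?good (L j) u j"
    by (metis lessThan_iff)
  show ?thesis
    unfolding frame_bound_def
  proof (intro exI[of _ "\<Sum>j<codim. L j"] conjI ballI allI impI)
    show "0 \<le> (\<Sum>j<codim. L j)" using L(1) by (intro sum_nonneg) auto
    fix u j assume u: "u \<in> M" and j: "j < codim"
    have le: "L j \<le> (\<Sum>j<codim. L j)"
      using L(1) j by (intro member_le_sum) auto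
    from L(2)[OF j u] obtain W g where "open W" "u \<in> W" "smooth_on W g"
      "\<forall>y. y \<in> W \<longrightarrow> y \<in> M \<longrightarrow> g y = v j y" and g: "\<And>x. norm (lin_deriv g u x) \<le> L j * norm x"
      by (elim exE conjE) simp
    moreover have "norm (lin_deriv g u x) \<le> (\<Sum>j<codim. L j) * norm x" for x
      using g[of x] mult_right_mono[OF le norm_ge_zero[of x]] by linarith
    ultimately show "?good (\<Sum>j<codim. L j) u j"
      by (intro exI[of _ W] exI[of _ g]) simp
  qed
qed

text \<open>In a chart, the derivative of the normal map factors as \<open>(1 + E) A\<close>, where \<open>A\<close> is its derivative
  on the zero section and \<open>E\<close> is the shape operator in direction \<open>t\<close>. The determinant of \<open>A\<close> is
  the area factor of the chart, since \<open>A\<close> maps the coordinate directions to tangent vectors and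
  the remaining basis vectors to the orthonormal normal frame.\<close>

lemma normal_map_chart_derivative:
  fixes L \<eta> :: real
  assumes frame_bound: "frame_bound L"
    and chart: "chart k M bs U \<psi>"
    and cs: "distinct (bs @ cs)" "set (bs @ cs) = Basis" "length cs = codim"
    and z: "coord_proj bs z \<in> U"
    and \<eta>: "\<eta> = codim * (L * (1 + codim)) * L2_set (\<lambda>j. z \<bullet> cs ! j) {..<codim}" "\<eta> < 1"
  shows "\<exists>\<Phi>'. ((\<lambda>z. normal_map codim v (\<lambda>j. z \<bullet> cs ! j) (\<psi> (coord_proj bs z))) has_derivative \<Phi>') (at z) \<and>
    (1 - \<eta>) ^ DIM('a) * chart.area_factor bs U \<psi> (coord_proj bs z) \<le> abs_det \<Phi>' \<and>
    abs_det \<Phi>' \<le> (1 + \<eta>) ^ DIM('a) * chart.area_factor bs U \<psi> (coord_proj bs z)"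
proof -
  interpret chart k M bs U \<psi> by (rule chart)
  note L = frame_boundD[OF frame_bound]
  let ?P = "coord_proj bs"
  define y where "y = ?P z"
  define u where "u = \<psi> y"
  define t where "t j = z \<bullet> cs ! j" for j
  have y: "y \<in> U" using z by (simp add: y_def)
  have u: "u \<in> M" using y image_subset by (auto simp: u_def)
  have P: "bounded_linear ?P" by (rule bounded_linear_coord_proj)
  obtain W h where W: "open W" "y \<in> W" "smooth_on W h" "\<And>y'. y' \<in> W \<Longrightarrow> y' \<in> U \<Longrightarrow> h y' = \<psi> y'"
    using smooth_\<psi> y by (rule smooth_map_onE) blast
  have "\<exists>p. open (fst p) \<and> u \<in> fst p \<and> smooth_on (fst p) (snd p) \<and>
      (\<forall>y. y \<in> fst p \<longrightarrow> y \<in> M \<longrightarrow> snd p y = v j y) \<and> (\<forall>x. norm (lin_deriv (snd p) u x) \<le> L * norm x)"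
    if "j < codim" for j
    using L(2)[OF u that] by auto
  then have "\<forall>j\<in>{..<codim}. \<exists>p. open (fst p) \<and> u \<in> fst p \<and> smooth_on (fst p) (snd p) \<and>
      (\<forall>y. y \<in> fst p \<longrightarrow> y \<in> M \<longrightarrow> snd p y = v j y) \<and> (\<forall>x. norm (lin_deriv (snd p) u x) \<le> L * norm x)"
    by simp
  from bchoice[OF this] obtain p where p: "\<forall>j\<in>{..<codim}. open (fst (p j)) \<and> u \<in> fst (p j) \<and>
      smooth_on (fst (p j)) (snd (p j)) \<and> (\<forall>y. y \<in> fst (p j) \<longrightarrow> y \<in> M \<longrightarrow> snd (p j) y = v j y) \<and>
      (\<forall>x. norm (lin_deriv (snd (p j)) u x) \<le> L * norm x)"
    by (elim exE)
  define Wg where "Wg j = fst (p j)" for j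
  define g where "g j = snd (p j)" for j
  have g: "\<And>j. j < codim \<Longrightarrow> open (Wg j)" "\<And>j. j < codim \<Longrightarrow> u \<in> Wg j"
    "\<And>j. j < codim \<Longrightarrow> smooth_on (Wg j) (g j)" "\<And>j y. j < codim \<Longrightarrow> y \<in> Wg j \<Longrightarrow> y \<in> M \<Longrightarrow> g j y = v j y"
    "\<And>j x. j < codim \<Longrightarrow> norm (lin_deriv (g j) u x) \<le> L * norm x"
    using p by (simp_all add: Wg_def g_def)
  have hy: "h y = u" using W(2,4) y by (simp add: u_def)
  let ?Dh = "\<lambda>w. lin_deriv h y (?P w)"
  have Dh_lin: "bounded_linear ?Dh"
    using bounded_linear_compose[OF bounded_linear_lin_deriv P] .
  obtain O' where O': "open O'" "U = span (set bs) \<inter> O'"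
    using openin_U unfolding openin_open by blast
  let ?N0 = "?P -` (W \<inter> O')"
  have N0: "open ?N0"
    using W(1) O'(1) by (intro open_vimage linear_continuous_on P) auto
  \<comment> \<open>On \<open>N\<close> the chart and all frame fields agree with their smooth
    extensions, so the normal map may be differentiated there through the extensions.\<close>
  define N where "N = ?N0 \<inter> (\<lambda>z. h (?P z)) -` (\<Inter>j<codim. Wg j)"
  have contP: "continuous_on UNIV ?P" using linear_continuous_on[OF P] .
  have "continuous_on ?N0 (\<lambda>z. h (?P z))"
    using Ck_on_imp_continuous_on[OF smooth_on_imp_Ck_on[OF W(3)]]
    by (rule continuous_on_compose2) (auto intro: continuous_on_subset[OF contP])
  then have N: "open N"
    unfolding N_def using g(1) by (intro continuous_open_preimage N0 open_INT) auto
  have zN: "z \<in> N"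
    using W(2) y O'(2) g(2) hy by (auto simp: N_def y_def)
  have NU: "?P z' \<in> U \<and> h (?P z') = \<psi> (?P z')" if "z' \<in> N" for z'
  proof -
    have "?P z' \<in> span (set bs)" by (simp add: coord_proj_eq_coord_sum coord_sum_mem_span)
    then have "?P z' \<in> U" using that O'(2) by (auto simp: N_def)
    then show ?thesis using W(4) that by (auto simp: N_def)
  qed
  have loc: "h (?P z') + (\<Sum>j<codim. (z' \<bullet> cs ! j) *\<^sub>R g j (h (?P z'))) =
      normal_map codim v (\<lambda>j. z' \<bullet> cs ! j) (\<psi> (?P z'))" if "z' \<in> N" for z'
  proof -
    have "\<psi> (?P z') \<in> M" using NU[OF that] image_subset by blast
    moreover have "\<psi> (?P z') \<in> Wg j" if "j < codim" for j
      using NU[OF \<open>z' \<in> N\<close>] \<open>z' \<in> N\<close> that by (auto simp: N_def)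
    ultimately show ?thesis
      using NU[OF that] g(4) unfolding normal_map_def by (auto intro!: sum.cong)
  qed
  let ?A = "\<lambda>w. ?Dh w + (\<Sum>j<codim. (w \<bullet> cs ! j) *\<^sub>R v j u)"
  \<comment> \<open>The normal components are removed before the frame is differentiated, because
    only the tangential motion of the foot point turns the frame. This makes \<open>?E\<close> a map
    of the ambient space that can be composed with \<open>?A\<close>.\<close>
  let ?E = "\<lambda>x. \<Sum>j<codim. t j *\<^sub>R lin_deriv (g j) u (x - (\<Sum>i<codim. (x \<bullet> v i u) *\<^sub>R v i u))"
  have A_lin: "bounded_linear ?A"
    by (intro bounded_linear_add Dh_lin bounded_linear_sum bounded_linear_compose[OF bounded_linear_scaleR_left] bounded_linear_inner_left)
  have proj_lin: "bounded_linear (\<lambda>x. x - (\<Sum>i<codim. (x \<bullet> v i u) *\<^sub>R v i u))"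
    by (intro bounded_linear_sub bounded_linear_ident bounded_linear_sum bounded_linear_compose[OF bounded_linear_scaleR_left] bounded_linear_inner_left)
  have E_lin: "bounded_linear ?E"
    by (intro bounded_linear_sum bounded_linear_compose[OF bounded_linear_scaleR_right] bounded_linear_compose[OF bounded_linear_lin_deriv proj_lin])
  have h_deriv: "(h has_derivative lin_deriv h y) (at y)"
    using Ck_on_has_derivative[OF W(1) smooth_on_imp_Ck_on[OF W(3)] W(2)] .
  have hP_deriv: "((\<lambda>z. h (?P z)) has_derivative ?Dh) (at z)"
    using has_derivative_compose[OF bounded_linear_imp_has_derivative[OF P] h_deriv[unfolded y_def]]
    by (simp add: y_def)
  have g_deriv: "((\<lambda>z. g j (h (?P z))) has_derivative (\<lambda>w. lin_deriv (g j) u (?Dh w))) (at z)" if j: "j < codim" for j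
  proof -
    have "(g j has_derivative lin_deriv (g j) u) (at u)"
      using Ck_on_has_derivative[OF g(1)[OF j] smooth_on_imp_Ck_on[OF g(3)[OF j]] g(2)[OF j]] .
    then have "(g j has_derivative lin_deriv (g j) u) (at (h (?P z)))"
      using hy by (simp add: y_def)
    from has_derivative_compose[OF hP_deriv this] show ?thesis .
  qed
  have gju: "g j (h (?P z)) = v j u" if "j < codim" for j
    using g(2,4) that u hy by (simp add: y_def)
  have t_deriv: "((\<lambda>z. (z \<bullet> cs ! j) *\<^sub>R g j (h (?P z))) has_derivative
      (\<lambda>w. t j *\<^sub>R lin_deriv (g j) u (?Dh w) + (w \<bullet> cs ! j) *\<^sub>R v j u)) (at z)" if j: "j < codim" for j
    using has_derivative_scaleR[OF bounded_linear_imp_has_derivative[OF bounded_linear_inner_left[of "cs ! j"]] g_deriv[OF j]]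
    by (simp add: t_def gju[OF j])
  have sum_deriv: "((\<lambda>z. h (?P z) + (\<Sum>j<codim. (z \<bullet> cs ! j) *\<^sub>R g j (h (?P z)))) has_derivative
      (\<lambda>w. ?Dh w + (\<Sum>j<codim. t j *\<^sub>R lin_deriv (g j) u (?Dh w) + (w \<bullet> cs ! j) *\<^sub>R v j u))) (at z)"
    using t_deriv by (intro has_derivative_add hP_deriv has_derivative_sum) auto
  have cs_sub: "set cs \<subseteq> Basis"
    unfolding cs(2)[symmetric] by simp
  have cs_Basis: "cs ! j \<in> Basis" if "j < codim" for j
    using subsetD[OF cs_sub nth_mem] that cs(3) by simp
  have disj: "set bs \<inter> set cs = {}" and dist_cs: "distinct cs"
    using cs(1) by simp_all
  have bs_cs: "bs ! i \<bullet> cs ! j = 0" if "i < k" "j < codim" for i j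
  proof -
    have "bs ! i \<in> set bs" "cs ! j \<in> set cs" using that length_bs cs(3) by simp_all
    then have "bs ! i \<noteq> cs ! j" using disj by force
    then show ?thesis using nth_bs_Basis[OF that(1)] cs_Basis[OF that(2)] by (simp add: inner_Basis)
  qed
  have cs_cs: "cs ! i \<bullet> cs ! j = (if i = j then 1 else 0)" if "i < codim" "j < codim" for i j
  proof -
    have "cs ! i = cs ! j \<longleftrightarrow> i = j" using that cs(3) dist_cs by (simp add: nth_eq_iff_index_eq)
    then show ?thesis using cs_Basis that by (simp add: inner_Basis)
  qed
  have P_bs: "?P (bs ! i) = bs ! i" if "i < k" for i
    using that length_bs distinct_bs bs_subset by (intro coord_proj_span span_base) auto
  have P_cs: "?P (cs ! j) = 0" if "j < codim" for j
    using bs_cs[OF _ that] length_bs by (simp add: coord_proj_def inner_commute)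
  have Dh_bs: "?Dh (bs ! i) = dir_deriv (bs ! i) \<psi> y" if "i < k" for i
    using that length_bs dir_deriv_extension[OF y _ W(1,2,4), of "bs ! i"] nth_bs_Basis[OF that]
    by (simp add: P_bs lin_deriv_Basis)
  have bs_normal: "dir_deriv (bs ! i) \<psi> y \<bullet> v j u = 0" if "i < k" "j < codim" for i j
    using frame_orthogonal_tangent[OF u that(2)] dir_deriv_tangent[OF y, of "bs ! i"] that length_bs
    by (simp add: u_def)
  have Dh_normal: "?Dh w \<bullet> v j u = 0" if "j < codim" for w j
  proof -
    have "?Dh w = (\<Sum>i<k. (w \<bullet> bs ! i) *\<^sub>R ?Dh (bs ! i))"
    proof -
      have "?P w = (\<Sum>i<k. (w \<bullet> bs ! i) *\<^sub>R ?P (bs ! i))"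
        by (simp add: coord_proj_def[of bs w] length_bs P_bs)
      then show ?thesis
        using bounded_linear.linear[OF bounded_linear_lin_deriv[of h y]]
        by (simp add: linear_sum linear_scale)
    qed
    then show ?thesis
      using that by (simp add: inner_sum_left Dh_bs bs_normal)
  qed
  have A_normal: "?A w \<bullet> v j u = w \<bullet> cs ! j" if "j < codim" for w j
    using that u by (simp add: inner_add_left Dh_normal frame_sum_inner)
  have factor: "?Dh w + (\<Sum>j<codim. t j *\<^sub>R lin_deriv (g j) u (?Dh w) + (w \<bullet> cs ! j) *\<^sub>R v j u) = ?A w + ?E (?A w)" for w
  proof -
    \<comment> \<open>The first summand \<open>?Dh w\<close> is tangential, so the normal components
      of \<open>?A w\<close> are exactly the fibre coordinates of \<open>w\<close>, and removing
      them recovers the motion of the foot point.\<close>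
    have "?A w - (\<Sum>i<codim. (?A w \<bullet> v i u) *\<^sub>R v i u) = ?Dh w"
      by (simp add: A_normal)
    then show ?thesis by (simp add: sum.distrib)
  qed
  have deriv: "((\<lambda>z. normal_map codim v (\<lambda>j. z \<bullet> cs ! j) (\<psi> (?P z))) has_derivative (\<lambda>w. ?A w + ?E (?A w))) (at z)"
    using has_derivative_transform_within_open[OF sum_deriv N zN loc] unfolding factor .
  have "norm (?E x) \<le> \<eta> * norm x" for x
  proof -
    have proj: "norm (x - (\<Sum>i<codim. (x \<bullet> v i u) *\<^sub>R v i u)) \<le> (1 + codim) * norm x"
    proof -
      have unit: "norm (v i u) = 1" if "i < codim" for i
        using frame_orthonormal[OF u that that] by (simp add: norm_eq_sqrt_inner)
      have "norm (\<Sum>i<codim. (x \<bullet> v i u) *\<^sub>R v i u) \<le> (\<Sum>i<codim. norm x)"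
      proof (intro order.trans[OF norm_sum] sum_mono)
        fix i assume "i \<in> {..<codim}"
        then show "norm ((x \<bullet> v i u) *\<^sub>R v i u) \<le> norm x"
          using Cauchy_Schwarz_ineq2[of x "v i u"] unit[of i] by simp
      qed
      then show ?thesis
        using norm_triangle_ineq4[of x "\<Sum>i<codim. (x \<bullet> v i u) *\<^sub>R v i u"] by (simp add: algebra_simps)
    qed
    let ?q = "x - (\<Sum>i<codim. (x \<bullet> v i u) *\<^sub>R v i u)"
    have "norm (?E x) \<le> (\<Sum>j<codim. L2_set t {..<codim} * (L * ((1 + codim) * norm x)))"
    proof (intro order.trans[OF norm_sum] sum_mono)
      fix j assume j: "j \<in> {..<codim}"
      have "\<bar>t j\<bar> \<le> L2_set t {..<codim}"
        using member_le_L2_set[of "{..<codim}" j "\<lambda>j. \<bar>t j\<bar>"] j by (simp add: L2_set_def)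
      moreover have "norm (lin_deriv (g j) u ?q) \<le> L * ((1 + codim) * norm x)"
        using g(5)[of j ?q] j mult_left_mono[OF proj L(1)] by simp
      ultimately show "norm (t j *\<^sub>R lin_deriv (g j) u ?q) \<le> L2_set t {..<codim} * (L * ((1 + codim) * norm x))"
        by (simp add: mult_mono)
    qed
    also have "\<dots> = \<eta> * norm x"
      by (simp add: \<eta>(1) t_def[abs_def] mult_ac)
    finally show ?thesis .
  qed
  moreover have "0 \<le> \<eta>" unfolding \<eta>(1) using L(1) by (intro mult_nonneg_nonneg L2_set_nonneg) auto
  ultimately have near: "(1 - \<eta>) ^ DIM('a) \<le> abs_det (\<lambda>x. x + ?E x)" "abs_det (\<lambda>x. x + ?E x) \<le> (1 + \<eta>) ^ DIM('a)"
    using abs_det_near_identity[OF E_lin _ _ \<eta>(2)] by blast+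
  have split: "abs_det (\<lambda>w. ?A w + ?E (?A w)) = abs_det (\<lambda>x. x + ?E x) * abs_det ?A"
    by (rule abs_det_compose[where A = "\<lambda>x. x + ?E x"])
      (intro bounded_linear.linear bounded_linear_add bounded_linear_ident E_lin A_lin)+
  have "abs_det ?A = area_factor y"
  proof -
    have A_bs: "?A (bs ! i) = dir_deriv (bs ! i) \<psi> y" if "i < k" for i
      using that bs_cs[OF that] by (simp add: Dh_bs)
    have A_cs: "?A (cs ! j) = v j u" if "j < codim" for j
    proof -
      have "lin_deriv h y 0 = 0" by (simp add: lin_deriv_def)
      moreover have "(\<Sum>i<codim. (cs ! j \<bullet> cs ! i) *\<^sub>R v i u) = v j u"
      proof -
        have "(\<Sum>i<codim. (cs ! j \<bullet> cs ! i) *\<^sub>R v i u) = (\<Sum>i<codim. if i = j then v j u else 0)"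
          using that by (intro sum.cong refl) (simp add: cs_cs)
        then show ?thesis using that by simp
      qed
      ultimately show ?thesis using P_cs[OF that] by simp
    qed
    let ?G = "Matrix.mat k k (\<lambda>(i, j). dir_deriv (bs ! i) \<psi> y \<bullet> dir_deriv (bs ! j) \<psi> y)"
    have A_nth: "?A ((bs @ cs) ! i) = (if i < k then dir_deriv (bs ! i) \<psi> y else v (i - k) u)"
      if "i < k + codim" for i
    proof (cases "i < k")
      case True
      then have "(bs @ cs) ! i = bs ! i" using length_bs by (simp add: nth_append)
      then show ?thesis using A_bs[OF True] True by (simp only: if_True)
    next
      case False
      then have "(bs @ cs) ! i = cs ! (i - k)" using length_bs by (simp add: nth_append)
      moreover have "i - k < codim" using False that by simp
      ultimately show ?thesis using A_cs False by (simp only: if_False)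
    qed
    have dim: "DIM('a) = k + codim" using k_le codim_eq by simp
    \<comment> \<open>The Gram matrix splits into blocks: chart derivatives are orthogonal to the
      frame, and the frame is orthonormal. Its determinant is the Gram determinant of the
      chart.\<close>
    have "Matrix.mat DIM('a) DIM('a) (\<lambda>(i, j). ?A ((bs @ cs) ! i) \<bullet> ?A ((bs @ cs) ! j)) =
        four_block_mat ?G (0\<^sub>m k codim) (0\<^sub>m codim k) (1\<^sub>m codim)"
      unfolding dim
    proof (rule eq_matI)
      fix i j assume "i < dim_row (four_block_mat ?G (0\<^sub>m k codim) (0\<^sub>m codim k) (1\<^sub>m codim))"
        "j < dim_col (four_block_mat ?G (0\<^sub>m k codim) (0\<^sub>m codim k) (1\<^sub>m codim))"
      then have ij: "i < k + codim" "j < k + codim" by simp_all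
      have "Matrix.mat (k + codim) (k + codim) (\<lambda>(i, j). ?A ((bs @ cs) ! i) \<bullet> ?A ((bs @ cs) ! j)) $$ (i, j) =
          ?A ((bs @ cs) ! i) \<bullet> ?A ((bs @ cs) ! j)"
        using ij by simp
      also have "\<dots> = (if i < k then dir_deriv (bs ! i) \<psi> y else v (i - k) u) \<bullet>
          (if j < k then dir_deriv (bs ! j) \<psi> y else v (j - k) u)"
        unfolding A_nth[OF ij(1)] A_nth[OF ij(2)] ..
      also have "\<dots> = four_block_mat ?G (0\<^sub>m k codim) (0\<^sub>m codim k) (1\<^sub>m codim) $$ (i, j)"
        using ij by (auto simp: bs_normal frame_orthonormal[OF u] inner_commute[of "v _ u" "dir_deriv _ _ _"])
      finally show "Matrix.mat (k + codim) (k + codim) (\<lambda>(i, j). ?A ((bs @ cs) ! i) \<bullet> ?A ((bs @ cs) ! j)) $$ (i, j) =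
          four_block_mat ?G (0\<^sub>m k codim) (0\<^sub>m codim k) (1\<^sub>m codim) $$ (i, j)" .
    qed simp_all
    then have "(abs_det ?A)\<^sup>2 = Determinant.det (four_block_mat ?G (0\<^sub>m k codim) (0\<^sub>m codim k) (1\<^sub>m codim))"
      using abs_det_gram[OF bounded_linear.linear[OF A_lin] cs(1,2)] by simp
    also have "\<dots> = Determinant.det ?G * Determinant.det (1\<^sub>m codim)"
      by (rule det_four_block_mat_upper_right_zero) auto
    also have "\<dots> = gram_det bs \<psi> y"
      by (simp add: gram_det_def length_bs)
    finally have "sqrt (gram_det bs \<psi> y) = abs_det ?A"
      using real_sqrt_unique[of "abs_det ?A" "gram_det bs \<psi> y"] by simp
    then show ?thesis using y by (simp add: area_factor_def)
  qed
  moreover have "0 \<le> abs_det ?A" by simp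
  ultimately show ?thesis
    using deriv near unfolding y_def[symmetric]
    by (intro exI[of _ "\<lambda>w. ?A w + ?E (?A w)"] conjI) (simp_all add: split mult_right_mono)
qed

end

text \<open>By convexity the power lies below its chord on the interval from 0 to 1; the slope 2^n -
  1 is the increment of the power over that interval.\<close>

lemma power_one_plus_le:
  fixes x :: real
  assumes "0 \<le> x" "x \<le> 1"
  shows "(1 + x) ^ n \<le> 1 + (2 ^ n - 1) * x"
proof (induction n)
  case (Suc n)
  have "(1 + x) ^ Suc n \<le> (1 + (2 ^ n - 1) * x) * (1 + x)"
    using Suc assms by (simp add: mult.commute mult_left_mono)
  also have "\<dots> = 1 + 2 ^ n * x + (2 ^ n - 1) * (x * x)"
    by (simp add: algebra_simps)
  also have "\<dots> \<le> 1 + 2 ^ n * x + (2 ^ n - 1) * x"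
    using assms by (intro add_left_mono mult_left_mono) (auto simp: mult_left_le_one_le)
  finally show ?case by (simp add: algebra_simps)
qed simp

section \<open>Fibre integrals and the two-sided tube formula\<close>

context tubular_manifold
begin

text \<open>Off \<open>M\<close> the frame is replaced by zero, which makes it Borel measurable.\<close>

definition V :: "nat \<Rightarrow> 'a \<Rightarrow> 'a" where
  "V j u = indicator M u *\<^sub>R v j u"

lemma measurable_V [measurable]: "j < codim \<Longrightarrow> V j \<in> borel_measurable borel"
  unfolding V_def[abs_def]
  using M_borel smooth_map_on_imp_continuous_on[OF frame_smooth]
  by (intro borel_measurable_continuous_on_indicator)

abbreviation S :: "(nat \<Rightarrow> real) \<Rightarrow> 'a \<Rightarrow> 'a" where
  "S \<equiv> normal_map codim V"

abbreviation tnorm :: "(nat \<Rightarrow> real) \<Rightarrow> real" where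
  "tnorm t \<equiv> L2_set t {..<codim}"

lemma S_eq: "u \<in> M \<Longrightarrow> S t u = normal_map codim v t u"
  by (simp add: normal_map_def V_def)

lemma S_cong: "(\<And>j. j < codim \<Longrightarrow> t j = t' j) \<Longrightarrow> S t u = S t' u"
  by (simp add: normal_map_def)

lemma measurable_tnorm [measurable]: "tnorm \<in> borel_measurable (lborel_PiM codim)"
proof -
  have "(\<lambda>t. \<Sum>i<codim. (t i)\<^sup>2) \<in> borel_measurable (lborel_PiM codim)"
    by (intro borel_measurable_sum borel_measurable_power measurable_lborel_PiM_component) simp
  from measurable_compose[OF this borel_measurable_sqrt] show ?thesis
    unfolding L2_set_def .
qed

lemma measurable_S [measurable]: "(\<lambda>x. S (snd x) (fst x)) \<in> borel_measurable (borel \<Otimes>\<^sub>M lborel_PiM codim)"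
proof -
  have "(\<lambda>x. snd x j) \<in> borel_measurable (borel \<Otimes>\<^sub>M lborel_PiM codim)" if "j < codim" for j
    using measurable_compose[OF measurable_snd measurable_lborel_PiM_component[OF that]] .
  moreover have "(\<lambda>x. V j (fst x)) \<in> borel_measurable (borel \<Otimes>\<^sub>M lborel_PiM codim)" if "j < codim" for j
    using measurable_compose[OF measurable_fst measurable_V[OF that]] .
  ultimately show ?thesis
    unfolding normal_map_def by (intro borel_measurable_add borel_measurable_sum borel_measurable_scaleR measurable_fst) auto
qed

text \<open>The factor \<open>1 + \<sigma> * tnorm t\<close> stands in for the Jacobian of the
  normal map relative to the product of volume and fibre measure. It is used with \<sigma> = C for
  upper and with \<sigma> = - C for lower bounds.\<close>

definition fiber_integral :: "real \<Rightarrow> real \<Rightarrow> ('a \<Rightarrow> real) \<Rightarrow> 'a \<Rightarrow> ennreal" where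
  "fiber_integral \<sigma> \<delta> f u =
     (\<integral>\<^sup>+ t. indicator {t. tnorm t < \<delta>} t * ennreal (f (S t u) * (1 + \<sigma> * tnorm t)) \<partial>lborel_PiM codim)"

lemma measurable_fiber_integrand:
  assumes [measurable]: "f \<in> borel_measurable borel"
  shows "(\<lambda>(u, t). indicator {t. tnorm t < \<delta>} t * ennreal (f (S t u) * (1 + \<sigma> * tnorm t)))
    \<in> borel_measurable (borel \<Otimes>\<^sub>M lborel_PiM codim)"
proof -
  have "{t \<in> space (lborel_PiM codim). tnorm t < \<delta>} \<in> sets (lborel_PiM codim)" by measurable
  then have ind: "(\<lambda>t. indicator {t. tnorm t < \<delta>} t :: ennreal) \<in> borel_measurable (lborel_PiM codim)"
    by (subst measurable_cong[where g = "indicator {t \<in> space (lborel_PiM codim). tnorm t < \<delta>}"]) (auto simp: indicator_def)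
  have "(\<lambda>x. f (S (snd x) (fst x))) \<in> borel_measurable (borel \<Otimes>\<^sub>M lborel_PiM codim)"
    by (rule measurable_compose[OF measurable_S]) simp
  moreover have "(\<lambda>x. tnorm (snd x)) \<in> borel_measurable (borel \<Otimes>\<^sub>M lborel_PiM codim)"
    by (rule measurable_compose[OF measurable_snd measurable_tnorm])
  moreover have "(\<lambda>x. indicator {t. tnorm t < \<delta>} (snd x) :: ennreal) \<in> borel_measurable (borel \<Otimes>\<^sub>M lborel_PiM codim)"
    by (rule measurable_compose[OF measurable_snd ind])
  ultimately show ?thesis
    unfolding split_def
    by (intro borel_measurable_times_ennreal measurable_compose[OF _ measurable_ennreal] borel_measurable_times borel_measurable_add borel_measurable_const)
qed

lemma measurable_fiber_slice:
  assumes "f \<in> borel_measurable borel"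
  shows "(\<lambda>t. indicator {t. tnorm t < \<delta>} t * ennreal (f (S t u) * (1 + \<sigma> * tnorm t))) \<in> borel_measurable (lborel_PiM codim)"
  using measurable_compose[OF measurable_Pair1'[of u borel "lborel_PiM codim"] measurable_fiber_integrand[OF assms, of \<delta> \<sigma>]]
  by simp

lemma measurable_fiber_integral [measurable]:
  assumes "f \<in> borel_measurable borel"
  shows "fiber_integral \<sigma> \<delta> f \<in> borel_measurable borel"
proof -
  interpret product_sigma_finite "\<lambda>_::nat. lborel :: real measure" ..
  interpret J: finite_product_sigma_finite "\<lambda>_. lborel" "{..<codim}" by standard simp
  show ?thesis
    unfolding fiber_integral_def[abs_def]
    by (rule J.borel_measurable_nn_integral[OF measurable_fiber_integrand[OF assms]])
qed

text \<open>Base and fibre coordinates are merged into one ambient variable \<open>z\<close>, whose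
  projection to the span of \<open>bs\<close> is the chart coordinate and whose components along
  \<open>cs\<close> are the fibre coordinates. This puts the fibre integral on the domain where the
  change of variables applies.\<close>

lemma fiber_integral_piece_measure:
  assumes chart: "chart k M bs U \<psi>"
    and cs: "distinct (bs @ cs)" "set (bs @ cs) = Basis" "length cs = codim"
    and B [measurable]: "B \<in> sets borel" and f [measurable]: "f \<in> borel_measurable borel"
  shows "(\<integral>\<^sup>+ u. fiber_integral \<sigma> \<delta> f u \<partial>chart.piece_measure bs U \<psi> B) =
    (\<integral>\<^sup>+ z. indicator {z. coord_proj bs z \<in> U \<and> \<psi> (coord_proj bs z) \<in> B \<and> tnorm (\<lambda>j. z \<bullet> cs ! j) < \<delta>} z *
      ennreal (f (normal_map codim v (\<lambda>j. z \<bullet> cs ! j) (\<psi> (coord_proj bs z))) *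
        ((1 + \<sigma> * tnorm (\<lambda>j. z \<bullet> cs ! j)) * chart.area_factor bs U \<psi> (coord_proj bs z))) \<partial>lborel)"
proof -
  interpret chart k M bs U \<psi> by (rule chart)
  let ?t = "\<lambda>z j. z \<bullet> cs ! j"
  let ?P = "coord_proj bs"
  define H where "H y t = indicator B (chart_map y) * ennreal (area_factor y) *
      (indicator {t. tnorm t < \<delta>} t * ennreal (f (S t (chart_map y)) * (1 + \<sigma> * tnorm t)))" for y t
  \<comment> \<open>A square root of a real is nonnegative only if its argument is. Here the sign is
    read off from the derivative bounds at \<open>t = 0\<close>, which place an absolute determinant
    below the area factor.\<close>
  have area: "0 \<le> area_factor y" for y
  proof (cases "y \<in> U")
    case True
    obtain L where L: "frame_bound L" using frame_extension by blast
    have y: "?P y = y" using True U_subset distinct_bs bs_subset by (intro coord_proj_span) auto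
    have "y \<bullet> cs ! j = 0" if "j < codim" for j
    proof -
      have "cs ! j \<in> set cs" using that cs(3) by simp
      then have "cs ! j \<in> Basis" "cs ! j \<notin> set bs" using cs(1) unfolding cs(2)[symmetric] by auto
      from coord_sum_inner_other[OF bs_subset this]
      show ?thesis using y coord_proj_eq_coord_sum[of bs y] by metis
    qed
    then have t0: "tnorm (?t y) = 0" by (simp add: L2_set_def)
    have "?P y \<in> U" using True y by simp
    have "real codim * (L * real (1 + codim)) * tnorm (?t y) < 1" by (simp add: t0)
    from normal_map_chart_derivative[OF L chart cs \<open>?P y \<in> U\<close> refl this]
    obtain \<Phi>' :: "'a \<Rightarrow> 'a" where "abs_det \<Phi>' \<le> (1 + real codim * (L * real (1 + codim)) * tnorm (?t y)) ^ DIM('a) * area_factor (?P y)"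
      by (elim exE conjE) (rule that)
    then have "abs_det \<Phi>' \<le> area_factor y" by (simp add: t0 y)
    then show ?thesis using order.trans[OF abs_det_nonneg] by blast
  qed (simp add: area_factor_def)
  have meas_t: "(\<lambda>z. tnorm (?t z)) \<in> borel_measurable borel"
    unfolding L2_set_def by measurable
  have meas_S: "(\<lambda>z. S (?t z) (chart_map (?P z))) \<in> borel_measurable borel"
  proof -
    have "?P \<in> borel_measurable borel"
      by (intro borel_measurable_continuous_onI linear_continuous_on bounded_linear_coord_proj)
    then have chi: "(\<lambda>z. chart_map (?P z)) \<in> borel_measurable borel" by measurable
    have "(\<lambda>z. V j (chart_map (?P z))) \<in> borel_measurable borel" if "j < codim" for j
      using measurable_compose[OF chi measurable_V[OF that]] .
    then show ?thesis
      unfolding normal_map_def by (intro borel_measurable_add borel_measurable_sum borel_measurable_scaleR chi) auto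
  qed
  have meas_P [measurable]: "?P \<in> borel_measurable borel"
    by (intro borel_measurable_continuous_onI linear_continuous_on bounded_linear_coord_proj)
  have meas_H: "(\<lambda>z. H (?P z) (?t z)) \<in> borel_measurable borel"
  proof -
    have "{z \<in> space borel. tnorm (?t z) < \<delta>} \<in> sets borel" using meas_t by measurable
    then have "(\<lambda>z. indicator {t. tnorm t < \<delta>} (?t z) :: ennreal) \<in> borel_measurable borel"
      by (subst measurable_cong[where g = "indicator {z \<in> space borel. tnorm (?t z) < \<delta>}"]) (auto simp: indicator_def)
    then show ?thesis
      unfolding H_def using measurable_compose[OF meas_S f] meas_t by measurable
  qed
  have "(\<integral>\<^sup>+ z. H (?P z) (?t z) \<partial>lborel) =
      (\<integral>\<^sup>+ y. (\<integral>\<^sup>+ t. H (?P (y + coord_sum cs t)) (?t (y + coord_sum cs t)) \<partial>lborel_PiM codim) \<partial>lebesgue_coord bs)"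
    using nn_integral_lborel_split[OF cs(1,2) meas_H] unfolding cs(3) .
  also have "\<dots> = (\<integral>\<^sup>+ y. (\<integral>\<^sup>+ t. H y t \<partial>lborel_PiM codim) \<partial>lebesgue_coord bs)"
  proof (rule nn_integral_cong_AE)
    show "AE y in lebesgue_coord bs. (\<integral>\<^sup>+ t. H (?P (y + coord_sum cs t)) (?t (y + coord_sum cs t)) \<partial>lborel_PiM codim) =
        (\<integral>\<^sup>+ t. H y t \<partial>lborel_PiM codim)"
      using AE_lebesgue_coord_span
    proof eventually_elim
      case (elim y)
      have y: "?P y = y" using elim distinct_bs bs_subset by (intro coord_proj_span)
      have dist_cs: "distinct cs" and disj: "set bs \<inter> set cs = {}" using cs(1) by simp_all
      have cs_sub: "set cs \<subseteq> Basis" unfolding cs(2)[symmetric] by simp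
      have P: "?P (y + coord_sum cs t) = y" for t
      proof -
        have "coord_sum cs t \<bullet> bs ! i = 0" if "i < length bs" for i
          using disj bs_subset nth_mem[OF that] by (intro coord_sum_inner_other cs_sub) blast+
        then have "?P (coord_sum cs t) = 0" by (simp add: coord_proj_def)
        then show ?thesis
          by (simp add: linear_add[OF bounded_linear.linear[OF bounded_linear_coord_proj]] y)
      qed
      have T: "?t (y + coord_sum cs t) j = t j" if j: "j < codim" for t j
      proof -
        have "cs ! j \<in> set cs" using j cs(3) by simp
        then have "cs ! j \<in> Basis" "cs ! j \<notin> set bs" using cs_sub disj by auto
        from coord_sum_inner_other[OF bs_subset this] have "y \<bullet> cs ! j = 0"
          using y coord_proj_eq_coord_sum[of bs y] by metis
        then show ?thesis
          using coord_sum_inner_nth[OF dist_cs cs_sub, of j t] j cs(3) by (simp add: inner_add_left)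
      qed
      have "H (?P (y + coord_sum cs t)) (?t (y + coord_sum cs t)) = H y t" for t
      proof -
        have "tnorm (?t (y + coord_sum cs t)) = tnorm t"
          by (rule L2_set_cong) (use T in auto)
        moreover have "S (?t (y + coord_sum cs t)) (chart_map y) = S t (chart_map y)"
          by (rule S_cong) (use T in auto)
        ultimately show ?thesis
          unfolding H_def P by (simp add: indicator_def)
      qed
      then show ?case by simp
    qed
  qed
  also have "\<dots> = (\<integral>\<^sup>+ y. indicator B (chart_map y) * ennreal (area_factor y) * fiber_integral \<sigma> \<delta> f (chart_map y) \<partial>lebesgue_coord bs)"
    unfolding H_def fiber_integral_def
    by (intro nn_integral_cong nn_integral_cmult measurable_fiber_slice f)
  also have "\<dots> = (\<integral>\<^sup>+ u. fiber_integral \<sigma> \<delta> f u \<partial>piece_measure B)"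
    by (rule nn_integral_piece_measure[OF B measurable_fiber_integral[OF f], symmetric])
  finally have "(\<integral>\<^sup>+ u. fiber_integral \<sigma> \<delta> f u \<partial>piece_measure B) = (\<integral>\<^sup>+ z. H (?P z) (?t z) \<partial>lborel)" ..
  also have "\<dots> = (\<integral>\<^sup>+ z. indicator {z. ?P z \<in> U \<and> \<psi> (?P z) \<in> B \<and> tnorm (?t z) < \<delta>} z *
      ennreal (f (normal_map codim v (?t z) (\<psi> (?P z))) * ((1 + \<sigma> * tnorm (?t z)) * area_factor (?P z))) \<partial>lborel)"
  proof (rule nn_integral_cong)
    fix z
    show "H (?P z) (?t z) = indicator {z. ?P z \<in> U \<and> \<psi> (?P z) \<in> B \<and> tnorm (?t z) < \<delta>} z *
      ennreal (f (normal_map codim v (?t z) (\<psi> (?P z))) * ((1 + \<sigma> * tnorm (?t z)) * area_factor (?P z)))"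
    proof (cases "?P z \<in> U")
      case True
      then have "S (?t z) (\<psi> (?P z)) = normal_map codim v (?t z) (\<psi> (?P z))"
        using image_subset by (intro S_eq) auto
      then show ?thesis
        using True unfolding H_def
        by (auto simp: indicator_def ennreal_mult'[OF area, symmetric] mult_ac)
    next
      case False
      then show ?thesis by (simp add: H_def area_factor_def)
    qed
  qed
  finally show ?thesis .
qed

text \<open>Change of variables for the normal map on the set \<open>D\<close> of coordinates: its
  image is the part of the tube over the given piece of the chart, and its Jacobian lies within the
  factors 1 - C|t| and 1 + C|t| of the area factor, with C = 2^d K for ambient dimension d.\<close>

lemma tube_formula_chart:
  fixes L \<delta> K :: real
  assumes L: "frame_bound L"
    and K: "K = codim * (L * (1 + codim))" "K * \<delta> < 1" and \<delta>: "\<delta> \<le> \<epsilon>"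
    and chart: "chart k M bs U \<psi>"
    and B [measurable]: "B \<in> sets borel" and img [measurable]: "\<psi> ` U \<in> sets borel"
    and f [measurable]: "f \<in> borel_measurable borel" and f_nonneg: "\<And>x. 0 \<le> f x"
  shows "(\<integral>\<^sup>+ x. indicator {x \<in> tube M \<delta>. foot x \<in> \<psi> ` U \<inter> B} x * ennreal (f x) \<partial>lborel)
      \<le> (\<integral>\<^sup>+ u. fiber_integral (2 ^ DIM('a) * K) \<delta> f u \<partial>chart.piece_measure bs U \<psi> B)"
    and "(\<integral>\<^sup>+ u. fiber_integral (- (2 ^ DIM('a) * K)) \<delta> f u \<partial>chart.piece_measure bs U \<psi> B)
      \<le> (\<integral>\<^sup>+ x. indicator {x \<in> tube M \<delta>. foot x \<in> \<psi> ` U \<inter> B} x * ennreal (f x) \<partial>lborel)"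
proof -
  interpret chart k M bs U \<psi> by (rule chart)
  obtain cs where cs12: "distinct (bs @ cs)" "set (bs @ cs) = Basis" and "length cs = DIM('a) - length bs"
    by (rule complementary_basis_list[OF distinct_bs bs_subset]) blast
  then have "length cs = codim" by (simp only: codim_eq length_bs)
  note cs = cs12 this
  have K0: "0 \<le> K" unfolding K(1) using frame_boundD(1)[OF L] by (intro mult_nonneg_nonneg) auto
  let ?C = "2 ^ DIM('a) * K"
  let ?t = "\<lambda>z j. z \<bullet> cs ! j" and ?P = "coord_proj bs"
  let ?\<Phi> = "\<lambda>z. normal_map codim v (?t z) (\<psi> (?P z))"
  define D where "D = {z. ?P z \<in> U \<and> \<psi> (?P z) \<in> B \<and> tnorm (?t z) < \<delta>}"
  have "\<exists>\<Phi>'. (?\<Phi> has_derivative \<Phi>') (at z) \<and>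
      (1 - ?C * tnorm (?t z)) * area_factor (?P z) \<le> abs_det \<Phi>' \<and>
      abs_det \<Phi>' \<le> (1 + ?C * tnorm (?t z)) * area_factor (?P z)" if "z \<in> D" for z
  proof -
    have z: "?P z \<in> U" "tnorm (?t z) < \<delta>" using that by (simp_all add: D_def)
    define \<eta> where "\<eta> = K * tnorm (?t z)"
    have \<eta>0: "0 \<le> \<eta>" using K0 by (simp add: \<eta>_def)
    have \<eta>1: "\<eta> < 1"
      using K(2) mult_left_mono[OF less_imp_le[OF z(2)] K0] by (simp add: \<eta>_def)
    obtain \<Phi>' where \<Phi>': "(?\<Phi> has_derivative \<Phi>') (at z)"
      "(1 - \<eta>) ^ DIM('a) * area_factor (?P z) \<le> abs_det \<Phi>'"
      "abs_det \<Phi>' \<le> (1 + \<eta>) ^ DIM('a) * area_factor (?P z)"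
      using normal_map_chart_derivative[OF L chart cs z(1) \<eta>_def[unfolded K(1)] \<eta>1] by blast
    have area: "0 \<le> area_factor (?P z)"
    proof -
      have "0 \<le> (1 + \<eta>) ^ DIM('a) * area_factor (?P z)"
        using order.trans[OF abs_det_nonneg \<Phi>'(3)] .
      moreover have "0 < (1 + \<eta>) ^ DIM('a)" using \<eta>0 by simp
      ultimately show ?thesis by (simp add: zero_le_mult_iff)
    qed
    have "(1 + \<eta>) ^ DIM('a) \<le> 1 + ?C * tnorm (?t z)"
    proof -
      have "(1 + \<eta>) ^ DIM('a) \<le> 1 + (2 ^ DIM('a) - 1) * \<eta>"
        using \<eta>0 \<eta>1 by (intro power_one_plus_le) auto
      also have "\<dots> \<le> 1 + 2 ^ DIM('a) * \<eta>" using \<eta>0 by (intro add_left_mono mult_right_mono) auto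
      finally show ?thesis by (simp add: \<eta>_def mult.assoc)
    qed
    \<comment> \<open>Bernoulli's inequality gives the slope \<open>DIM('a)\<close>, which is
      enlarged to \<open>2 ^ DIM('a)\<close> so that one constant serves both directions.\<close>
    moreover have "1 - ?C * tnorm (?t z) \<le> (1 - \<eta>) ^ DIM('a)"
    proof -
      have "real DIM('a) \<le> 2 ^ DIM('a)"
        using of_nat_mono[OF less_imp_le[OF less_exp[of "DIM('a)"]]] by (metis of_nat_numeral of_nat_power)
      then have "1 - 2 ^ DIM('a) * \<eta> \<le> 1 + real DIM('a) * (- \<eta>)"
        using \<eta>0 mult_right_mono[of "real DIM('a)" "2 ^ DIM('a)" \<eta>] by simp
      also have "\<dots> \<le> (1 + - \<eta>) ^ DIM('a)"
        using \<eta>1 by (intro Bernoulli_inequality) simp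
      finally show ?thesis by (simp add: \<eta>_def mult.assoc)
    qed
    ultimately have "(1 - ?C * tnorm (?t z)) * area_factor (?P z) \<le> abs_det \<Phi>'"
      "abs_det \<Phi>' \<le> (1 + ?C * tnorm (?t z)) * area_factor (?P z)"
      using order.trans[OF mult_right_mono[OF _ area] \<Phi>'(2)] order.trans[OF \<Phi>'(3) mult_right_mono[OF _ area]]
      by simp_all
    with \<Phi>'(1) show ?thesis by (intro exI[of _ \<Phi>'] conjI)
  qed
  then have "\<forall>z\<in>D. \<exists>\<Phi>'. (?\<Phi> has_derivative \<Phi>') (at z) \<and>
      (1 - ?C * tnorm (?t z)) * area_factor (?P z) \<le> abs_det \<Phi>' \<and>
      abs_det \<Phi>' \<le> (1 + ?C * tnorm (?t z)) * area_factor (?P z)"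
    by (intro ballI)
  from bchoice[OF this] obtain \<Phi>' where *: "\<forall>z\<in>D. (?\<Phi> has_derivative \<Phi>' z) (at z) \<and>
      (1 - ?C * tnorm (?t z)) * area_factor (?P z) \<le> abs_det (\<Phi>' z) \<and>
      abs_det (\<Phi>' z) \<le> (1 + ?C * tnorm (?t z)) * area_factor (?P z)" ..
  have der: "\<And>z. z \<in> D \<Longrightarrow> (?\<Phi> has_derivative \<Phi>' z) (at z)"
    and low: "\<And>z. z \<in> D \<Longrightarrow> (1 - ?C * tnorm (?t z)) * area_factor (?P z) \<le> abs_det (\<Phi>' z)"
    and upp: "\<And>z. z \<in> D \<Longrightarrow> abs_det (\<Phi>' z) \<le> (1 + ?C * tnorm (?t z)) * area_factor (?P z)"
    using * by simp_all
  have meas_P [measurable]: "?P \<in> borel_measurable borel"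
    by (intro borel_measurable_continuous_onI linear_continuous_on bounded_linear_coord_proj)
  have D_borel: "D \<in> sets borel"
  proof -
    have [measurable]: "(\<lambda>z. tnorm (?t z)) \<in> borel_measurable borel"
      unfolding L2_set_def by measurable
    have "{z \<in> space borel. ?P z \<in> U \<and> chart_map (?P z) \<in> B \<and> tnorm (?t z) < \<delta>} \<in> sets borel" by measurable
    moreover have "{z \<in> space borel. ?P z \<in> U \<and> chart_map (?P z) \<in> B \<and> tnorm (?t z) < \<delta>} = D"
      by (auto simp: D_def)
    ultimately show ?thesis by (simp only:)
  qed
  have image: "?\<Phi> ` D = {x \<in> tube M \<delta>. foot x \<in> \<psi> ` U \<inter> B}"
  proof (intro equalityI subsetI)
    fix x assume "x \<in> ?\<Phi> ` D"
    then obtain z where z: "z \<in> D" "x = ?\<Phi> z" by blast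
    have u: "\<psi> (?P z) \<in> M" using z image_subset by (auto simp: D_def)
    moreover have "tnorm (?t z) < \<delta>" using z by (simp add: D_def)
    ultimately have "x \<in> tube M \<delta>" "foot x = \<psi> (?P z)"
      using z(2) \<delta> foot_normal_map[OF u, of "?t z"] by (auto simp: mem_tube_iff)
    then show "x \<in> {x \<in> tube M \<delta>. foot x \<in> \<psi> ` U \<inter> B}"
      using z by (simp add: D_def)
  next
    fix x assume "x \<in> {x \<in> tube M \<delta>. foot x \<in> \<psi> ` U \<inter> B}"
    then have x: "x \<in> tube M \<delta>" "foot x \<in> \<psi> ` U" "foot x \<in> B" by auto
    obtain u t where u: "u \<in> M" and t: "tnorm t < \<delta>" "x = normal_map codim v t u"
      using x(1) unfolding mem_tube_iff by blast
    have "foot x = u" using foot_normal_map[OF u, of t] t \<delta> by simp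
    then obtain y where y: "y \<in> U" "u = \<psi> y" using x(2) by blast
    let ?z = "y + coord_sum cs t"
    have dist_cs: "distinct cs" and disj: "set bs \<inter> set cs = {}" using cs(1) by simp_all
    have cs_sub: "set cs \<subseteq> Basis" unfolding cs(2)[symmetric] by simp
    have Py: "?P y = y" using y U_subset distinct_bs bs_subset by (intro coord_proj_span) auto
    have P: "?P ?z = y"
    proof -
      have "coord_sum cs t \<bullet> bs ! i = 0" if "i < length bs" for i
        using disj bs_subset nth_mem[OF that] by (intro coord_sum_inner_other cs_sub) blast+
      then have "?P (coord_sum cs t) = 0" by (simp add: coord_proj_def)
      then show ?thesis
        by (simp add: linear_add[OF bounded_linear.linear[OF bounded_linear_coord_proj]] Py)
    qed
    have T: "?t ?z j = t j" if j: "j < codim" for j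
    proof -
      have "cs ! j \<in> set cs" using j cs(3) by simp
      then have "cs ! j \<in> Basis" "cs ! j \<notin> set bs" using cs_sub disj by auto
      from coord_sum_inner_other[OF bs_subset this] have "y \<bullet> cs ! j = 0"
        using Py coord_proj_eq_coord_sum[of bs y] by metis
      then show ?thesis
        using coord_sum_inner_nth[OF dist_cs cs_sub, of j t] j cs(3) by (simp add: inner_add_left)
    qed
    have "tnorm (?t ?z) = tnorm t" by (rule L2_set_cong) (use T in auto)
    then have "?z \<in> D" using P y t x(3) \<open>foot x = u\<close> by (simp add: D_def)
    moreover have "?\<Phi> ?z = x" unfolding P using t(2) y(2) T by (simp add: normal_map_def)
    ultimately show "x \<in> ?\<Phi> ` D" by (intro image_eqI[of _ _ ?z]) simp_all
  qed
  have [measurable]: "tube M \<delta> \<in> sets borel" using \<delta> by (rule tube_borel)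
  have image_borel: "?\<Phi> ` D \<in> sets borel"
  proof -
    have "{x \<in> space borel. x \<in> tube M \<delta> \<and> foot x \<in> \<psi> ` U \<inter> B} \<in> sets borel" by measurable
    then show ?thesis unfolding image by simp
  qed
  \<comment> \<open>The foot point recovers the chart coordinate, and pairing with the frame
    recovers the fibre coordinates.\<close>
  have inj: "inj_on ?\<Phi> D"
  proof (rule inj_onI)
    fix z z' assume z: "z \<in> D" "z' \<in> D" and eq: "?\<Phi> z = ?\<Phi> z'"
    have u: "\<psi> (?P z) \<in> M" "\<psi> (?P z') \<in> M" using z image_subset by (auto simp: D_def)
    have "tnorm (?t z) < \<epsilon>" "tnorm (?t z') < \<epsilon>" using z \<delta> by (auto simp: D_def)
    then have ueq: "\<psi> (?P z) = \<psi> (?P z')"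
      using eq foot_normal_map[OF u(1), of "?t z"] foot_normal_map[OF u(2), of "?t z'"] by metis
    then have Peq: "?P z = ?P z'"
      using inj_onD[OF inj_\<psi>] z by (simp add: D_def)
    have "(\<Sum>j<codim. ?t z j *\<^sub>R v j (\<psi> (?P z))) = (\<Sum>j<codim. ?t z' j *\<^sub>R v j (\<psi> (?P z)))"
      using eq ueq by (simp add: normal_map_def)
    then have "?t z j = ?t z' j" if "j < codim" for j
      using frame_sum_inner[OF u(1) that, of "?t z"] frame_sum_inner[OF u(1) that, of "?t z'"] by metis
    then have "coord_proj cs z = coord_proj cs z'"
      using cs(3) by (simp add: coord_proj_def)
    then show "z = z'"
      using Peq coord_decomposition[OF cs(1,2)] by metis
  qed
  have cov: "(\<integral>\<^sup>+ x. indicator {x \<in> tube M \<delta>. foot x \<in> \<psi> ` U \<inter> B} x * ennreal (f x) \<partial>lborel) =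
      (\<integral>\<^sup>+ z. indicator D z * ennreal (f (?\<Phi> z) * abs_det (\<Phi>' z)) \<partial>lborel)"
    unfolding image[symmetric]
    by (rule nn_integral_change_of_variables[OF D_borel image_borel f f_nonneg der inj])
  show "(\<integral>\<^sup>+ x. indicator {x \<in> tube M \<delta>. foot x \<in> \<psi> ` U \<inter> B} x * ennreal (f x) \<partial>lborel)
      \<le> (\<integral>\<^sup>+ u. fiber_integral ?C \<delta> f u \<partial>piece_measure B)"
    unfolding cov fiber_integral_piece_measure[OF chart cs B f] D_def[symmetric]
    by (intro nn_integral_mono) (auto simp: indicator_def intro!: ennreal_leI mult_left_mono upp f_nonneg)
  show "(\<integral>\<^sup>+ u. fiber_integral (- ?C) \<delta> f u \<partial>piece_measure B)
      \<le> (\<integral>\<^sup>+ x. indicator {x \<in> tube M \<delta>. foot x \<in> \<psi> ` U \<inter> B} x * ennreal (f x) \<partial>lborel)"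
    unfolding cov fiber_integral_piece_measure[OF chart cs B f] D_def[symmetric]
  proof (intro nn_integral_mono)
    fix z
    show "indicator D z * ennreal (f (?\<Phi> z) * ((1 + - ?C * tnorm (?t z)) * area_factor (?P z)))
        \<le> indicator D z * ennreal (f (?\<Phi> z) * abs_det (\<Phi>' z))"
      using low[of z] f_nonneg[of "?\<Phi> z"] by (auto simp: indicator_def intro!: ennreal_leI mult_left_mono)
  qed
qed

text \<open>The tube is cut according to the first chart whose image contains the foot point, in
  parallel with the pieces of the volume measure, and the chart-wise estimates are added. The
  condition \<open>C * \<delta>0 \<le> 1\<close> keeps the lower factor 1 - C|t| nonnegative inside
  the tube.\<close>

lemma tube_formula:
  obtains C \<delta>0 where "0 \<le> C" "0 < \<delta>0" "\<delta>0 \<le> \<epsilon>" "C * \<delta>0 \<le> 1"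
    "\<And>\<delta> f. \<delta> \<le> \<delta>0 \<Longrightarrow> f \<in> borel_measurable borel \<Longrightarrow> (\<And>x. 0 \<le> f x) \<Longrightarrow>
      (\<integral>\<^sup>+ x. indicator (tube M \<delta>) x * ennreal (f x) \<partial>lborel) \<le> (\<integral>\<^sup>+ u. fiber_integral C \<delta> f u \<partial>vol)"
    "\<And>\<delta> f. \<delta> \<le> \<delta>0 \<Longrightarrow> f \<in> borel_measurable borel \<Longrightarrow> (\<And>x. 0 \<le> f x) \<Longrightarrow>
      (\<integral>\<^sup>+ u. fiber_integral (- C) \<delta> f u \<partial>vol) \<le> (\<integral>\<^sup>+ x. indicator (tube M \<delta>) x * ennreal (f x) \<partial>lborel)"
proof -
  obtain L where L: "frame_bound L" using frame_extension by blast
  define K where "K = codim * (L * (1 + codim))"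
  define C where "C = 2 ^ DIM('a) * K"
  \<comment> \<open>The bound 1 / (1 + C + K) secures \<open>K * \<delta> < 1\<close>, which keeps
    the shape operator below 1, together with \<open>C * \<delta>0 \<le> 1\<close>.\<close>
  define \<delta>0 where "\<delta>0 = min \<epsilon> (1 / (1 + C + K))"
  have K0: "0 \<le> K" unfolding K_def using frame_boundD(1)[OF L] by (intro mult_nonneg_nonneg) auto
  then have C0: "0 \<le> C" by (simp add: C_def)
  have \<delta>0: "0 < \<delta>0" "\<delta>0 \<le> \<epsilon>" using radius_pos K0 C0 by (auto simp: \<delta>0_def)
  have le: "\<delta>0 \<le> 1 / (1 + C + K)" by (simp add: \<delta>0_def)
  have "C * \<delta>0 \<le> C * (1 / (1 + C + K))" using le C0 by (rule mult_left_mono)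
  also have "\<dots> \<le> 1" using K0 C0 by (simp add: divide_simps)
  finally have C1: "C * \<delta>0 \<le> 1" .
  have K1: "K * \<delta> < 1" if "\<delta> \<le> \<delta>0" for \<delta>
  proof -
    have "K * \<delta> \<le> K * (1 / (1 + C + K))" using le that K0 by (intro mult_left_mono) auto
    also have "\<dots> < 1" using K0 C0 by (simp add: divide_simps)
    finally show ?thesis .
  qed
  define E where "E \<delta> j = {x \<in> tube M \<delta>. foot x \<in> param_image (atlas ! j) \<inter> - earlier j}" for \<delta> j
  have E_borel: "E \<delta> j \<in> sets borel" if "\<delta> \<le> \<delta>0" "j < length atlas" for \<delta> j
  proof -
    have [measurable]: "tube M \<delta> \<in> sets borel" using that \<delta>0 by (intro tube_borel) simp
    note [measurable] = param_image_borel[OF that(2)] earlier_borel[OF that(2)]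
    have "{x \<in> space borel. x \<in> tube M \<delta> \<and> foot x \<in> param_image (atlas ! j) \<inter> - earlier j} \<in> sets borel"
      by measurable
    then show ?thesis by (simp add: E_def)
  qed
  have disj: "disjoint_family_on (E \<delta>) {..<length atlas}" for \<delta>
  proof -
    have "E \<delta> i \<inter> E \<delta> j = {}" if "i < j" for i j
      using that by (auto simp: E_def earlier_def)
    then show ?thesis
      unfolding disjoint_family_on_def by (metis Int_commute linorder_neqE_nat)
  qed
  have cover: "(\<Union>j<length atlas. E \<delta> j) = tube M \<delta>" if "\<delta> \<le> \<delta>0" for \<delta>
  proof (intro equalityI subsetI)
    fix x assume x: "x \<in> tube M \<delta>"
    then have "foot x \<in> M"
      using that \<delta>0 foot_mem tube_eq_foot[of \<delta>] by auto
    then obtain c where "c \<in> set atlas" "foot x \<in> param_image c"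
      using finite_atlas unfolding finite_atlas_def by blast
    then have ex: "\<exists>j. j < length atlas \<and> foot x \<in> param_image (atlas ! j)"
      by (metis in_set_conv_nth)
    define j where "j = (LEAST j. j < length atlas \<and> foot x \<in> param_image (atlas ! j))"
    have j: "j < length atlas" "foot x \<in> param_image (atlas ! j)"
      using LeastI_ex[OF ex] by (auto simp: j_def)
    moreover have "foot x \<notin> param_image (atlas ! i)" if "i < j" for i
      using not_less_Least[OF that[unfolded j_def]] that j(1) by simp
    ultimately show "x \<in> (\<Union>j<length atlas. E \<delta> j)"
      using x by (auto simp: E_def earlier_def)
  qed (auto simp: E_def)
  have split: "(\<integral>\<^sup>+ x. indicator (tube M \<delta>) x * ennreal (f x) \<partial>lborel) =
      (\<Sum>j<length atlas. \<integral>\<^sup>+ x. indicator (E \<delta> j) x * ennreal (f x) \<partial>lborel)"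
    if "\<delta> \<le> \<delta>0" and [measurable]: "f \<in> borel_measurable borel" for \<delta> f
  proof -
    have "(\<integral>\<^sup>+ x. indicator (tube M \<delta>) x * ennreal (f x) \<partial>lborel) =
        (\<integral>\<^sup>+ x. (\<Sum>j<length atlas. indicator (E \<delta> j) x * ennreal (f x)) \<partial>lborel)"
      unfolding cover[OF that(1), symmetric] indicator_UN_disjoint[OF finite_lessThan disj]
      by (simp add: sum_distrib_right)
    also have "\<dots> = (\<Sum>j<length atlas. \<integral>\<^sup>+ x. indicator (E \<delta> j) x * ennreal (f x) \<partial>lborel)"
      using E_borel[OF that(1)] by (intro nn_integral_sum) auto
    finally show ?thesis .
  qed
  have vol: "(\<integral>\<^sup>+ u. fiber_integral \<sigma> \<delta> f u \<partial>vol) = (\<Sum>j<length atlas. \<integral>\<^sup>+ u. fiber_integral \<sigma> \<delta> f u \<partial>piece j)"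
    if "f \<in> borel_measurable borel" for \<sigma> \<delta> f
    using that by (intro nn_integral_vol measurable_fiber_integral)
  have "(\<integral>\<^sup>+ x. indicator (E \<delta> j) x * ennreal (f x) \<partial>lborel) \<le> (\<integral>\<^sup>+ u. fiber_integral C \<delta> f u \<partial>piece j) \<and>
      (\<integral>\<^sup>+ u. fiber_integral (- C) \<delta> f u \<partial>piece j) \<le> (\<integral>\<^sup>+ x. indicator (E \<delta> j) x * ennreal (f x) \<partial>lborel)"
    if \<delta>: "\<delta> \<le> \<delta>0" and f: "f \<in> borel_measurable borel" "\<And>x. 0 \<le> f x" and j: "j < length atlas" for \<delta> f j
  proof -
    obtain bs U \<psi> where eq: "atlas ! j = (bs, U, \<psi>)" by (rule prod_cases3)
    have img: "\<psi> ` U \<in> sets borel" using param_image_borel[OF j] by (simp add: eq param_image_def)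
    have B: "- earlier j \<in> sets borel" using earlier_borel[OF j] by simp
    have "\<delta> \<le> \<epsilon>" using \<delta> \<delta>0 by simp
    from tube_formula_chart[OF L K_def K1[OF \<delta>] this chart_atlas[OF j eq] B img f]
    show ?thesis by (simp add: C_def E_def eq param_image_def piece_def)
  qed
  note bound = this
  show ?thesis
  proof (rule that[OF C0 \<delta>0 C1])
    fix \<delta> and f :: "'a \<Rightarrow> real" assume \<delta>: "\<delta> \<le> \<delta>0" and f: "f \<in> borel_measurable borel" "\<And>x. 0 \<le> f x"
    show "(\<integral>\<^sup>+ x. indicator (tube M \<delta>) x * ennreal (f x) \<partial>lborel) \<le> (\<integral>\<^sup>+ u. fiber_integral C \<delta> f u \<partial>vol)"
      unfolding split[OF \<delta> f(1)] vol[OF f(1)] using bound[OF \<delta> f] by (intro sum_mono) simp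
    show "(\<integral>\<^sup>+ u. fiber_integral (- C) \<delta> f u \<partial>vol) \<le> (\<integral>\<^sup>+ x. indicator (tube M \<delta>) x * ennreal (f x) \<partial>lborel)"
      unfolding split[OF \<delta> f(1)] vol[OF f(1)] using bound[OF \<delta> f] by (intro sum_mono) simp
  qed
qed

end

section \<open>Laplace's method along the normal fibres\<close>

text \<open>Chosen to dominate 1, 2/a and 2/a^2 at once. With y = a x^2 one has 1 + 2 x^2 + x^4 = 1
  + (2/a) y + (2/a^2) (y^2/2), which is then at most this constant times exp y.\<close>

definition moment_const :: "real \<Rightarrow> real" where
  "moment_const a = 1 + 2 / a + 2 / a\<^sup>2"

text \<open>After the substitution x = sqrt n * s the left factor becomes (x + x^3) / sqrt n. The
  polynomial in x is paid for with half of the Gaussian exponent, and n^(-1/2) remains.\<close>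

lemma moment_le_exp:
  fixes a n s :: real
  assumes "0 < a" "0 < n" "0 \<le> s"
  shows "(s + n * s ^ 3) * exp (- (2 * a * n * s\<^sup>2)) \<le> moment_const a / sqrt n * exp (- (a * n * s\<^sup>2))"
proof -
  define x where "x = sqrt n * s"
  have x2: "x\<^sup>2 = n * s\<^sup>2" using assms by (simp add: x_def power_mult_distrib)
  have "s + n * s ^ 3 = (x + x ^ 3) / sqrt n"
  proof -
    have "x + x ^ 3 = x + x\<^sup>2 * x" by (simp add: power3_eq_cube power2_eq_square)
    then have "x + x ^ 3 = sqrt n * (s + n * s ^ 3)"
      unfolding x2 by (simp add: x_def algebra_simps power3_eq_cube power2_eq_square)
    then show ?thesis using assms by simp
  qed
  moreover have "x + x ^ 3 \<le> moment_const a * exp (a * x\<^sup>2)"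
  proof -
    define y where "y = a * x\<^sup>2"
    have y: "0 \<le> y" "x\<^sup>2 = y / a" using assms by (simp_all add: y_def)
    have sq: "x \<le> 1 + x\<^sup>2"
      using zero_le_power2[of "x - 1 / 2"] by (simp add: power2_diff power_divide)
    have "x\<^sup>2 * x \<le> x\<^sup>2 * (1 + x\<^sup>2)"
      using sq by (intro mult_left_mono) auto
    then have "x + x ^ 3 \<le> 1 + 2 * x\<^sup>2 + (x\<^sup>2)\<^sup>2"
      using sq by (simp add: power3_eq_cube power2_eq_square algebra_simps)
    also have "\<dots> = 1 * 1 + 2 / a * y + 2 / a\<^sup>2 * (y\<^sup>2 / 2)"
      by (simp add: y(2) power_divide)
    also have "\<dots> \<le> moment_const a * 1 + moment_const a * y + moment_const a * (y\<^sup>2 / 2)"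
      using assms y(1) by (intro add_mono mult_right_mono) (auto simp: moment_const_def)
    also have "\<dots> = moment_const a * (1 + y + y\<^sup>2 / 2)"
      by (simp add: algebra_simps)
    also have "\<dots> \<le> moment_const a * exp y"
      using exp_lower_Taylor_quadratic[OF y(1)] assms by (intro mult_left_mono) (auto simp: moment_const_def)
    finally show ?thesis by (simp add: y_def)
  qed
  ultimately have "(s + n * s ^ 3) * exp (- (2 * a * n * s\<^sup>2)) \<le>
      moment_const a * exp (a * x\<^sup>2) / sqrt n * exp (- (2 * a * n * s\<^sup>2))"
    using assms by (intro mult_right_mono) (simp_all add: divide_right_mono)
  also have "\<dots> = moment_const a / sqrt n * (exp (a * x\<^sup>2) * exp (- (2 * a * n * s\<^sup>2)))"
    by simp
  also have "exp (a * x\<^sup>2) * exp (- (2 * a * n * s\<^sup>2)) = exp (- (a * n * s\<^sup>2))"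
    unfolding x2 by (simp add: exp_add[symmetric])
  finally show ?thesis .
qed

locale laplace_manifold = tubular_manifold k M v \<epsilon> codim
  for k :: nat and M :: "'a::euclidean_space set" and v \<epsilon> codim +
  fixes \<pi>0 l :: "'a \<Rightarrow> real" and X :: "'a set"
  assumes pi0_smooth: "smooth_on UNIV \<pi>0" and pi0_pos: "\<And>x. 0 < \<pi>0 x"
    and l_measurable [measurable]: "l \<in> borel_measurable borel" and l_nonneg: "\<And>x. 0 \<le> l x"
    and open_X: "open X" and M_subset_X: "M \<subseteq> X" and l_C3: "Ck_on 3 X l"
    and l_zero: "\<And>u. u \<in> M \<Longrightarrow> l u = 0"
    and hessian_pos: "\<And>u. u \<in> M \<Longrightarrow> positive_definite (normal_hessian k v l u)"
begin

text \<open>The coefficients of the Hessian of \<open>l\<close> on the normal space, written in the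
  frame.\<close>

definition H :: "'a \<Rightarrow> nat \<Rightarrow> nat \<Rightarrow> real" where
  "H u i j = lin_deriv2 l u (v j u) (v i u)"

lemma l_C2: "Ck_on 2 X l" and l_C1: "Ck_on (Suc 0) X l"
  by (rule Ck_on_le[OF l_C3], simp)+

text \<open>As \<open>l\<close> is nonnegative, its zeros are minima.\<close>

lemma lin_deriv_l_zero:
  assumes "u \<in> M"
  shows "lin_deriv l u w = 0"
proof -
  have "(l has_derivative lin_deriv l u) (at u)"
    using Ck_on_has_derivative[OF open_X l_C1] assms M_subset_X by blast
  from differential_zero_maxmin[OF _ open_X this, of] have "lin_deriv l u = (\<lambda>v. 0)"
    using assms M_subset_X l_zero[OF assms] l_nonneg by auto
  then show ?thesis by simp
qed

lemma H_sym: "u \<in> M \<Longrightarrow> H u i j = H u j i"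
  unfolding H_def using lin_deriv2_commute[OF open_X _ l_C2] M_subset_X by blast

text \<open>The iterated coordinate derivatives are taken along lines in the normal space. The outer
  derivative needs the inner one only near the origin, where the points stay in the open set
  \<open>X\<close> and the chain rule applies.\<close>

lemma normal_hessian_eq:
  assumes u: "u \<in> M"
  shows "normal_hessian k v l u = Matrix.mat codim codim (\<lambda>(i, j). H u i j)"
proof -
  let ?g = "\<lambda>t. l (normal_map codim v t u)"
  have upd: "normal_map codim v (t(j := r)) u = normal_map codim v (t(j := 0)) u + r *\<^sub>R v j u" if "j < codim" for t j r
  proof -
    have "(\<Sum>i<codim. (t(j := r)) i *\<^sub>R v i u) = (\<Sum>i<codim. (t(j := 0)) i *\<^sub>R v i u + (if i = j then r *\<^sub>R v j u else 0))"
      by (intro sum.cong refl) auto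
    also have "\<dots> = (\<Sum>i<codim. (t(j := 0)) i *\<^sub>R v i u) + r *\<^sub>R v j u"
      using that by (simp add: sum.distrib)
    finally show ?thesis by (simp add: normal_map_def add.assoc)
  qed
  have first: "coord_deriv j ?g t = lin_deriv l (normal_map codim v t u) (v j u)"
    if "normal_map codim v t u \<in> X" and j: "j < codim" for t j
  proof -
    have eq: "normal_map codim v (t(j := 0)) u + t j *\<^sub>R v j u = normal_map codim v t u"
      using upd[OF j, of t "t j"] by simp
    have "((\<lambda>r. l (normal_map codim v (t(j := 0)) u + r *\<^sub>R v j u)) has_vector_derivative
        lin_deriv l (normal_map codim v (t(j := 0)) u + t j *\<^sub>R v j u) (v j u)) (at (t j))"
      using that(1) by (intro Ck_on_has_vector_derivative_line[OF open_X l_C1]) (simp add: eq)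
    moreover have "(\<lambda>r. ?g (t(j := r))) = (\<lambda>r. l (normal_map codim v (t(j := 0)) u + r *\<^sub>R v j u))"
      by (intro ext arg_cong[of _ _ l] upd j)
    ultimately have "((\<lambda>r. ?g (t(j := r))) has_real_derivative lin_deriv l (normal_map codim v t u) (v j u)) (at (t j))"
      unfolding has_real_derivative_iff_has_vector_derivative eq by (simp only:)
    then show ?thesis
      unfolding coord_deriv_def by (rule DERIV_imp_deriv)
  qed
  have "coord_deriv i (coord_deriv j ?g) (\<lambda>_. 0) = H u i j" if ij: "i < codim" "j < codim" for i j
  proof -
    have line: "normal_map codim v ((\<lambda>_. 0)(i := r)) u = u + r *\<^sub>R v i u" for r
    proof -
      have "(\<lambda>_. 0)(i := 0) = (\<lambda>_. 0 :: real)" by auto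
      then show ?thesis
        using upd[OF ij(1), of "\<lambda>_. 0" r] by (simp add: normal_map_def del: fun_upd_apply)
    qed
    have "open ((\<lambda>r. u + r *\<^sub>R v i u) -` X)"
      using open_X by (intro open_vimage continuous_intros) auto
    moreover have "0 \<in> (\<lambda>r. u + r *\<^sub>R v i u) -` X"
      using u M_subset_X by auto
    ultimately have "eventually (\<lambda>r. r \<in> (\<lambda>r. u + r *\<^sub>R v i u) -` X) (nhds 0)"
      by (rule eventually_nhds_in_open)
    then have "eventually (\<lambda>r. coord_deriv j ?g ((\<lambda>_. 0)(i := r)) = lin_deriv l (u + r *\<^sub>R v i u) (v j u)) (nhds 0)"
    proof (rule eventually_mono)
      fix r assume "r \<in> (\<lambda>r. u + r *\<^sub>R v i u) -` X"
      then have "normal_map codim v ((\<lambda>_. 0)(i := r)) u \<in> X" unfolding line by simp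
      from first[OF this ij(2)] show "coord_deriv j ?g ((\<lambda>_. 0)(i := r)) = lin_deriv l (u + r *\<^sub>R v i u) (v j u)"
        unfolding line .
    qed
    then have "coord_deriv i (coord_deriv j ?g) (\<lambda>_. 0) = deriv (\<lambda>r. lin_deriv l (u + r *\<^sub>R v i u) (v j u)) 0"
      unfolding coord_deriv_def[of i] by (intro deriv_cong_ev) simp_all
    also have "\<dots> = (\<Sum>b\<in>Basis. (v j u \<bullet> b) * lin_deriv (dir_deriv b l) u (v i u))"
    proof (rule DERIV_imp_deriv)
      have C2: "Ck_on (Suc (Suc 0)) X l" using l_C2 by (simp add: numeral_2_eq_2)
      have "((\<lambda>r. dir_deriv b l (u + r *\<^sub>R v i u)) has_real_derivative lin_deriv (dir_deriv b l) u (v i u)) (at 0)"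
        if "b \<in> Basis" for b
        using Ck_on_has_vector_derivative_line[OF open_X Ck_on_dir_deriv[OF C2 that], of u 0 "v i u"] u M_subset_X
        by (auto simp: has_real_derivative_iff_has_vector_derivative)
      then show "((\<lambda>r. lin_deriv l (u + r *\<^sub>R v i u) (v j u)) has_real_derivative
          (\<Sum>b\<in>Basis. (v j u \<bullet> b) * lin_deriv (dir_deriv b l) u (v i u))) (at 0)"
        unfolding lin_deriv_def[of l] real_scaleR_def by (intro DERIV_sum DERIV_cmult)
    qed
    finally show ?thesis by (simp add: H_def lin_deriv2_def)
  qed
  then show ?thesis
    unfolding normal_hessian_def hessian_def codim_eq[symmetric] by (intro cong_mat) auto
qed

lemma quad_form_H:
  "quad_form codim (H u) t = lin_deriv2 l u (\<Sum>j<codim. t j *\<^sub>R v j u) (\<Sum>j<codim. t j *\<^sub>R v j u)"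
proof -
  have "lin_deriv2 l u (\<Sum>j<codim. t j *\<^sub>R v j u) (\<Sum>j<codim. t j *\<^sub>R v j u) =
      (\<Sum>i<codim. t i * lin_deriv2 l u (\<Sum>j<codim. t j *\<^sub>R v j u) (v i u))"
    by (simp add: linear_sum[OF linear_lin_deriv2_right] linear_scale[OF linear_lin_deriv2_right])
  also have "\<dots> = (\<Sum>i<codim. t i * (\<Sum>j<codim. t j * lin_deriv2 l u (v j u) (v i u)))"
    by (simp add: linear_sum[OF linear_lin_deriv2_left] linear_scale[OF linear_lin_deriv2_left])
  also have "\<dots> = quad_form codim (H u) t"
    by (simp add: quad_form_def H_def sum_distrib_left mult_ac)
  finally show ?thesis ..
qed

lemma quad_form_pos:
  assumes "u \<in> M" "\<exists>i<codim. t i \<noteq> 0"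
  shows "0 < quad_form codim (H u) t"
  using positive_definite_imp_quad_form_pos[OF _ assms(2), of "H u"] hessian_pos[OF assms(1)]
  unfolding normal_hessian_eq[OF assms(1)] by simp

text \<open>Positivity at each point becomes a uniform bound by compactness of the unit normal
  bundle; homogeneity of degree two extends the bounds to all \<open>t\<close>.\<close>

lemma quad_form_bounds:
  obtains c0 c1 where "0 < c0" "0 < c1"
    "\<And>u t. u \<in> M \<Longrightarrow> c0 * (tnorm t)\<^sup>2 \<le> quad_form codim (H u) t"
    "\<And>u t. u \<in> M \<Longrightarrow> quad_form codim (H u) t \<le> c1 * (tnorm t)\<^sup>2"
proof -
  \<comment> \<open>The unit normal bundle: a vector is normal if it equals its projection to the
    span of the frame, and this is a closed condition.\<close>
  define Z where "Z = {z \<in> M \<times> sphere (0::'a) 1. snd z - (\<Sum>j<codim. (snd z \<bullet> v j (fst z)) *\<^sub>R v j (fst z)) = 0}"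
  have cont_v: "continuous_on (M \<times> sphere (0::'a) 1) (\<lambda>z. v j (fst z))" if "j < codim" for j
    using smooth_map_on_imp_continuous_on[OF frame_smooth[OF that]]
    by (rule continuous_on_compose2) (auto intro: continuous_intros)
  have Mc: "compact (M \<times> sphere (0::'a) 1)"
    using compact_M by (intro compact_Times) auto
  have "closed Z"
    unfolding Z_def using cont_v
    by (intro continuous_closed_preimage_constant compact_imp_closed[OF Mc] continuous_intros) auto
  then have Z: "compact Z"
  proof -
    have "(M \<times> sphere 0 1) \<inter> Z = Z" by (auto simp: Z_def)
    then show ?thesis using compact_Int_closed[OF Mc \<open>closed Z\<close>] by simp
  qed
  let ?Q = "\<lambda>(u, w). lin_deriv2 l u w w"
  have contQ: "continuous_on Z ?Q"
    using M_subset_X by (intro continuous_on_subset[OF continuous_on_lin_deriv2[OF l_C2]]) (auto simp: Z_def)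
  have Zpos: "0 < ?Q z" if z: "z \<in> Z" for z
  proof -
    obtain u w where uw: "z = (u, w)" "u \<in> M" "norm w = 1" "w = (\<Sum>j<codim. (w \<bullet> v j u) *\<^sub>R v j u)"
      using z by (auto simp: Z_def)
    have "\<exists>i<codim. w \<bullet> v i u \<noteq> 0"
    proof (rule ccontr)
      assume "\<not> (\<exists>i<codim. w \<bullet> v i u \<noteq> 0)"
      then have "(\<Sum>j<codim. (w \<bullet> v j u) *\<^sub>R v j u) = 0" by simp
      then show False using uw(3,4) by simp
    qed
    from quad_form_pos[OF uw(2) this] show ?thesis
      unfolding quad_form_H uw(4)[symmetric] using uw(1) by simp
  qed
  obtain c0 c1 where c: "0 < c0" "0 < c1" "\<And>z. z \<in> Z \<Longrightarrow> c0 \<le> ?Q z" "\<And>z. z \<in> Z \<Longrightarrow> ?Q z \<le> c1"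
  \<comment> \<open>The bundle is empty in codimension 0, where the only normal vector is zero and
    any positive constants will do.\<close>
  proof (cases "Z = {}")
    case True
    then show ?thesis using that[of 1 1] by simp
  next
    case False
    obtain a where a: "a \<in> Z" "\<forall>z\<in>Z. ?Q a \<le> ?Q z"
      using continuous_attains_inf[OF Z False contQ] by (rule bexE)
    obtain b where b: "b \<in> Z" "\<forall>z\<in>Z. ?Q z \<le> ?Q b"
      using continuous_attains_sup[OF Z False contQ] by (rule bexE)
    show ?thesis
    proof (rule that[of "?Q a" "?Q b"])
      show "0 < ?Q a" "0 < ?Q b" using Zpos[OF a(1)] Zpos[OF b(1)] .
      show "?Q a \<le> ?Q z" "?Q z \<le> ?Q b" if "z \<in> Z" for z
        using bspec[OF a(2) that] bspec[OF b(2) that] .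
    qed
  qed
  have bounds: "c0 * (tnorm t)\<^sup>2 \<le> quad_form codim (H u) t \<and> quad_form codim (H u) t \<le> c1 * (tnorm t)\<^sup>2"
    if u: "u \<in> M" for u t
  proof (cases "tnorm t = 0")
    case True
    then have "(\<Sum>j<codim. t j *\<^sub>R v j u) = 0" using frame_sum_norm[OF u, of t] by simp
    then show ?thesis
      unfolding quad_form_H using True linear_0[OF linear_lin_deriv2_left[of l u 0]] by simp
  next
    case False
    let ?s = "tnorm t" and ?w = "\<Sum>j<codim. t j *\<^sub>R v j u"
    define w1 where "w1 = (1 / ?s) *\<^sub>R ?w"
    have "w1 \<bullet> v j u = t j / ?s" if "j < codim" for j
      using frame_sum_inner[OF u that, of t] by (simp add: w1_def)
    then have "(\<Sum>j<codim. (w1 \<bullet> v j u) *\<^sub>R v j u) = w1"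
      by (simp add: w1_def scaleR_sum_right)
    moreover have "norm w1 = 1"
      using frame_sum_norm[OF u, of t] False by (simp add: w1_def)
    ultimately have "(u, w1) \<in> Z"
      using u by (simp add: Z_def)
    moreover have "lin_deriv2 l u ?w ?w = ?s\<^sup>2 * lin_deriv2 l u w1 w1"
    proof -
      have "?w = ?s *\<^sub>R w1" using False by (simp add: w1_def)
      then show ?thesis
        by (simp only: linear_scale[OF linear_lin_deriv2_right] linear_scale[OF linear_lin_deriv2_left])
          (simp add: power2_eq_square)
    qed
    ultimately show ?thesis
      unfolding quad_form_H using c(3,4)[of "(u, w1)"] by (simp add: mult.commute mult_right_mono)
  qed
  then show ?thesis using that c(1,2) by blast
qed

definition hdet :: "'a \<Rightarrow> real" where
  "hdet u = Determinant.det (Matrix.mat codim codim (\<lambda>(i, j). H u i j))"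

lemma hdet_pos: "u \<in> M \<Longrightarrow> 0 < hdet u"
  unfolding hdet_def using gaussian_integral[of codim "H u"] H_sym quad_form_pos by blast

text \<open>The unnormalised limit density of this component, cut off outside \<open>M\<close> to
  make it Borel on the whole space.\<close>

definition weight :: "'a \<Rightarrow> real" where
  "weight u = indicator M u * (\<pi>0 u * hdet u powr (- 1 / 2))"

lemma limit_weight_eq: "u \<in> M \<Longrightarrow> limit_weight k v \<pi>0 l u = weight u"
  by (simp add: limit_weight_def weight_def normal_hessian_eq hdet_def normal_map_def)

lemma continuous_on_pi0: "continuous_on A \<pi>0"
  using Ck_on_imp_continuous_on[OF smooth_on_imp_Ck_on[OF pi0_smooth]] continuous_on_subset by blast

lemma measurable_pi0 [measurable]: "\<pi>0 \<in> borel_measurable borel"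
  using continuous_on_pi0 by (rule borel_measurable_continuous_onI)

lemma measurable_weight [measurable]: "weight \<in> borel_measurable borel"
proof -
  have "continuous_on M (\<lambda>u. H u i j)" if "i < codim" "j < codim" for i j
  proof -
    have "continuous_on X (dir_deriv a (dir_deriv b l))" if "a \<in> Basis" "b \<in> Basis" for a b
      using l_C2 that by (simp add: numeral_2_eq_2)
    then have "continuous_on M (dir_deriv a (dir_deriv b l))" if "a \<in> Basis" "b \<in> Basis" for a b
      using that M_subset_X continuous_on_subset by blast
    then show ?thesis
      unfolding H_def lin_deriv2_def lin_deriv_def
      using smooth_map_on_imp_continuous_on[OF frame_smooth] that by (intro continuous_intros) auto
  qed
  then have "continuous_on M hdet"
    unfolding hdet_def by (intro continuous_on_det)
  then have "continuous_on M (\<lambda>u. \<pi>0 u * hdet u powr (- 1 / 2))"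
    using hdet_pos by (intro continuous_intros continuous_on_pi0) force+
  then show ?thesis
    unfolding weight_def[abs_def] using M_borel
    by (simp only: real_scaleR_def[symmetric]) (intro borel_measurable_continuous_on_indicator)
qed

definition lap :: "real \<Rightarrow> 'a \<Rightarrow> real" where
  "lap n x = exp (- (n * l x)) * \<pi>0 x"

lemma lap_nonneg: "0 \<le> lap n x"
  using pi0_pos[of x] by (simp add: lap_def less_imp_le)

lemma measurable_lap [measurable]: "lap n \<in> borel_measurable borel"
  unfolding lap_def[abs_def] by measurable

definition gauss :: "real \<Rightarrow> real" where
  "gauss n = sqrt ((2 * pi / n) ^ codim)"

lemma gauss_pos: "0 < n \<Longrightarrow> 0 < gauss n"
  by (simp add: gauss_def)

lemma gaussian_fiber:
  assumes "u \<in> M" "0 < n"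
  shows "(\<integral>\<^sup>+ t. ennreal (exp (- (n * quad_form codim (H u) t / 2))) \<partial>lborel_PiM codim) = ennreal (gauss n * hdet u powr (- 1 / 2))"
  using gaussian_integral_scaled[of codim "H u" n] H_sym[OF assms(1)] quad_form_pos[OF assms(1)] assms(2)
  by (simp add: gauss_def hdet_def)

lemma gaussian_fiber_isotropic:
  assumes "0 < n" "0 < a"
  shows "(\<integral>\<^sup>+ t. ennreal (exp (- (a * n * (tnorm t)\<^sup>2))) \<partial>lborel_PiM codim) = ennreal (gauss n * sqrt ((1 / (2 * a)) ^ codim))"
proof -
  have "(tnorm t)\<^sup>2 = (\<Sum>j<codim. (t j)\<^sup>2)" for t
    by (simp add: L2_set_def sum_nonneg)
  moreover have "(2 * pi / (2 * a * n)) ^ codim = (2 * pi / n) ^ codim * (1 / (2 * a)) ^ codim"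
    using assms by (simp add: power_mult_distrib[symmetric] mult.commute)
  ultimately show ?thesis
    using gaussian_integral_isotropic[of "2 * a * n" codim] assms by (simp add: gauss_def real_sqrt_mult mult.assoc)
qed

text \<open>On a fibre, \<open>\<ell>\<close> is its Hessian form up to a cubic error and \<open>\<pi>0\<close> and the Jacobian
  are constant up to a linear error; by the lemma \<open>moment_le_exp\<close> these errors cost a factor
  \<open>n powr (- 1 / 2)\<close>.\<close>

lemma fiber_pointwise:
  assumes C: "0 \<le> C" "0 < \<delta>0" "C * \<delta>0 \<le> 1"
  obtains \<delta> a A where "0 < \<delta>" "\<delta> \<le> \<delta>0" "\<delta> \<le> 1" "0 < a" "0 \<le> A"
    "\<And>n u t. 1 \<le> n \<Longrightarrow> u \<in> M \<Longrightarrow> tnorm t < \<delta> \<Longrightarrow> lap n (S t u) * (1 + C * tnorm t) \<le>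
      \<pi>0 u * (exp (- (n * quad_form codim (H u) t / 2)) + A / sqrt n * exp (- (a * n * (tnorm t)\<^sup>2)))"
    "\<And>n u t. 1 \<le> n \<Longrightarrow> u \<in> M \<Longrightarrow> tnorm t < \<delta> \<Longrightarrow> tnorm t * lap n (S t u) * (1 + C * tnorm t) \<le>
      \<pi>0 u * (A / sqrt n * exp (- (a * n * (tnorm t)\<^sup>2)))"
    "\<And>n u t. 1 \<le> n \<Longrightarrow> u \<in> M \<Longrightarrow> tnorm t < \<delta> \<Longrightarrow> \<pi>0 u * exp (- (n * quad_form codim (H u) t / 2)) \<le>
      lap n (S t u) * (1 - C * tnorm t) + \<pi>0 u * (A / sqrt n * exp (- (a * n * (tnorm t)\<^sup>2)))"
    "\<And>n u t. 1 \<le> n \<Longrightarrow> u \<in> M \<Longrightarrow> \<delta> \<le> tnorm t \<Longrightarrow> \<pi>0 u * exp (- (n * quad_form codim (H u) t / 2)) \<le>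
      \<pi>0 u * (A / sqrt n * exp (- (a * n * (tnorm t)\<^sup>2)))"
proof -
  obtain c0 c1 where c: "0 < c0" "\<And>u t. u \<in> M \<Longrightarrow> c0 * (tnorm t)\<^sup>2 \<le> quad_form codim (H u) t"
    using quad_form_bounds by metis
  obtain C1 d1 where T: "0 < d1" "0 \<le> C1" "\<And>u w. u \<in> M \<Longrightarrow> norm w \<le> d1 \<Longrightarrow>
       \<bar>l (u + w) - (l u + lin_deriv l u w + lin_deriv2 l u w w / 2)\<bar> \<le> C1 * norm w ^ 3"
    by (rule Ck_on_taylor3_uniform[OF open_X compact_M M_subset_X l_C3]) blast
  obtain C2 where P: "0 \<le> C2" "\<And>u w. u \<in> M \<Longrightarrow> norm w \<le> 1 \<Longrightarrow> \<bar>\<pi>0 (u + w) - \<pi>0 u\<bar> \<le> C2 * norm w"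
    by (rule Ck_on_lipschitz_near_compact[OF smooth_on_imp_Ck_on[OF pi0_smooth, of "Suc 0"] compact_M, of 1]) blast
  obtain u0 where u0: "u0 \<in> M" "\<And>u. u \<in> M \<Longrightarrow> \<pi>0 u0 \<le> \<pi>0 u"
    using continuous_attains_inf[OF compact_M M_nonempty continuous_on_pi0] by blast
  \<comment> \<open>The Lipschitz constant of the prior relative to its minimum over
    \<open>M\<close>; it turns the additive error in \<pi>0 into a multiplicative one.\<close>
  define B where "B = C2 / \<pi>0 u0"
  have B0: "0 \<le> B" using P(1) pi0_pos[of u0] by (simp add: B_def)
  \<comment> \<open>The exponent is spent in portions. Half of the Hessian form is at least 4a|t|^2;
    the cubic error uses up 2a|t|^2 of it, \<open>moment_le_exp\<close> another a|t|^2, and a|t|^2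
    is left for the remainder.\<close>
  define a where "a = c0 / 8"
  have a: "0 < a" using c(1) by (simp add: a_def)
  \<comment> \<open>The last entry gives C1 \<delta> at most 2a, so that the cubic Taylor error
    stays below 2a|t|^2.\<close>
  define \<delta> where "\<delta> = min (min \<delta>0 1) (min d1 (2 * a / (1 + C1)))"
  have \<delta>: "0 < \<delta>" "\<delta> \<le> \<delta>0" "\<delta> \<le> 1" "\<delta> \<le> d1"
    using C T a by (auto simp: \<delta>_def)
  define r where "r = 1 / \<delta>"
  have di: "0 < r" using \<delta>(1) by (simp add: r_def)
  have C1\<delta>: "C1 * \<delta> \<le> 2 * a"
  proof -
    have "C1 * \<delta> \<le> C1 * (2 * a / (1 + C1))"
      using T(2) by (intro mult_left_mono) (auto simp: \<delta>_def)
    also have "\<dots> \<le> 2 * a" using T(2) a by (simp add: divide_simps algebra_simps)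
    finally show ?thesis .
  qed
  \<comment> \<open>One constant for the coefficients of all error terms. The summand
    \<open>r\<close>, which is 1/\<delta>, serves the region |t| \<ge> \<delta>, where 1 is at most
    |t|/\<delta> and the whole Gaussian tail counts as an error.\<close>
  define D where "D = (1 + B) * (1 + C) * (1 + C1) + r"
  have D: "0 \<le> D" using B0 C(1) T(2) di by (simp add: D_def)
  define A where "A = D * moment_const a"
  have A: "0 \<le> A" using D a by (simp add: A_def moment_const_def)
  have R: "D * ((s + n * s ^ 3) * exp (- (2 * a * n * s\<^sup>2))) \<le> A / sqrt n * exp (- (a * n * s\<^sup>2))"
    if "1 \<le> n" "0 \<le> s" for n s
    using mult_left_mono[OF moment_le_exp[OF a, of n s] D] that by (simp add: A_def)
  have tay: "\<bar>l (S t u) - quad_form codim (H u) t / 2\<bar> \<le> C1 * tnorm t ^ 3" if "u \<in> M" "tnorm t < \<delta>" for u t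
  proof -
    have "norm (\<Sum>j<codim. t j *\<^sub>R v j u) = tnorm t" using frame_sum_norm that by blast
    then show ?thesis
      using T(3)[OF that(1), of "\<Sum>j<codim. t j *\<^sub>R v j u"] that \<delta>(4) unfolding S_eq[OF that(1)]
      by (simp add: normal_map_def l_zero lin_deriv_l_zero quad_form_H)
  qed
  have pi: "\<pi>0 (S t u) \<le> \<pi>0 u * (1 + B * tnorm t)" "\<pi>0 u * (1 - B * tnorm t) \<le> \<pi>0 (S t u)"
    if "u \<in> M" "tnorm t < \<delta>" for u t
  proof -
    have "norm (\<Sum>j<codim. t j *\<^sub>R v j u) = tnorm t" using frame_sum_norm that by blast
    then have "\<bar>\<pi>0 (S t u) - \<pi>0 u\<bar> \<le> C2 * tnorm t"
      using P(2)[OF that(1), of "\<Sum>j<codim. t j *\<^sub>R v j u"] that \<delta>(3) unfolding S_eq[OF that(1)]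
      by (simp add: normal_map_def)
    also have "\<dots> = \<pi>0 u0 * (B * tnorm t)"
      using pi0_pos[of u0] by (simp add: B_def)
    also have "\<dots> \<le> \<pi>0 u * (B * tnorm t)"
      using u0(2)[OF that(1)] B0 by (intro mult_right_mono) auto
    finally show "\<pi>0 (S t u) \<le> \<pi>0 u * (1 + B * tnorm t)" "\<pi>0 u * (1 - B * tnorm t) \<le> \<pi>0 (S t u)"
      by (auto simp: algebra_simps)
  qed
  have q: "exp (- (n * quad_form codim (H u) t / 2)) \<le> exp (- (4 * a * n * (tnorm t)\<^sup>2))"
    if "1 \<le> n" "u \<in> M" for n u t
    using mult_left_mono[OF c(2)[OF that(2), of t], of n] that(1) by (simp add: a_def mult_ac)
  have cubic: "n * (C1 * s ^ 3) \<le> 2 * a * n * s\<^sup>2" if "1 \<le> n" "0 \<le> s" "s < \<delta>" for n s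
  proof -
    have "C1 * s \<le> 2 * a"
      using mult_left_mono[of s \<delta> C1] that T(2) C1\<delta> by simp
    then have "(n * s\<^sup>2) * (C1 * s) \<le> (n * s\<^sup>2) * (2 * a)"
      using that by (intro mult_left_mono) auto
    then show ?thesis by (simp add: power3_eq_cube power2_eq_square mult_ac)
  qed
  have linC: "(1 + B * s) * (1 + C * s) \<le> 1 + ((1 + B) * (1 + C) - 1) * s" "(1 + B * s) * (1 + C * s) \<le> (1 + B) * (1 + C)"
    if "0 \<le> s" "s \<le> 1" for s
  proof -
    have "B * C * (s * s) \<le> B * C * s"
      using that B0 C(1) by (intro mult_left_mono) (auto simp: mult_left_le_one_le)
    then show "(1 + B * s) * (1 + C * s) \<le> 1 + ((1 + B) * (1 + C) - 1) * s"
      by (simp add: algebra_simps)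
    show "(1 + B * s) * (1 + C * s) \<le> (1 + B) * (1 + C)"
      using that B0 C(1) by (intro mult_mono add_left_mono) (auto simp: mult_left_le)
  qed
  have weak: "lap n (S t u) * (1 + C * tnorm t) \<le> \<pi>0 u * ((1 + B * tnorm t) * (1 + C * tnorm t) *
      (exp (- (n * quad_form codim (H u) t / 2)) * exp (n * (C1 * tnorm t ^ 3))))"
    if n: "1 \<le> n" and u: "u \<in> M" and t: "tnorm t < \<delta>" for n u t
  proof -
    have "n * (quad_form codim (H u) t / 2 - C1 * tnorm t ^ 3) \<le> n * l (S t u)"
      using tay[OF u t] n by (intro mult_left_mono) auto
    then have "exp (- (n * l (S t u))) \<le> exp (- (n * quad_form codim (H u) t / 2)) * exp (n * (C1 * tnorm t ^ 3))"
      unfolding exp_add[symmetric] by (simp add: algebra_simps)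
    then have "lap n (S t u) \<le> exp (- (n * quad_form codim (H u) t / 2)) * exp (n * (C1 * tnorm t ^ 3)) * (\<pi>0 u * (1 + B * tnorm t))"
      unfolding lap_def using pi(1)[OF u t] pi0_pos[of "S t u"] by (intro mult_mono) auto
    from mult_right_mono[OF this, of "1 + C * tnorm t"] show ?thesis
      using C(1) by (simp add: mult_ac)
  qed
  have upper: "lap n (S t u) * (1 + C * tnorm t) \<le>
      \<pi>0 u * (exp (- (n * quad_form codim (H u) t / 2)) + A / sqrt n * exp (- (a * n * (tnorm t)\<^sup>2)))"
    if n: "1 \<le> n" and u: "u \<in> M" and t: "tnorm t < \<delta>" for n u t
  proof -
    let ?s = "tnorm t" and ?e = "exp (- (n * quad_form codim (H u) t / 2))" and ?E = "exp (- (2 * a * n * (tnorm t)\<^sup>2))"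
    let ?x = "n * (C1 * ?s ^ 3)" and ?J = "(1 + B * ?s) * (1 + C * ?s)"
    have s: "0 \<le> ?s" "?s \<le> 1" using t \<delta> by auto
    have x0: "0 \<le> ?x" using n T(2) by simp
    have J0: "0 \<le> ?J" using B0 C(1) by simp
    have eE: "?e * exp ?x \<le> ?E" "?e \<le> ?E"
    proof -
      have "?e * exp ?x \<le> exp (- (4 * a * n * ?s\<^sup>2)) * exp (2 * a * n * ?s\<^sup>2)"
        using q[OF n u, of t] cubic[OF n s(1) t] by (intro mult_mono) auto
      also have "\<dots> = ?E" by (simp add: exp_add[symmetric])
      finally show "?e * exp ?x \<le> ?E" .
      moreover have "?e * 1 \<le> ?e * exp ?x" using x0 by (intro mult_left_mono) auto
      ultimately have "?e * 1 \<le> ?E" by (rule order.trans[rotated])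
      then show "?e \<le> ?E" by (simp only: mult_1_right)
    qed
    \<comment> \<open>The leading term keeps coefficient exactly 1, and the excess carries a factor
      \<open>?x\<close>; it follows from 1 - x \<le> exp (- x).\<close>
    have "exp ?x \<le> 1 + ?x * exp ?x"
    proof -
      have "1 + (- ?x) \<le> exp (- ?x)" by (rule exp_ge_add_one_self)
      then have "(1 - ?x) * exp ?x \<le> exp (- ?x) * exp ?x" by (intro mult_right_mono) auto
      then show ?thesis by (simp add: exp_add[symmetric] algebra_simps)
    qed
    then have "?J * (?e * exp ?x) \<le> ?J * (?e * (1 + ?x * exp ?x))"
      using J0 by (intro mult_left_mono) auto
    also have "\<dots> = ?J * ?e + ?J * (?x * (?e * exp ?x))" by (simp add: algebra_simps)
    also have "\<dots> \<le> (1 + ((1 + B) * (1 + C) - 1) * ?s) * ?e + (1 + B) * (1 + C) * (?x * ?E)"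
    proof (intro add_mono)
      show "?J * ?e \<le> (1 + ((1 + B) * (1 + C) - 1) * ?s) * ?e"
        using linC(1)[OF s] by (rule mult_right_mono) simp
      show "?J * (?x * (?e * exp ?x)) \<le> (1 + B) * (1 + C) * (?x * ?E)"
      proof (rule mult_mono[OF linC(2)[OF s] mult_left_mono[OF eE(1) x0]])
        show "0 \<le> (1 + B) * (1 + C)" using B0 C(1) by simp
        show "0 \<le> ?x * (?e * exp ?x)" by (rule mult_nonneg_nonneg[OF x0]) simp
      qed
    qed
    also have "\<dots> = ?e + ((1 + B) * (1 + C) - 1) * ?s * ?e + (1 + B) * (1 + C) * C1 * (n * ?s ^ 3) * ?E"
      by (simp add: algebra_simps)
    also have "\<dots> \<le> ?e + D * ?s * ?E + D * (n * ?s ^ 3) * ?E"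
    proof -
      have "0 \<le> (1 + B) * (1 + C) * C1" using B0 C(1) T(2) by simp
      moreover have "0 \<le> B + C + B * C" using B0 C(1) by simp
      ultimately have "(1 + B) * (1 + C) - 1 \<le> D" "(1 + B) * (1 + C) * C1 \<le> D" "0 \<le> (1 + B) * (1 + C) - 1"
        using di unfolding D_def by (auto simp: algebra_simps)
      then show ?thesis
        using s n eE(2) by (intro add_mono mult_mono order.refl) auto
    qed
    also have "\<dots> = ?e + D * ((?s + n * ?s ^ 3) * ?E)" by (simp add: algebra_simps)
    also have "\<dots> \<le> ?e + A / sqrt n * exp (- (a * n * ?s\<^sup>2))"
      using R[OF n s(1)] by simp
    finally show ?thesis
      using order.trans[OF weak[OF n u t] mult_left_mono[OF _ less_imp_le[OF pi0_pos[of u]]]] by simp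
  qed
  have disp: "tnorm t * lap n (S t u) * (1 + C * tnorm t) \<le> \<pi>0 u * (A / sqrt n * exp (- (a * n * (tnorm t)\<^sup>2)))"
    if n: "1 \<le> n" and u: "u \<in> M" and t: "tnorm t < \<delta>" for n u t
  proof -
    let ?s = "tnorm t" and ?e = "exp (- (n * quad_form codim (H u) t / 2))" and ?E = "exp (- (2 * a * n * (tnorm t)\<^sup>2))"
    let ?x = "n * (C1 * ?s ^ 3)"
    have s: "0 \<le> ?s" "?s \<le> 1" using t \<delta> by auto
    have "?e * exp ?x \<le> exp (- (4 * a * n * ?s\<^sup>2)) * exp (2 * a * n * ?s\<^sup>2)"
      using q[OF n u, of t] cubic[OF n s(1) t] by (intro mult_mono) auto
    also have "\<dots> = ?E" by (simp add: exp_add[symmetric])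
    finally have eE: "?e * exp ?x \<le> ?E" .
    have "(1 + B * ?s) * (1 + C * ?s) * (?e * exp ?x) \<le> (1 + B) * (1 + C) * ?E"
      by (rule mult_mono[OF linC(2)[OF s] eE]) (use B0 C(1) in simp_all)
    also have "\<dots> \<le> D * ?E"
    proof -
      have "0 \<le> (1 + B) * (1 + C) * C1" using B0 C(1) T(2) by simp
      then have "(1 + B) * (1 + C) \<le> D" using di unfolding D_def by (simp add: algebra_simps)
      then show ?thesis by (intro mult_right_mono) auto
    qed
    finally have "?s * (\<pi>0 u * ((1 + B * ?s) * (1 + C * ?s) * (?e * exp ?x))) \<le> ?s * (\<pi>0 u * (D * ?E))"
      using s pi0_pos[of u] by (intro mult_left_mono) auto
    moreover have "?s * (lap n (S t u) * (1 + C * ?s)) \<le> ?s * (\<pi>0 u * ((1 + B * ?s) * (1 + C * ?s) * (?e * exp ?x)))"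
      using weak[OF n u t] s by (intro mult_left_mono) auto
    moreover have "?s * (\<pi>0 u * (D * ?E)) \<le> \<pi>0 u * (D * ((?s + n * ?s ^ 3) * ?E))"
    proof -
      have "D * (?s * ?E) \<le> D * ((?s + n * ?s ^ 3) * ?E)"
        using D s n by (intro mult_left_mono mult_right_mono) auto
      from mult_left_mono[OF this less_imp_le[OF pi0_pos[of u]]] show ?thesis by (simp add: mult_ac)
    qed
    moreover have "\<pi>0 u * (D * ((?s + n * ?s ^ 3) * ?E)) \<le> \<pi>0 u * (A / sqrt n * exp (- (a * n * ?s\<^sup>2)))"
      using R[OF n s(1)] pi0_pos[of u] by (intro mult_left_mono) auto
    ultimately show ?thesis by (simp only: mult.assoc)
  qed
  have lower: "\<pi>0 u * exp (- (n * quad_form codim (H u) t / 2)) \<le>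
      lap n (S t u) * (1 - C * tnorm t) + \<pi>0 u * (A / sqrt n * exp (- (a * n * (tnorm t)\<^sup>2)))"
    if n: "1 \<le> n" and u: "u \<in> M" and t: "tnorm t < \<delta>" for n u t
  proof -
    let ?s = "tnorm t" and ?e = "exp (- (n * quad_form codim (H u) t / 2))" and ?E = "exp (- (2 * a * n * (tnorm t)\<^sup>2))"
    let ?x = "n * (C1 * ?s ^ 3)"
    have s: "0 \<le> ?s" "?s \<le> 1" using t \<delta> by auto
    have x0: "0 \<le> ?x" using n T(2) by simp
    have Cs: "0 \<le> 1 - C * ?s" "1 - C * ?s \<le> 1"
      using mult_left_mono[of ?s \<delta>0 C] t \<delta> C by auto
    \<comment> \<open>Truncation at 0 puts this factor into the unit interval, so that it can be
      combined with the others by the product estimate below.\<close>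
    define p where "p = max 0 (1 - B * ?s)"
    have p: "0 \<le> p" "p \<le> 1" "1 - B * ?s \<le> p" using B0 s by (auto simp: p_def)
    have pip: "\<pi>0 u * p \<le> \<pi>0 (S t u)"
      using pi(2)[OF u t] pi0_pos[of "S t u"] by (auto simp: p_def max_def)
    have eE: "?e \<le> ?E"
      using q[OF n u, of t] a n by (intro order.trans[OF q[OF n u, of t]]) (simp add: mult_right_mono)
    have "n * l (S t u) \<le> n * (quad_form codim (H u) t / 2 + C1 * ?s ^ 3)"
      using tay[OF u t] n by (intro mult_left_mono) auto
    then have "?e * exp (- ?x) \<le> exp (- (n * l (S t u)))"
      unfolding exp_add[symmetric] by (simp add: algebra_simps)
    then have 0: "?e * exp (- ?x) * (\<pi>0 u * p) \<le> lap n (S t u)"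
      unfolding lap_def using pip p pi0_pos[of u] by (intro mult_mono) auto
    have 1: "\<pi>0 u * (?e * (exp (- ?x) * p * (1 - C * ?s))) \<le> lap n (S t u) * (1 - C * ?s)"
      using mult_right_mono[OF 0 Cs(1)] by (simp add: mult_ac)
    have ex: "1 - ?x \<le> exp (- ?x)" "exp (- ?x) \<le> 1" "0 \<le> exp (- ?x)"
      using exp_ge_add_one_self[of "- ?x"] x0 by auto
    \<comment> \<open>For factors between 0 and 1 the losses at most add up. Applied twice, it turns
      the losses from the Taylor error, the prior and the Jacobian into a sum.\<close>
    have prod: "1 - (1 - y) - (1 - z) \<le> y * z" if "0 \<le> y" "y \<le> 1" "0 \<le> z" "z \<le> 1" for y z :: real
      using mult_nonneg_nonneg[of "1 - y" "1 - z"] that by (simp add: algebra_simps)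
    have "1 - (1 - exp (- ?x)) - (1 - p) \<le> exp (- ?x) * p"
      using ex p by (intro prod) auto
    moreover have "1 - (1 - exp (- ?x) * p) - (1 - (1 - C * ?s)) \<le> exp (- ?x) * p * (1 - C * ?s)"
      using ex p Cs by (intro prod) (auto intro: mult_le_one)
    ultimately have "1 - ?x - B * ?s - C * ?s \<le> exp (- ?x) * p * (1 - C * ?s)"
      using ex p by linarith
    then have "?e * (1 - ?x - B * ?s - C * ?s) \<le> ?e * (exp (- ?x) * p * (1 - C * ?s))"
      by (intro mult_left_mono) auto
    moreover have "?e * (?x + B * ?s + C * ?s) \<le> D * ((?s + n * ?s ^ 3) * ?E)"
    proof -
      have "0 \<le> B * C" "0 \<le> (B + C + B * C) * C1" using B0 C(1) T(2) by simp_all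
      then have "C1 \<le> D" "B + C \<le> D" using T(2) B0 C(1) di unfolding D_def by (auto simp: algebra_simps add_increasing2)
      then have "C1 * (n * ?s ^ 3) + (B + C) * ?s \<le> D * (n * ?s ^ 3) + D * ?s"
        using n s by (intro add_mono mult_right_mono) auto
      then have "?x + B * ?s + C * ?s \<le> D * (?s + n * ?s ^ 3)"
        by (simp add: algebra_simps)
      then have "?e * (?x + B * ?s + C * ?s) \<le> ?E * (D * (?s + n * ?s ^ 3))"
        using eE x0 B0 C(1) s by (intro mult_mono) auto
      then show ?thesis by (simp add: mult_ac)
    qed
    moreover have "?e * (1 - ?x - B * ?s - C * ?s) = ?e - ?e * (?x + B * ?s + C * ?s)"
      by (simp add: algebra_simps)
    ultimately have "?e \<le> ?e * (exp (- ?x) * p * (1 - C * ?s)) + A / sqrt n * exp (- (a * n * ?s\<^sup>2))"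
      using R[OF n s(1)] by linarith
    from mult_left_mono[OF this less_imp_le[OF pi0_pos[of u]]] show ?thesis
      using 1 by (simp add: distrib_left)
  qed
  have far: "\<pi>0 u * exp (- (n * quad_form codim (H u) t / 2)) \<le> \<pi>0 u * (A / sqrt n * exp (- (a * n * (tnorm t)\<^sup>2)))"
    if n: "1 \<le> n" and u: "u \<in> M" and t: "\<delta> \<le> tnorm t" for n u t
  proof -
    let ?s = "tnorm t" and ?e = "exp (- (n * quad_form codim (H u) t / 2))" and ?E = "exp (- (2 * a * n * (tnorm t)\<^sup>2))"
    have "?e \<le> ?E"
      using q[OF n u, of t] a n by (intro order.trans[OF q[OF n u, of t]]) (simp add: mult_right_mono)
    also have "\<dots> \<le> (D * (?s + n * ?s ^ 3)) * ?E"
    proof -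
      have "1 / \<delta> \<le> D" using B0 C(1) T(2) by (simp add: D_def r_def)
      have "1 \<le> (1 / \<delta>) * ?s" using t \<delta>(1) by simp
      also have "\<dots> \<le> D * (?s + n * ?s ^ 3)"
        using \<open>1 / \<delta> \<le> D\<close> D n by (intro mult_mono) auto
      finally have "1 * ?E \<le> (D * (?s + n * ?s ^ 3)) * ?E" by (intro mult_right_mono) auto
      then show ?thesis by simp
    qed
    also have "\<dots> \<le> A / sqrt n * exp (- (a * n * ?s\<^sup>2))"
      using R[OF n, of ?s] by (simp add: mult.assoc)
    finally show ?thesis using pi0_pos[of u] by (intro mult_left_mono) auto
  qed
  show ?thesis
    by (rule that[OF \<delta>(1-3) a A upper disp lower far])
qed

end

section \<open>Integration of the fibre estimates over the manifold\<close>

context tubular_manifold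
begin

lemma open_tube_le:
  assumes "\<delta> \<le> \<epsilon>"
  shows "open (tube M \<delta>)"
proof -
  have "continuous_on (tube M \<epsilon>) (\<lambda>x. norm (x - foot x))"
    by (intro continuous_intros continuous_on_foot)
  then have "open (tube M \<epsilon> \<inter> (\<lambda>x. norm (x - foot x)) -` {..<\<delta>})"
    using open_tube by (intro continuous_open_preimage) auto
  moreover have "tube M \<epsilon> \<inter> (\<lambda>x. norm (x - foot x)) -` {..<\<delta>} = tube M \<delta>"
    unfolding tube_eq_foot[OF assms] by auto
  ultimately show ?thesis by simp
qed

lemma M_subset_tube: "0 < \<delta> \<Longrightarrow> M \<subseteq> tube M \<delta>"
  by (force simp: mem_tube_iff normal_map_def L2_set_def intro: exI[of _ "\<lambda>_. 0"])

lemma bounded_tube: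
  assumes "\<delta> \<le> \<epsilon>"
  shows "bounded (tube M \<delta>)"
proof -
  obtain b where b: "\<And>u. u \<in> M \<Longrightarrow> norm u \<le> b"
    using compact_imp_bounded[OF compact_M] unfolding bounded_iff by blast
  have "norm x \<le> b + \<delta>" if "x \<in> tube M \<delta>" for x
  proof -
    have "x \<in> tube M \<epsilon>" "norm (x - foot x) < \<delta>" using that tube_eq_foot[OF assms] by auto
    then show ?thesis using b[OF foot_mem[of x]] norm_triangle_sub[of x "foot x"] by linarith
  qed
  then show ?thesis unfolding bounded_iff by blast
qed

end

context laplace_manifold
begin

text \<open>Kept as an extended number, because its finiteness is only obtained together with the
  Laplace estimates.\<close>

definition total_weight :: ennreal where
  "total_weight = (\<integral>\<^sup>+ u. ennreal (weight u) \<partial>vol)"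

text \<open>Finite because the tube is bounded and the prior is bounded on its closure; positive
  because the tube contains a ball and the integrand is positive everywhere.\<close>

lemma nn_integral_lap_tube:
  assumes "\<delta> \<le> \<epsilon>" "0 < \<delta>" "0 \<le> n"
  shows "(\<integral>\<^sup>+ x. indicator (tube M \<delta>) x * ennreal (lap n x) \<partial>lborel) < \<infinity>"
    and "0 < (\<integral>\<^sup>+ x. indicator (tube M \<delta>) x * ennreal (lap n x) \<partial>lborel)"
proof -
  have [measurable]: "tube M \<delta> \<in> sets borel" by (rule tube_borel) fact
  have "compact (closure (tube M \<delta>))"
    using bounded_tube[OF assms(1)] by (simp add: compact_closure)
  then have "bounded (\<pi>0 ` closure (tube M \<delta>))"
    by (intro compact_imp_bounded compact_continuous_image continuous_on_pi0)
  then obtain b where b: "\<And>x. x \<in> closure (tube M \<delta>) \<Longrightarrow> \<bar>\<pi>0 x\<bar> \<le> b"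
    unfolding bounded_iff by auto
  have le: "lap n x \<le> b" if "x \<in> tube M \<delta>" for x
  proof -
    have "exp (- (n * l x)) \<le> 1" using assms(3) l_nonneg[of x] by simp
    then have "lap n x \<le> 1 * \<pi>0 x" unfolding lap_def using pi0_pos[of x] by (intro mult_right_mono) auto
    then show ?thesis using b[of x] that closure_subset by fastforce
  qed
  have "(\<integral>\<^sup>+ x. indicator (tube M \<delta>) x * ennreal (lap n x) \<partial>lborel) \<le> (\<integral>\<^sup>+ x. ennreal b * indicator (tube M \<delta>) x \<partial>lborel)"
    using le by (intro nn_integral_mono) (auto simp: indicator_def intro: ennreal_leI)
  also have "\<dots> = ennreal b * emeasure lborel (tube M \<delta>)"
    by (rule nn_integral_cmult_indicator) simp
  also have "\<dots> < \<infinity>"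
    using emeasure_bounded_finite[OF bounded_tube[OF assms(1)]] by (simp add: ennreal_mult_less_top)
  finally show "(\<integral>\<^sup>+ x. indicator (tube M \<delta>) x * ennreal (lap n x) \<partial>lborel) < \<infinity>" .
  show "0 < (\<integral>\<^sup>+ x. indicator (tube M \<delta>) x * ennreal (lap n x) \<partial>lborel)"
  proof (rule ccontr)
    assume "\<not> ?thesis"
    then have "(\<integral>\<^sup>+ x. indicator (tube M \<delta>) x * ennreal (lap n x) \<partial>lborel) = 0" by simp
    then have "AE x in lborel. indicator (tube M \<delta>) x * ennreal (lap n x) = 0"
      by (subst (asm) nn_integral_0_iff_AE) auto
    then have "AE x in lborel. x \<notin> tube M \<delta>"
    proof eventually_elim
      case (elim x)
      have "0 < lap n x" using pi0_pos[of x] by (simp add: lap_def)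
      with elim show ?case by (auto simp: indicator_def split: if_splits)
    qed
    then have null: "tube M \<delta> \<in> null_sets lborel"
      using AE_iff_null_sets[of "tube M \<delta>" lborel] by simp
    obtain u where "u \<in> M" using M_nonempty by blast
    then have "u \<in> tube M \<delta>" using M_subset_tube[OF assms(2)] by blast
    then obtain r where r: "0 < r" "ball u r \<subseteq> tube M \<delta>"
      using open_tube_le[OF assms(1)] openE by blast
    have "emeasure lborel (ball u r) = 0"
      using null_sets_subset[OF null _ r(2)] by auto
    moreover have "0 < unit_ball_vol (real DIM('a))" by simp
    ultimately show False using r(1) by (simp add: emeasure_ball)
  qed
qed

text \<open>The pointwise fibre estimates are integrated first over the fibre, where the main term
  is an exact Gaussian integral, and then over \<open>M\<close> by the tube formula. The upper bound
  is localised to a set \<open>B\<close> of foot points, which is constant on each fibre.\<close>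

lemma laplace_tube:
  obtains \<delta> A where "0 < \<delta>" "\<delta> \<le> \<epsilon>" "0 \<le> A" "total_weight < \<infinity>"
    "\<And>n B. 1 \<le> n \<Longrightarrow> B \<in> sets borel \<Longrightarrow>
      (\<integral>\<^sup>+ x. indicator (tube M \<delta>) x * (indicator B (foot x) * ennreal (lap n x)) \<partial>lborel) \<le>
      ennreal (gauss n * (1 + A / sqrt n)) * (\<integral>\<^sup>+ u. indicator B u * ennreal (weight u) \<partial>vol)"
    "\<And>n. 1 \<le> n \<Longrightarrow>
      (\<integral>\<^sup>+ x. indicator (tube M \<delta>) x * ennreal (norm (x - foot x) * lap n x) \<partial>lborel) \<le>
      ennreal (gauss n * (A / sqrt n)) * total_weight"
    "\<And>n. 1 \<le> n \<Longrightarrow> ennreal (gauss n) * total_weight \<le>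
      (\<integral>\<^sup>+ x. indicator (tube M \<delta>) x * ennreal (lap n x) \<partial>lborel) + ennreal (gauss n * (A / sqrt n)) * total_weight"
proof -
  obtain C \<delta>0 where C: "0 \<le> C" "0 < \<delta>0" "\<delta>0 \<le> \<epsilon>" "C * \<delta>0 \<le> 1" and
    up: "\<And>\<delta> f. \<delta> \<le> \<delta>0 \<Longrightarrow> f \<in> borel_measurable borel \<Longrightarrow> (\<And>x. 0 \<le> f x) \<Longrightarrow>
      (\<integral>\<^sup>+ x. indicator (tube M \<delta>) x * ennreal (f x) \<partial>lborel) \<le> (\<integral>\<^sup>+ u. fiber_integral C \<delta> f u \<partial>vol)" and
    lo: "\<And>\<delta> f. \<delta> \<le> \<delta>0 \<Longrightarrow> f \<in> borel_measurable borel \<Longrightarrow> (\<And>x. 0 \<le> f x) \<Longrightarrow>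
      (\<integral>\<^sup>+ u. fiber_integral (- C) \<delta> f u \<partial>vol) \<le> (\<integral>\<^sup>+ x. indicator (tube M \<delta>) x * ennreal (f x) \<partial>lborel)"
    by (rule tube_formula) blast
  define E where "E n u t = exp (- (n * quad_form codim (H u) t / 2))" for n :: real and u :: 'a and t
  obtain \<delta> a A0 where \<delta>: "0 < \<delta>" "\<delta> \<le> \<delta>0" "\<delta> \<le> 1" and a: "0 < a" and A0: "0 \<le> A0" and
    F1: "\<And>n u t. 1 \<le> n \<Longrightarrow> u \<in> M \<Longrightarrow> tnorm t < \<delta> \<Longrightarrow> lap n (S t u) * (1 + C * tnorm t) \<le>
      \<pi>0 u * (E n u t + A0 / sqrt n * exp (- (a * n * (tnorm t)\<^sup>2)))" and
    F2: "\<And>n u t. 1 \<le> n \<Longrightarrow> u \<in> M \<Longrightarrow> tnorm t < \<delta> \<Longrightarrow> tnorm t * lap n (S t u) * (1 + C * tnorm t) \<le>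
      \<pi>0 u * (A0 / sqrt n * exp (- (a * n * (tnorm t)\<^sup>2)))" and
    F3: "\<And>n u t. 1 \<le> n \<Longrightarrow> u \<in> M \<Longrightarrow> tnorm t < \<delta> \<Longrightarrow> \<pi>0 u * E n u t \<le>
      lap n (S t u) * (1 - C * tnorm t) + \<pi>0 u * (A0 / sqrt n * exp (- (a * n * (tnorm t)\<^sup>2)))" and
    F4: "\<And>n u t. 1 \<le> n \<Longrightarrow> u \<in> M \<Longrightarrow> \<delta> \<le> tnorm t \<Longrightarrow> \<pi>0 u * E n u t \<le>
      \<pi>0 u * (A0 / sqrt n * exp (- (a * n * (tnorm t)\<^sup>2)))"
    unfolding E_def by (rule fiber_pointwise[OF C(1,2,4)]) blast
  have \<delta>\<epsilon>: "\<delta> \<le> \<epsilon>" using \<delta> C by simp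
  obtain c1 where c1: "0 < c1" "\<And>u t. u \<in> M \<Longrightarrow> quad_form codim (H u) t \<le> c1 * (tnorm t)\<^sup>2"
    by (rule quad_form_bounds) blast
  define \<kappa> where "\<kappa> = sqrt ((1 / (2 * a)) ^ codim)"
  \<comment> \<open>A uniform lower bound for the determinant factor in \<open>weight\<close>.
    Dividing by it expresses the remainder, which is an isotropic Gaussian, as a multiple of the
    weight at the same point.\<close>
  define m where "m = sqrt ((1 / c1) ^ codim)"
  have m: "0 < m" using c1(1) by (simp add: m_def)
  have \<kappa>: "0 \<le> \<kappa>" using a by (simp add: \<kappa>_def)
  define A where "A = A0 * \<kappa> / m"
  have A: "0 \<le> A" using A0 \<kappa> m by (simp add: A_def)
  define rem where "rem n u = ennreal (gauss n * (A / sqrt n)) * ennreal (weight u)" for n u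
  have meas_E [measurable]: "E n u \<in> borel_measurable (lborel_PiM codim)" for n u
    unfolding E_def by measurable
  have meas_G [measurable]: "(\<lambda>t. exp (- (a * n * (tnorm t)\<^sup>2))) \<in> borel_measurable (lborel_PiM codim)" for n
    by measurable
  have main: "(\<integral>\<^sup>+ t. ennreal (\<pi>0 u * E n u t) \<partial>lborel_PiM codim) = ennreal (gauss n) * ennreal (weight u)"
    if "1 \<le> n" "u \<in> M" for n u
  proof -
    have "(\<integral>\<^sup>+ t. ennreal (\<pi>0 u * E n u t) \<partial>lborel_PiM codim) = ennreal (\<pi>0 u) * ennreal (gauss n * hdet u powr (- 1 / 2))"
      using gaussian_fiber[OF that(2), of n] that pi0_pos[of u]
      by (simp add: ennreal_mult' nn_integral_cmult E_def less_imp_le)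
    also have "\<dots> = ennreal (\<pi>0 u * (gauss n * hdet u powr (- 1 / 2)))"
      by (rule ennreal_mult'[symmetric]) (use pi0_pos[of u] in simp)
    also have "\<pi>0 u * (gauss n * hdet u powr (- 1 / 2)) = gauss n * weight u"
      using that by (simp add: weight_def)
    also have "ennreal (gauss n * weight u) = ennreal (gauss n) * ennreal (weight u)"
      using gauss_pos[of n] that by (intro ennreal_mult') auto
    finally show ?thesis .
  qed
  have remainder: "(\<integral>\<^sup>+ t. ennreal (\<pi>0 u * (A0 / sqrt n * exp (- (a * n * (tnorm t)\<^sup>2)))) \<partial>lborel_PiM codim) \<le> rem n u"
    if n: "1 \<le> n" and u: "u \<in> M" for n u
  proof -
    \<comment> \<open>The determinant is bounded by comparing Gaussian integrals: the Hessian form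
      lies below c1|t|^2, so its Gaussian has at least the mass of the isotropic one.\<close>
    have "ennreal (gauss n * m) = (\<integral>\<^sup>+ t. ennreal (exp (- (c1 / 2 * n * (tnorm t)\<^sup>2))) \<partial>lborel_PiM codim)"
      using gaussian_fiber_isotropic[of n "c1 / 2"] c1(1) n by (simp add: m_def)
    also have "\<dots> \<le> (\<integral>\<^sup>+ t. ennreal (E n u t) \<partial>lborel_PiM codim)"
      using mult_left_mono[OF c1(2)[OF u], of n] n unfolding E_def
      by (intro nn_integral_mono ennreal_leI) (simp add: mult_ac)
    also have "\<dots> = ennreal (gauss n * hdet u powr (- 1 / 2))"
      using gaussian_fiber[OF u, of n] n by (simp add: E_def)
    finally have "gauss n * m \<le> gauss n * hdet u powr (- 1 / 2)"
      using gauss_pos[of n] n by (subst (asm) ennreal_le_iff) auto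
    then have hm: "m \<le> hdet u powr (- 1 / 2)"
      using gauss_pos[of n] n by (simp add: mult_le_cancel_left_pos)
    have "(\<integral>\<^sup>+ t. ennreal (\<pi>0 u * (A0 / sqrt n * exp (- (a * n * (tnorm t)\<^sup>2)))) \<partial>lborel_PiM codim) =
        (\<integral>\<^sup>+ t. ennreal (\<pi>0 u * (A0 / sqrt n)) * ennreal (exp (- (a * n * (tnorm t)\<^sup>2))) \<partial>lborel_PiM codim)"
      using pi0_pos[of u] A0 n by (simp add: ennreal_mult'[symmetric] less_imp_le mult.assoc)
    also have "\<dots> = ennreal (\<pi>0 u * (A0 / sqrt n)) * ennreal (gauss n * \<kappa>)"
      using gaussian_fiber_isotropic[of n a] a n by (subst nn_integral_cmult) (simp_all add: \<kappa>_def)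
    also have "\<dots> = ennreal (\<pi>0 u * (A0 / sqrt n) * (gauss n * \<kappa>))"
      using pi0_pos[of u] A0 n by (intro ennreal_mult'[symmetric]) (simp add: less_imp_le)
    also have "\<dots> \<le> ennreal (gauss n * (A / sqrt n) * weight u)"
    proof (rule ennreal_leI)
      have "\<pi>0 u * (A0 / sqrt n) * (gauss n * \<kappa>) = (\<pi>0 u * gauss n * (A / sqrt n)) * m"
        using m by (simp add: A_def)
      also have "\<dots> \<le> (\<pi>0 u * gauss n * (A / sqrt n)) * hdet u powr (- 1 / 2)"
        using hm pi0_pos[of u] gauss_pos[of n] A n by (intro mult_left_mono) (auto simp: less_imp_le)
      finally show "\<pi>0 u * (A0 / sqrt n) * (gauss n * \<kappa>) \<le> gauss n * (A / sqrt n) * weight u"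
        using u by (simp add: weight_def mult_ac)
    qed
    also have "\<dots> = rem n u"
      unfolding rem_def using gauss_pos[of n] A n by (intro ennreal_mult') (simp add: less_imp_le)
    finally show ?thesis .
  qed
  have sum_split: "ennreal (gauss n * (1 + A / sqrt n)) * x = ennreal (gauss n) * x + ennreal (gauss n * (A / sqrt n)) * x"
    if "1 \<le> n" for n :: real and x
  proof -
    have "ennreal (gauss n * (1 + A / sqrt n)) = ennreal (gauss n) + ennreal (gauss n * (A / sqrt n))"
      using gauss_pos[of n] A that by (subst ennreal_plus[symmetric]) (simp_all add: less_imp_le algebra_simps)
    then show ?thesis by (simp add: distrib_right)
  qed
  have foot_S: "foot (S t u) = u" if "u \<in> M" "tnorm t < \<delta>" for u t
    using foot_normal_map[OF that(1), of t] that \<delta>\<epsilon> by (simp add: S_eq[OF that(1)])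
  have fib_up: "fiber_integral C \<delta> (\<lambda>x. indicator B (foot x) * lap n x) u \<le>
      indicator B u * (ennreal (gauss n * (1 + A / sqrt n)) * ennreal (weight u))"
    if n: "1 \<le> n" and u: "u \<in> M" for n u B
  proof -
    have "fiber_integral C \<delta> (\<lambda>x. indicator B (foot x) * lap n x) u \<le>
        (\<integral>\<^sup>+ t. indicator B u * (ennreal (\<pi>0 u * E n u t) + ennreal (\<pi>0 u * (A0 / sqrt n * exp (- (a * n * (tnorm t)\<^sup>2))))) \<partial>lborel_PiM codim)"
      unfolding fiber_integral_def
    proof (rule nn_integral_mono)
      fix t
      show "indicator {t. tnorm t < \<delta>} t * ennreal (indicator B (foot (S t u)) * lap n (S t u) * (1 + C * tnorm t)) \<le>
        indicator B u * (ennreal (\<pi>0 u * E n u t) + ennreal (\<pi>0 u * (A0 / sqrt n * exp (- (a * n * (tnorm t)\<^sup>2)))))"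
      proof (cases "tnorm t < \<delta> \<and> u \<in> B")
        case True
        have "ennreal (lap n (S t u) * (1 + C * tnorm t)) \<le> ennreal (\<pi>0 u * E n u t + \<pi>0 u * (A0 / sqrt n * exp (- (a * n * (tnorm t)\<^sup>2))))"
          using F1[OF n u, of t] True by (intro ennreal_leI) (simp add: distrib_left)
        also have "\<dots> = ennreal (\<pi>0 u * E n u t) + ennreal (\<pi>0 u * (A0 / sqrt n * exp (- (a * n * (tnorm t)\<^sup>2))))"
          using pi0_pos[of u] A0 n by (intro ennreal_plus) (simp_all add: less_imp_le E_def)
        finally show ?thesis using True foot_S[OF u, of t] by simp
      next
        case False
        then show ?thesis using foot_S[OF u, of t] by (auto simp: indicator_def)
      qed
    qed
    also have "\<dots> = indicator B u * ((\<integral>\<^sup>+ t. ennreal (\<pi>0 u * E n u t) \<partial>lborel_PiM codim) +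
        (\<integral>\<^sup>+ t. ennreal (\<pi>0 u * (A0 / sqrt n * exp (- (a * n * (tnorm t)\<^sup>2)))) \<partial>lborel_PiM codim))"
      by (subst nn_integral_cmult, simp, subst nn_integral_add) simp_all
    also have "\<dots> \<le> indicator B u * (ennreal (gauss n) * ennreal (weight u) + rem n u)"
      unfolding main[OF n u] by (intro mult_left_mono add_left_mono remainder[OF n u]) simp
    also have "\<dots> = indicator B u * (ennreal (gauss n * (1 + A / sqrt n)) * ennreal (weight u))"
      by (simp add: sum_split[OF n] rem_def)
    finally show ?thesis .
  qed
  have fib_disp: "fiber_integral C \<delta> (\<lambda>x. norm (x - foot x) * lap n x) u \<le> rem n u"
    if n: "1 \<le> n" and u: "u \<in> M" for n u
  proof -
    have "fiber_integral C \<delta> (\<lambda>x. norm (x - foot x) * lap n x) u \<le>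
        (\<integral>\<^sup>+ t. ennreal (\<pi>0 u * (A0 / sqrt n * exp (- (a * n * (tnorm t)\<^sup>2)))) \<partial>lborel_PiM codim)"
      unfolding fiber_integral_def
    proof (rule nn_integral_mono)
      fix t
      have nrm: "norm (S t u - u) = tnorm t"
        using norm_normal_map_diff[OF u, of t] S_eq[OF u, of t] by simp
      show "indicator {t. tnorm t < \<delta>} t * ennreal (norm (S t u - foot (S t u)) * lap n (S t u) * (1 + C * tnorm t)) \<le>
        ennreal (\<pi>0 u * (A0 / sqrt n * exp (- (a * n * (tnorm t)\<^sup>2))))"
        using F2[OF n u, of t] foot_S[OF u, of t] nrm by (cases "tnorm t < \<delta>") (auto intro: ennreal_leI)
    qed
    then show ?thesis using remainder[OF n u] by (rule order.trans)
  qed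
  have fib_lo: "ennreal (gauss n) * ennreal (weight u) \<le> fiber_integral (- C) \<delta> (lap n) u + rem n u"
    if n: "1 \<le> n" and u: "u \<in> M" for n u
  proof -
    let ?R = "\<lambda>t. ennreal (\<pi>0 u * (A0 / sqrt n * exp (- (a * n * (tnorm t)\<^sup>2))))"
    let ?F = "\<lambda>t. indicator {t. tnorm t < \<delta>} t * ennreal (lap n (S t u) * (1 + - C * tnorm t))"
    have "ennreal (gauss n) * ennreal (weight u) = (\<integral>\<^sup>+ t. ennreal (\<pi>0 u * E n u t) \<partial>lborel_PiM codim)"
      by (rule main[OF n u, symmetric])
    also have "\<dots> \<le> (\<integral>\<^sup>+ t. ?F t + ?R t \<partial>lborel_PiM codim)"
    proof (rule nn_integral_mono)
      fix t
      show "ennreal (\<pi>0 u * E n u t) \<le> ?F t + ?R t"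
      proof (cases "tnorm t < \<delta>")
        case True
        have "C * tnorm t \<le> C * \<delta>0" using True \<delta>(2) C(1) by (intro mult_left_mono) auto
        then have pos: "0 \<le> lap n (S t u) * (1 + - C * tnorm t)"
          using C(4) lap_nonneg by (intro mult_nonneg_nonneg) auto
        have "ennreal (\<pi>0 u * E n u t) \<le> ennreal (lap n (S t u) * (1 + - C * tnorm t) + \<pi>0 u * (A0 / sqrt n * exp (- (a * n * (tnorm t)\<^sup>2))))"
          using F3[OF n u True] by (intro ennreal_leI) simp
        also have "\<dots> = ennreal (lap n (S t u) * (1 + - C * tnorm t)) + ?R t"
          using pos pi0_pos[of u] A0 n by (intro ennreal_plus) (simp_all add: less_imp_le)
        finally show ?thesis using True by simp
      next
        case False
        then show ?thesis using F4[OF n u, of t] by (simp add: ennreal_leI)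
      qed
    qed
    also have "\<dots> = (\<integral>\<^sup>+ t. ?F t \<partial>lborel_PiM codim) + (\<integral>\<^sup>+ t. ?R t \<partial>lborel_PiM codim)"
      by (rule nn_integral_add[OF measurable_fiber_slice[OF measurable_lap]]) measurable
    also have "\<dots> \<le> fiber_integral (- C) \<delta> (lap n) u + rem n u"
      unfolding fiber_integral_def by (intro add_left_mono remainder[OF n u])
    finally show ?thesis .
  qed
  have wt_meas [measurable]: "(\<lambda>u. ennreal (weight u)) \<in> borel_measurable vol"
    by (simp cong: measurable_cong_sets)
  have fib_meas [measurable]: "fiber_integral \<sigma> \<delta> (lap n) \<in> borel_measurable vol" for \<sigma> n
    using measurable_fiber_integral[OF measurable_lap] by (simp cong: measurable_cong_sets)
  have finite: "total_weight < \<infinity>"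
  proof -
    \<comment> \<open>At this \<open>n\<close> the relative error is at most 1/2, so half of the
      main term is below the mass in the tube, which is finite.\<close>
    define n where "n = max 1 (4 * A\<^sup>2)"
    have n: "1 \<le> n" by (simp add: n_def)
    have "2 * A \<le> sqrt n"
      using A by (intro real_le_rsqrt) (simp add: n_def power_mult_distrib)
    then have half: "A / sqrt n \<le> 1 / 2" using n by (simp add: divide_simps)
    have "ennreal (gauss n / 2) * ennreal (weight u) \<le> fiber_integral (- C) \<delta> (lap n) u" if u: "u \<in> M" for u
    proof -
      have "gauss n * (A / sqrt n) \<le> gauss n / 2"
        using mult_left_mono[OF half, of "gauss n"] gauss_pos[of n] n by simp
      then have "rem n u \<le> ennreal (gauss n / 2) * ennreal (weight u)"
        unfolding rem_def by (intro mult_right_mono ennreal_leI) auto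
      then have "ennreal (gauss n) * ennreal (weight u) \<le> fiber_integral (- C) \<delta> (lap n) u + ennreal (gauss n / 2) * ennreal (weight u)"
        using fib_lo[OF n u] by (meson add_left_mono order.trans)
      moreover have "ennreal (gauss n) * ennreal (weight u) = ennreal (gauss n / 2) * ennreal (weight u) + ennreal (gauss n / 2) * ennreal (weight u)"
        using gauss_pos[of n] n by (simp add: distrib_right[symmetric] ennreal_plus[symmetric] del: ennreal_plus)
      moreover have "ennreal (gauss n / 2) * ennreal (weight u) < \<top>"
        by (simp add: ennreal_mult_less_top)
      ultimately show ?thesis
        by (auto simp: ennreal_add_left_cancel_le add.commute[of "fiber_integral _ _ _ _"])
    qed
    then have "(\<integral>\<^sup>+ u. ennreal (gauss n / 2) * ennreal (weight u) \<partial>vol) \<le> (\<integral>\<^sup>+ u. fiber_integral (- C) \<delta> (lap n) u \<partial>vol)"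
      using AE_vol by (intro nn_integral_mono_AE) auto
    also have "\<dots> \<le> (\<integral>\<^sup>+ x. indicator (tube M \<delta>) x * ennreal (lap n x) \<partial>lborel)"
      by (rule lo[OF \<delta>(2) measurable_lap lap_nonneg])
    also have "\<dots> < \<infinity>"
      using n by (intro nn_integral_lap_tube(1) \<delta>\<epsilon> \<delta>(1)) auto
    finally have "ennreal (gauss n / 2) * total_weight < \<infinity>"
      unfolding total_weight_def by (subst (asm) nn_integral_cmult) auto
    then show ?thesis
      using gauss_pos[of n] n by (auto simp: ennreal_mult_less_top)
  qed
  have U: "(\<integral>\<^sup>+ x. indicator (tube M \<delta>) x * (indicator B (foot x) * ennreal (lap n x)) \<partial>lborel) \<le>
      ennreal (gauss n * (1 + A / sqrt n)) * (\<integral>\<^sup>+ u. indicator B u * ennreal (weight u) \<partial>vol)"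
    if n: "1 \<le> n" and B [measurable]: "B \<in> sets borel" for n B
  proof -
    have "(\<integral>\<^sup>+ x. indicator (tube M \<delta>) x * (indicator B (foot x) * ennreal (lap n x)) \<partial>lborel) =
        (\<integral>\<^sup>+ x. indicator (tube M \<delta>) x * ennreal (indicator B (foot x) * lap n x) \<partial>lborel)"
      by (intro nn_integral_cong) (auto simp: indicator_def)
    also have "\<dots> \<le> (\<integral>\<^sup>+ u. fiber_integral C \<delta> (\<lambda>x. indicator B (foot x) * lap n x) u \<partial>vol)"
      by (rule up[OF \<delta>(2)]) (measurable, simp add: lap_nonneg)
    also have "\<dots> \<le> (\<integral>\<^sup>+ u. indicator B u * (ennreal (gauss n * (1 + A / sqrt n)) * ennreal (weight u)) \<partial>vol)"
      using AE_vol fib_up[OF n] by (intro nn_integral_mono_AE) auto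
    also have "\<dots> = (\<integral>\<^sup>+ u. ennreal (gauss n * (1 + A / sqrt n)) * (indicator B u * ennreal (weight u)) \<partial>vol)"
      by (simp add: mult_ac)
    also have "\<dots> = ennreal (gauss n * (1 + A / sqrt n)) * (\<integral>\<^sup>+ u. indicator B u * ennreal (weight u) \<partial>vol)"
      by (rule nn_integral_cmult) measurable
    finally show ?thesis .
  qed
  have D: "(\<integral>\<^sup>+ x. indicator (tube M \<delta>) x * ennreal (norm (x - foot x) * lap n x) \<partial>lborel) \<le>
      ennreal (gauss n * (A / sqrt n)) * total_weight" if n: "1 \<le> n" for n
  proof -
    have "(\<integral>\<^sup>+ x. indicator (tube M \<delta>) x * ennreal (norm (x - foot x) * lap n x) \<partial>lborel) \<le>
        (\<integral>\<^sup>+ u. fiber_integral C \<delta> (\<lambda>x. norm (x - foot x) * lap n x) u \<partial>vol)"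
      by (rule up[OF \<delta>(2)]) (measurable, simp add: lap_nonneg)
    also have "\<dots> \<le> (\<integral>\<^sup>+ u. rem n u \<partial>vol)"
      using AE_vol fib_disp[OF n] by (intro nn_integral_mono_AE) auto
    also have "\<dots> = ennreal (gauss n * (A / sqrt n)) * total_weight"
      unfolding rem_def total_weight_def by (rule nn_integral_cmult) measurable
    finally show ?thesis .
  qed
  have L: "ennreal (gauss n) * total_weight \<le>
      (\<integral>\<^sup>+ x. indicator (tube M \<delta>) x * ennreal (lap n x) \<partial>lborel) + ennreal (gauss n * (A / sqrt n)) * total_weight"
    if n: "1 \<le> n" for n
  proof -
    have "ennreal (gauss n) * total_weight = (\<integral>\<^sup>+ u. ennreal (gauss n) * ennreal (weight u) \<partial>vol)"
      unfolding total_weight_def by (rule nn_integral_cmult[symmetric]) measurable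
    also have "\<dots> \<le> (\<integral>\<^sup>+ u. fiber_integral (- C) \<delta> (lap n) u + rem n u \<partial>vol)"
      using AE_vol fib_lo[OF n] by (intro nn_integral_mono_AE) auto
    also have "\<dots> = (\<integral>\<^sup>+ u. fiber_integral (- C) \<delta> (lap n) u \<partial>vol) + (\<integral>\<^sup>+ u. rem n u \<partial>vol)"
      unfolding rem_def by (rule nn_integral_add) measurable
    also have "(\<integral>\<^sup>+ u. rem n u \<partial>vol) = ennreal (gauss n * (A / sqrt n)) * total_weight"
      unfolding rem_def total_weight_def by (rule nn_integral_cmult) measurable
    finally show ?thesis
      using add_right_mono[OF lo[OF \<delta>(2) measurable_lap[of n] lap_nonneg]] by (rule order.trans)
  qed
  show ?thesis
    by (rule that[OF \<delta>(1) \<delta>\<epsilon> A finite U D L])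
qed

text \<open>If the total weight vanished, the upper Laplace estimate with \<open>B = UNIV\<close>
  would make the mass in the tube vanish.\<close>

lemma total_weight_pos: "0 < total_weight"
proof -
  obtain \<delta> A where \<delta>: "0 < \<delta>" "\<delta> \<le> \<epsilon>" and
    U: "\<And>n B. 1 \<le> n \<Longrightarrow> B \<in> sets borel \<Longrightarrow>
      (\<integral>\<^sup>+ x. indicator (tube M \<delta>) x * (indicator B (foot x) * ennreal (lap n x)) \<partial>lborel) \<le>
      ennreal (gauss n * (1 + A / sqrt n)) * (\<integral>\<^sup>+ u. indicator B u * ennreal (weight u) \<partial>vol)"
    by (rule laplace_tube) blast
  have "0 < (\<integral>\<^sup>+ x. indicator (tube M \<delta>) x * ennreal (lap 1 x) \<partial>lborel)"
    by (rule nn_integral_lap_tube(2)[OF \<delta>(2,1)]) simp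
  also have "\<dots> \<le> ennreal (gauss 1 * (1 + A / sqrt 1)) * total_weight"
    using U[of 1 UNIV] by (simp add: total_weight_def)
  finally show ?thesis
    by (auto simp: zero_less_iff_neq_zero)
qed

end

section \<open>Wasserstein bounds from partial transport\<close>

text \<open>The fraction \<open>h\<close> of \<open>\<mu>\<close> is moved by \<open>T\<close>, and what remains is coupled independently
  with the part of \<open>\<nu>\<close> that is not yet used.\<close>

lemma coupling_cost_partial_transport:
  fixes \<mu> \<nu> :: "'a::euclidean_space measure" and T :: "'a \<Rightarrow> 'a" and h :: "'a \<Rightarrow> real"
  assumes \<mu>: "prob_space \<mu>" "sets \<mu> = sets borel" and \<nu>: "prob_space \<nu>" "sets \<nu> = sets borel"
    and T [measurable]: "T \<in> borel_measurable borel" and h [measurable]: "h \<in> borel_measurable borel"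
    and h01: "\<And>x. 0 \<le> h x" "\<And>x. h x \<le> 1"
    and le: "\<And>B. B \<in> sets borel \<Longrightarrow> (\<integral>\<^sup>+ x. indicator B (T x) * ennreal (h x) \<partial>\<mu>) \<le> emeasure \<nu> B"
    and supp: "AE y in \<nu>. norm (y - y0) \<le> D"
  shows "(INF \<gamma>\<in>couplings \<mu> \<nu>. \<integral>\<^sup>+ (x, y). ennreal (norm (x - y) ^ p) \<partial>\<gamma>) \<le>
    (\<integral>\<^sup>+ x. ennreal (norm (x - T x) ^ p * h x) \<partial>\<mu>) + (\<integral>\<^sup>+ x. ennreal ((norm (x - y0) + D) ^ p * (1 - h x)) \<partial>\<mu>)"
proof -
  interpret \<mu>: prob_space \<mu> by fact
  interpret \<nu>: prob_space \<nu> by fact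
  note [measurable_cong] = \<mu>(2) \<nu>(2)
  have sp: "space \<mu> = UNIV" "space \<nu> = UNIV"
    using sets_eq_imp_space_eq[OF \<mu>(2)] sets_eq_imp_space_eq[OF \<nu>(2)] by simp_all
  define \<beta> where "\<beta> = density \<mu> (\<lambda>x. ennreal (1 - h x))"
  define \<tau> where "\<tau> = distr (density \<mu> (\<lambda>x. ennreal (h x))) borel T"
  define \<alpha> where "\<alpha> = distr (density \<mu> (\<lambda>x. ennreal (h x))) borel (\<lambda>x. (x, T x))"
  define m where "m = emeasure \<beta> UNIV"
  have dens: "emeasure (density \<mu> (\<lambda>x. ennreal (h x))) B + emeasure \<beta> B = emeasure \<mu> B" if [measurable]: "B \<in> sets borel" for B
  proof -
    have "emeasure (density \<mu> (\<lambda>x. ennreal (h x))) B + emeasure \<beta> B =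
        (\<integral>\<^sup>+ x. ennreal (h x) * indicator B x + ennreal (1 - h x) * indicator B x \<partial>\<mu>)"
      unfolding \<beta>_def using that \<mu>(2) by (simp add: emeasure_density nn_integral_add)
    also have "\<dots> = (\<integral>\<^sup>+ x. indicator B x \<partial>\<mu>)"
      using h01 by (intro nn_integral_cong) (auto simp: distrib_right[symmetric] ennreal_plus[symmetric] simp del: ennreal_plus)
    finally show ?thesis using that \<mu>(2) by simp
  qed
  have \<tau>_emeasure: "emeasure \<tau> B = (\<integral>\<^sup>+ x. ennreal (h x) * indicator B (T x) \<partial>\<mu>)" if [measurable]: "B \<in> sets borel" for B
  proof -
    have "emeasure \<tau> B = emeasure (density \<mu> (\<lambda>x. ennreal (h x))) (T -` B)"
      unfolding \<tau>_def by (subst emeasure_distr) (simp_all add: sp)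
    also have "\<dots> = (\<integral>\<^sup>+ x. ennreal (h x) * indicator (T -` B) x \<partial>\<mu>)"
      using measurable_sets_borel[OF T that] \<mu>(2) by (subst emeasure_density) simp_all
    also have "\<dots> = (\<integral>\<^sup>+ x. ennreal (h x) * indicator B (T x) \<partial>\<mu>)"
      by (intro nn_integral_cong) (simp add: indicator_def)
    finally show ?thesis .
  qed
  have \<tau>_le: "emeasure \<tau> B \<le> emeasure \<nu> B" if [measurable]: "B \<in> sets borel" for B
  proof -
    have "emeasure \<tau> B = (\<integral>\<^sup>+ x. indicator B (T x) * ennreal (h x) \<partial>\<mu>)"
      by (simp add: \<tau>_emeasure[OF that] mult.commute)
    also have "\<dots> \<le> emeasure \<nu> B" using that by (rule le)
    finally show ?thesis .
  qed
  have \<tau>_sets: "sets \<tau> = sets \<nu>" using \<nu>(2) by (simp add: \<tau>_def)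
  have \<tau>_fin: "finite_measure \<tau>"
  proof (rule finite_measureI)
    have "emeasure \<tau> (space \<tau>) \<le> emeasure \<nu> UNIV" using \<tau>_le[of UNIV] by (simp add: \<tau>_def)
    also have "\<dots> \<le> 1" using \<nu>.emeasure_space_1 sp by simp
    finally show "emeasure \<tau> (space \<tau>) \<noteq> \<infinity>" by (auto simp: top_unique)
  qed
  \<comment> \<open>What the image of the transported part leaves of \<nu>. That this difference is
    a measure is the point of the domination hypothesis; its mass is the mass \<open>m\<close> of
    \<beta>, as both measures complete the same amount to 1.\<close>
  define \<rho> where "\<rho> = diff_measure \<nu> \<tau>"
  have \<rho>_sets [measurable_cong]: "sets \<rho> = sets borel" using \<nu>(2) by (simp add: \<rho>_def)
  have \<rho>: "emeasure \<rho> B = emeasure \<nu> B - emeasure \<tau> B" if "B \<in> sets borel" for B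
    unfolding \<rho>_def using that \<nu>(2) \<tau>_le \<tau>_sets
    by (intro emeasure_diff_measure \<tau>_fin) (auto intro: \<nu>.finite_measure_axioms)
  have \<rho>\<tau>: "emeasure \<tau> B + emeasure \<rho> B = emeasure \<nu> B" if "B \<in> sets borel" for B
    using \<rho>[OF that] \<tau>_le[OF that] by (simp add: add_diff_inverse_ennreal)
  have \<tau>_UNIV: "emeasure \<tau> UNIV = emeasure (density \<mu> (\<lambda>x. ennreal (h x))) UNIV"
    unfolding \<tau>_def by (subst emeasure_distr) (simp_all add: sp)
  have \<rho>_UNIV: "emeasure \<rho> UNIV = m"
  proof -
    have "emeasure \<tau> UNIV + emeasure \<rho> UNIV = 1" using \<rho>\<tau>[of UNIV] \<nu>.emeasure_space_1 sp by simp
    moreover have "emeasure \<tau> UNIV + m = 1"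
      using dens[of UNIV] \<tau>_UNIV \<mu>.emeasure_space_1 sp by (simp add: m_def)
    moreover have "emeasure \<tau> UNIV \<noteq> \<top>"
      using finite_measure.emeasure_finite[OF \<tau>_fin, of UNIV] by simp
    ultimately have "emeasure \<tau> UNIV + emeasure \<rho> UNIV = emeasure \<tau> UNIV + m" by simp
    with \<open>emeasure \<tau> UNIV \<noteq> \<top>\<close> show ?thesis by (simp add: ennreal_add_left_cancel)
  qed
  have m1: "m \<le> 1"
  proof -
    have "m \<le> emeasure (density \<mu> (\<lambda>x. ennreal (h x))) UNIV + m" by simp
    also have "\<dots> = 1" using dens[of UNIV] \<mu>.emeasure_space_1 sp by (simp add: m_def)
    finally show ?thesis .
  qed
  have \<beta>_sets [measurable_cong]: "sets \<beta> = sets borel" using \<mu>(2) by (simp add: \<beta>_def)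
  have minv: "m * inverse m = 1" if "m \<noteq> 0"
  proof -
    have "m \<noteq> \<top>" using m1 by (auto simp: top_unique)
    then show ?thesis using that by (simp add: divide_ennreal_def[symmetric] ennreal_divide_self less_top)
  qed
  \<comment> \<open>For \<open>m = 0\<close> the inverse is infinite, but then \<open>b\<close> is 0
    and the product of infinity and 0 is 0; the case in which nothing remains is thus
    covered.\<close>
  have inv: "inverse m * (b * m) = b" if "b \<le> m" for b
  proof (cases "m = 0")
    case True
    then show ?thesis using that by simp
  next
    case False
    then show ?thesis using minv by (metis mult.assoc mult.commute mult_1_right)
  qed
  have \<rho>_fin: "finite_measure \<rho>"
  proof (rule finite_measureI)
    have "space \<rho> = UNIV" using sets_eq_imp_space_eq[OF \<rho>_sets] by simp
    then show "emeasure \<rho> (space \<rho>) \<noteq> \<infinity>" using \<rho>_UNIV m1 by (auto simp: top_unique)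
  qed
  have \<beta>_fin: "finite_measure \<beta>"
  proof (rule finite_measureI)
    have "space \<beta> = UNIV" using sets_eq_imp_space_eq[OF \<beta>_sets] by simp
    then show "emeasure \<beta> (space \<beta>) \<noteq> \<infinity>" using m1 by (auto simp: top_unique m_def)
  qed
  interpret \<rho>: finite_measure \<rho> by fact
  interpret \<beta>: finite_measure \<beta> by fact
  have pair_sets: "sets (\<beta> \<Otimes>\<^sub>M \<rho>) = sets borel"
    using sets_pair_measure_cong[OF \<beta>_sets \<rho>_sets] unfolding borel_prod .
  \<comment> \<open>The coupling has two summands: the law of (x, T x) on the transported part, and
    the product of the two remainders divided by their common mass.\<close>
  define N where "N b = (if b then \<alpha> else scale_measure (inverse m) (\<beta> \<Otimes>\<^sub>M \<rho>))" for b :: bool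
  have N_sets: "sets (N b) = sets borel" for b
    by (simp add: N_def \<alpha>_def pair_sets)
  define \<gamma> where "\<gamma> = sum_measure UNIV N"
  have UNIV_bool_sum: "(\<Sum>b\<in>UNIV. F b) = F True + F False" for F :: "bool \<Rightarrow> ennreal"
    by (simp add: UNIV_bool)
  have spaces: "space \<beta> = UNIV" "space \<rho> = UNIV"
    using sets_eq_imp_space_eq[OF \<beta>_sets] sets_eq_imp_space_eq[OF \<rho>_sets] by simp_all
  have meas_pair: "(\<lambda>x. (x, T x)) \<in> measurable borel borel"
    by measurable
  have nn\<gamma>: "(\<integral>\<^sup>+ z. f z \<partial>\<gamma>) = (\<integral>\<^sup>+ x. ennreal (h x) * f (x, T x) \<partial>\<mu>) + inverse m * (\<integral>\<^sup>+ x. \<integral>\<^sup>+ y. f (x, y) \<partial>\<rho> \<partial>\<beta>)"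
    if f [measurable]: "f \<in> borel_measurable borel" for f
  proof -
    have f1: "(\<lambda>x. f (x, T x)) \<in> borel_measurable borel"
      using measurable_compose[OF meas_pair f] .
    have f2: "f \<in> borel_measurable (\<beta> \<Otimes>\<^sub>M \<rho>)"
      using f pair_sets by (simp cong: measurable_cong_sets)
    have "(\<integral>\<^sup>+ z. f z \<partial>\<gamma>) = (\<integral>\<^sup>+ z. f z \<partial>\<alpha>) + (\<integral>\<^sup>+ z. f z \<partial>scale_measure (inverse m) (\<beta> \<Otimes>\<^sub>M \<rho>))"
      unfolding \<gamma>_def using nn_integral_sum_measure[of UNIV N f] N_sets f by (simp add: UNIV_bool_sum N_def)
    also have "(\<integral>\<^sup>+ z. f z \<partial>\<alpha>) = (\<integral>\<^sup>+ x. ennreal (h x) * f (x, T x) \<partial>\<mu>)"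
      unfolding \<alpha>_def using f1 meas_pair
      by (subst nn_integral_distr) (simp_all add: nn_integral_density cong: measurable_cong_sets)
    also have "(\<integral>\<^sup>+ z. f z \<partial>scale_measure (inverse m) (\<beta> \<Otimes>\<^sub>M \<rho>)) = inverse m * (\<integral>\<^sup>+ z. f z \<partial>(\<beta> \<Otimes>\<^sub>M \<rho>))"
      using f2 by (rule nn_integral_scale_measure)
    also have "(\<integral>\<^sup>+ z. f z \<partial>(\<beta> \<Otimes>\<^sub>M \<rho>)) = (\<integral>\<^sup>+ x. \<integral>\<^sup>+ y. f (x, y) \<partial>\<rho> \<partial>\<beta>)"
      using f2 by (rule \<rho>.nn_integral_fst[symmetric])
    finally show ?thesis .
  qed
  have \<gamma>_sets: "sets \<gamma> = sets borel" by (simp add: \<gamma>_def)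
  have proj_borel: "(fst :: 'a \<times> 'a \<Rightarrow> 'a) \<in> borel_measurable borel" "(snd :: 'a \<times> 'a \<Rightarrow> 'a) \<in> borel_measurable borel"
    by (auto intro!: borel_measurable_continuous_onI continuous_intros)
  then have fst_meas: "fst \<in> measurable \<gamma> borel" "snd \<in> measurable \<gamma> borel"
    using measurable_cong_sets[OF \<gamma>_sets refl, of borel] by auto
  have "distr \<gamma> borel fst = \<mu>"
  proof (rule measure_eqI)
    fix B assume "B \<in> sets (distr \<gamma> borel fst)"
    then have B [measurable]: "B \<in> sets borel" by simp
    have "emeasure (distr \<gamma> borel fst) B = (\<integral>\<^sup>+ z. indicator B (fst z) \<partial>\<gamma>)"
      using B by (subst nn_integral_distr[OF fst_meas(1), symmetric]) simp_all
    also have "\<dots> = (\<integral>\<^sup>+ x. ennreal (h x) * indicator B x \<partial>\<mu>) + inverse m * (\<integral>\<^sup>+ x. \<integral>\<^sup>+ y. indicator B x \<partial>\<rho> \<partial>\<beta>)"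
      by (subst nn\<gamma>[OF measurable_compose[OF proj_borel(1) borel_measurable_indicator[OF B]]]) simp
    also have "(\<integral>\<^sup>+ x. \<integral>\<^sup>+ y. indicator B x \<partial>\<rho> \<partial>\<beta>) = emeasure \<beta> B * m"
      by (simp add: spaces \<rho>_UNIV nn_integral_multc \<beta>_sets)
    also have "inverse m * (emeasure \<beta> B * m) = emeasure \<beta> B"
      using \<beta>_sets B by (intro inv) (auto simp: m_def intro: emeasure_mono)
    also have "(\<integral>\<^sup>+ x. ennreal (h x) * indicator B x \<partial>\<mu>) = emeasure (density \<mu> (\<lambda>x. ennreal (h x))) B"
      using B \<mu>(2) by (subst emeasure_density) auto
    also have "\<dots> + emeasure \<beta> B = emeasure \<mu> B" by (rule dens[OF B])
    finally show "emeasure (distr \<gamma> borel fst) B = emeasure \<mu> B" .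
  qed (simp add: \<mu>)
  moreover have "distr \<gamma> borel snd = \<nu>"
  proof (rule measure_eqI)
    fix B assume "B \<in> sets (distr \<gamma> borel snd)"
    then have B [measurable]: "B \<in> sets borel" by simp
    have "emeasure (distr \<gamma> borel snd) B = (\<integral>\<^sup>+ z. indicator B (snd z) \<partial>\<gamma>)"
      using B by (subst nn_integral_distr[OF fst_meas(2), symmetric]) simp_all
    also have "\<dots> = (\<integral>\<^sup>+ x. ennreal (h x) * indicator B (T x) \<partial>\<mu>) + inverse m * (\<integral>\<^sup>+ x. \<integral>\<^sup>+ y. indicator B y \<partial>\<rho> \<partial>\<beta>)"
      by (subst nn\<gamma>[OF measurable_compose[OF proj_borel(2) borel_measurable_indicator[OF B]]]) simp
    also have "(\<integral>\<^sup>+ x. \<integral>\<^sup>+ y. indicator B y \<partial>\<rho> \<partial>\<beta>) = emeasure \<rho> B * m"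
      using B by (simp add: spaces m_def \<rho>_sets)
    also have "inverse m * (emeasure \<rho> B * m) = emeasure \<rho> B"
      using B \<rho>_sets by (intro inv) (auto simp: \<rho>_UNIV[symmetric] intro: emeasure_mono)
    also have "(\<integral>\<^sup>+ x. ennreal (h x) * indicator B (T x) \<partial>\<mu>) = emeasure \<tau> B"
      by (rule \<tau>_emeasure[OF B, symmetric])
    also have "emeasure \<tau> B + emeasure \<rho> B = emeasure \<nu> B" by (rule \<rho>\<tau>[OF B])
    finally show "emeasure (distr \<gamma> borel snd) B = emeasure \<nu> B" .
  qed (simp add: \<nu>)
  ultimately have "\<gamma> \<in> couplings \<mu> \<nu>"
    using \<gamma>_sets by (simp add: couplings_def)
  then have "(INF \<gamma>\<in>couplings \<mu> \<nu>. \<integral>\<^sup>+ (x, y). ennreal (norm (x - y) ^ p) \<partial>\<gamma>) \<le>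
      (\<integral>\<^sup>+ z. ennreal (norm (fst z - snd z) ^ p) \<partial>\<gamma>)"
    by (intro INF_lower2[of \<gamma>]) (auto simp: split_def)
  also have "\<dots> = (\<integral>\<^sup>+ x. ennreal (h x) * ennreal (norm (x - T x) ^ p) \<partial>\<mu>) +
      inverse m * (\<integral>\<^sup>+ x. \<integral>\<^sup>+ y. ennreal (norm (x - y) ^ p) \<partial>\<rho> \<partial>\<beta>)"
    by (subst nn\<gamma>) (auto intro!: measurable_compose[OF _ measurable_ennreal] borel_measurable_continuous_onI continuous_intros)
  also have "(\<integral>\<^sup>+ x. ennreal (h x) * ennreal (norm (x - T x) ^ p) \<partial>\<mu>) = (\<integral>\<^sup>+ x. ennreal (norm (x - T x) ^ p * h x) \<partial>\<mu>)"
    using h01 by (intro nn_integral_cong) (simp add: ennreal_mult' mult.commute)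
  also have "inverse m * (\<integral>\<^sup>+ x. \<integral>\<^sup>+ y. ennreal (norm (x - y) ^ p) \<partial>\<rho> \<partial>\<beta>) \<le>
      (\<integral>\<^sup>+ x. ennreal ((norm (x - y0) + D) ^ p * (1 - h x)) \<partial>\<mu>)"
  proof -
    \<comment> \<open>Being a part of \<nu>, the remainder also lives in the ball of radius
      \<open>D\<close> around \<open>y0\<close>, so the distance from \<open>x\<close> is at most
      the distance from \<open>x\<close> to \<open>y0\<close> plus \<open>D\<close>.\<close>
    have null: "AE y in \<rho>. norm (y - y0) \<le> D"
    proof -
      have meas: "{y. \<not> norm (y - y0) \<le> D} \<in> sets borel" by measurable
      have "emeasure \<nu> {y. \<not> norm (y - y0) \<le> D} = 0"
        using supp meas \<nu>(2) by (subst (asm) AE_iff_measurable[OF _ refl]) (auto simp: sp)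
      then have "emeasure \<rho> {y. \<not> norm (y - y0) \<le> D} = 0"
        using \<rho>\<tau>[OF meas] by simp
      then show ?thesis
        using meas by (subst AE_iff_measurable[OF _ refl]) (auto simp: spaces \<rho>_sets)
    qed
    have "(\<integral>\<^sup>+ x. \<integral>\<^sup>+ y. ennreal (norm (x - y) ^ p) \<partial>\<rho> \<partial>\<beta>) \<le> (\<integral>\<^sup>+ x. \<integral>\<^sup>+ y. ennreal ((norm (x - y0) + D) ^ p) \<partial>\<rho> \<partial>\<beta>)"
    proof (rule nn_integral_mono, rule nn_integral_mono_AE)
      fix x
      show "AE y in \<rho>. ennreal (norm (x - y) ^ p) \<le> ennreal ((norm (x - y0) + D) ^ p)"
        using null
      proof eventually_elim
        case (elim y)
        then show ?case
          using norm_triangle_ineq4[of "x - y0" "y - y0"] by (intro ennreal_leI power_mono) auto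
      qed
    qed
    also have "\<dots> = (\<integral>\<^sup>+ x. ennreal ((norm (x - y0) + D) ^ p) \<partial>\<beta>) * m"
      by (simp add: spaces \<rho>_UNIV nn_integral_multc)
    finally have "inverse m * (\<integral>\<^sup>+ x. \<integral>\<^sup>+ y. ennreal (norm (x - y) ^ p) \<partial>\<rho> \<partial>\<beta>) \<le>
        inverse m * ((\<integral>\<^sup>+ x. ennreal ((norm (x - y0) + D) ^ p) \<partial>\<beta>) * m)"
      by (rule mult_left_mono) simp
    also have "\<dots> \<le> (\<integral>\<^sup>+ x. ennreal ((norm (x - y0) + D) ^ p) \<partial>\<beta>)"
    proof (cases "m = 0")
      case False
      have "inverse m * (J * m) = J" for J
        using minv[OF False] by (metis mult.assoc mult.commute mult_1_right)
      then show ?thesis by simp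
    qed simp
    also have "\<dots> = (\<integral>\<^sup>+ x. ennreal (1 - h x) * ennreal ((norm (x - y0) + D) ^ p) \<partial>\<mu>)"
      unfolding \<beta>_def by (rule nn_integral_density) measurable
    also have "\<dots> = (\<integral>\<^sup>+ x. ennreal ((norm (x - y0) + D) ^ p * (1 - h x)) \<partial>\<mu>)"
      using h01 by (intro nn_integral_cong) (simp add: ennreal_mult' mult.commute)
    finally show ?thesis .
  qed
  finally show ?thesis by (simp add: add_left_mono)
qed

lemma wasserstein_le:
  assumes p: "1 \<le> p" and K: "0 \<le> K" and n: "1 \<le> (n :: nat)"
    and le: "(INF \<gamma>\<in>couplings \<mu> \<nu>. \<integral>\<^sup>+ (x, y). ennreal (norm (x - y) ^ p) \<partial>\<gamma>) \<le> ennreal (K / sqrt n)"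
  shows "wasserstein p \<mu> \<nu> \<le> ennreal (root p K * real n powr (- 1 / (2 * real p)))"
proof -
  let ?I = "INF \<gamma>\<in>couplings \<mu> \<nu>. \<integral>\<^sup>+ (x, y). ennreal (norm (x - y) ^ p) \<partial>\<gamma>"
  have "?I < \<infinity>" using le_less_trans[OF le ennreal_less_top] by (simp only: infinity_ennreal_def)
  then have fin: "?I \<noteq> \<infinity>" by (rule less_imp_neq)
  have "enn2real ?I \<le> K / sqrt n"
    using enn2real_mono[OF le] K by simp
  then have "root p (enn2real ?I) \<le> root p (K / sqrt n)"
    using p by (intro real_root_le_mono) auto
  also have "\<dots> = root p K * root p (1 / sqrt n)"
    using real_root_mult[of p K "1 / sqrt n"] p by simp
  also have "root p (1 / sqrt n) = real n powr (- 1 / (2 * real p))"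
  proof -
    have "root p (1 / sqrt n) = (1 / sqrt n) powr (1 / p)"
      using p n by (intro root_powr_inverse) auto
    also have "(1 / sqrt n) powr (1 / p) = (real n powr (- 1 / 2)) powr (1 / p)"
      using n by (simp add: powr_minus powr_half_sqrt divide_simps)
    also have "(real n powr (- 1 / 2)) powr (1 / p) = real n powr (- 1 / (2 * real p))"
      by (simp add: powr_powr)
    finally show ?thesis .
  qed
  finally show ?thesis
    unfolding wasserstein_def ennreal_root_def if_not_P[OF fin] by (rule ennreal_leI)
qed

text \<open>From (1 + y/N)^N \<le> exp y at y = \<kappa> x. The shift to x - 1 appears because one
  factor exp (- l) is held back for integrability away from the tubes.\<close>

lemma power_le_exp_decay:
  fixes x \<kappa> :: real
  assumes "0 < \<kappa>" "1 \<le> x"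
  shows "x ^ N * exp (- ((x - 1) * \<kappa>)) \<le> exp \<kappa> * (real (Suc N) / \<kappa>) ^ Suc N"
proof -
  let ?N = "Suc N"
  have "(\<kappa> * x / ?N) ^ ?N \<le> (1 + \<kappa> * x / ?N) ^ ?N"
    using assms by (intro power_mono) auto
  also have "\<dots> \<le> exp (\<kappa> * x)"
  proof (intro exp_ge_one_plus_x_over_n_power_n)
    have "0 \<le> \<kappa> * x" using assms by simp
    then show "- real ?N \<le> \<kappa> * x" by linarith
  qed simp
  finally have "(\<kappa> * x / ?N) ^ ?N \<le> exp (\<kappa> * x)" .
  then have "x ^ ?N * (\<kappa> / ?N) ^ ?N \<le> exp (\<kappa> * x)"
    by (simp add: power_mult_distrib[symmetric] mult.commute del: power_Suc)
  then have "x ^ ?N * (\<kappa> / ?N) ^ ?N * (real ?N / \<kappa>) ^ ?N \<le> exp (\<kappa> * x) * (real ?N / \<kappa>) ^ ?N"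
    using assms by (intro mult_right_mono) auto
  moreover have "(\<kappa> / ?N) ^ ?N * (real ?N / \<kappa>) ^ ?N = 1"
    unfolding power_mult_distrib[symmetric] using assms by simp
  ultimately have "x ^ ?N \<le> exp (\<kappa> * x) * (real ?N / \<kappa>) ^ ?N"
    by (simp only: mult.assoc mult_1_right)
  then have "x ^ ?N * exp (- ((x - 1) * \<kappa>)) \<le> exp (\<kappa> * x) * (real ?N / \<kappa>) ^ ?N * exp (- ((x - 1) * \<kappa>))"
    by (intro mult_right_mono) auto
  also have "\<dots> = exp (\<kappa> * x) * exp (- ((x - 1) * \<kappa>)) * (real ?N / \<kappa>) ^ ?N"
    by (simp only: mult_ac)
  also have "exp (\<kappa> * x) * exp (- ((x - 1) * \<kappa>)) = exp \<kappa>"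
    by (simp add: exp_add[symmetric] algebra_simps)
  finally have "x ^ ?N * exp (- ((x - 1) * \<kappa>)) \<le> exp \<kappa> * (real ?N / \<kappa>) ^ ?N" .
  moreover have "x ^ N \<le> x ^ ?N"
    using assms by (intro power_increasing) auto
  ultimately show ?thesis
    using mult_right_mono[of "x ^ N" "x ^ ?N" "exp (- ((x - 1) * \<kappa>))"] by simp
qed

section \<open>From tubes to the Wasserstein distance\<close>

text \<open>The geometry is forgotten: components \<open>i\<close> in \<open>I\<close> have a tube
  \<open>E i\<close>, a projection \<open>T i\<close>, a volume \<open>V i\<close> with weight
  \<open>w i\<close> of total \<open>W i\<close>, a relative error \<open>A i\<close> and a Gaussian
  factor \<open>G i n\<close>. For the top components \<open>J\<close> this factor is the common
  \<open>g n\<close>, for the others it is smaller by n^(-1/2). The polynomial lower bound on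
  \<open>g\<close> is what lets exponentially small terms be absorbed.\<close>

locale laplace_pieces =
  fixes I J :: "nat set" and E :: "nat \<Rightarrow> 'a::euclidean_space set" and T :: "nat \<Rightarrow> 'a \<Rightarrow> 'a"
    and V :: "nat \<Rightarrow> 'a measure" and w :: "nat \<Rightarrow> 'a \<Rightarrow> real" and W A :: "nat \<Rightarrow> real"
    and G :: "nat \<Rightarrow> nat \<Rightarrow> real" and g :: "nat \<Rightarrow> real" and CG :: real and N p :: nat
    and D \<kappa> \<epsilon> :: real and y0 :: 'a and l \<pi>0 :: "'a \<Rightarrow> real"
  assumes finite_I: "finite I" and J_sub: "J \<subseteq> I" and J_nonempty: "J \<noteq> {}" and p: "1 \<le> p"
    and E_borel: "\<And>i. i \<in> I \<Longrightarrow> E i \<in> sets borel" and E_disjoint: "disjoint_family_on E I"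
    and T_meas: "\<And>i. i \<in> I \<Longrightarrow> T i \<in> borel_measurable borel"
    and T_near: "\<And>i x. i \<in> I \<Longrightarrow> x \<in> E i \<Longrightarrow> norm (x - T i x) \<le> \<epsilon>"
    and E_bound: "\<And>i x. i \<in> I \<Longrightarrow> x \<in> E i \<Longrightarrow> norm (x - y0) \<le> D"
    and V_sets: "\<And>i. i \<in> I \<Longrightarrow> sets (V i) = sets borel"
    and w_meas: "\<And>i. i \<in> I \<Longrightarrow> w i \<in> borel_measurable borel"
    and W_eq: "\<And>i. i \<in> I \<Longrightarrow> (\<integral>\<^sup>+ u. ennreal (w i u) \<partial>V i) = ennreal (W i)"
    and W_pos: "\<And>i. i \<in> I \<Longrightarrow> 0 < W i"
    and V_bound: "\<And>i. i \<in> I \<Longrightarrow> AE u in V i. norm (u - y0) \<le> D"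
    and A_nonneg: "\<And>i. i \<in> I \<Longrightarrow> 0 \<le> A i"
    and nonneg: "0 \<le> D" "0 < \<kappa>" "0 \<le> \<epsilon>" "0 \<le> CG"
    and g_pos: "\<And>n. 1 \<le> n \<Longrightarrow> 0 < g n"
    and g_antimono: "\<And>n n'. 1 \<le> n \<Longrightarrow> n \<le> n' \<Longrightarrow> g n' \<le> g n"
    and g_lower: "\<And>n. 1 \<le> n \<Longrightarrow> 1 / real n ^ N \<le> g n"
    and G_top: "\<And>i n. i \<in> J \<Longrightarrow> G i n = g n"
    and G_low: "\<And>i n. i \<in> I - J \<Longrightarrow> 1 \<le> n \<Longrightarrow> G i n \<le> CG * g n / sqrt n"
    and G_nonneg: "\<And>i n. i \<in> I \<Longrightarrow> 0 \<le> G i n"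
    and upper: "\<And>i n B. i \<in> I \<Longrightarrow> 1 \<le> n \<Longrightarrow> B \<in> sets borel \<Longrightarrow>
      (\<integral>\<^sup>+ x. indicator (E i) x * (indicator B (T i x) * ennreal (exp (- (real n * l x)) * \<pi>0 x)) \<partial>lborel) \<le>
      ennreal (G i n * (1 + A i / sqrt n)) * (\<integral>\<^sup>+ u. indicator B u * ennreal (w i u) \<partial>V i)"
    and deviation: "\<And>i n. i \<in> I \<Longrightarrow> 1 \<le> n \<Longrightarrow>
      (\<integral>\<^sup>+ x. indicator (E i) x * ennreal (norm (x - T i x) * (exp (- (real n * l x)) * \<pi>0 x)) \<partial>lborel) \<le>
      ennreal (G i n * (A i / sqrt n)) * ennreal (W i)"
    and lower: "\<And>i n. i \<in> I \<Longrightarrow> 1 \<le> n \<Longrightarrow> ennreal (G i n) * ennreal (W i) \<le>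
      (\<integral>\<^sup>+ x. indicator (E i) x * ennreal (exp (- (real n * l x)) * \<pi>0 x) \<partial>lborel) +
      ennreal (G i n * (A i / sqrt n)) * ennreal (W i)"
    and outside: "\<And>x. x \<notin> (\<Union>i\<in>I. E i) \<Longrightarrow> \<kappa> \<le> l x"
    and l_meas: "l \<in> borel_measurable borel" and l_nonneg: "\<And>x. 0 \<le> l x"
    and pi0_meas: "\<pi>0 \<in> borel_measurable borel" and pi0_nonneg: "\<And>x. 0 \<le> \<pi>0 x"
    and mass_fin: "(\<integral>\<^sup>+ x. ennreal (exp (- l x) * \<pi>0 x) \<partial>lborel) < \<infinity>"
    and moment: "(\<integral>\<^sup>+ x. ennreal (norm (x - y0) ^ p * (exp (- l x) * \<pi>0 x)) \<partial>lborel) < \<infinity>"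
begin

definition bolt :: "nat \<Rightarrow> 'a \<Rightarrow> real" where
  "bolt n x = exp (- (real n * l x)) * \<pi>0 x"

definition Z :: "nat \<Rightarrow> ennreal" where
  "Z n = (\<integral>\<^sup>+ x. ennreal (bolt n x) \<partial>lborel)"

definition \<Lambda> :: real where "\<Lambda> = (\<Sum>i\<in>J. W i)"

definition AA :: real where "AA = (\<Sum>i\<in>I. A i)"

definition top_tubes :: "'a set" where "top_tubes = (\<Union>i\<in>J. E i)"

text \<open>The projections of the top tubes glued together; at most one summand is nonzero, and the
  value elsewhere is 0.\<close>

definition \<Theta> :: "'a \<Rightarrow> 'a" where
  "\<Theta> x = (\<Sum>i\<in>J. indicator (E i) x *\<^sub>R T i x)"

lemma finite_J: "finite J"
  using finite_I J_sub finite_subset by blast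

lemma measurable_bolt [measurable]: "bolt n \<in> borel_measurable borel"
  unfolding bolt_def using l_meas pi0_meas by measurable

lemma bolt_nonneg [simp]: "0 \<le> bolt n x"
  using pi0_nonneg by (simp add: bolt_def)

lemma \<Lambda>_pos: "0 < \<Lambda>"
  unfolding \<Lambda>_def using finite_J J_nonempty J_sub W_pos by (intro sum_pos) auto

lemma A_le: "i \<in> I \<Longrightarrow> A i \<le> AA"
  unfolding AA_def using finite_I A_nonneg by (intro member_le_sum) auto

lemma AA_nonneg: "0 \<le> AA"
  unfolding AA_def using A_nonneg by (intro sum_nonneg) auto

lemma indicator_pieces:
  assumes "i \<in> I" "j \<in> I" "x \<in> E i"
  shows "indicator (E j) x = (if j = i then 1 else 0)"
  using assms E_disjoint by (auto simp: disjoint_family_on_def indicator_def)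

lemma sum_pieces:
  fixes f :: "nat \<Rightarrow> 'b::semiring_1"
  assumes "S \<subseteq> I" "i \<in> S" "x \<in> E i"
  shows "(\<Sum>j\<in>S. indicator (E j) x * f j) = f i"
proof -
  have "(\<Sum>j\<in>S. indicator (E j) x * f j) = (\<Sum>j\<in>S. if j = i then f j else 0)"
    using assms by (intro sum.cong refl) (auto simp: indicator_pieces[of i _ x] subset_iff)
  also have "\<dots> = f i"
    using assms finite_subset[OF assms(1) finite_I] by simp
  finally show ?thesis .
qed

lemma \<Theta>_eq: "i \<in> J \<Longrightarrow> x \<in> E i \<Longrightarrow> \<Theta> x = T i x"
proof -
  assume i: "i \<in> J" "x \<in> E i"
  have "\<Theta> x = (\<Sum>j\<in>J. if j = i then T j x else 0)"
    unfolding \<Theta>_def using i J_sub by (intro sum.cong refl) (auto simp: indicator_pieces[of i _ x] subset_iff)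
  also have "\<dots> = T i x" using i finite_J by simp
  finally show ?thesis .
qed

lemma measurable_\<Theta> [measurable]: "\<Theta> \<in> borel_measurable borel"
  unfolding \<Theta>_def using E_borel T_meas J_sub
  by (intro borel_measurable_sum borel_measurable_scaleR borel_measurable_indicator) auto

lemma top_tubes_borel [measurable]: "top_tubes \<in> sets borel"
  unfolding top_tubes_def using finite_J E_borel J_sub by (intro sets.finite_UN) auto

lemma nn_integral_pieces:
  assumes "S \<subseteq> I" and f: "\<And>i. i \<in> S \<Longrightarrow> f i \<in> borel_measurable borel"
  shows "(\<integral>\<^sup>+ x. (\<Sum>i\<in>S. indicator (E i) x * f i x) \<partial>lborel) = (\<Sum>i\<in>S. \<integral>\<^sup>+ x. indicator (E i) x * f i x \<partial>lborel)"
proof (rule nn_integral_sum)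
  fix i assume "i \<in> S"
  then have "E i \<in> sets borel" "f i \<in> borel_measurable borel" using assms E_borel by auto
  then show "(\<lambda>x. indicator (E i) x * f i x) \<in> borel_measurable lborel" by measurable
qed

lemma ennreal_sum_W: "(\<Sum>i\<in>J. ennreal (c i) * ennreal (W i)) = ennreal (\<Sum>i\<in>J. c i * W i)"
  if "\<And>i. i \<in> J \<Longrightarrow> 0 \<le> c i"
proof -
  have "(\<Sum>i\<in>J. ennreal (c i) * ennreal (W i)) = (\<Sum>i\<in>J. ennreal (c i * W i))"
    using that J_sub W_pos by (intro sum.cong refl ennreal_mult[symmetric]) (auto intro: less_imp_le)
  also have "\<dots> = ennreal (\<Sum>i\<in>J. c i * W i)"
    using that J_sub W_pos by (intro sum_ennreal mult_nonneg_nonneg) (auto intro: less_imp_le)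
  finally show ?thesis .
qed

lemma sum_W_le: "(\<Sum>i\<in>J. (a * A i) * W i) \<le> (a * AA) * \<Lambda>" if "0 \<le> a"
proof -
  have "(\<Sum>i\<in>J. (a * A i) * W i) \<le> (\<Sum>i\<in>J. (a * AA) * W i)"
    using that J_sub W_pos A_le by (intro sum_mono mult_right_mono mult_left_mono) (auto intro: less_imp_le)
  then show ?thesis by (simp add: \<Lambda>_def sum_distrib_left)
qed

lemma Z_antimono: "n \<le> n' \<Longrightarrow> Z n' \<le> Z n"
  unfolding Z_def bolt_def
  by (intro nn_integral_mono ennreal_leI mult_right_mono) (auto simp: pi0_nonneg l_nonneg intro: mult_right_mono)

lemma Z_finite: "1 \<le> n \<Longrightarrow> Z n < \<infinity>"
  using Z_antimono[of 1 n] mass_fin by (auto simp: Z_def bolt_def intro: le_less_trans)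

lemma Z_lower:
  assumes n: "1 \<le> n"
  shows "g n * \<Lambda> \<le> enn2real (Z n) + g n / sqrt n * AA * \<Lambda>"
proof -
  have g: "0 \<le> g n" using g_pos[OF n] by simp
  have A: "\<And>i. i \<in> J \<Longrightarrow> 0 \<le> A i" using A_nonneg J_sub by auto
  have "ennreal (g n * \<Lambda>) = (\<Sum>i\<in>J. ennreal (g n) * ennreal (W i))"
    using g by (subst ennreal_sum_W) (simp_all add: \<Lambda>_def sum_distrib_left)
  also have "\<dots> \<le> (\<Sum>i\<in>J. (\<integral>\<^sup>+ x. indicator (E i) x * ennreal (bolt n x) \<partial>lborel) + ennreal (g n / sqrt n * A i) * ennreal (W i))"
  proof (rule sum_mono)
    fix i assume i: "i \<in> J"
    then show "ennreal (g n) * ennreal (W i) \<le> (\<integral>\<^sup>+ x. indicator (E i) x * ennreal (bolt n x) \<partial>lborel) + ennreal (g n / sqrt n * A i) * ennreal (W i)"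
      using lower[of i n] n J_sub G_top[OF i] by (auto simp: bolt_def)
  qed
  also have "\<dots> = (\<Sum>i\<in>J. \<integral>\<^sup>+ x. indicator (E i) x * ennreal (bolt n x) \<partial>lborel) + ennreal (\<Sum>i\<in>J. (g n / sqrt n * A i) * W i)"
    using g A by (subst ennreal_sum_W[symmetric]) (auto simp: sum.distrib)
  also have "\<dots> \<le> Z n + ennreal (g n / sqrt n * AA * \<Lambda>)"
  proof (rule add_mono)
    have "(\<Sum>i\<in>J. \<integral>\<^sup>+ x. indicator (E i) x * ennreal (bolt n x) \<partial>lborel) =
        (\<integral>\<^sup>+ x. (\<Sum>i\<in>J. indicator (E i) x * ennreal (bolt n x)) \<partial>lborel)"
      using J_sub by (intro nn_integral_pieces[symmetric]) auto
    also have "\<dots> \<le> Z n"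
      unfolding Z_def
    proof (rule nn_integral_mono)
      fix x
      show "(\<Sum>i\<in>J. indicator (E i) x * ennreal (bolt n x)) \<le> ennreal (bolt n x)"
      proof (cases "x \<in> top_tubes")
        case True
        then obtain i where i: "i \<in> J" "x \<in> E i" by (auto simp: top_tubes_def)
        show ?thesis using sum_pieces[OF J_sub i, of "\<lambda>_. ennreal (bolt n x)"] by simp
      next
        case False
        then have "(\<Sum>i\<in>J. indicator (E i) x * ennreal (bolt n x)) = 0"
          by (intro sum.neutral) (auto simp: top_tubes_def)
        then show ?thesis by simp
      qed
    qed
    finally show "(\<Sum>i\<in>J. \<integral>\<^sup>+ x. indicator (E i) x * ennreal (bolt n x) \<partial>lborel) \<le> Z n" .
    show "ennreal (\<Sum>i\<in>J. (g n / sqrt n * A i) * W i) \<le> ennreal (g n / sqrt n * AA * \<Lambda>)"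
      using g by (intro ennreal_leI sum_W_le) simp
  qed
  also have "\<dots> = ennreal (enn2real (Z n) + g n / sqrt n * AA * \<Lambda>)"
    using Z_finite[OF n] g AA_nonneg \<Lambda>_pos by (subst ennreal_plus) (auto simp: less_top)
  finally show ?thesis
    using g AA_nonneg \<Lambda>_pos by (subst (asm) ennreal_le_iff) auto
qed

text \<open>The estimate \<open>Z_lower\<close> says something only once the relative error
  \<open>AA / sqrt n\<close> is below 1. The finitely many smaller \<open>n\<close> are covered by
  monotonicity of \<open>Z\<close> and \<open>g\<close>.\<close>

lemma Z_lower_gaussian:
  obtains \<zeta> where "0 < \<zeta>" "\<And>n. 1 \<le> n \<Longrightarrow> \<zeta> * g n \<le> enn2real (Z n)"
proof -
  obtain n0 :: nat where n0: "(2 * AA)\<^sup>2 \<le> n0" "1 \<le> n0"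
    using real_arch_simple[of "max 1 ((2 * AA)\<^sup>2)"] by auto
  have large: "g n * (\<Lambda> / 2) \<le> enn2real (Z n)" if n: "n0 \<le> n" for n
  proof -
    have "(2 * AA)\<^sup>2 \<le> real n" using n0 n by linarith
    then have "2 * AA \<le> sqrt n" by (rule real_le_rsqrt)
    then have "AA / sqrt n \<le> 1 / 2" using n n0 by (simp add: divide_simps)
    then have "(g n * \<Lambda>) * (AA / sqrt n) \<le> (g n * \<Lambda>) * (1 / 2)"
      using g_pos[of n] n n0 \<Lambda>_pos by (intro mult_left_mono) auto
    moreover have "g n / sqrt n * AA * \<Lambda> = (g n * \<Lambda>) * (AA / sqrt n)" by simp
    ultimately have "g n * \<Lambda> \<le> enn2real (Z n) + g n * \<Lambda> * (1 / 2)"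
      using Z_lower[of n] n n0 by linarith
    then show ?thesis by linarith
  qed
  have g1: "0 < g 1" "0 < g n0" "g n0 \<le> g 1" using g_pos[of 1] g_pos[of n0] g_antimono[of 1 n0] n0 by auto
  \<comment> \<open>The ratio \<open>g n0 / g 1\<close> is at most 1, so this constant is fine for
    large \<open>n\<close>; for \<open>n\<close> below \<open>n0\<close> it makes \<zeta>
    \<open>g n\<close> at most \<open>g n0\<close> \<Lambda>/2, hence at most \<open>Z n0\<close>
    and so at most \<open>Z n\<close>.\<close>
  define \<zeta> where "\<zeta> = \<Lambda> / 2 * (g n0 / g 1)"
  show thesis
  proof
    show "0 < \<zeta>" using g1 \<Lambda>_pos by (simp add: \<zeta>_def)
    fix n :: nat assume n: "1 \<le> n"
    show "\<zeta> * g n \<le> enn2real (Z n)"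
    proof (cases "n0 \<le> n")
      case True
      have "\<zeta> \<le> \<Lambda> / 2" using g1 \<Lambda>_pos by (simp add: \<zeta>_def mult_left_le divide_simps)
      then have "\<zeta> * g n \<le> g n * (\<Lambda> / 2)" using g_pos[OF n] by (simp add: mult.commute mult_left_mono)
      then show ?thesis using large[OF True] by simp
    next
      case False
      have "\<zeta> * g n \<le> \<zeta> * g 1" using g_antimono[of 1 n] n \<open>0 < \<zeta>\<close> by (intro mult_left_mono) auto
      also have "\<dots> = g n0 * (\<Lambda> / 2)" using g1 by (simp add: \<zeta>_def)
      also have "\<dots> \<le> enn2real (Z n0)" by (rule large) simp
      also have "\<dots> \<le> enn2real (Z n)" using False Z_antimono[of n n0] Z_finite[OF n] by (intro enn2real_mono) auto
      finally show ?thesis .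
    qed
  qed
qed

lemma push_forward_le:
  assumes n: "1 \<le> n" and B [measurable]: "B \<in> sets borel"
  shows "(\<integral>\<^sup>+ x. indicator B (\<Theta> x) * (indicator top_tubes x * ennreal (bolt n x)) \<partial>lborel) \<le>
    ennreal (g n * (1 + AA / sqrt n)) * (\<Sum>i\<in>J. \<integral>\<^sup>+ u. indicator B u * ennreal (w i u) \<partial>V i)"
proof -
  have g: "0 \<le> g n" using g_pos[OF n] by simp
  have "(\<integral>\<^sup>+ x. indicator B (\<Theta> x) * (indicator top_tubes x * ennreal (bolt n x)) \<partial>lborel) =
      (\<integral>\<^sup>+ x. (\<Sum>i\<in>J. indicator (E i) x * (indicator B (T i x) * ennreal (bolt n x))) \<partial>lborel)"
  proof (rule nn_integral_cong)
    fix x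
    show "indicator B (\<Theta> x) * (indicator top_tubes x * ennreal (bolt n x)) =
        (\<Sum>i\<in>J. indicator (E i) x * (indicator B (T i x) * ennreal (bolt n x)))"
    proof (cases "x \<in> top_tubes")
      case True
      then obtain i where i: "i \<in> J" "x \<in> E i" by (auto simp: top_tubes_def)
      show ?thesis
        using sum_pieces[OF J_sub i, of "\<lambda>i. indicator B (T i x) * ennreal (bolt n x)"] True \<Theta>_eq[OF i] by simp
    next
      case False
      then have "(\<Sum>i\<in>J. indicator (E i) x * (indicator B (T i x) * ennreal (bolt n x))) = 0"
        by (intro sum.neutral) (auto simp: top_tubes_def)
      then show ?thesis using False by simp
    qed
  qed
  also have "\<dots> = (\<Sum>i\<in>J. \<integral>\<^sup>+ x. indicator (E i) x * (indicator B (T i x) * ennreal (bolt n x)) \<partial>lborel)"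
  proof (rule nn_integral_pieces[OF J_sub])
    fix i assume "i \<in> J"
    then have [measurable]: "T i \<in> borel_measurable borel" using T_meas J_sub by auto
    show "(\<lambda>x. indicator B (T i x) * ennreal (bolt n x)) \<in> borel_measurable borel" by measurable
  qed
  also have "\<dots> \<le> (\<Sum>i\<in>J. ennreal (g n * (1 + AA / sqrt n)) * (\<integral>\<^sup>+ u. indicator B u * ennreal (w i u) \<partial>V i))"
  proof (rule sum_mono)
    fix i assume i: "i \<in> J"
    then have iI: "i \<in> I" using J_sub by auto
    have "g n * (1 + A i / sqrt n) \<le> g n * (1 + AA / sqrt n)"
      using g A_le[OF iI] by (intro mult_left_mono add_left_mono divide_right_mono) auto
    then have "ennreal (G i n * (1 + A i / sqrt n)) * (\<integral>\<^sup>+ u. indicator B u * ennreal (w i u) \<partial>V i) \<le>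
        ennreal (g n * (1 + AA / sqrt n)) * (\<integral>\<^sup>+ u. indicator B u * ennreal (w i u) \<partial>V i)"
      unfolding G_top[OF i] by (intro mult_right_mono ennreal_leI) auto
    then show "(\<integral>\<^sup>+ x. indicator (E i) x * (indicator B (T i x) * ennreal (bolt n x)) \<partial>lborel) \<le>
        ennreal (g n * (1 + AA / sqrt n)) * (\<integral>\<^sup>+ u. indicator B u * ennreal (w i u) \<partial>V i)"
      using upper[OF iI n B] unfolding bolt_def by (rule order_trans[rotated])
  qed
  finally show ?thesis by (simp add: sum_distrib_left)
qed

text \<open>Since displacements are at most \<epsilon>, all but one factor of the p-th power are
  bounded by \<epsilon>, and the first moment estimate \<open>deviation\<close> takes care of the
  last.\<close>

lemma transport_cost:
  assumes n: "1 \<le> n"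
  shows "(\<integral>\<^sup>+ x. ennreal (norm (x - \<Theta> x) ^ p * indicator top_tubes x * bolt n x) \<partial>lborel) \<le>
    ennreal (\<epsilon> ^ (p - 1) * (g n / sqrt n * AA * \<Lambda>))"
proof -
  have g: "0 \<le> g n" using g_pos[OF n] by simp
  have A: "\<And>i. i \<in> J \<Longrightarrow> 0 \<le> A i" using A_nonneg J_sub by auto
  have "(\<integral>\<^sup>+ x. ennreal (norm (x - \<Theta> x) ^ p * indicator top_tubes x * bolt n x) \<partial>lborel) \<le>
      (\<integral>\<^sup>+ x. ennreal (\<epsilon> ^ (p - 1)) * (\<Sum>i\<in>J. indicator (E i) x * ennreal (norm (x - T i x) * bolt n x)) \<partial>lborel)"
  proof (rule nn_integral_mono)
    fix x
    show "ennreal (norm (x - \<Theta> x) ^ p * indicator top_tubes x * bolt n x) \<le>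
        ennreal (\<epsilon> ^ (p - 1)) * (\<Sum>i\<in>J. indicator (E i) x * ennreal (norm (x - T i x) * bolt n x))"
    proof (cases "x \<in> top_tubes")
      case True
      then obtain i where i: "i \<in> J" "x \<in> E i" by (auto simp: top_tubes_def)
      have "norm (x - T i x) ^ p = norm (x - T i x) ^ (p - 1) * norm (x - T i x)"
        using p by (simp add: power_Suc2[symmetric] del: power_Suc)
      also have "\<dots> \<le> \<epsilon> ^ (p - 1) * norm (x - T i x)"
        using T_near[of i x] i J_sub by (intro mult_right_mono power_mono) auto
      finally have "norm (x - T i x) ^ p * bolt n x \<le> \<epsilon> ^ (p - 1) * norm (x - T i x) * bolt n x"
        by (intro mult_right_mono) auto
      then have "ennreal (norm (x - T i x) ^ p * bolt n x) \<le> ennreal (\<epsilon> ^ (p - 1)) * ennreal (norm (x - T i x) * bolt n x)"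
        using nonneg by (subst ennreal_mult[symmetric]) (auto intro!: ennreal_leI simp: mult.assoc)
      then show ?thesis
        using sum_pieces[OF J_sub i, of "\<lambda>i. ennreal (norm (x - T i x) * bolt n x)"] True \<Theta>_eq[OF i] by simp
    qed simp
  qed
  also have "\<dots> = ennreal (\<epsilon> ^ (p - 1)) * (\<Sum>i\<in>J. \<integral>\<^sup>+ x. indicator (E i) x * ennreal (norm (x - T i x) * bolt n x) \<partial>lborel)"
  proof (subst nn_integral_cmult)
    have m: "(\<lambda>x. ennreal (norm (x - T i x) * bolt n x)) \<in> borel_measurable borel" if "i \<in> J" for i
    proof -
      have [measurable]: "T i \<in> borel_measurable borel" using T_meas J_sub that by auto
      show ?thesis by measurable
    qed
    show "(\<lambda>x. \<Sum>i\<in>J. indicator (E i) x * ennreal (norm (x - T i x) * bolt n x)) \<in> borel_measurable lborel"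
      using m E_borel J_sub by (intro borel_measurable_sum borel_measurable_times) auto
    show "ennreal (\<epsilon> ^ (p - 1)) * (\<integral>\<^sup>+ x. (\<Sum>i\<in>J. indicator (E i) x * ennreal (norm (x - T i x) * bolt n x)) \<partial>lborel) =
        ennreal (\<epsilon> ^ (p - 1)) * (\<Sum>i\<in>J. \<integral>\<^sup>+ x. indicator (E i) x * ennreal (norm (x - T i x) * bolt n x) \<partial>lborel)"
      using m by (subst nn_integral_pieces[OF J_sub]) auto
  qed
  also have "\<dots> \<le> ennreal (\<epsilon> ^ (p - 1)) * (\<Sum>i\<in>J. ennreal (g n / sqrt n * A i) * ennreal (W i))"
  proof (intro mult_left_mono sum_mono)
    fix i assume i: "i \<in> J"
    then show "(\<integral>\<^sup>+ x. indicator (E i) x * ennreal (norm (x - T i x) * bolt n x) \<partial>lborel) \<le>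
        ennreal (g n / sqrt n * A i) * ennreal (W i)"
      using deviation[of i n] n J_sub G_top[OF i] by (auto simp: bolt_def)
  qed simp
  also have "\<dots> = ennreal (\<epsilon> ^ (p - 1) * (\<Sum>i\<in>J. (g n / sqrt n * A i) * W i))"
    using g A nonneg by (subst ennreal_sum_W) (auto simp: ennreal_mult')
  also have "\<dots> \<le> ennreal (\<epsilon> ^ (p - 1) * (g n / sqrt n * AA * \<Lambda>))"
    using g nonneg by (intro ennreal_leI mult_left_mono sum_W_le) auto
  finally show ?thesis .
qed

lemma piece_mass_le:
  assumes n: "1 \<le> n" and i: "i \<in> I"
  shows "(\<integral>\<^sup>+ x. indicator (E i) x * ennreal (bolt n x) \<partial>lborel) \<le> ennreal (G i n * ((1 + AA) * W i))"
proof -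
  have "(\<integral>\<^sup>+ x. indicator (E i) x * ennreal (bolt n x) \<partial>lborel) \<le> ennreal (G i n * (1 + A i / sqrt n)) * ennreal (W i)"
    using upper[OF i n, of UNIV] W_eq[OF i] by (simp add: bolt_def)
  also have "\<dots> = ennreal (G i n * (1 + A i / sqrt n) * W i)"
    using W_pos[OF i] by (simp add: ennreal_mult'')
  also have "\<dots> \<le> ennreal (G i n * (1 + AA) * W i)"
  proof (intro ennreal_leI mult_right_mono mult_left_mono add_left_mono)
    have "A i / sqrt n \<le> A i / 1" using n A_nonneg[OF i] by (intro divide_left_mono) auto
    then show "A i / sqrt n \<le> AA" using A_le[OF i] by simp
  qed (use W_pos[OF i] G_nonneg[OF i] in auto)
  finally show ?thesis by (simp add: mult.assoc)
qed

text \<open>Three sources: the fraction 1 - \<theta> held back in the top tubes, the lower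
  dimensional tubes, and the region outside. On the tubes the distance is at most 2D; outside, the
  moment condition at \<open>n = 1\<close> controls it.\<close>

lemma remaining_cost:
  assumes n: "1 \<le> n" and \<theta>: "0 \<le> \<theta>" "\<theta> \<le> 1"
  shows "(\<integral>\<^sup>+ x. ennreal ((norm (x - y0) + D) ^ p * (1 - \<theta> * indicator top_tubes x) * bolt n x) \<partial>lborel) \<le>
    ennreal ((2 * D) ^ p * ((1 - \<theta>) * g n + CG * g n / sqrt n) * ((1 + AA) * (\<Sum>i\<in>I. W i))) +
    ennreal (exp (- ((real n - 1) * \<kappa>))) * (\<integral>\<^sup>+ x. ennreal (2 ^ p * (norm (x - y0) ^ p + D ^ p) * bolt 1 x) \<partial>lborel)"
proof -
  have g: "0 \<le> g n" using g_pos[OF n] by simp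
  let ?e = "exp (- ((real n - 1) * \<kappa>))"
  define s where "s i = (2 * D) ^ p * (if i \<in> J then 1 - \<theta> else 1)" for i
  have s: "0 \<le> s i" for i using \<theta> nonneg by (simp add: s_def)
  have "(\<integral>\<^sup>+ x. ennreal ((norm (x - y0) + D) ^ p * (1 - \<theta> * indicator top_tubes x) * bolt n x) \<partial>lborel) \<le>
     (\<integral>\<^sup>+ x. (\<Sum>i\<in>I. indicator (E i) x * (ennreal (s i) * ennreal (bolt n x))) +
       ennreal ?e * ennreal (2 ^ p * (norm (x - y0) ^ p + D ^ p) * bolt 1 x) \<partial>lborel)"
  proof (rule nn_integral_mono)
    fix x
    show "ennreal ((norm (x - y0) + D) ^ p * (1 - \<theta> * indicator top_tubes x) * bolt n x) \<le>
      (\<Sum>i\<in>I. indicator (E i) x * (ennreal (s i) * ennreal (bolt n x))) +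
       ennreal ?e * ennreal (2 ^ p * (norm (x - y0) ^ p + D ^ p) * bolt 1 x)" (is "_ \<le> ?S + ?R")
    proof (cases "x \<in> (\<Union>i\<in>I. E i)")
      case True
      then obtain i where i: "i \<in> I" "x \<in> E i" by auto
      have "\<not> (j \<in> J \<and> x \<in> E j)" if "i \<notin> J" for j
        using that i J_sub disjoint_family_onD[OF E_disjoint, of i j] by blast
      then have top: "x \<in> top_tubes \<longleftrightarrow> i \<in> J"
        using i by (auto simp: top_tubes_def)
      have "(norm (x - y0) + D) ^ p \<le> (2 * D) ^ p"
        using E_bound[OF i] nonneg by (intro power_mono) auto
      then have "(norm (x - y0) + D) ^ p * (1 - \<theta> * indicator top_tubes x) \<le> (2 * D) ^ p * (1 - \<theta> * indicator top_tubes x)"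
        using \<theta> by (intro mult_right_mono) (auto simp: indicator_def)
      also have "\<dots> = s i"
        using top by (simp add: s_def indicator_def)
      finally have "(norm (x - y0) + D) ^ p * (1 - \<theta> * indicator top_tubes x) \<le> s i" .
      then have "ennreal ((norm (x - y0) + D) ^ p * (1 - \<theta> * indicator top_tubes x) * bolt n x) \<le> ennreal (s i) * ennreal (bolt n x)"
        using s by (subst ennreal_mult[symmetric]) (auto intro!: ennreal_leI mult_right_mono)
      also have "\<dots> = ?S"
        using sum_pieces[OF subset_refl i, of "\<lambda>i. ennreal (s i) * ennreal (bolt n x)"] by simp
      finally show ?thesis by (rule order_trans) simp
    next
      case False
      \<comment> \<open>One factor exp (- l) stays with the integrand and makes it integrable; the
        other n - 1 factors are uniformly small because \<open>l\<close> is at least \<kappa> off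
        the tubes.\<close>
      have "exp (- (real n * l x)) = exp (- ((real n - 1) * l x)) * exp (- l x)"
        by (simp add: exp_add[symmetric] algebra_simps)
      also have "\<dots> \<le> ?e * exp (- l x)"
        using outside[OF False] n by (intro mult_right_mono) (auto intro: mult_left_mono)
      finally have b: "bolt n x \<le> ?e * bolt 1 x"
        unfolding bolt_def using pi0_nonneg[of x] by (simp add: mult_right_mono mult.assoc[symmetric])
      have "(norm (x - y0) + D) ^ p \<le> (2 * max (norm (x - y0)) D) ^ p"
        using nonneg by (intro power_mono) auto
      also have "\<dots> \<le> 2 ^ p * (norm (x - y0) ^ p + D ^ p)"
        using nonneg by (auto simp: power_mult_distrib max_def)
      finally have "(norm (x - y0) + D) ^ p * (1 - \<theta> * indicator top_tubes x) \<le> 2 ^ p * (norm (x - y0) ^ p + D ^ p) * 1"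
        using \<theta> nonneg by (intro mult_mono[of "(norm (x - y0) + D) ^ p"]) (auto simp: indicator_def)
      then have c: "(norm (x - y0) + D) ^ p * (1 - \<theta> * indicator top_tubes x) \<le> 2 ^ p * (norm (x - y0) ^ p + D ^ p)"
        by simp
      have "(norm (x - y0) + D) ^ p * (1 - \<theta> * indicator top_tubes x) * bolt n x \<le>
          2 ^ p * (norm (x - y0) ^ p + D ^ p) * (?e * bolt 1 x)"
        by (rule mult_mono[OF c b]) (use nonneg in auto)
      then have "ennreal ((norm (x - y0) + D) ^ p * (1 - \<theta> * indicator top_tubes x) * bolt n x) \<le> ?R"
        using nonneg by (subst ennreal_mult[symmetric]) (auto intro!: ennreal_leI simp: mult_ac)
      then show ?thesis by (rule order_trans) simp
    qed
  qed
  also have "\<dots> = (\<integral>\<^sup>+ x. (\<Sum>i\<in>I. indicator (E i) x * (ennreal (s i) * ennreal (bolt n x))) \<partial>lborel) +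
       ennreal ?e * (\<integral>\<^sup>+ x. ennreal (2 ^ p * (norm (x - y0) ^ p + D ^ p) * bolt 1 x) \<partial>lborel)"
  proof (subst nn_integral_add)
    show "(\<lambda>x. \<Sum>i\<in>I. indicator (E i) x * (ennreal (s i) * ennreal (bolt n x))) \<in> borel_measurable lborel"
      using E_borel by (intro borel_measurable_sum borel_measurable_times) auto
  qed (auto simp: nn_integral_cmult)
  also have "(\<integral>\<^sup>+ x. (\<Sum>i\<in>I. indicator (E i) x * (ennreal (s i) * ennreal (bolt n x))) \<partial>lborel) =
      (\<Sum>i\<in>I. \<integral>\<^sup>+ x. indicator (E i) x * (ennreal (s i) * ennreal (bolt n x)) \<partial>lborel)"
    by (rule nn_integral_pieces) auto
  also have "\<dots> \<le> (\<Sum>i\<in>I. ennreal ((2 * D) ^ p * ((1 - \<theta>) * g n + CG * g n / sqrt n) * ((1 + AA) * W i)))"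
  proof (rule sum_mono)
    fix i assume i: "i \<in> I"
    have [measurable]: "E i \<in> sets borel" by (rule E_borel[OF i])
    have "(\<integral>\<^sup>+ x. indicator (E i) x * (ennreal (s i) * ennreal (bolt n x)) \<partial>lborel) =
        ennreal (s i) * (\<integral>\<^sup>+ x. indicator (E i) x * ennreal (bolt n x) \<partial>lborel)"
      by (subst nn_integral_cmult[symmetric]) (auto simp: mult_ac)
    also have "\<dots> \<le> ennreal (s i) * ennreal (G i n * ((1 + AA) * W i))"
      using piece_mass_le[OF n i] by (rule mult_left_mono) simp
    also have "\<dots> = ennreal (s i * G i n * ((1 + AA) * W i))"
      using s by (simp add: ennreal_mult' mult.assoc)
    also have "\<dots> \<le> ennreal ((2 * D) ^ p * ((1 - \<theta>) * g n + CG * g n / sqrt n) * ((1 + AA) * W i))"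
    proof (intro ennreal_leI mult_right_mono)
      show "s i * G i n \<le> (2 * D) ^ p * ((1 - \<theta>) * g n + CG * g n / sqrt n)"
      proof (cases "i \<in> J")
        case True
        then show ?thesis
          using g nonneg by (auto simp: s_def G_top mult.assoc intro!: mult_left_mono)
      next
        case False
        have "0 \<le> (1 - \<theta>) * g n" using g \<theta> by simp
        then show ?thesis
          using False G_low[of i n] i n nonneg by (auto simp: s_def intro!: mult_left_mono)
      qed
    qed (use AA_nonneg W_pos[OF i] in auto)
    finally show "(\<integral>\<^sup>+ x. indicator (E i) x * (ennreal (s i) * ennreal (bolt n x)) \<partial>lborel) \<le>
        ennreal ((2 * D) ^ p * ((1 - \<theta>) * g n + CG * g n / sqrt n) * ((1 + AA) * W i))" .
  qed
  also have "\<dots> = ennreal ((2 * D) ^ p * ((1 - \<theta>) * g n + CG * g n / sqrt n) * ((1 + AA) * (\<Sum>i\<in>I. W i)))"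
    using g nonneg \<theta> AA_nonneg W_pos
    by (subst sum_ennreal) (auto simp: sum_distrib_left intro!: mult_nonneg_nonneg add_nonneg_nonneg less_imp_le[OF W_pos])
  finally show ?thesis by (simp add: add_right_mono)
qed

definition \<mu> :: "nat \<Rightarrow> 'a measure" where
  "\<mu> n = density lborel (\<lambda>x. ennreal (bolt n x) / Z n)"

lemma nn_integral_\<mu>:
  assumes [measurable]: "f \<in> borel_measurable borel"
  shows "(\<integral>\<^sup>+ x. f x \<partial>\<mu> n) = (\<integral>\<^sup>+ x. f x * ennreal (bolt n x) \<partial>lborel) / Z n"
proof -
  have "(\<integral>\<^sup>+ x. f x \<partial>\<mu> n) = (\<integral>\<^sup>+ x. inverse (Z n) * (f x * ennreal (bolt n x)) \<partial>lborel)"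
    unfolding \<mu>_def by (subst nn_integral_density) (auto simp: divide_ennreal_def mult_ac)
  also have "\<dots> = inverse (Z n) * (\<integral>\<^sup>+ x. f x * ennreal (bolt n x) \<partial>lborel)"
    by (rule nn_integral_cmult) measurable
  finally show ?thesis by (simp add: divide_ennreal_def mult.commute)
qed

text \<open>The partial transport is applied with the fraction \<theta> on the top tubes. Both cost
  terms are bounded by multiples of \<open>g n / sqrt n\<close>, and dividing by \<open>Z n\<close>,
  which is at least \<zeta> \<open>g n\<close>, removes the Gaussian factor.\<close>

lemma wasserstein_cost:
  assumes \<nu>: "sets \<nu> = sets borel"
    "\<And>B. B \<in> sets borel \<Longrightarrow> emeasure \<nu> B = (\<Sum>i\<in>J. \<integral>\<^sup>+ u. indicator B u * ennreal (w i u) \<partial>V i) / ennreal \<Lambda>"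
  obtains K where "0 \<le> K" "\<And>n. 1 \<le> n \<Longrightarrow>
    (INF \<gamma>\<in>couplings (\<mu> n) \<nu>. \<integral>\<^sup>+ (x, y). ennreal (norm (x - y) ^ p) \<partial>\<gamma>) \<le> ennreal (K / sqrt n)"
proof -
  obtain \<zeta> where \<zeta>: "0 < \<zeta>" "\<And>n. 1 \<le> n \<Longrightarrow> \<zeta> * g n \<le> enn2real (Z n)"
    by (rule Z_lower_gaussian) blast
  define Q where "Q = enn2real (\<integral>\<^sup>+ x. ennreal (2 ^ p * (norm (x - y0) ^ p + D ^ p) * bolt 1 x) \<partial>lborel)"
  have Q: "(\<integral>\<^sup>+ x. ennreal (2 ^ p * (norm (x - y0) ^ p + D ^ p) * bolt 1 x) \<partial>lborel) = ennreal Q" "0 \<le> Q"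
  proof -
    have "(\<integral>\<^sup>+ x. ennreal (2 ^ p * (norm (x - y0) ^ p + D ^ p) * bolt 1 x) \<partial>lborel) =
        (\<integral>\<^sup>+ x. ennreal (2 ^ p) * ennreal (norm (x - y0) ^ p * bolt 1 x) + ennreal (2 ^ p * D ^ p) * ennreal (bolt 1 x) \<partial>lborel)"
      using nonneg by (intro nn_integral_cong) (simp add: ennreal_mult[symmetric] ennreal_plus[symmetric] algebra_simps del: ennreal_plus)
    also have "\<dots> = ennreal (2 ^ p) * (\<integral>\<^sup>+ x. ennreal (norm (x - y0) ^ p * bolt 1 x) \<partial>lborel) +
        ennreal (2 ^ p * D ^ p) * (\<integral>\<^sup>+ x. ennreal (bolt 1 x) \<partial>lborel)"
      by (simp add: nn_integral_add nn_integral_cmult)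
    also have "\<dots> < \<infinity>"
      using mass_fin moment by (simp add: bolt_def ennreal_mult_less_top)
    finally show "(\<integral>\<^sup>+ x. ennreal (2 ^ p * (norm (x - y0) ^ p + D ^ p) * bolt 1 x) \<partial>lborel) = ennreal Q"
      unfolding Q_def by simp
  qed (simp add: Q_def)
  \<comment> \<open>The power is one higher than the exponent \<open>N\<close> in the lower bound of
    \<open>g\<close>, so that the exponential is at most C0 times \<open>g n\<close> divided by
    \<open>n\<close>, and hence by \<open>sqrt n\<close>.\<close>
  define C0 where "C0 = exp \<kappa> * (real (Suc (Suc N)) / \<kappa>) ^ Suc (Suc N)"
  have C0: "0 \<le> C0" using nonneg by (simp add: C0_def)
  define WI where "WI = (\<Sum>i\<in>I. W i)"
  have WI: "0 \<le> WI" unfolding WI_def using W_pos by (intro sum_nonneg) (auto intro: less_imp_le)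
  define c1 where "c1 = \<epsilon> ^ (p - 1) * (AA * \<Lambda>)"
  define c2 where "c2 = (2 * D) ^ p * (2 * AA + CG) * ((1 + AA) * WI) + C0 * Q"
  have c: "0 \<le> c1" "0 \<le> c2"
    using nonneg AA_nonneg \<Lambda>_pos WI C0 Q(2) by (auto simp: c1_def c2_def intro!: add_nonneg_nonneg mult_nonneg_nonneg)
  have Z: "Z n = ennreal (enn2real (Z n))" "0 < enn2real (Z n)" if "1 \<le> n" for n
  proof -
    show "Z n = ennreal (enn2real (Z n))" using Z_finite[OF that] by (simp add: less_top)
    have "0 < \<zeta> * g n" using \<zeta>(1) g_pos[OF that] by simp
    then show "0 < enn2real (Z n)" using \<zeta>(2)[OF that] by linarith
  qed
  have divide_Z: "ennreal c / Z n = ennreal (c / enn2real (Z n))" if "0 \<le> c" "1 \<le> n" for c n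
    using Z[OF that(2)] divide_ennreal[OF that(1), of "enn2real (Z n)"] by simp
  have \<mu>_cost: "(\<integral>\<^sup>+ x. ennreal (f x) \<partial>\<mu> n) \<le> ennreal (c / \<zeta> / sqrt n)"
    if n: "1 \<le> n" and f [measurable]: "f \<in> borel_measurable borel" and c: "0 \<le> c"
      and le: "(\<integral>\<^sup>+ x. ennreal (f x * bolt n x) \<partial>lborel) \<le> ennreal (c * (g n / sqrt n))" for f n c
  proof -
    have "(\<integral>\<^sup>+ x. ennreal (f x) \<partial>\<mu> n) = (\<integral>\<^sup>+ x. ennreal (f x * bolt n x) \<partial>lborel) / Z n"
      by (subst nn_integral_\<mu>) (simp_all add: ennreal_mult'')
    also have "\<dots> \<le> ennreal (c * (g n / sqrt n)) / Z n"
      using le by (rule divide_right_mono_ennreal)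
    also have "\<dots> = ennreal (c * (g n / sqrt n) / enn2real (Z n))"
      using c g_pos[OF n] n by (intro divide_Z) auto
    also have "\<dots> \<le> ennreal (c * (g n / sqrt n) / (\<zeta> * g n))"
      using \<zeta> n c g_pos[OF n] Z(2)[OF n] by (intro ennreal_leI divide_left_mono mult_pos_pos) auto
    also have "c * (g n / sqrt n) / (\<zeta> * g n) = c / \<zeta> / sqrt n"
      using g_pos[OF n] by simp
    finally show ?thesis .
  qed
  have \<nu>_prob: "prob_space \<nu>"
  proof
    have "space \<nu> = UNIV" using sets_eq_imp_space_eq[OF \<nu>(1)] by simp
    then have "emeasure \<nu> (space \<nu>) = (\<Sum>i\<in>J. \<integral>\<^sup>+ u. ennreal (w i u) \<partial>V i) / ennreal \<Lambda>"
      using \<nu>(2)[of UNIV] by simp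
    also have "(\<Sum>i\<in>J. \<integral>\<^sup>+ u. ennreal (w i u) \<partial>V i) = (\<Sum>i\<in>J. ennreal (W i))"
      using J_sub W_eq by (intro sum.cong) auto
    also have "\<dots> = ennreal \<Lambda>"
      unfolding \<Lambda>_def using J_sub W_pos by (intro sum_ennreal) (auto intro: less_imp_le)
    finally show "emeasure \<nu> (space \<nu>) = 1" using \<Lambda>_pos by (simp add: divide_ennreal)
  qed
  have \<nu>_bound: "AE y in \<nu>. norm (y - y0) \<le> D"
  proof -
    have sp: "space \<nu> = UNIV" using sets_eq_imp_space_eq[OF \<nu>(1)] by simp
    have meas: "{y. \<not> norm (y - y0) \<le> D} \<in> sets borel" by measurable
    have "(\<integral>\<^sup>+ u. indicator {y. \<not> norm (y - y0) \<le> D} u * ennreal (w i u) \<partial>V i) = 0" if "i \<in> J" for i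
    proof -
      have "i \<in> I" using that J_sub by auto
      then have "AE u in V i. indicator {y. \<not> norm (y - y0) \<le> D} u * ennreal (w i u) = 0"
        using V_bound[of i] by (intro eventually_mono[OF V_bound]) simp_all
      then have "(\<integral>\<^sup>+ u. indicator {y. \<not> norm (y - y0) \<le> D} u * ennreal (w i u) \<partial>V i) = (\<integral>\<^sup>+ u. 0 \<partial>V i)"
        by (rule nn_integral_cong_AE)
      then show ?thesis by simp
    qed
    then have "emeasure \<nu> {y. \<not> norm (y - y0) \<le> D} = 0"
      using \<nu>(2)[OF meas] by simp
    then show ?thesis
      using meas \<nu>(1) by (subst AE_iff_measurable[OF _ refl]) (auto simp: sp)
  qed
  show thesis
  proof
    show "0 \<le> (c1 + c2) / \<zeta>" using c \<zeta> by simp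
    fix n :: nat assume n: "1 \<le> n"
    have g: "0 < g n" by (rule g_pos[OF n])
    define a where "a = AA / sqrt n"
    have a: "0 \<le> a" using AA_nonneg by (simp add: a_def)
    \<comment> \<open>The numerator comes from the lower bound 1 - a for the normalising constant,
      the denominator from the upper bound 1 + a for the image measure; with this fraction the image
      lies below \<nu>. For a \<ge> 1, that is for small \<open>n\<close>, it is 0 and nothing is
      transported.\<close>
    define \<theta> where "\<theta> = max 0 ((1 - a) / (1 + a))"
    have \<theta>: "0 \<le> \<theta>" "\<theta> \<le> 1" "1 - \<theta> \<le> 2 * a" "\<theta> * (1 + a) \<le> max 0 (1 - a)"
    proof -
      show "0 \<le> \<theta>" "\<theta> \<le> 1" using a by (auto simp: \<theta>_def)
      have "1 - (1 - a) / (1 + a) = 2 * a / (1 + a)" using a by (simp add: field_simps)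
      also have "\<dots> \<le> 2 * a / 1" using a by (intro divide_left_mono) auto
      finally show "1 - \<theta> \<le> 2 * a" by (simp add: \<theta>_def)
      show "\<theta> * (1 + a) \<le> max 0 (1 - a)" using a by (auto simp: \<theta>_def max_def field_simps)
    qed
    let ?h = "\<lambda>x. \<theta> * indicator top_tubes x :: real"
    have \<mu>_prob: "prob_space (\<mu> n)"
    proof
      have "emeasure (\<mu> n) (space (\<mu> n)) = (\<integral>\<^sup>+ x. 1 \<partial>\<mu> n)" by simp
      also have "\<dots> = Z n / Z n" by (subst nn_integral_\<mu>) (simp_all add: Z_def)
      also have "\<dots> = 1" using Z[OF n] Z_finite[OF n] by (intro ennreal_divide_self) (auto simp: zero_less_iff_neq_zero)
      finally show "emeasure (\<mu> n) (space (\<mu> n)) = 1" .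
    qed
    have le: "(\<integral>\<^sup>+ x. indicator B (\<Theta> x) * ennreal (?h x) \<partial>\<mu> n) \<le> emeasure \<nu> B" if B [measurable]: "B \<in> sets borel" for B
    proof -
      let ?S = "\<Sum>i\<in>J. \<integral>\<^sup>+ u. indicator B u * ennreal (w i u) \<partial>V i"
      have "(\<integral>\<^sup>+ x. indicator B (\<Theta> x) * ennreal (?h x) \<partial>\<mu> n) =
          (\<integral>\<^sup>+ x. ennreal \<theta> * (indicator B (\<Theta> x) * (indicator top_tubes x * ennreal (bolt n x))) \<partial>lborel) / Z n"
        using \<theta> by (subst nn_integral_\<mu>) (auto intro!: arg_cong2[where f = "(/)"] nn_integral_cong simp: indicator_def)
      also have "\<dots> = ennreal \<theta> * (\<integral>\<^sup>+ x. indicator B (\<Theta> x) * (indicator top_tubes x * ennreal (bolt n x)) \<partial>lborel) / Z n"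
        by (subst nn_integral_cmult) auto
      also have "\<dots> \<le> ennreal \<theta> * (ennreal (g n * (1 + a)) * ?S) / Z n"
        unfolding a_def by (intro divide_right_mono_ennreal mult_left_mono push_forward_le n B) simp
      also have "\<dots> = ennreal (\<theta> * (g n * (1 + a))) / Z n * ?S"
        using \<theta> by (simp add: ennreal_mult' divide_ennreal_def mult_ac)
      also have "\<dots> \<le> ennreal (1 / \<Lambda>) * ?S"
      proof (rule mult_right_mono)
        have "g n * max 0 (1 - a) * \<Lambda> \<le> enn2real (Z n)"
        proof (cases "a \<le> 1")
          case True
          have "g n * (1 - a) * \<Lambda> = g n * \<Lambda> - g n / sqrt n * AA * \<Lambda>"
            by (simp add: a_def algebra_simps)
          then show ?thesis using True Z_lower[OF n] by (simp add: max_def)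
        qed (simp add: max_def)
        moreover have "\<theta> * (g n * (1 + a)) * \<Lambda> \<le> g n * max 0 (1 - a) * \<Lambda>"
          using mult_left_mono[OF \<theta>(4), of "g n * \<Lambda>"] g \<Lambda>_pos by (simp add: mult_ac)
        ultimately have "\<theta> * (g n * (1 + a)) * \<Lambda> \<le> enn2real (Z n)" by linarith
        then have "\<theta> * (g n * (1 + a)) / enn2real (Z n) \<le> 1 / \<Lambda>"
          using \<Lambda>_pos Z(2)[OF n] by (simp add: field_simps)
        moreover have "ennreal (\<theta> * (g n * (1 + a))) / Z n = ennreal (\<theta> * (g n * (1 + a)) / enn2real (Z n))"
          using \<theta> g a n by (intro divide_Z) auto
        ultimately show "ennreal (\<theta> * (g n * (1 + a))) / Z n \<le> ennreal (1 / \<Lambda>)"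
          by (simp add: ennreal_leI)
      qed simp
      also have "\<dots> = emeasure \<nu> B"
        using \<nu>(2)[OF B] \<Lambda>_pos by (simp add: divide_ennreal_def inverse_ennreal mult.commute divide_inverse)
      finally show ?thesis .
    qed
    have near: "(\<integral>\<^sup>+ x. ennreal (norm (x - \<Theta> x) ^ p * ?h x) \<partial>\<mu> n) \<le> ennreal (c1 / \<zeta> / sqrt n)"
    proof (rule \<mu>_cost[OF n _ c(1)])
      have "(\<integral>\<^sup>+ x. ennreal (norm (x - \<Theta> x) ^ p * ?h x * bolt n x) \<partial>lborel) \<le>
          (\<integral>\<^sup>+ x. ennreal (norm (x - \<Theta> x) ^ p * indicator top_tubes x * bolt n x) \<partial>lborel)"
        using \<theta> by (intro nn_integral_mono ennreal_leI mult_right_mono mult_left_mono) (auto simp: indicator_def)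
      also have "\<dots> \<le> ennreal (\<epsilon> ^ (p - 1) * (g n / sqrt n * AA * \<Lambda>))"
        by (rule transport_cost[OF n])
      also have "\<epsilon> ^ (p - 1) * (g n / sqrt n * AA * \<Lambda>) = c1 * (g n / sqrt n)"
        by (simp add: c1_def)
      finally show "(\<integral>\<^sup>+ x. ennreal (norm (x - \<Theta> x) ^ p * ?h x * bolt n x) \<partial>lborel) \<le> ennreal (c1 * (g n / sqrt n))" .
    qed measurable
    have far: "(\<integral>\<^sup>+ x. ennreal ((norm (x - y0) + D) ^ p * (1 - ?h x)) \<partial>\<mu> n) \<le> ennreal (c2 / \<zeta> / sqrt n)"
    proof (rule \<mu>_cost[OF n _ c(2)])
      have "(\<integral>\<^sup>+ x. ennreal ((norm (x - y0) + D) ^ p * (1 - ?h x) * bolt n x) \<partial>lborel) \<le>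
        ennreal ((2 * D) ^ p * ((1 - \<theta>) * g n + CG * g n / sqrt n) * ((1 + AA) * WI)) +
        ennreal (exp (- ((real n - 1) * \<kappa>))) * ennreal Q"
        using remaining_cost[OF n \<theta>(1,2)] unfolding Q WI_def .
      also have "\<dots> = ennreal ((2 * D) ^ p * ((1 - \<theta>) * g n + CG * g n / sqrt n) * ((1 + AA) * WI) +
        exp (- ((real n - 1) * \<kappa>)) * Q)"
        using nonneg \<theta> g AA_nonneg WI Q(2) by (subst ennreal_plus) (auto simp: ennreal_mult')
      also have "\<dots> \<le> ennreal (c2 * (g n / sqrt n))"
      proof (rule ennreal_leI)
        have "(1 - \<theta>) * g n + CG * g n / sqrt n \<le> (2 * a) * g n + CG * g n / sqrt n"
          using \<theta> g by (intro add_right_mono mult_right_mono) auto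
        also have "\<dots> = (2 * AA + CG) * (g n / sqrt n)"
          by (simp add: a_def algebra_simps add_divide_distrib)
        finally have 1: "(2 * D) ^ p * ((1 - \<theta>) * g n + CG * g n / sqrt n) * ((1 + AA) * WI) \<le>
            (2 * D) ^ p * ((2 * AA + CG) * (g n / sqrt n)) * ((1 + AA) * WI)"
          using nonneg AA_nonneg WI by (intro mult_right_mono mult_left_mono) auto
        have "real n ^ Suc N * exp (- ((real n - 1) * \<kappa>)) \<le> C0"
          unfolding C0_def using power_le_exp_decay[of \<kappa> "real n" "Suc N"] nonneg n by simp
        then have "exp (- ((real n - 1) * \<kappa>)) \<le> C0 / real n ^ Suc N"
          using n by (simp add: field_simps)
        also have "\<dots> = C0 * (1 / real n ^ N) / real n" by simp
        also have "\<dots> \<le> C0 * g n / sqrt n"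
        proof (rule frac_le)
          show "C0 * (1 / real n ^ N) \<le> C0 * g n" by (rule mult_left_mono[OF g_lower[OF n] C0])
          have "1 * sqrt n \<le> sqrt n * sqrt n" using n by (intro mult_right_mono) auto
          then show "sqrt n \<le> real n" by simp
        qed (use C0 g n in auto)
        finally have "exp (- ((real n - 1) * \<kappa>)) * Q \<le> C0 * g n / sqrt n * Q"
          using Q(2) by (rule mult_right_mono)
        moreover have "c2 * (g n / sqrt n) =
            (2 * D) ^ p * ((2 * AA + CG) * (g n / sqrt n)) * ((1 + AA) * WI) + C0 * g n / sqrt n * Q"
          by (simp add: c2_def algebra_simps add_divide_distrib)
        ultimately show "(2 * D) ^ p * ((1 - \<theta>) * g n + CG * g n / sqrt n) * ((1 + AA) * WI) +
            exp (- ((real n - 1) * \<kappa>)) * Q \<le> c2 * (g n / sqrt n)"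
          using 1 by linarith
      qed
      finally show "(\<integral>\<^sup>+ x. ennreal ((norm (x - y0) + D) ^ p * (1 - ?h x) * bolt n x) \<partial>lborel) \<le> ennreal (c2 * (g n / sqrt n))" .
    qed measurable
    have "(INF \<gamma>\<in>couplings (\<mu> n) \<nu>. \<integral>\<^sup>+ (x, y). ennreal (norm (x - y) ^ p) \<partial>\<gamma>) \<le>
      (\<integral>\<^sup>+ x. ennreal (norm (x - \<Theta> x) ^ p * ?h x) \<partial>\<mu> n) + (\<integral>\<^sup>+ x. ennreal ((norm (x - y0) + D) ^ p * (1 - ?h x)) \<partial>\<mu> n)"
    proof (rule coupling_cost_partial_transport[OF \<mu>_prob _ \<nu>_prob \<nu>(1) _ _ _ _ le \<nu>_bound])
      show "sets (\<mu> n) = sets borel" by (simp add: \<mu>_def)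
    qed (use \<theta> in \<open>auto simp: indicator_def\<close>)
    also have "\<dots> \<le> ennreal (c1 / \<zeta> / sqrt n) + ennreal (c2 / \<zeta> / sqrt n)"
      by (rule add_mono[OF near far])
    also have "\<dots> = ennreal ((c1 + c2) / \<zeta> / sqrt n)"
      using c \<zeta> by (subst ennreal_plus[symmetric]) (auto simp: add_divide_distrib)
    finally show "(INF \<gamma>\<in>couplings (\<mu> n) \<nu>. \<integral>\<^sup>+ (x, y). ennreal (norm (x - y) ^ p) \<partial>\<gamma>) \<le> ennreal ((c1 + c2) / \<zeta> / sqrt n)" .
  qed
qed

end

text \<open>Everything that the argument for a single manifold delivers, stated in terms of global
  definitions. Through this predicate the projection and the constants can be chosen for all indices
  at once, outside the locale in which they are constructed.\<close>

definition tube_estimates ::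
  "nat \<Rightarrow> 'a::euclidean_space set \<Rightarrow> (nat \<Rightarrow> 'a \<Rightarrow> 'a) \<Rightarrow> real \<Rightarrow> ('a \<Rightarrow> real) \<Rightarrow> ('a \<Rightarrow> real) \<Rightarrow>
    ('a \<Rightarrow> 'a) \<Rightarrow> real \<Rightarrow> real \<Rightarrow> real \<Rightarrow> bool" where
  "tube_estimates k M v \<epsilon> \<pi>0 l T \<delta> A W \<longleftrightarrow>
    k \<le> DIM('a) \<and> M \<noteq> {} \<and> T \<in> borel_measurable borel \<and> 0 < \<delta> \<and> \<delta> \<le> \<epsilon> \<and> 0 \<le> A \<and> 0 < W \<and>
    (\<forall>x\<in>tube M \<delta>. norm (x - T x) \<le> \<epsilon>) \<and> tube M \<delta> \<in> sets borel \<and> bounded (tube M \<delta>) \<and> M \<subseteq> tube M \<delta> \<and>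
    sets (intrinsic_measure k M) = sets borel \<and> (AE u in intrinsic_measure k M. u \<in> M) \<and>
    (\<lambda>u. indicator M u * limit_weight k v \<pi>0 l u) \<in> borel_measurable borel \<and>
    (\<integral>\<^sup>+ u. ennreal (indicator M u * limit_weight k v \<pi>0 l u) \<partial>intrinsic_measure k M) = ennreal W \<and>
    (\<forall>n::nat. 1 \<le> n \<longrightarrow>
      (\<forall>B\<in>sets borel. (\<integral>\<^sup>+ x. indicator (tube M \<delta>) x * (indicator B (T x) * ennreal (exp (- (real n * l x)) * \<pi>0 x)) \<partial>lborel) \<le>
        ennreal (sqrt ((2 * pi / n) ^ (DIM('a) - k)) * (1 + A / sqrt n)) *
        (\<integral>\<^sup>+ u. indicator B u * ennreal (indicator M u * limit_weight k v \<pi>0 l u) \<partial>intrinsic_measure k M)) \<and>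
      (\<integral>\<^sup>+ x. indicator (tube M \<delta>) x * ennreal (norm (x - T x) * (exp (- (real n * l x)) * \<pi>0 x)) \<partial>lborel) \<le>
        ennreal (sqrt ((2 * pi / n) ^ (DIM('a) - k)) * (A / sqrt n)) * ennreal W \<and>
      ennreal (sqrt ((2 * pi / n) ^ (DIM('a) - k))) * ennreal W \<le>
        (\<integral>\<^sup>+ x. indicator (tube M \<delta>) x * ennreal (exp (- (real n * l x)) * \<pi>0 x) \<partial>lborel) +
        ennreal (sqrt ((2 * pi / n) ^ (DIM('a) - k)) * (A / sqrt n)) * ennreal W)"

lemma (in laplace_manifold) tube_estimates: "\<exists>T \<delta> A W. tube_estimates k M v \<epsilon> \<pi>0 l T \<delta> A W"
proof -
  obtain \<delta> A where \<delta>: "0 < \<delta>" "\<delta> \<le> \<epsilon>" "0 \<le> A" "total_weight < \<infinity>"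
    and U: "\<And>n B. 1 \<le> n \<Longrightarrow> B \<in> sets borel \<Longrightarrow>
      (\<integral>\<^sup>+ x. indicator (tube M \<delta>) x * (indicator B (foot x) * ennreal (lap n x)) \<partial>lborel) \<le>
      ennreal (gauss n * (1 + A / sqrt n)) * (\<integral>\<^sup>+ u. indicator B u * ennreal (weight u) \<partial>vol)"
    and D: "\<And>n. 1 \<le> n \<Longrightarrow>
      (\<integral>\<^sup>+ x. indicator (tube M \<delta>) x * ennreal (norm (x - foot x) * lap n x) \<partial>lborel) \<le>
      ennreal (gauss n * (A / sqrt n)) * total_weight"
    and L: "\<And>n. 1 \<le> n \<Longrightarrow> ennreal (gauss n) * total_weight \<le>
      (\<integral>\<^sup>+ x. indicator (tube M \<delta>) x * ennreal (lap n x) \<partial>lborel) + ennreal (gauss n * (A / sqrt n)) * total_weight"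
    by (rule laplace_tube) blast
  have w: "indicator M u * limit_weight k v \<pi>0 l u = weight u" for u
    by (cases "u \<in> M") (simp_all add: limit_weight_eq weight_def)
  have W: "total_weight = ennreal (enn2real total_weight)" "0 < enn2real total_weight"
    using \<delta>(4) total_weight_pos by (simp_all add: less_top enn2real_positive_iff)
  have near: "norm (x - foot x) \<le> \<epsilon>" if "x \<in> tube M \<delta>" for x
    using that \<delta>(2) unfolding tube_eq_foot[OF \<delta>(2)] by simp
  have est: "1 \<le> n \<longrightarrow>
      (\<forall>B\<in>sets borel. (\<integral>\<^sup>+ x. indicator (tube M \<delta>) x * (indicator B (foot x) * ennreal (exp (- (real n * l x)) * \<pi>0 x)) \<partial>lborel) \<le>
        ennreal (sqrt ((2 * pi / n) ^ codim) * (1 + A / sqrt n)) * (\<integral>\<^sup>+ u. indicator B u * ennreal (weight u) \<partial>vol)) \<and>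
      (\<integral>\<^sup>+ x. indicator (tube M \<delta>) x * ennreal (norm (x - foot x) * (exp (- (real n * l x)) * \<pi>0 x)) \<partial>lborel) \<le>
        ennreal (sqrt ((2 * pi / n) ^ codim) * (A / sqrt n)) * ennreal (enn2real total_weight) \<and>
      ennreal (sqrt ((2 * pi / n) ^ codim)) * ennreal (enn2real total_weight) \<le>
        (\<integral>\<^sup>+ x. indicator (tube M \<delta>) x * ennreal (exp (- (real n * l x)) * \<pi>0 x) \<partial>lborel) +
        ennreal (sqrt ((2 * pi / n) ^ codim) * (A / sqrt n)) * ennreal (enn2real total_weight)" for n :: nat
    unfolding W(1)[symmetric] lap_def[symmetric] gauss_def[symmetric]
    using U[of "real n"] D[of "real n"] L[of "real n"] by simp
  have "tube_estimates k M v \<epsilon> \<pi>0 l foot \<delta> A (enn2real total_weight)"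
    unfolding tube_estimates_def w codim_eq[symmetric]
  proof (intro conjI allI)
    show "(\<integral>\<^sup>+ u. ennreal (weight u) \<partial>vol) = ennreal (enn2real total_weight)"
      using W(1) by (simp add: total_weight_def)
    show "\<forall>x\<in>tube M \<delta>. norm (x - foot x) \<le> \<epsilon>" using near by blast
  qed (rule \<delta> W(2) k_le M_nonempty tube_borel[OF \<delta>(2)] bounded_tube[OF \<delta>(2)] M_subset_tube[OF \<delta>(1)]
    sets_vol AE_vol measurable_foot measurable_weight est)+
  then show ?thesis by blast
qed

section \<open>Posterior and limit measure, and the final assembly\<close>

lemma tube_mono: "\<delta> \<le> \<delta>' \<Longrightarrow> tube M \<delta> \<subseteq> tube M \<delta>'"
  by (force simp: tube_def normal_disc_bundle_def)

lemma posterior_const_eq: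
  assumes [measurable]: "\<pi>0 \<in> borel_measurable borel" "l \<in> borel_measurable borel" and pos: "\<And>x. 0 \<le> \<pi>0 x"
  shows "posterior_const \<pi>0 l n = (\<integral>\<^sup>+ x. ennreal (exp (- (real n * l x)) * \<pi>0 x) \<partial>lborel)"
  unfolding posterior_const_def prior_def
  by (subst nn_integral_density) (auto intro!: nn_integral_cong simp: ennreal_mult mult.commute pos)

lemma posterior_eq:
  assumes [measurable]: "\<pi>0 \<in> borel_measurable borel" "l \<in> borel_measurable borel" and pos: "\<And>x. 0 \<le> \<pi>0 x"
  shows "posterior \<pi>0 l n = density lborel (\<lambda>x. ennreal (exp (- (real n * l x)) * \<pi>0 x) / posterior_const \<pi>0 l n)"
  unfolding posterior_def prior_def
  by (subst density_density_eq) (auto intro!: density_cong simp: ennreal_mult divide_ennreal_def mult_ac pos)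

text \<open>The first bound rests on 1 \<le> 2 pi. In the second, each of the \<open>e\<close>
  additional codimensions contributes a factor sqrt (2 pi / n); one power of n^(-1/2) is kept and
  the constants are collected in (2 pi)^(d/2).\<close>

lemma gauss_factor_bounds:
  fixes n c e :: nat
  assumes n: "1 \<le> n"
  shows "1 / real n ^ c \<le> sqrt ((2 * pi / n) ^ c)"
    and "1 \<le> e \<Longrightarrow> e \<le> d \<Longrightarrow> sqrt ((2 * pi / n) ^ (c + e)) \<le> sqrt ((2 * pi) ^ d) * sqrt ((2 * pi / n) ^ c) / sqrt n"
proof -
  have pi: "1 \<le> 2 * pi" using pi_gt3 by simp
  have "(1 / real n ^ c)\<^sup>2 \<le> 1 / real n ^ c"
    using n by (simp add: power2_eq_square divide_simps mult_left_le)
  also have "1 / real n ^ c = (1 / n) ^ c" by (simp add: power_one_over)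
  also have "\<dots> \<le> (2 * pi / n) ^ c" using pi n by (intro power_mono divide_right_mono) auto
  finally show "1 / real n ^ c \<le> sqrt ((2 * pi / n) ^ c)" by (rule real_le_rsqrt)
  assume e: "1 \<le> e" "e \<le> d"
  have "real n ^ 1 \<le> real n ^ e" using n e by (intro power_increasing) auto
  then have "(2 * pi) ^ e / real n ^ e \<le> (2 * pi) ^ d / real n"
    using pi e n by (intro frac_le power_increasing) auto
  then have "sqrt ((2 * pi / n) ^ e) \<le> sqrt ((2 * pi) ^ d) / sqrt n"
    by (simp add: power_divide real_sqrt_divide[symmetric] del: real_sqrt_divide)
  then have "sqrt ((2 * pi / n) ^ c) * sqrt ((2 * pi / n) ^ e) \<le> sqrt ((2 * pi / n) ^ c) * (sqrt ((2 * pi) ^ d) / sqrt n)"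
    by (rule mult_left_mono) simp
  then show "sqrt ((2 * pi / n) ^ (c + e)) \<le> sqrt ((2 * pi) ^ d) * sqrt ((2 * pi / n) ^ c) / sqrt n"
    by (simp add: power_add real_sqrt_mult mult_ac)
qed

text \<open>Within distance 1 of \<open>y0\<close> the density is bounded, and farther away it is
  dominated by its p-th moment about \<open>y0\<close>.\<close>

lemma posterior_mass_finite:
  fixes y0 :: "'a::euclidean_space"
  assumes pi: "continuous_on UNIV \<pi>0" "\<And>x. 0 < \<pi>0 x" and l: "l \<in> borel_measurable borel" "\<And>x. 0 \<le> l x"
    and moment: "(\<integral>\<^sup>+ x. ennreal (norm (x - y0) ^ p * (exp (- l x) * \<pi>0 x)) \<partial>lborel) < \<infinity>"
  shows "(\<integral>\<^sup>+ x. ennreal (exp (- l x) * \<pi>0 x) \<partial>lborel) < \<infinity>"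
proof -
  have [measurable]: "\<pi>0 \<in> borel_measurable borel" "l \<in> borel_measurable borel"
    using pi l by (auto intro: borel_measurable_continuous_onI)
  have "bounded (\<pi>0 ` cball y0 1)"
    using pi(1) by (intro compact_imp_bounded compact_continuous_image) (auto intro: continuous_on_subset)
  then obtain C where "\<forall>z\<in>\<pi>0 ` cball y0 1. norm z \<le> C"
    unfolding bounded_iff by blast
  then have C: "\<pi>0 x \<le> C" if "x \<in> cball y0 1" for x
  proof -
    have "norm (\<pi>0 x) \<le> C" using that \<open>\<forall>z\<in>\<pi>0 ` cball y0 1. norm z \<le> C\<close> by blast
    then show ?thesis using abs_ge_self[of "\<pi>0 x"] by simp
  qed
  have [measurable]: "cball y0 1 \<in> sets borel" by simp
  have "(\<integral>\<^sup>+ x. ennreal (exp (- l x) * \<pi>0 x) \<partial>lborel) \<le>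
      (\<integral>\<^sup>+ x. ennreal C * indicator (cball y0 1) x + ennreal (norm (x - y0) ^ p * (exp (- l x) * \<pi>0 x)) \<partial>lborel)"
  proof (rule nn_integral_mono)
    fix x
    show "ennreal (exp (- l x) * \<pi>0 x) \<le> ennreal C * indicator (cball y0 1) x + ennreal (norm (x - y0) ^ p * (exp (- l x) * \<pi>0 x))"
    proof (cases "x \<in> cball y0 1")
      case True
      have "exp (- l x) * \<pi>0 x \<le> 1 * C"
        using C[OF True] l(2)[of x] pi(2)[of x] by (intro mult_mono) auto
      then have "ennreal (exp (- l x) * \<pi>0 x) \<le> ennreal C" by (intro ennreal_leI) simp
      also have "\<dots> \<le> ennreal C * indicator (cball y0 1) x + ennreal (norm (x - y0) ^ p * (exp (- l x) * \<pi>0 x))"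
        using True by simp
      finally show ?thesis .
    next
      case False
      then have "1 \<le> norm (x - y0) ^ p"
        by (intro one_le_power) (simp add: dist_norm norm_minus_commute)
      then have "1 * (exp (- l x) * \<pi>0 x) \<le> norm (x - y0) ^ p * (exp (- l x) * \<pi>0 x)"
        using pi(2)[of x] by (intro mult_right_mono) auto
      then show ?thesis using False by (simp add: ennreal_leI)
    qed
  qed
  also have "\<dots> = ennreal C * emeasure lborel (cball y0 1) +
      (\<integral>\<^sup>+ x. ennreal (norm (x - y0) ^ p * (exp (- l x) * \<pi>0 x)) \<partial>lborel)"
    by (simp add: nn_integral_add nn_integral_cmult_indicator)
  also have "\<dots> < \<infinity>"
    using moment emeasure_lborel_cball_finite[of y0 1] by (simp add: ennreal_mult_less_top)
  finally show ?thesis .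
qed

text \<open>Brings the limit into the form of a normalised sum of weighted volumes. On
  \<open>M i\<close> the density reduces to the single term of that component by disjointness, and
  the Bochner integrals in its denominator are the numbers \<open>W i\<close>.\<close>

lemma emeasure_limit_measure:
  fixes m :: nat and k :: "nat \<Rightarrow> nat" and M :: "nat \<Rightarrow> 'a::euclidean_space set"
    and v :: "nat \<Rightarrow> nat \<Rightarrow> 'a \<Rightarrow> 'a" and \<pi>0 l :: "'a \<Rightarrow> real"
  defines "J \<equiv> top_indices m k M"
  defines "V \<equiv> \<lambda>i. intrinsic_measure (k i) (M i)"
  defines "w \<equiv> \<lambda>i u. indicator (M i) u * limit_weight (k i) (v i) \<pi>0 l u"
  assumes pos: "\<And>x. 0 < \<pi>0 x" and disj: "disjoint_family_on M {..<m}"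
    and M: "\<And>i. i \<in> J \<Longrightarrow> M i \<in> sets borel"
    and V: "\<And>i. i \<in> J \<Longrightarrow> sets (V i) = sets borel" "\<And>i. i \<in> J \<Longrightarrow> AE u in V i. u \<in> M i"
    and w: "\<And>i. i \<in> J \<Longrightarrow> w i \<in> borel_measurable borel" "\<And>i. i \<in> J \<Longrightarrow> (\<integral>\<^sup>+ u. ennreal (w i u) \<partial>V i) = ennreal (W i)"
    and W: "\<And>i. i \<in> J \<Longrightarrow> 0 < W i" and B: "B \<in> sets borel"
  shows "emeasure (limit_measure m k M v \<pi>0 l) B = (\<Sum>i\<in>J. \<integral>\<^sup>+ u. indicator B u * ennreal (w i u) \<partial>V i) / ennreal (\<Sum>i\<in>J. W i)"
proof -
  have finJ: "finite J" and Jm: "J \<subseteq> {..<m}" by (auto simp: J_def top_indices_def)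
  have w0: "0 \<le> w i u" for i u
    unfolding w_def limit_weight_def using less_imp_le[OF pos] by auto
  define \<Lambda> where "\<Lambda> = (\<Sum>i\<in>J. W i)"
  have \<Lambda>: "0 \<le> \<Lambda>" unfolding \<Lambda>_def using W by (intro sum_nonneg) (auto intro: less_imp_le)
  have total: "total_intrinsic_measure m k M = sum_measure J V"
    unfolding total_intrinsic_measure_def sum_measure_def J_def[symmetric]
  proof (rule measure_of_eq)
    fix A :: "'a set" assume "A \<in> sigma_sets UNIV (sets borel)"
    then have A [measurable]: "A \<in> sets borel" using sets.sigma_sets_eq[of "borel :: 'a measure"] by simp
    show "(\<Sum>i\<in>J. emeasure (intrinsic_measure (k i) (M i)) (A \<inter> M i)) = (\<Sum>i\<in>J. emeasure (V i) A)"
    proof (rule sum.cong[OF refl])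
      fix i assume i: "i \<in> J"
      have "emeasure (V i) (A \<inter> M i) = emeasure (V i) A"
        using V(2)[OF i] V(1)[OF i] A M[OF i] by (intro emeasure_eq_AE) auto
      then show "emeasure (intrinsic_measure (k i) (M i)) (A \<inter> M i) = emeasure (V i) A"
        by (simp add: V_def)
    qed
  qed simp
  have dens: "limit_density m k M v \<pi>0 l u = (\<Sum>i\<in>J. w i u) / \<Lambda>" for u
  proof -
    have "set_lebesgue_integral (intrinsic_measure (k i) (M i)) (M i) (limit_weight (k i) (v i) \<pi>0 l) = W i" if i: "i \<in> J" for i
    proof -
      have "set_lebesgue_integral (intrinsic_measure (k i) (M i)) (M i) (limit_weight (k i) (v i) \<pi>0 l) = (\<integral>u. w i u \<partial>V i)"
        by (simp add: set_lebesgue_integral_def w_def V_def)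
      also have "\<dots> = enn2real (\<integral>\<^sup>+ u. ennreal (w i u) \<partial>V i)"
        using w(1)[OF i] V(1)[OF i] w0 by (intro integral_eq_nn_integral) (auto cong: measurable_cong_sets)
      also have "\<dots> = W i" using w(2)[OF i] W[OF i] by simp
      finally show ?thesis .
    qed
    then show ?thesis
      unfolding limit_density_def J_def[symmetric] \<Lambda>_def by (simp add: w_def mult.commute)
  qed
  have meas: "(\<lambda>u. ennreal (limit_density m k M v \<pi>0 l u)) \<in> borel_measurable borel"
    unfolding dens using w(1) by measurable
  have "emeasure (limit_measure m k M v \<pi>0 l) B =
      (\<integral>\<^sup>+ u. ennreal (limit_density m k M v \<pi>0 l u) * indicator B u \<partial>sum_measure J V)"
    unfolding limit_measure_def total using B meas by (subst emeasure_density) auto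
  also have "\<dots> = (\<Sum>i\<in>J. \<integral>\<^sup>+ u. ennreal (limit_density m k M v \<pi>0 l u) * indicator B u \<partial>V i)"
    using V(1) B meas finJ by (intro nn_integral_sum_measure) auto
  also have "\<dots> = (\<Sum>i\<in>J. (\<integral>\<^sup>+ u. indicator B u * ennreal (w i u) \<partial>V i) / ennreal \<Lambda>)"
  proof (rule sum.cong[OF refl])
    fix i assume i: "i \<in> J"
    have "(\<integral>\<^sup>+ u. ennreal (limit_density m k M v \<pi>0 l u) * indicator B u \<partial>V i) =
        (\<integral>\<^sup>+ u. (indicator B u * ennreal (w i u)) / ennreal \<Lambda> \<partial>V i)"
    proof (rule nn_integral_cong_AE)
      show "AE u in V i. ennreal (limit_density m k M v \<pi>0 l u) * indicator B u = (indicator B u * ennreal (w i u)) / ennreal \<Lambda>"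
        using V(2)[OF i]
      proof eventually_elim
        case (elim u)
        have w_eq: "w j u = (if j = i then w i u else 0)" if "j \<in> J" for j
          using elim that i Jm disjoint_family_onD[OF disj, of i j] by (auto simp: w_def indicator_def)
        have "(\<Sum>j\<in>J. w j u) = (\<Sum>j\<in>J. if j = i then w i u else 0)"
          by (rule sum.cong[OF refl], rule w_eq)
        then have "limit_density m k M v \<pi>0 l u = w i u / \<Lambda>"
          using dens i finJ by simp
        moreover have "0 < \<Lambda>"
          unfolding \<Lambda>_def using i finJ W by (intro sum_pos) auto
        ultimately show ?case
          using w0[of i u] by (cases "u \<in> B") (simp_all add: divide_ennreal)
      qed
    qed
    also have "\<dots> = (\<integral>\<^sup>+ u. indicator B u * ennreal (w i u) \<partial>V i) / ennreal \<Lambda>"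
      using w(1)[OF i] V(1)[OF i] B by (intro nn_integral_divide) (auto cong: measurable_cong_sets)
    finally show "(\<integral>\<^sup>+ u. ennreal (limit_density m k M v \<pi>0 l u) * indicator B u \<partial>V i) =
      (\<integral>\<^sup>+ u. indicator B u * ennreal (w i u) \<partial>V i) / ennreal \<Lambda>" .
  qed
  also have "\<dots> = (\<Sum>i\<in>J. \<integral>\<^sup>+ u. indicator B u * ennreal (w i u) \<partial>V i) / ennreal \<Lambda>"
    by (simp add: divide_ennreal_def sum_distrib_right)
  finally show ?thesis by (simp add: \<Lambda>_def)
qed

theorem theorem3p6:
  fixes p m :: nat
    and \<pi>0 l :: "'a::euclidean_space \<Rightarrow> real"
    and k :: "nat \<Rightarrow> nat"
    and M :: "nat \<Rightarrow> 'a set"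
    and v :: "nat \<Rightarrow> nat \<Rightarrow> 'a \<Rightarrow> 'a"
    and \<epsilon> :: real
    and y0 :: 'a
    and F :: "'a set"
  assumes p: "1 \<le> p"
    and pi0_smooth: "smooth_on UNIV \<pi>0"
    and pi0_pos: "\<And>x. 0 < \<pi>0 x"
    and l_measurable: "l \<in> borel_measurable borel"
    and l_nonneg: "\<And>x. 0 \<le> l x"
    and M_number: "1 \<le> m"
    and M_dim: "\<And>i. i < m \<Longrightarrow> 1 \<le> k i"
    and M_admissible: "\<And>i. i < m \<Longrightarrow> admissible (k i) (M i)"
    and M_frame: "\<And>i. i < m \<Longrightarrow> normal_frame (k i) (M i) (v i)"
    and M_disjoint: "disjoint_family_on M {..<m}"
    and M_zeros: "{x. l x = 0} = (\<Union>i<m. M i)"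
    and I_zero: "l y0 = 0"
    and I_moment: "(\<integral>\<^sup>+ x. ennreal (norm (x - y0) ^ p * exp (- l x)) \<partial>prior \<pi>0) < \<infinity>"
    and T_radius: "\<And>i. i < m \<Longrightarrow> tubular_radius (M i) \<epsilon>"
    and T_disjoint: "disjoint_family_on (\<lambda>i. tube (M i) \<epsilon>) {..<m}"
    and T_inf: "\<And>\<delta>. 0 < \<delta> \<Longrightarrow> \<delta> \<le> \<epsilon> \<Longrightarrow> 0 < Inf (l ` (UNIV - (\<Union>i<m. tube (M i) \<delta>)))"
    and S_smooth: "Ck_on (2 * p + 2) (interior F) l"
    and S_tubes: "\<And>i. i < m \<Longrightarrow> tube (M i) \<epsilon> \<subseteq> interior F"
    and P: "\<And>i u. i < m \<Longrightarrow> u \<in> M i \<Longrightarrow> positive_definite (normal_hessian (k i) (v i) l u)"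
  shows "\<exists>K::real. 0 < K \<and> (\<forall>n::nat. 1 \<le> n \<longrightarrow>
           wasserstein p (posterior \<pi>0 l n) (limit_measure m k M v \<pi>0 l)
             \<le> ennreal (K * real n powr (- 1 / (2 * real p))))"
proof -
  define J where "J = top_indices m k M"
  define kmax where "kmax = Max (k ` {..<m})"
  define V where "V i = intrinsic_measure (k i) (M i)" for i
  define w where "w i u = indicator (M i) u * limit_weight (k i) (v i) \<pi>0 l u" for i u
  have l_borel [measurable]: "l \<in> borel_measurable borel" by (rule l_measurable)
  have \<epsilon>: "0 < \<epsilon>" using T_radius[of 0] M_number by (simp add: tubular_radius_def)
  \<comment> \<open>Projection, radius, error constant and total weight are packed into one tuple,
    so that a single choice over the index set produces all four families.\<close>
  have est: "\<forall>i\<in>{..<m}. \<exists>q. tube_estimates (k i) (M i) (v i) \<epsilon> \<pi>0 l (fst q) (fst (snd q)) (fst (snd (snd q))) (snd (snd (snd q)))"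
  proof
    fix i assume "i \<in> {..<m}"
    then have i: "i < m" by simp
    have "M i \<subseteq> tube (M i) \<epsilon>"
    proof
      fix u assume "u \<in> M i"
      have zero: "0 \<in> orthogonal_comp (tangent_space (M i) u)"
        by (rule subspace_0[OF subspace_orthogonal_comp])
      have "(u, 0) \<in> normal_disc_bundle (M i) \<epsilon>"
        using \<epsilon> zero \<open>u \<in> M i\<close> by (simp add: normal_disc_bundle_def)
      then show "u \<in> tube (M i) \<epsilon>" unfolding tube_def by force
    qed
    interpret laplace_manifold "k i" "M i" "v i" \<epsilon> "DIM('a) - k i" \<pi>0 l "interior F"
    proof
      show "M i \<subseteq> interior F" using \<open>M i \<subseteq> tube (M i) \<epsilon>\<close> S_tubes[OF i] by (rule order_trans)
      \<comment> \<open>As p is at least 1, the order 2p + 2 is at least 4.\<close>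
      show "Ck_on 3 (interior F) l" using S_smooth p by (intro Ck_on_le[OF S_smooth]) auto
      show "l u = 0" if "u \<in> M i" for u using that i M_zeros by blast
    qed (fact refl M_admissible[OF i] M_frame[OF i] T_radius[OF i] pi0_smooth pi0_pos l_measurable l_nonneg open_interior | rule P[OF i])+
    obtain T \<delta> A W where "tube_estimates (k i) (M i) (v i) \<epsilon> \<pi>0 l T \<delta> A W"
      using tube_estimates by blast
    then have "tube_estimates (k i) (M i) (v i) \<epsilon> \<pi>0 l (fst (T, \<delta>, A, W)) (fst (snd (T, \<delta>, A, W)))
        (fst (snd (snd (T, \<delta>, A, W)))) (snd (snd (snd (T, \<delta>, A, W))))" by simp
    then show "\<exists>q. tube_estimates (k i) (M i) (v i) \<epsilon> \<pi>0 l (fst q) (fst (snd q)) (fst (snd (snd q))) (snd (snd (snd q)))"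
      by (rule exI)
  qed
  obtain q where q: "\<forall>i\<in>{..<m}. tube_estimates (k i) (M i) (v i) \<epsilon> \<pi>0 l (fst (q i)) (fst (snd (q i))) (fst (snd (snd (q i)))) (snd (snd (snd (q i))))"
    using bchoice[OF est] by (rule exE)
  define T where "T i = fst (q i)" for i
  define \<delta> where "\<delta> i = fst (snd (q i))" for i
  define A where "A i = fst (snd (snd (q i)))" for i
  define W where "W i = snd (snd (snd (q i)))" for i
  have est: "tube_estimates (k i) (M i) (v i) \<epsilon> \<pi>0 l (T i) (\<delta> i) (A i) (W i)" if "i < m" for i
    using q that unfolding T_def \<delta>_def A_def W_def by simp
  note est = est[unfolded tube_estimates_def, folded w_def V_def]
  have k_le: "k i \<le> DIM('a)" and M_nonempty: "M i \<noteq> {}" and T: "T i \<in> borel_measurable borel"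
    and \<delta>: "0 < \<delta> i" "\<delta> i \<le> \<epsilon>" and A: "0 \<le> A i" and W: "0 < W i"
    and near: "\<forall>x\<in>tube (M i) (\<delta> i). norm (x - T i x) \<le> \<epsilon>"
    and tube: "tube (M i) (\<delta> i) \<in> sets borel" "bounded (tube (M i) (\<delta> i))" "M i \<subseteq> tube (M i) (\<delta> i)"
    and V: "sets (V i) = sets borel" "AE u in V i. u \<in> M i"
    and w: "w i \<in> borel_measurable borel" "(\<integral>\<^sup>+ u. ennreal (w i u) \<partial>V i) = ennreal (W i)"
    if "i < m" for i
    using est[OF that] by blast+
  have kmax: "k i \<le> kmax" if "i < m" for i
    unfolding kmax_def using that by (intro Max_ge) auto
  have "0 \<in> {..<m}" using M_number by simp
  then have ne: "{..<m} \<noteq> {}" by blast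
  have "kmax \<in> k ` {..<m}"
    unfolding kmax_def using ne by (intro Max_in) auto
  then obtain i0 where i0: "i0 < m" "k i0 = kmax" by auto
  \<comment> \<open>The index set is defined by inclusion in the top part. A nonempty component
    inside that union meets, and by disjointness equals, one of the components of maximal
    dimension.\<close>
  have J: "J = {i. i < m \<and> k i = kmax}"
  proof (intro equalityI subsetI)
    fix i assume "i \<in> J"
    then have i: "i < m" "M i \<subseteq> (\<Union>j\<in>{j. j < m \<and> k j = kmax}. M j)"
      by (auto simp: J_def top_indices_def top_part_def kmax_def)
    obtain u where u: "u \<in> M i" using M_nonempty[OF i(1)] by auto
    then obtain j where "j < m" "k j = kmax" "u \<in> M j" using i(2) by auto
    then have "j = i" using disjoint_family_onD[OF M_disjoint, of i j] i(1) u by auto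
    then show "i \<in> {i. i < m \<and> k i = kmax}" using \<open>k j = kmax\<close> i by simp
  qed (auto simp: J_def top_indices_def top_part_def kmax_def)
  have Jm: "i < m" if "i \<in> J" for i using that J by simp
  define c where "c = DIM('a) - kmax"
  define g where "g n = sqrt ((2 * pi / real n) ^ c)" for n :: nat
  define G where "G i n = sqrt ((2 * pi / real n) ^ (DIM('a) - k i))" for i and n :: nat
  \<comment> \<open>The Laplace estimates come with a radius for each component, whereas the infimum
    condition speaks of a common one. Outside the individual tubes one is also outside those of the
    smallest radius.\<close>
  define \<delta>0 where "\<delta>0 = Min (\<delta> ` {..<m})"
  have \<delta>0: "0 < \<delta>0" "\<delta>0 \<le> \<epsilon>" "\<And>i. i < m \<Longrightarrow> \<delta>0 \<le> \<delta> i"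
  proof -
    have "\<delta>0 \<in> \<delta> ` {..<m}" unfolding \<delta>0_def using ne by (intro Min_in) auto
    then show "0 < \<delta>0" "\<delta>0 \<le> \<epsilon>" using \<delta> by auto
    show "\<delta>0 \<le> \<delta> i" if "i < m" for i unfolding \<delta>0_def using that by (intro Min_le) auto
  qed
  define \<kappa> where "\<kappa> = Inf (l ` (UNIV - (\<Union>i<m. tube (M i) \<delta>0)))"
  have \<kappa>: "0 < \<kappa>" unfolding \<kappa>_def using T_inf[OF \<delta>0(1,2)] .
  have pi0_cont: "continuous_on UNIV \<pi>0"
    using pi0_smooth by (metis Ck_on.simps(1) smooth_on_def)
  then have pi0_borel [measurable]: "\<pi>0 \<in> borel_measurable borel" by (rule borel_measurable_continuous_onI)
  have moment: "(\<integral>\<^sup>+ x. ennreal (norm (x - y0) ^ p * (exp (- l x) * \<pi>0 x)) \<partial>lborel) < \<infinity>"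
  proof -
    have "(\<integral>\<^sup>+ x. ennreal (norm (x - y0) ^ p * exp (- l x)) \<partial>prior \<pi>0) =
        (\<integral>\<^sup>+ x. ennreal (norm (x - y0) ^ p * (exp (- l x) * \<pi>0 x)) \<partial>lborel)"
      unfolding prior_def using pi0_pos
      by (subst nn_integral_density) (auto intro!: nn_integral_cong simp: ennreal_mult[symmetric] less_imp_le mult_ac)
    then show ?thesis using I_moment by simp
  qed
  have mass: "(\<integral>\<^sup>+ x. ennreal (exp (- l x) * \<pi>0 x) \<partial>lborel) < \<infinity>"
    by (rule posterior_mass_finite[OF pi0_cont pi0_pos l_measurable l_nonneg moment])
  have "bounded (\<Union>i<m. tube (M i) (\<delta> i))"
    using tube(2) by (intro bounded_UN) auto
  then obtain D0 where D0: "\<forall>x\<in>(\<Union>i<m. tube (M i) (\<delta> i)). norm x \<le> D0"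
    unfolding bounded_iff by blast
  define D where "D = \<bar>D0\<bar> + norm y0"
  have D: "norm (x - y0) \<le> D" if "i < m" "x \<in> tube (M i) (\<delta> i)" for i x
  proof -
    have "norm x \<le> D0" using D0 that by blast
    then show ?thesis using norm_triangle_ineq4[of x y0] by (simp add: D_def)
  qed
  have cJ: "DIM('a) - k i = c" if "i \<in> J" for i using that J by (simp add: c_def)
  interpret pieces: laplace_pieces "{..<m}" J "\<lambda>i. tube (M i) (\<delta> i)" T V w W A G g "sqrt ((2 * pi) ^ DIM('a))" c p D \<kappa> \<epsilon> y0 l \<pi>0
  proof
    show "finite {..<m}" by simp
    show "J \<subseteq> {..<m}" using Jm by blast
    show "J \<noteq> {}" using i0 J by blast
    show "1 \<le> p" by (rule p)
    show "disjoint_family_on (\<lambda>i. tube (M i) (\<delta> i)) {..<m}"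
      unfolding disjoint_family_on_def
    proof (intro ballI impI)
      fix i j assume "i \<in> {..<m}" "j \<in> {..<m}" "i \<noteq> j"
      then show "tube (M i) (\<delta> i) \<inter> tube (M j) (\<delta> j) = {}"
        using disjoint_family_onD[OF T_disjoint, of i j] tube_mono[OF \<delta>(2), of i "M i"] tube_mono[OF \<delta>(2), of j "M j"] by blast
    qed
    fix i assume "i \<in> {..<m}"
    then have i: "i < m" by simp
    show "tube (M i) (\<delta> i) \<in> sets borel" by (rule tube(1)[OF i])
    show "T i \<in> borel_measurable borel" by (rule T[OF i])
    show "norm (x - T i x) \<le> \<epsilon>" if "x \<in> tube (M i) (\<delta> i)" for x using near[OF i] that by blast
    show "norm (x - y0) \<le> D" if "x \<in> tube (M i) (\<delta> i)" for x by (rule D[OF i that])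
    show "sets (V i) = sets borel" by (rule V(1)[OF i])
    show "w i \<in> borel_measurable borel" by (rule w(1)[OF i])
    show "(\<integral>\<^sup>+ u. ennreal (w i u) \<partial>V i) = ennreal (W i)" by (rule w(2)[OF i])
    show "0 < W i" by (rule W[OF i])
    show "AE u in V i. norm (u - y0) \<le> D"
      using V(2)[OF i] by (rule eventually_mono) (use D[OF i] tube(3)[OF i] in blast)
    show "0 \<le> A i" by (rule A[OF i])
    show "0 \<le> G i n" for n by (simp add: G_def)
    fix n :: nat assume n: "1 \<le> n"
    show "(\<integral>\<^sup>+ x. indicator (tube (M i) (\<delta> i)) x * (indicator B (T i x) * ennreal (exp (- (real n * l x)) * \<pi>0 x)) \<partial>lborel) \<le>
      ennreal (G i n * (1 + A i / sqrt n)) * (\<integral>\<^sup>+ u. indicator B u * ennreal (w i u) \<partial>V i)" if "B \<in> sets borel" for B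
      using est[OF i] n that unfolding G_def by blast
    show "(\<integral>\<^sup>+ x. indicator (tube (M i) (\<delta> i)) x * ennreal (norm (x - T i x) * (exp (- (real n * l x)) * \<pi>0 x)) \<partial>lborel) \<le>
      ennreal (G i n * (A i / sqrt n)) * ennreal (W i)"
      using est[OF i] n unfolding G_def by blast
    show "ennreal (G i n) * ennreal (W i) \<le>
      (\<integral>\<^sup>+ x. indicator (tube (M i) (\<delta> i)) x * ennreal (exp (- (real n * l x)) * \<pi>0 x) \<partial>lborel) +
      ennreal (G i n * (A i / sqrt n)) * ennreal (W i)"
      using est[OF i] n unfolding G_def by blast
  next
    show "0 \<le> D" by (simp add: D_def)
    show "0 < \<kappa>" by (rule \<kappa>)
    show "0 \<le> \<epsilon>" using \<epsilon> by simp
    show "0 \<le> sqrt ((2 * pi) ^ DIM('a))" by simp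
    show "0 < g n" if "1 \<le> n" for n using that by (simp add: g_def)
    show "g n' \<le> g n" if "1 \<le> n" "n \<le> n'" for n n'
      unfolding g_def using that by (intro real_sqrt_le_mono power_mono divide_left_mono) auto
    show "1 / real n ^ c \<le> g n" if "1 \<le> n" for n
      unfolding g_def by (rule gauss_factor_bounds(1)[OF that])
    show "G i n = g n" if "i \<in> J" for i n
      using cJ[OF that] by (simp add: G_def g_def)
    show "G i n \<le> sqrt ((2 * pi) ^ DIM('a)) * g n / sqrt n" if "i \<in> {..<m} - J" "1 \<le> n" for i n
    proof -
      \<comment> \<open>The missing dimensions of a lower component are its additional codimensions
        relative to \<open>c\<close>.\<close>
      have "k i < kmax" using that J kmax[of i] by auto
      moreover have "kmax \<le> DIM('a)" using k_le[OF i0(1)] i0 by simp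
      ultimately have "DIM('a) - k i = c + (kmax - k i)" "1 \<le> kmax - k i" "kmax - k i \<le> DIM('a)"
        by (auto simp: c_def)
      then show ?thesis
        unfolding G_def g_def using gauss_factor_bounds(2)[OF that(2), of "kmax - k i" "DIM('a)" c] by simp
    qed
    show "\<kappa> \<le> l x" if "x \<notin> (\<Union>i\<in>{..<m}. tube (M i) (\<delta> i))" for x
    proof -
      have "x \<notin> tube (M i) \<delta>0" if "i < m" for i
        using \<open>x \<notin> _\<close> that tube_mono[OF \<delta>0(3)[OF that], of "M i"] by blast
      then have "x \<in> UNIV - (\<Union>i<m. tube (M i) \<delta>0)" by blast
      moreover have "bdd_below (l ` (UNIV - (\<Union>i<m. tube (M i) \<delta>0)))"
        using l_nonneg by (intro bdd_belowI[of _ 0]) auto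
      ultimately show ?thesis unfolding \<kappa>_def by (intro cInf_lower) auto
    qed
    show "0 \<le> \<pi>0 x" for x by (rule less_imp_le[OF pi0_pos])
  qed (fact l_measurable l_nonneg pi0_borel mass moment)+
  have lim: "emeasure (limit_measure m k M v \<pi>0 l) B = (\<Sum>i\<in>J. \<integral>\<^sup>+ u. indicator B u * ennreal (w i u) \<partial>V i) / ennreal pieces.\<Lambda>"
    if "B \<in> sets borel" for B
    unfolding pieces.\<Lambda>_def unfolding w_def[abs_def] V_def J_def
  proof (rule emeasure_limit_measure[OF pi0_pos M_disjoint])
    fix i assume "i \<in> top_indices m k M"
    then have i: "i < m" using Jm J_def by blast
    show "M i \<in> sets borel"
      using M_admissible[OF i] by (simp add: admissible_def borel_compact)
  qed (use Jm[unfolded J_def] V[unfolded V_def] w[unfolded w_def[abs_def] V_def] W that in auto)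
  have sets_lim: "sets (limit_measure m k M v \<pi>0 l) = sets borel"
    by (simp add: limit_measure_def total_intrinsic_measure_def sets.sigma_sets_eq[of borel, simplified])
  obtain K where K: "0 \<le> K" "\<And>n. 1 \<le> n \<Longrightarrow>
      (INF \<gamma>\<in>couplings (pieces.\<mu> n) (limit_measure m k M v \<pi>0 l). \<integral>\<^sup>+ (x, y). ennreal (norm (x - y) ^ p) \<partial>\<gamma>) \<le> ennreal (K / sqrt n)"
    using pieces.wasserstein_cost[OF sets_lim lim] by blast
  have post: "posterior \<pi>0 l n = pieces.\<mu> n" for n
    unfolding pieces.\<mu>_def pieces.Z_def pieces.bolt_def
    using less_imp_le[OF pi0_pos] by (subst posterior_eq) (simp_all add: posterior_const_eq)
  show ?thesis
  proof (intro exI conjI allI impI)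
    \<comment> \<open>The cost constant \<open>K\<close> is only known to be nonnegative; adding 1
      makes the final constant strictly positive.\<close>
    show "0 < root p (K + 1)" using K(1) p by simp
    fix n :: nat assume n: "1 \<le> n"
    have "ennreal (K / sqrt n) \<le> ennreal ((K + 1) / sqrt n)"
      by (intro ennreal_leI divide_right_mono) auto
    with K(2)[OF n] have "(INF \<gamma>\<in>couplings (pieces.\<mu> n) (limit_measure m k M v \<pi>0 l). \<integral>\<^sup>+ (x, y). ennreal (norm (x - y) ^ p) \<partial>\<gamma>) \<le> ennreal ((K + 1) / sqrt n)"
      by (rule order_trans)
    then show "wasserstein p (posterior \<pi>0 l n) (limit_measure m k M v \<pi>0 l) \<le> ennreal (root p (K + 1) * real n powr (- 1 / (2 * real p)))"
      unfolding post using p K(1) n by (intro wasserstein_le) auto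
  qed
qed

end
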